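(* Let $\rho=\rho_{AB}$ be any state on a finite-dimensional bipartite quantum system $AB$. Then the distillable entanglement under dually non-entangling operations equals the regularised Piani relative entropy of entanglement: $$E_{d,\mathrm{DNE}}(\rho)=D^{\mathbb{SEP},\infty}(\rho\|\mathcal S).$$ Moreover, for every sequence $(\delta_n)_n$ with $\delta_n\ge 0$ and $\delta_n=2^{o(n)}$ (i.e. $\limsup_{n\to\infty}\frac1n\log_2(1+\delta_n)=0$), $$E_{d,\mathrm{DNE}^g_{(\delta_n)}}(\rho)=D^{\mathbb{SEP},\infty}(\rho\|\mathcal S).$$ In particular, $E_{d,\mathrm{ADNE}}(\rho)=E_{d,\mathrm{DNE}}(\rho)=D^{\mathbb{SEP},\infty}(\rho\|\mathcal S)$. As a consequence, if $\rho$ is entangled (not separable), then $$E_{d,\mathrm{DNE}}(\rho)\ \ge\ D^{\mathbb{SEP}}(\rho\|\mathcal S)\ >\ 0 .$$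
   Context: All Hilbert spaces are finite-dimensional; states are density operators (positive semi-definite, unit trace). $\mathcal S=\mathcal S(A\!:\!B)$ is the set of separable states on $AB$, i.e. finite convex combinations of product states $\alpha_A\otimes\beta_B$; $\mathrm{cone}(\mathcal S)=\{\lambda\sigma:\lambda\ge0,\sigma\in\mathcal S\}$; $\mathcal S_n=\mathcal S(A^n\!:\!B^n)$ is the set of separable states on $n$ copies (all $A$'s versus all $B$'s). $\mathbb{SEP}$ is the set of separable measurements: finite families $(E_x)_x$ with $E_x\in\mathrm{cone}(\mathcal S)$ and $\sum_xE_x=\mathbb 1$. Piani relative entropy: $D^{\mathbb{SEP}}(\rho\|\sigma)=\sup_{(E_x)_x\in\mathbb{SEP}}\sum_x\mathrm{Tr}[\rho E_x]\log_2\frac{\mathrm{Tr}[\rho E_x]}{\mathrm{Tr}[\sigma E_x]}$ (usual conventions: terms with $\mathrm{Tr}[\rho E_x]=0$ are $0$; value $+\infty$ if some $\mathrm{Tr}[\sigma E_x]=0<\mathrm{Tr}[\rho E_x]$). $D^{\mathbb{SEP}}(\rho\|\mathcal S)=\inf_{\sigma\in\mathcal S}D^{\mathbb{SEP}}(\rho\|\sigma)$, and $D^{\mathbb{SEP},\infty}(\rho\|\mathcal S)=\lim_{n\to\infty}\frac1nD^{\mathbb{SEP}}(\rho^{\otimes n}\|\mathcal S_n)$ (the limit exists by super-additivity). Generalised robustness: $R^g_{\mathcal S}(\rho)=\min\{r\ge0:\exists\,\sigma\in\mathcal S,\ \rho\le(1+r)\sigma\}$. The adjoint $\Xi^\dagger$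 of a channel $\Xi$ is defined by $\mathrm{Tr}[X\,\Xi(Y)]=\mathrm{Tr}[\Xi^\dagger(X)Y]$. For $\delta\ge0$, $\mathrm{DNE}^g_\delta(AB\to A'B')$ is the set of completely positive trace-preserving maps $\Xi$ from operators on $AB$ to operators on $A'B'$ such that $R^g_{\mathcal S}(\Xi(\sigma))\le\delta$ for all $\sigma\in\mathcal S(A\!:\!B)$ and $\Xi^\dagger(\mathcal S(A'\!:\!B'))\subseteq\mathrm{cone}(\mathcal S(A\!:\!B))$. $\mathrm{DNE}=\mathrm{DNE}^g_0$ (dually non-entangling operations). Let $\Phi_2=|\Phi_2\rangle\langle\Phi_2|$, $|\Phi_2\rangle=\frac1{\sqrt2}(|00\rangle+|11\rangle)$ on a two-qubit system $A_0B_0$; $\Phi_2^{\otimes m}$ is viewed as a bipartite state on $A_0^m:B_0^m$. For $\varepsilon\in[0,1)$ the one-shot distillable entanglement is $$E^{(1),\varepsilon}_{d,\mathrm{DNE}^g_\delta}(\rho)=\max\Big\{m\in\mathbb N:\ \inf_{\Theta\in\mathrm{DNE}^g_\delta(AB\to A_0^mB_0^m)}\tfrac12\|\Theta(\rho)-\Phi_2^{\otimes m}\|_1\le\varepsilon\Big\}.$$ For a sequence $\delta_n\ge0$, $E_{d,\mathrm{DNE}^g_{(\delta_n)}}(\rho)=\lim_{\varepsilon\to0^+}\liminf_{n\to\infty}\frac1nE^{(1),\varepsilon}_{d,\mathrm{DNE}^g_{\delta_n}}(\rho^{\otimes n})$, and $E_{d,\mathrm{DNE}}$ is the case $\delta_n\equiv0$.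 $E_{d,\mathrm{ADNE}}(\rho)$ (asymptotically dually non-entangling operations) is the supremum of $E_{d,\mathrm{DNE}^g_{(\delta_n)}}(\rho)$ over sequences with $\delta_n\ge 0$, $\delta_n\to0$. *)

theory Defs
  imports
    "Jordan_Normal_Form.Schur_Decomposition"
    "HOL-Library.Extended_Real"
begin

section \<open>Operators on finite-dimensional Hilbert spaces\<close>

definition trace_mat :: "complex mat \<Rightarrow> complex" where
  "trace_mat X = (\<Sum>i<dim_row X. X $$ (i, i))"

text \<open>The order on \<^typ>\<open>complex\<close> is the one of \<^theory>\<open>HOL-Library.Complex_Order\<close>: \<open>0 \<le> z\<close> says
  that \<open>z\<close> is real and nonnegative. Hermiticity is therefore implied.\<close>

definition psd :: "nat \<Rightarrow> complex mat \<Rightarrow> bool" where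
  "psd n X \<longleftrightarrow> X \<in> carrier_mat n n \<and> (\<forall>v \<in> carrier_vec n. 0 \<le> (X *\<^sub>v v) \<bullet>c v)"

definition loewner_le :: "nat \<Rightarrow> complex mat \<Rightarrow> complex mat \<Rightarrow> bool" where
  "loewner_le n X Y \<longleftrightarrow> psd n (Y - X)"

definition density_op :: "nat \<Rightarrow> complex mat \<Rightarrow> bool" where
  "density_op n \<rho> \<longleftrightarrow> psd n \<rho> \<and> trace_mat \<rho> = 1"

definition abs_mat :: "complex mat \<Rightarrow> complex mat" where
  "abs_mat X = (THE P. psd (dim_col X) P \<and> P * P = mat_adjoint X * X)"

definition trace_norm :: "complex mat \<Rightarrow> real" where
  "trace_norm X = Re (trace_mat (abs_mat X))"

definition mat_sum :: "nat \<Rightarrow> nat \<Rightarrow> (nat \<Rightarrow> complex mat) \<Rightarrow> complex mat" where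
  "mat_sum n k F = mat n n (\<lambda>(r, s). \<Sum>x<k. F x $$ (r, s))"

section \<open>Tensor products\<close>

text \<open>A bipartite operator on \<open>A : B\<close> with local dimensions \<open>dA\<close>, \<open>dB\<close> is a square matrix of size
  \<open>dA * dB\<close>, the basis vector \<open>|a>|b>\<close> having index \<open>a * dB + b\<close>.\<close>

definition tensor_mat :: "complex mat \<Rightarrow> complex mat \<Rightarrow> complex mat" where
  "tensor_mat X Y = mat (dim_row X * dim_row Y) (dim_col X * dim_col Y)
     (\<lambda>(r, s). X $$ (r div dim_row Y, s div dim_col Y) * Y $$ (r mod dim_row Y, s mod dim_col Y))"

text \<open>Tensor product of an operator \<open>X\<close> on \<open>A : B\<close> with an operator \<open>Y\<close> on \<open>C : D\<close>, regarded as a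
  bipartite operator on \<open>AC : BD\<close>. The basis vector \<open>|a c>|b d>\<close> has index
  \<open>(a * dC + c) * (dB * dD) + (b * dD + d)\<close>, from which the two functions below recover
  the index \<open>a * dB + b\<close> of \<open>|a>|b>\<close> and the index \<open>c * dD + d\<close> of \<open>|c>|d>\<close>.\<close>

definition idx1 :: "nat \<Rightarrow> nat \<Rightarrow> nat \<Rightarrow> nat \<Rightarrow> nat" where
  "idx1 dB dC dD i = (i div (dB * dD) div dC) * dB + i mod (dB * dD) div dD"

definition idx2 :: "nat \<Rightarrow> nat \<Rightarrow> nat \<Rightarrow> nat \<Rightarrow> nat" where
  "idx2 dB dC dD i = (i div (dB * dD) mod dC) * dD + i mod (dB * dD) mod dD"

definition bip_tensor ::
  "nat \<Rightarrow> nat \<Rightarrow> nat \<Rightarrow> nat \<Rightarrow> complex mat \<Rightarrow> complex mat \<Rightarrow> complex mat" where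
  "bip_tensor dA dB dC dD X Y = mat ((dA * dC) * (dB * dD)) ((dA * dC) * (dB * dD))
     (\<lambda>(r, s). X $$ (idx1 dB dC dD r, idx1 dB dC dD s) * Y $$ (idx2 dB dC dD r, idx2 dB dC dD s))"

lemma bip_tensor_tensor_mat:
  assumes "X \<in> carrier_mat dA dA" "Y \<in> carrier_mat dB dB"
    and "Z \<in> carrier_mat dC dC" "W \<in> carrier_mat dD dD"
  shows "bip_tensor dA dB dC dD (tensor_mat X Y) (tensor_mat Z W)
       = tensor_mat (tensor_mat X Z) (tensor_mat Y W)"
proof (rule eq_matI)
  fix r s
  assume "r < dim_row (tensor_mat (tensor_mat X Z) (tensor_mat Y W))"
    and "s < dim_col (tensor_mat (tensor_mat X Z) (tensor_mat Y W))"
  then have r: "r < (dA * dC) * (dB * dD)" and s: "s < (dA * dC) * (dB * dD)"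
    using assms by (auto simp: tensor_mat_def)
  have bd: "i div (dB * dD) div dC < dA" "i div (dB * dD) mod dC < dC"
    "i mod (dB * dD) div dD < dB" "i mod (dB * dD) mod dD < dD"
    "i div (dB * dD) < dA * dC" "i mod (dB * dD) < dB * dD"
    "idx1 dB dC dD i < dA * dB" "idx2 dB dC dD i < dC * dD"
    "idx1 dB dC dD i div dB = i div (dB * dD) div dC"
    "idx1 dB dC dD i mod dB = i mod (dB * dD) div dD"
    "idx2 dB dC dD i div dD = i div (dB * dD) mod dC"
    "idx2 dB dC dD i mod dD = i mod (dB * dD) mod dD"
    if i: "i < (dA * dC) * (dB * dD)" for i
  proof -
    have pos: "dA > 0" "dB > 0" "dC > 0" "dD > 0" using i by (auto intro!: gr0I)
    have less: "a * q + b < p * q" if "a < p" "b < q" for a b p q :: nat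
    proof -
      have "a * q + b < Suc a * q" using that(2) by simp
      also have "\<dots> \<le> p * q" using that(1) by (intro mult_right_mono) auto
      finally show ?thesis .
    qed
    show 5: "i div (dB * dD) < dA * dC" using i by (simp add: less_mult_imp_div_less)
    show 6: "i mod (dB * dD) < dB * dD" using pos by simp
    show 1: "i div (dB * dD) div dC < dA" using 5 by (simp add: less_mult_imp_div_less)
    show 2: "i div (dB * dD) mod dC < dC" using pos by simp
    show 3: "i mod (dB * dD) div dD < dB" using 6 by (simp add: less_mult_imp_div_less)
    show 4: "i mod (dB * dD) mod dD < dD" using pos by simp
    show "idx1 dB dC dD i < dA * dB" "idx2 dB dC dD i < dC * dD"
      unfolding idx1_def idx2_def using less 1 2 3 4 by blast+
    show "idx1 dB dC dD i div dB = i div (dB * dD) div dC"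
      "idx1 dB dC dD i mod dB = i mod (dB * dD) div dD"
      "idx2 dB dC dD i div dD = i div (dB * dD) mod dC"
      "idx2 dB dC dD i mod dD = i mod (dB * dD) mod dD"
      unfolding idx1_def idx2_def using 3 4 pos by simp_all
  qed
  show "bip_tensor dA dB dC dD (tensor_mat X Y) (tensor_mat Z W) $$ (r, s)
      = tensor_mat (tensor_mat X Z) (tensor_mat Y W) $$ (r, s)"
    using assms r s bd[OF r] bd[OF s] by (simp add: bip_tensor_def tensor_mat_def)
qed (use assms in \<open>auto simp: bip_tensor_def tensor_mat_def\<close>)

text \<open>The \<open>n\<close>-fold tensor power, as a bipartite operator on \<open>A\<^sup>n : B\<^sup>n\<close> with local dimensions
  \<open>dA ^ n\<close> and \<open>dB ^ n\<close>.\<close>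

fun bip_power :: "nat \<Rightarrow> nat \<Rightarrow> complex mat \<Rightarrow> nat \<Rightarrow> complex mat" where
  "bip_power dA dB X 0 = 1\<^sub>m 1"
| "bip_power dA dB X (Suc n) = bip_tensor dA dB (dA ^ n) (dB ^ n) X (bip_power dA dB X n)"

section \<open>Separable states and the Piani relative entropy\<close>

definition sep_states :: "nat \<Rightarrow> nat \<Rightarrow> complex mat set" where
  "sep_states dA dB = {\<sigma>. \<exists>k (p :: nat \<Rightarrow> real) \<alpha> \<beta>.
     (\<forall>x<k. 0 \<le> p x \<and> density_op dA (\<alpha> x) \<and> density_op dB (\<beta> x)) \<and> (\<Sum>x<k. p x) = 1 \<and>
     \<sigma> = mat_sum (dA * dB) k (\<lambda>x. complex_of_real (p x) \<cdot>\<^sub>m tensor_mat (\<alpha> x) (\<beta> x))}"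

definition cone_of :: "complex mat set \<Rightarrow> complex mat set" where
  "cone_of S = {complex_of_real c \<cdot>\<^sub>m \<sigma> | c \<sigma>. 0 \<le> c \<and> \<sigma> \<in> S}"

text \<open>A finite measurement is given by its number \<open>k\<close> of outcomes and its effects
  \<open>E 0, \<dots>, E (k - 1)\<close>.\<close>

definition SEP :: "nat \<Rightarrow> nat \<Rightarrow> (nat \<times> (nat \<Rightarrow> complex mat)) set" where
  "SEP dA dB = {(k, E). (\<forall>x<k. E x \<in> cone_of (sep_states dA dB)) \<and>
     mat_sum (dA * dB) k E = 1\<^sub>m (dA * dB)}"

definition rel_entr_term :: "real \<Rightarrow> real \<Rightarrow> ereal" where
  "rel_entr_term p q =
     (if p = 0 then 0 else if q = 0 then \<infinity> else ereal (p * log 2 (p / q)))"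

definition D_SEP :: "nat \<Rightarrow> nat \<Rightarrow> complex mat \<Rightarrow> complex mat \<Rightarrow> ereal" where
  "D_SEP dA dB \<rho> \<sigma> = (SUP (k, E) \<in> SEP dA dB.
     \<Sum>x<k. rel_entr_term (Re (trace_mat (\<rho> * E x))) (Re (trace_mat (\<sigma> * E x))))"

definition D_SEP_S :: "nat \<Rightarrow> nat \<Rightarrow> complex mat \<Rightarrow> ereal" where
  "D_SEP_S dA dB \<rho> = (INF \<sigma> \<in> sep_states dA dB. D_SEP dA dB \<rho> \<sigma>)"

definition D_SEP_reg :: "nat \<Rightarrow> nat \<Rightarrow> complex mat \<Rightarrow> ereal" where
  "D_SEP_reg dA dB \<rho> =
     lim (\<lambda>n. ereal (1 / real n) * D_SEP_S (dA ^ n) (dB ^ n) (bip_power dA dB \<rho> n))"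

section \<open>Channels and dually non-entangling operations\<close>

definition linear_op :: "nat \<Rightarrow> nat \<Rightarrow> (complex mat \<Rightarrow> complex mat) \<Rightarrow> bool" where
  "linear_op n m \<Xi> \<longleftrightarrow>
     (\<forall>X \<in> carrier_mat n n. \<Xi> X \<in> carrier_mat m m) \<and>
     (\<forall>X \<in> carrier_mat n n. \<forall>Y \<in> carrier_mat n n. \<Xi> (X + Y) = \<Xi> X + \<Xi> Y) \<and>
     (\<forall>c. \<forall>X \<in> carrier_mat n n. \<Xi> (c \<cdot>\<^sub>m X) = c \<cdot>\<^sub>m \<Xi> X)"

text \<open>The image of \<open>X\<close> under \<open>\<Xi> \<otimes> id\<close>, where the reference system has dimension \<open>k\<close> and is the
  second tensor factor: \<open>\<Xi>\<close> is applied to the block of \<open>X\<close> belonging to each pair of reference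
  indices.\<close>

definition ampliation ::
  "nat \<Rightarrow> nat \<Rightarrow> nat \<Rightarrow> (complex mat \<Rightarrow> complex mat) \<Rightarrow> complex mat \<Rightarrow> complex mat" where
  "ampliation n m k \<Xi> X = mat (m * k) (m * k)
     (\<lambda>(r, s). \<Xi> (mat n n (\<lambda>(i, j). X $$ (i * k + r mod k, j * k + s mod k))) $$ (r div k, s div k))"

definition completely_positive :: "nat \<Rightarrow> nat \<Rightarrow> (complex mat \<Rightarrow> complex mat) \<Rightarrow> bool" where
  "completely_positive n m \<Xi> \<longleftrightarrow> (\<forall>k X. psd (n * k) X \<longrightarrow> psd (m * k) (ampliation n m k \<Xi> X))"

definition trace_preserving :: "nat \<Rightarrow> (complex mat \<Rightarrow> complex mat) \<Rightarrow> bool" where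
  "trace_preserving n \<Xi> \<longleftrightarrow> (\<forall>X \<in> carrier_mat n n. trace_mat (\<Xi> X) = trace_mat X)"

definition channel :: "nat \<Rightarrow> nat \<Rightarrow> (complex mat \<Rightarrow> complex mat) \<Rightarrow> bool" where
  "channel n m \<Xi> \<longleftrightarrow> linear_op n m \<Xi> \<and> completely_positive n m \<Xi> \<and> trace_preserving n \<Xi>"

definition adjoint_map ::
  "nat \<Rightarrow> (complex mat \<Rightarrow> complex mat) \<Rightarrow> complex mat \<Rightarrow> complex mat" where
  "adjoint_map n \<Xi> X = (THE Z. Z \<in> carrier_mat n n \<and>
     (\<forall>Y \<in> carrier_mat n n. trace_mat (X * \<Xi> Y) = trace_mat (Z * Y)))"

text \<open>The least element exists for every state, since the set of separable states is compact and
  contains the maximally mixed state.\<close>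

definition robustness_g :: "nat \<Rightarrow> nat \<Rightarrow> complex mat \<Rightarrow> real" where
  "robustness_g dA dB \<rho> = (LEAST r. 0 \<le> r \<and>
     (\<exists>\<sigma> \<in> sep_states dA dB. loewner_le (dA * dB) \<rho> (complex_of_real (1 + r) \<cdot>\<^sub>m \<sigma>)))"

text \<open>Channels from operators on \<open>A : B\<close> to operators on \<open>A' : B'\<close>, the local dimensions of
  \<open>A' : B'\<close> being \<open>dC\<close> and \<open>dD\<close>.\<close>

definition DNE_g ::
  "real \<Rightarrow> nat \<Rightarrow> nat \<Rightarrow> nat \<Rightarrow> nat \<Rightarrow> (complex mat \<Rightarrow> complex mat) set" where
  "DNE_g \<delta> dA dB dC dD = {\<Xi>. channel (dA * dB) (dC * dD) \<Xi> \<and>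
     (\<forall>\<sigma> \<in> sep_states dA dB. robustness_g dC dD (\<Xi> \<sigma>) \<le> \<delta>) \<and>
     adjoint_map (dA * dB) \<Xi> ` sep_states dC dD \<subseteq> cone_of (sep_states dA dB)}"

section \<open>Distillable entanglement\<close>

text \<open>With the indexing \<open>a * 2 + b\<close>, the vectors \<open>|00>\<close> and \<open>|11>\<close> have index \<open>0\<close> and \<open>3\<close>.\<close>

definition Phi2_ket :: "complex vec" where
  "Phi2_ket = complex_of_real (1 / sqrt 2) \<cdot>\<^sub>v (unit_vec 4 0 + unit_vec 4 3)"

definition Phi2 :: "complex mat" where
  "Phi2 = mat 4 4 (\<lambda>(i, j). Phi2_ket $ i * cnj (Phi2_ket $ j))"

text \<open>For \<open>0 \<le> \<epsilon> < 1\<close> and \<open>0 \<le> \<delta>\<close> the set is finite and contains \<open>0\<close>.\<close>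

definition E_oneshot :: "real \<Rightarrow> nat \<Rightarrow> nat \<Rightarrow> real \<Rightarrow> complex mat \<Rightarrow> nat" where
  "E_oneshot \<delta> dA dB \<epsilon> \<rho> = Max {m. (INF \<Theta> \<in> DNE_g \<delta> dA dB (2 ^ m) (2 ^ m).
     1 / 2 * trace_norm (\<Theta> \<rho> - bip_power 2 2 Phi2 m)) \<le> \<epsilon>}"

definition E_DNE_g :: "(nat \<Rightarrow> real) \<Rightarrow> nat \<Rightarrow> nat \<Rightarrow> complex mat \<Rightarrow> ereal" where
  "E_DNE_g \<delta> dA dB \<rho> = Lim (at_right (0 :: real)) (\<lambda>\<epsilon>. liminf (\<lambda>n.
     ereal (1 / real n * real (E_oneshot (\<delta> n) (dA ^ n) (dB ^ n) \<epsilon> (bip_power dA dB \<rho> n)))))"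

definition E_DNE :: "nat \<Rightarrow> nat \<Rightarrow> complex mat \<Rightarrow> ereal" where
  "E_DNE dA dB \<rho> = E_DNE_g (\<lambda>_. 0) dA dB \<rho>"

definition E_ADNE :: "nat \<Rightarrow> nat \<Rightarrow> complex mat \<Rightarrow> ereal" where
  "E_ADNE dA dB \<rho> = (SUP \<delta> \<in> {\<delta>. (\<forall>n. 0 \<le> \<delta> n) \<and> \<delta> \<longlonglongrightarrow> 0}. E_DNE_g \<delta> dA dB \<rho>)"

end

(* The Piani relative entropy has a variational form: D^SEP(rho||sigma) ln 2 is the supremum, over
   separable measurements (E_x) and weights c_x > 0, of
     sum_x tr(rho E_x) ln c_x + 1 - sum_x c_x tr(sigma E_x),
   which is affine in sigma. As the separable states are compact and convex, a minimax argument gives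
   for each v < D^SEP(rho||S) ln 2 one weighted measurement with sum_x c_x tr(sigma E_x) <= 1 for all
   separable sigma and sum_x tr(rho E_x) ln c_x >= v. The first bound is multiplicative under tensor
   products because the E_x are themselves separable. A Chernoff bound for the log-weights therefore
   yields, for v < D^SEP(rho^k||S_k) / k, a test T_n on n copies with T_n and 1 - T_n in the separable
   cone, tr(sigma T_n) <= 2^(-nv) for all separable sigma, and tr(rho^n (1 - T_n)) -> 0. Measuring
   {T_n, 1 - T_n} and preparing Phi or (1 - Phi)/(d^2 - 1) with d = 2^(nv) is dually non-entangling,
   since the output on separable states is an isotropic state with overlap at most 1/d, which is
   separable. Hence the distillation rate is at least sup_k D^SEP(rho^k||S_k) / k.

   Conversely, the adjoint of a map in DNE_delta pulls the separable measurement
   {(1 + d Phi)/(d + 1), d (1 - Phi)/(d + 1)} back to a separable measurement, and the variational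
   form gives (1 - eps) m <= D^SEP(rho||S) + 2 + log2(1 + delta) for an output of m ebits with error
   eps. Both bounds together also show that D^SEP(rho^n||S_n) / n converges. *)
theory Submission
  imports Defs "HOL-Analysis.Function_Topology" "HOL-Analysis.L2_Norm"
begin

section \<open>Quadratic forms and conic hulls of rank-one matrices\<close>

text \<open>The notions at stake are defined by \<open>LEAST\<close>, \<open>THE\<close>,
  \<open>Max\<close>, \<open>lim\<close> and \<open>Lim\<close>, so before any bound can be used the
  minimum in the robustness, the adjoint, the finiteness of the achievable yields and the two limits
  have to be established. The entropy may be infinite at some \<sigma>. Its variational form
  consists of real functions that are affine in \<sigma>, so compactness and minimax are applied to
  affine functions only; the weight c_x plays the part of a likelihood ratio chosen before \<sigma>
  is known. A separable state of many copies may be strongly entangled among the A systems and among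
  the B systems. What makes the bound on the weighted effects multiplicative all the same is that
  contracting a product vector with a product vector of one block leaves a product vector on the
  remaining block. Separability of the isotropic operators comes down to 1 + d \<Phi> and 1 -
  \<Phi>. Both are written as explicit averages over finitely many phases, in place of an integral
  over unitaries. The sequence \<delta>_n matters in the converse only: it multiplies the overlap
  with \<Phi> on separable inputs by at most 1 + \<delta>_n and thus costs log2(1 + \<delta>_n)
  bits, which vanish per copy.\<close>

definition qf :: "nat \<Rightarrow> complex mat \<Rightarrow> (nat \<Rightarrow> complex) \<Rightarrow> complex" where
  "qf n X v = (\<Sum>i<n. \<Sum>j<n. cnj (v i) * X $$ (i, j) * v j)"

text \<open>Vectors are plain functions of which only the entries below the dimension matter. Sums
  and products of vectors then carry no side conditions, and \<open>nrm_cong\<close>,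
  \<open>cip_cong\<close> and \<open>qf_cong\<close> discard the remaining entries.\<close>

definition ro :: "nat \<Rightarrow> (nat \<Rightarrow> complex) \<Rightarrow> complex mat" where
  "ro n v = mat n n (\<lambda>(i, j). v i * cnj (v j))"

text \<open>The pairing tr(X Y) as a double sum; in this form symmetry and the rules for finite sums
  hold without carrier conditions.\<close>

definition trp :: "nat \<Rightarrow> complex mat \<Rightarrow> complex mat \<Rightarrow> complex" where
  "trp n X Y = (\<Sum>i<n. \<Sum>j<n. X $$ (i, j) * Y $$ (j, i))"

definition nrm :: "nat \<Rightarrow> (nat \<Rightarrow> complex) \<Rightarrow> real" where
  "nrm n v = (\<Sum>i<n. (cmod (v i))\<^sup>2)"

definition cip :: "nat \<Rightarrow> (nat \<Rightarrow> complex) \<Rightarrow> (nat \<Rightarrow> complex) \<Rightarrow> complex" where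
  "cip n u v = (\<Sum>i<n. cnj (u i) * v i)"

lemma ro_carrier [simp]: "ro n v \<in> carrier_mat n n"
  and dim_ro [simp]: "dim_row (ro n v) = n" "dim_col (ro n v) = n"
  and index_ro [simp]: "i < n \<Longrightarrow> j < n \<Longrightarrow> ro n v $$ (i, j) = v i * cnj (v j)"
  by (auto simp: ro_def)

lemma mat_sum_carrier [simp]: "mat_sum n k F \<in> carrier_mat n n"
  and dim_mat_sum [simp]: "dim_row (mat_sum n k F) = n" "dim_col (mat_sum n k F) = n"
  and index_mat_sum [simp]: "i < n \<Longrightarrow> j < n \<Longrightarrow> mat_sum n k F $$ (i, j) = (\<Sum>x<k. F x $$ (i, j))"
  by (auto simp: mat_sum_def)

lemma mult_cnj_self: "z * cnj z = complex_of_real ((cmod z)\<^sup>2)"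
  using complex_norm_square[of z] by simp

lemma of_real_cmod_square: "(complex_of_real (cmod z))\<^sup>2 = z * cnj z"
  by (simp add: mult_cnj_self)

lemma nonneg_of_real_complex [simp]: "0 \<le> complex_of_real x \<longleftrightarrow> 0 \<le> x"
  by (simp add: less_eq_complex_def)

lemma nrm_nonneg [simp]: "0 \<le> nrm n v"
  by (simp add: nrm_def sum_nonneg)

lemma cip_self: "cip n v v = complex_of_real (nrm n v)"
  by (simp add: cip_def nrm_def mult.commute[of "cnj _"] mult_cnj_self)

section \<open>Linearity of traces, pairings and quadratic forms\<close>

lemma trace_mult_eq_trp:
  assumes "X \<in> carrier_mat n n" "Y \<in> carrier_mat n n"
  shows "trace_mat (X * Y) = trp n X Y"
  using assms by (simp add: trace_mat_def trp_def scalar_prod_def lessThan_atLeast0)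

lemma trp_commute: "trp n X Y = trp n Y X"
  unfolding trp_def by (subst sum.swap) (simp add: mult.commute)

lemma trp_add_left: 
  assumes "X \<in> carrier_mat n n" "Y \<in> carrier_mat n n"
  shows "trp n (X + Y) Z = trp n X Z + trp n Y Z"
  using assms by (simp add: trp_def sum.distrib algebra_simps)

lemma trp_minus_left: 
  assumes "X \<in> carrier_mat n n" "Y \<in> carrier_mat n n"
  shows "trp n (X - Y) Z = trp n X Z - trp n Y Z"
  using assms by (simp add: trp_def sum_subtractf algebra_simps)

lemma trp_smult_left: 
  assumes "X \<in> carrier_mat n n"
  shows "trp n (c \<cdot>\<^sub>m X) Z = c * trp n X Z"
  using assms by (simp add: trp_def sum_distrib_left mult.assoc)

lemma trp_mat_sum_left: "trp n (mat_sum n k F) Z = (\<Sum>x<k. trp n (F x) Z)"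
proof -
  have "trp n (mat_sum n k F) Z = (\<Sum>i<n. \<Sum>j<n. \<Sum>x<k. F x $$ (i, j) * Z $$ (j, i))"
    by (simp add: trp_def sum_distrib_right)
  also have "\<dots> = (\<Sum>i<n. \<Sum>x<k. \<Sum>j<n. F x $$ (i, j) * Z $$ (j, i))"
    by (intro sum.cong refl sum.swap)
  also have "\<dots> = (\<Sum>x<k. \<Sum>i<n. \<Sum>j<n. F x $$ (i, j) * Z $$ (j, i))"
    by (rule sum.swap)
  finally show ?thesis by (simp add: trp_def)
qed

lemma trp_zero_left [simp]: "trp n (0\<^sub>m n n) Z = 0"
  by (simp add: trp_def)

lemma trp_add_right: 
  assumes "X \<in> carrier_mat n n" "Y \<in> carrier_mat n n"
  shows "trp n Z (X + Y) = trp n Z X + trp n Z Y"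
  using trp_add_left[OF assms] by (simp add: trp_commute)

lemma trp_minus_right: 
  assumes "X \<in> carrier_mat n n" "Y \<in> carrier_mat n n"
  shows "trp n Z (X - Y) = trp n Z X - trp n Z Y"
  using trp_minus_left[OF assms] by (simp add: trp_commute)

lemma trp_smult_right: 
  assumes "X \<in> carrier_mat n n"
  shows "trp n Z (c \<cdot>\<^sub>m X) = c * trp n Z X"
  using trp_smult_left[OF assms] by (simp add: trp_commute)

lemma trp_mat_sum_right: "trp n Z (mat_sum n k F) = (\<Sum>x<k. trp n Z (F x))"
  using trp_mat_sum_left by (simp add: trp_commute)

lemma trp_zero_right [simp]: "trp n Z (0\<^sub>m n n) = 0"
  by (simp add: trp_def)

lemma trp_one_right [simp]: 
  assumes "X \<in> carrier_mat n n"
  shows "trp n X (1\<^sub>m n) = trace_mat X"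
  using assms by (simp add: trp_def trace_mat_def if_distrib cong: if_cong)

lemma trp_one_left [simp]: "X \<in> carrier_mat n n \<Longrightarrow> trp n (1\<^sub>m n) X = trace_mat X"
  using trp_one_right by (simp add: trp_commute)

lemma trp_ro: "trp n X (ro n v) = qf n X v"
  unfolding trp_def qf_def by (intro sum.cong refl) (simp add: mult_ac)

lemma trace_add:
  "X \<in> carrier_mat n n \<Longrightarrow> Y \<in> carrier_mat n n \<Longrightarrow> trace_mat (X + Y) = trace_mat X + trace_mat Y"
  by (simp add: trace_mat_def sum.distrib)

lemma trace_minus:
  "X \<in> carrier_mat n n \<Longrightarrow> Y \<in> carrier_mat n n \<Longrightarrow> trace_mat (X - Y) = trace_mat X - trace_mat Y"
  by (simp add: trace_mat_def sum_subtractf)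

lemma trace_smult: "X \<in> carrier_mat n n \<Longrightarrow> trace_mat (c \<cdot>\<^sub>m X) = c * trace_mat X"
  by (simp add: trace_mat_def sum_distrib_left)

lemma trace_mat_sum: 
  assumes "\<And>x. x < k \<Longrightarrow> F x \<in> carrier_mat n n"
  shows "trace_mat (mat_sum n k F) = (\<Sum>x<k. trace_mat (F x))"
proof -
  have "trace_mat (mat_sum n k F) = (\<Sum>x<k. \<Sum>i<n. F x $$ (i, i))"
    by (simp add: trace_mat_def sum.swap[of _ "{..<k}"])
  also have "\<dots> = (\<Sum>x<k. trace_mat (F x))"
    using assms by (intro sum.cong) (auto simp: trace_mat_def)
  finally show ?thesis .
qed

lemma trace_ro: "trace_mat (ro n v) = complex_of_real (nrm n v)"
  by (simp add: trace_mat_def nrm_def mult_cnj_self)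

lemma trace_one [simp]: "trace_mat (1\<^sub>m n) = of_nat n"
  by (simp add: trace_mat_def)

lemma trace_zero [simp]: "trace_mat (0\<^sub>m n n) = 0"
  by (simp add: trace_mat_def)

lemma qf_add: "X \<in> carrier_mat n n \<Longrightarrow> Y \<in> carrier_mat n n \<Longrightarrow> qf n (X + Y) v = qf n X v + qf n Y v"
  by (simp add: trp_add_left flip: trp_ro)

lemma qf_minus: "X \<in> carrier_mat n n \<Longrightarrow> Y \<in> carrier_mat n n \<Longrightarrow> qf n (X - Y) v = qf n X v - qf n Y v"
  by (simp add: trp_minus_left flip: trp_ro)

lemma qf_smult: "X \<in> carrier_mat n n \<Longrightarrow> qf n (c \<cdot>\<^sub>m X) v = c * qf n X v"
  by (simp add: trp_smult_left flip: trp_ro)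

lemma qf_mat_sum: "qf n (mat_sum n k F) v = (\<Sum>x<k. qf n (F x) v)"
  by (simp add: trp_mat_sum_left flip: trp_ro)

lemma qf_zero [simp]: "qf n (0\<^sub>m n n) v = 0"
  by (simp flip: trp_ro)

lemma qf_one [simp]: "qf n (1\<^sub>m n) v = complex_of_real (nrm n v)"
  by (simp add: trace_ro flip: trp_ro)

lemma qf_ro: "qf n (ro n u) v = complex_of_real ((cmod (cip n u v))\<^sup>2)"
proof -
  have "qf n (ro n u) v = (\<Sum>i<n. \<Sum>j<n. (cnj (v i) * u i) * (cnj (u j) * v j))"
    by (simp add: qf_def mult_ac)
  also have "\<dots> = (\<Sum>i<n. cnj (v i) * u i) * (\<Sum>j<n. cnj (u j) * v j)"
    by (simp add: sum_product)
  also have "(\<Sum>i<n. cnj (v i) * u i) = cnj (cip n u v)"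
    by (simp add: cip_def mult.commute)
  also have "(\<Sum>j<n. cnj (u j) * v j) = cip n u v"
    by (simp add: cip_def)
  finally show ?thesis
    by (metis mult_cnj_self mult.commute)
qed

lemma nonneg_complex_iff: "0 \<le> (z :: complex) \<longleftrightarrow> z = complex_of_real (Re z) \<and> 0 \<le> Re z"
  by (auto simp: less_eq_complex_def complex_eq_iff)

lemma psd_iff_qf: "psd n X \<longleftrightarrow> X \<in> carrier_mat n n \<and> (\<forall>v. 0 \<le> qf n X v)"
proof (cases "X \<in> carrier_mat n n")
  case True
  have eq: "(X *\<^sub>v w) \<bullet>c w = qf n X (\<lambda>i. w $ i)" if "w \<in> carrier_vec n" for w
    using that True
    by (auto simp: qf_def scalar_prod_def sum_distrib_left sum_distrib_right lessThan_atLeast0 mult_ac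
        intro!: sum.cong)
  have "0 \<le> qf n X v" if "psd n X" for v
  proof -
    have "qf n X (\<lambda>i. vec n v $ i) = qf n X v"
      by (simp add: qf_def)
    moreover have "0 \<le> (X *\<^sub>v vec n v) \<bullet>c vec n v"
      using that unfolding psd_def by (blast intro: vec_carrier)
    ultimately show ?thesis using eq[of "vec n v"] by (simp only: vec_carrier)
  qed
  moreover have "psd n X" if "\<And>v. 0 \<le> qf n X v"
    using that eq True by (auto simp: psd_def)
  ultimately show ?thesis using True by blast
qed (auto simp: psd_def)

lemma psd_carrier: "psd n X \<Longrightarrow> X \<in> carrier_mat n n"
  by (simp add: psd_def)

text \<open>All cones of operators occurring below (positive operators, separable operators) are
  generated by rank-one operators of vectors from a suitable set \<open>G\<close>.\<close>

inductive_set rcone :: "nat \<Rightarrow> (nat \<Rightarrow> complex) set \<Rightarrow> complex mat set" for n G where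
  rcone_zero: "0\<^sub>m n n \<in> rcone n G"
| rcone_step: "X \<in> rcone n G \<Longrightarrow> v \<in> G \<Longrightarrow> X + ro n v \<in> rcone n G"

lemma rcone_carrier: "X \<in> rcone n G \<Longrightarrow> X \<in> carrier_mat n n"
  by (induction rule: rcone.induct) auto

lemma rcone_ro: "v \<in> G \<Longrightarrow> ro n v \<in> rcone n G"
  using rcone_step[OF rcone_zero, of v G n] by simp

lemma rcone_add: "Y \<in> rcone n G \<Longrightarrow> X \<in> rcone n G \<Longrightarrow> X + Y \<in> rcone n G"
proof (induction rule: rcone.induct)
  case (rcone_step Y v)
  then have "X + (Y + ro n v) = (X + Y) + ro n v"
    using rcone_carrier by (intro assoc_add_mat[symmetric, of _ n n]) auto
  then show ?case using rcone_step rcone.rcone_step by metis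
qed (use rcone_carrier in auto)

lemma mat_sum_Suc: "F k \<in> carrier_mat n n \<Longrightarrow> mat_sum n (Suc k) F = mat_sum n k F + F k"
  by (intro eq_matI) auto

lemma mat_sum_0 [simp]: "mat_sum n 0 F = 0\<^sub>m n n"
  by (intro eq_matI) auto

lemma rcone_mat_sum: "(\<And>x. x < k \<Longrightarrow> F x \<in> rcone n G) \<Longrightarrow> mat_sum n k F \<in> rcone n G"
proof (induction k)
  case (Suc k)
  then have "mat_sum n (Suc k) F = mat_sum n k F + F k"
    by (intro mat_sum_Suc rcone_carrier) auto
  then show ?case using Suc by (simp add: rcone_add)
qed (simp add: rcone_zero)

lemma ro_scale:
  assumes "0 \<le> c"
  shows "ro n (\<lambda>i. complex_of_real (sqrt c) * v i) = complex_of_real c \<cdot>\<^sub>m ro n v"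
proof (rule eq_matI)
  fix i j assume "i < dim_row (complex_of_real c \<cdot>\<^sub>m ro n v)" "j < dim_col (complex_of_real c \<cdot>\<^sub>m ro n v)"
  then have ij: "i < n" "j < n" by auto
  define s where "s = complex_of_real (sqrt c)"
  have ss: "s * s = complex_of_real c" "cnj s = s"
    using assms by (auto simp: s_def simp flip: of_real_mult)
  have "s * v i * cnj (s * v j) = (s * s) * (v i * cnj (v j))"
    by (simp add: ss(2))
  then show "ro n (\<lambda>i. complex_of_real (sqrt c) * v i) $$ (i, j) = (complex_of_real c \<cdot>\<^sub>m ro n v) $$ (i, j)"
    using ij by (simp add: ss(1) flip: s_def)
qed auto

lemma rcone_smult:
  assumes G: "\<And>c v. v \<in> G \<Longrightarrow> (\<lambda>i. complex_of_real c * v i) \<in> G"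
  shows "X \<in> rcone n G \<Longrightarrow> 0 \<le> c \<Longrightarrow> complex_of_real c \<cdot>\<^sub>m X \<in> rcone n G"
proof (induction rule: rcone.induct)
  case rcone_zero
  have "complex_of_real c \<cdot>\<^sub>m 0\<^sub>m n n = 0\<^sub>m n n" by (intro eq_matI) auto
  then show ?case by (simp add: rcone.rcone_zero)
next
  case (rcone_step X v)
  have "complex_of_real c \<cdot>\<^sub>m (X + ro n v) = complex_of_real c \<cdot>\<^sub>m X + ro n (\<lambda>i. complex_of_real (sqrt c) * v i)"
    using rcone_step(4) rcone_carrier[OF rcone_step(1)]
    by (simp add: ro_scale add_smult_distrib_left_mat[OF _ ro_carrier])
  then show ?case using rcone_step G by (simp add: rcone.rcone_step)
qed

lemma rcone_imp_sum:
  "X \<in> rcone n G \<Longrightarrow> \<exists>(k::nat) V. (\<forall>x<k. V x \<in> G) \<and> X = mat_sum n k (\<lambda>x. ro n (V x))"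
proof (induction rule: rcone.induct)
  case rcone_zero
  have "0\<^sub>m n n = mat_sum n 0 (\<lambda>x. ro n (undefined x))" by simp
  then show ?case by blast
next
  case (rcone_step X v)
  then obtain k V where "\<forall>x<k. V x \<in> G" "X = mat_sum n k (\<lambda>x. ro n (V x))" by blast
  then have "X + ro n v = mat_sum n (Suc k) (\<lambda>x. ro n ((V(k := v)) x))" 
    "\<forall>x<Suc k. (V(k := v)) x \<in> G"
    using rcone_step(2) by (auto simp: less_Suc_eq intro!: eq_matI)
  then show ?case by blast
qed

lemma psd_add: "psd n X \<Longrightarrow> psd n Y \<Longrightarrow> psd n (X + Y)"
  by (auto simp: psd_iff_qf qf_add)

lemma psd_smult: "psd n X \<Longrightarrow> 0 \<le> c \<Longrightarrow> psd n (complex_of_real c \<cdot>\<^sub>m X)"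
  by (auto simp: psd_iff_qf qf_smult less_eq_complex_def)

lemma psd_ro: "psd n (ro n v)"
  by (auto simp: psd_iff_qf qf_ro less_eq_complex_def)

lemma psd_zero: "psd n (0\<^sub>m n n)"
  by (auto simp: psd_iff_qf)

lemma psd_one: "psd n (1\<^sub>m n)"
  by (auto simp: psd_iff_qf)

lemma rcone_psd: "X \<in> rcone n G \<Longrightarrow> psd n X"
  by (induction rule: rcone.induct) (auto intro: psd_zero psd_add psd_ro)

section \<open>Polarisation and Hermitian matrices\<close>

definition hermitian :: "nat \<Rightarrow> complex mat \<Rightarrow> bool" where
  "hermitian n X \<longleftrightarrow> X \<in> carrier_mat n n \<and> (\<forall>i<n. \<forall>j<n. X $$ (j, i) = cnj (X $$ (i, j)))"

lemma qf_sesqui: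
  assumes "X \<in> carrier_mat n n"
  shows "qf n X (\<lambda>i. a * u i + b * v i) = cnj a * a * qf n X u + cnj b * b * qf n X v
    + cnj a * b * (\<Sum>i<n. \<Sum>j<n. cnj (u i) * X $$ (i, j) * v j)
    + cnj b * a * (\<Sum>i<n. \<Sum>j<n. cnj (v i) * X $$ (i, j) * u j)"
  unfolding qf_def sum_distrib_left sum.distrib[symmetric]
  by (intro sum.cong refl) (simp add: algebra_simps)

lemma sesqui_unit:
  assumes "p < n" "q < n"
  shows "(\<Sum>i<n. \<Sum>j<n. cnj (if i = p then 1 else 0) * X $$ (i, j) * (if j = q then 1 else 0)) = X $$ (p, q)"
proof -
  have "(\<Sum>i<n. \<Sum>j<n. cnj (if i = p then 1 else 0) * X $$ (i, j) * (if j = q then 1 else 0))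
     = (\<Sum>i<n. if i = p then X $$ (i, q) else 0)"
    using assms by (intro sum.cong refl) (auto simp: if_distrib cong: if_cong)
  then show ?thesis using assms by simp
qed

text \<open>The four phases 1, -1, \<i>, -\<i> recover single entries from values of the form, so
  quadratic forms separate all complex matrices, Hermitian or not.\<close>

lemma polarization:
  assumes X: "X \<in> carrier_mat n n" and pq: "p < n" "q < n"
  defines "e \<equiv> \<lambda>p i. if i = p then 1 else 0 :: complex"
  shows "4 * X $$ (p, q) = qf n X (\<lambda>i. 1 * e p i + 1 * e q i) - qf n X (\<lambda>i. 1 * e p i + (-1) * e q i)
     - \<i> * qf n X (\<lambda>i. 1 * e p i + \<i> * e q i) + \<i> * qf n X (\<lambda>i. 1 * e p i + (-\<i>) * e q i)"
  unfolding qf_sesqui[OF X] e_def sesqui_unit[OF pq] sesqui_unit[OF pq(2,1)]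
  by (simp add: algebra_simps)

lemma qf_eq_imp_eq:
  assumes "X \<in> carrier_mat n n" "Y \<in> carrier_mat n n" "\<And>v. qf n X v = qf n Y v"
  shows "X = Y"
proof (rule eq_matI)
  fix i j assume "i < dim_row Y" "j < dim_col Y"
  then have ij: "i < n" "j < n" using assms by auto
  have "4 * X $$ (i, j) = 4 * Y $$ (i, j)"
    unfolding polarization[OF assms(1) ij] polarization[OF assms(2) ij] assms(3) ..
  then show "X $$ (i, j) = Y $$ (i, j)" by simp
qed (use assms in auto)

lemma psd_hermitian:
  assumes "psd n X" shows "hermitian n X"
  unfolding hermitian_def
proof safe
  show X: "X \<in> carrier_mat n n" using assms by (simp add: psd_def)
  fix i j assume ij: "i < n" "j < n"
  define e where "e p i = (if i = p then 1 else 0 :: complex)" for p i :: nat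
  have r: "Im (qf n X v) = 0" for v
    using assms by (auto simp: psd_iff_qf less_eq_complex_def)
  have d: "qf n X (e p) = X $$ (p, p)" if "p < n" for p
    using sesqui_unit[OF that that, of X] by (simp add: qf_def e_def)
  have "Im (X $$ (i, i)) = 0" "Im (X $$ (j, j)) = 0"
    using d r ij by metis+
  moreover have "Im (cnj a * a * X $$ (i, i) + cnj b * b * X $$ (j, j)
     + cnj a * b * X $$ (i, j) + cnj b * a * X $$ (j, i)) = 0" for a b
  proof -
    have "qf n X (\<lambda>k. a * e i k + b * e j k) = cnj a * a * X $$ (i, i) + cnj b * b * X $$ (j, j)
     + cnj a * b * X $$ (i, j) + cnj b * a * X $$ (j, i)"
      using ij unfolding qf_sesqui[OF X] d[OF ij(1)] d[OF ij(2)] by (simp add: e_def sesqui_unit)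
    then show ?thesis using r by metis
  qed
  \<comment> \<open>The coefficient pairs (1, 1) and (1, \<i>) isolate Im(X_ij + X_ji) and Re(X_ij -
    X_ji), the diagonal being real.\<close>
  from this[of 1 1] this[of 1 \<i>]
  have "Im (X $$ (i, i)) + Im (X $$ (j, j)) + Im (X $$ (i, j)) + Im (X $$ (j, i)) = 0"
    "Im (X $$ (i, i)) + Im (X $$ (j, j)) + Re (X $$ (i, j)) - Re (X $$ (j, i)) = 0"
    by simp_all
  ultimately show "X $$ (j, i) = cnj (X $$ (i, j))"
    by (simp add: complex_eq_iff)
qed

section \<open>The spectral theorem and the trace norm\<close>

text \<open>Gaussian elimination on the last coordinate: multiples of a pivot p are subtracted from
  the other vectors, and the coefficient of p is fixed last. It serves over the complex numbers, for
  a vector orthogonal to fewer than n vectors, and over the reals, for the Caratheodory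
  argument.\<close>

lemma linear_dependence:
  fixes f :: "'k \<Rightarrow> nat \<Rightarrow> 'a :: field"
  assumes "finite K" "n < card K"
  shows "\<exists>c. (\<exists>i\<in>K. c i \<noteq> 0) \<and> (\<forall>j<n. (\<Sum>i\<in>K. c i * f i j) = 0)"
  using assms
proof (induction n arbitrary: K f)
  case 0
  then obtain i where "i \<in> K" by (metis card_gt_0_iff ex_in_conv)
  then show ?case by (intro exI[of _ "\<lambda>_. 1"]) auto
next
  case (Suc n)
  show ?case
  proof (cases "\<forall>i\<in>K. f i n = 0")
    case True
    have "n < card K" using Suc.prems by simp
    from Suc.IH[OF Suc.prems(1) this, of f] obtain c where
      "\<exists>i\<in>K. c i \<noteq> 0" "\<forall>j<n. (\<Sum>i\<in>K. c i * f i j) = 0" by blast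
    then show ?thesis using True by (intro exI[of _ c]) (auto simp: less_Suc_eq)
  next
    case False
    then obtain p where p: "p \<in> K" "f p n \<noteq> 0" by blast
    define K' where "K' = K - {p}"
    define g where "g i j = f i j - f i n / f p n * f p j" for i j
    have K': "finite K'" "n < card K'" using Suc.prems p by (auto simp: K'_def)
    from Suc.IH[OF this, of g] obtain c where
      c: "\<exists>i\<in>K'. c i \<noteq> 0" "\<forall>j<n. (\<Sum>i\<in>K'. c i * g i j) = 0" by blast
    define s where "s = (\<Sum>i\<in>K'. c i * f i n / f p n)"
    define c' where "c' = c(p := - s)"
    have sum: "(\<Sum>i\<in>K. c' i * f i j) = (\<Sum>i\<in>K'. c i * f i j) - s * f p j" for j
    proof -
      have "(\<Sum>i\<in>K. c' i * f i j) = c' p * f p j + (\<Sum>i\<in>K'. c' i * f i j)"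
        using Suc.prems p by (simp add: K'_def sum.remove)
      also have "(\<Sum>i\<in>K'. c' i * f i j) = (\<Sum>i\<in>K'. c i * f i j)"
        by (intro sum.cong) (auto simp: c'_def K'_def)
      finally show ?thesis by (simp add: c'_def)
    qed
    have "(\<Sum>i\<in>K. c' i * f i j) = 0" if "j < Suc n" for j
    proof (cases "j = n")
      case True
      then show ?thesis unfolding sum s_def sum_distrib_right using p by simp
    next
      case False
      then have "(\<Sum>i\<in>K'. c i * g i j) = 0" using c(2) that by simp
      moreover have "(\<Sum>i\<in>K'. c i * g i j) = (\<Sum>i\<in>K'. c i * f i j) - s * f p j"
        unfolding g_def s_def sum_distrib_right sum_subtractf[symmetric]
        by (intro sum.cong) (auto simp: algebra_simps)
      ultimately show ?thesis unfolding sum by simp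
    qed
    moreover have "\<exists>i\<in>K. c' i \<noteq> 0" using c(1) by (auto simp: c'_def K'_def)
    ultimately show ?thesis by (intro exI[of _ c']) auto
  qed
qed

section \<open>Positive matrices as sums of rank-one matrices\<close>

definition mv :: "nat \<Rightarrow> complex mat \<Rightarrow> (nat \<Rightarrow> complex) \<Rightarrow> nat \<Rightarrow> complex" where
  "mv n X v i = (\<Sum>j<n. X $$ (i, j) * v j)"

lemma qf_eq_cip_mv: "qf n X v = cip n v (mv n X v)"
  by (simp add: qf_def cip_def mv_def sum_distrib_left mult.assoc)

lemma hermitianD: "hermitian n X \<Longrightarrow> i < n \<Longrightarrow> j < n \<Longrightarrow> cnj (X $$ (i, j)) = X $$ (j, i)"
  unfolding hermitian_def by metis

lemma cip_mv_hermitian: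
  assumes "hermitian n X" shows "cip n u (mv n X v) = cip n (mv n X u) v"
proof -
  have "cip n (mv n X u) v = (\<Sum>i<n. \<Sum>j<n. cnj (u j) * X $$ (j, i) * v i)"
    using hermitianD[OF assms]
    by (simp add: cip_def mv_def sum_distrib_left sum_distrib_right mult_ac)
  also have "\<dots> = (\<Sum>j<n. \<Sum>i<n. cnj (u j) * X $$ (j, i) * v i)"
    by (rule sum.swap)
  finally show ?thesis by (simp add: cip_def mv_def sum_distrib_left mult.assoc)
qed

lemma cip_cnj: "cnj (cip n u v) = cip n v u"
  by (simp add: cip_def mult.commute)

lemma nrm_eq_0_iff: "nrm n v = 0 \<longleftrightarrow> (\<forall>i<n. v i = 0)"
  by (auto simp: nrm_def sum_nonneg_eq_0_iff)

lemma qf_shift: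
  assumes X: "X \<in> carrier_mat n n"
  shows "qf n X (\<lambda>i. v i + t * w i) = qf n X v + cnj t * t * qf n X w
     + t * cip n v (mv n X w) + cnj t * cip n w (mv n X v)"
proof -
  have "cip n u (mv n X v) = (\<Sum>i<n. \<Sum>j<n. cnj (u i) * X $$ (i, j) * v j)" for u v
    by (simp add: cip_def mv_def sum_distrib_left mult.assoc)
  then show ?thesis
    using qf_sesqui[OF X, of 1 v t w] by (simp add: algebra_simps)
qed

text \<open>Completing the square: the form of the reduced matrix at v is the form of X at v + t e_p
  for the t that minimises it, so it stays nonnegative.\<close>

lemma psd_schur_complement:
  assumes "psd n X" "p < n" "X $$ (p, p) \<noteq> 0"
  defines "c \<equiv> Re (X $$ (p, p))"
  shows "0 < c" "psd n (X - complex_of_real (1 / c) \<cdot>\<^sub>m ro n (\<lambda>i. X $$ (i, p)))"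
proof -
  have X: "X \<in> carrier_mat n n" and h: "hermitian n X"
    using assms by (auto simp: psd_carrier psd_hermitian)
  define e where "e i = (if i = p then 1 else 0 :: complex)" for i
  have mve: "mv n X e i = X $$ (i, p)" for i
    using assms(2) by (simp add: mv_def e_def if_distrib cong: if_cong)
  have e1: "cip n e w = w p" for w
    using assms(2) by (simp add: cip_def e_def if_distrib if_distribR cong: if_cong)
  have qe: "qf n X e = X $$ (p, p)"
    by (simp add: qf_eq_cip_mv e1 mve)
  have "0 \<le> X $$ (p, p)" using assms(1) by (auto simp: psd_iff_qf simp flip: qe)
  then have pp: "X $$ (p, p) = complex_of_real c" "0 \<le> c"
    by (auto simp: c_def nonneg_complex_iff)
  then show "0 < c" using assms(3) by auto
  show "psd n (X - complex_of_real (1 / c) \<cdot>\<^sub>m ro n (\<lambda>i. X $$ (i, p)))"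
    unfolding psd_iff_qf
  proof (intro conjI allI)
    fix v
    define z where "z = cip n (\<lambda>i. X $$ (i, p)) v"
    define t where "t = - z / complex_of_real c"
    have mve': "mv n X e = (\<lambda>i. X $$ (i, p))" by (rule ext) (rule mve)
    have z1: "cip n v (mv n X e) = cnj z"
      unfolding mve' z_def cip_cnj ..
    have z2: "cip n e (mv n X v) = z"
      unfolding cip_mv_hermitian[OF h] mve' z_def ..
    have "qf n X (\<lambda>i. v i + t * e i) = qf n X v + cnj t * t * complex_of_real c + t * cnj z + cnj t * z"
      unfolding qf_shift[OF X] z1 z2 qe pp ..
    also have "\<dots> = qf n X v - complex_of_real ((cmod z)\<^sup>2) / complex_of_real c"
      using \<open>0 < c\<close> by (simp add: t_def field_simps of_real_cmod_square)
    also have "\<dots> = qf n (X - complex_of_real (1 / c) \<cdot>\<^sub>m ro n (\<lambda>i. X $$ (i, p))) v"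
      using X by (simp add: qf_minus qf_smult qf_ro z_def)
    finally show "0 \<le> qf n (X - complex_of_real (1 / c) \<cdot>\<^sub>m ro n (\<lambda>i. X $$ (i, p))) v"
      using assms(1) by (metis psd_iff_qf)
  qed (use X in auto)
qed

lemma psd_diag_zero:
  assumes "psd n X" "\<And>i. i < n \<Longrightarrow> X $$ (i, i) = 0"
  shows "X = 0\<^sub>m n n"
proof (rule eq_matI)
  have X: "X \<in> carrier_mat n n" and h: "hermitian n X"
    using assms by (auto simp: psd_carrier psd_hermitian)
  then show "dim_row X = dim_row (0\<^sub>m n n)" "dim_col X = dim_col (0\<^sub>m n n)" by auto
  fix i j assume "i < dim_row (0\<^sub>m n n)" "j < dim_col (0\<^sub>m n n)"
  then have ij: "i < n" "j < n" by auto
  define e where "e p i = (if i = p then 1 else 0 :: complex)" for p i :: nat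
  have mve: "mv n X (e p) i = X $$ (i, p)" if "p < n" for i p
    using that by (simp add: mv_def e_def if_distrib cong: if_cong)
  have e1: "cip n (e p) w = w p" if "p < n" for w p
    using that by (simp add: cip_def e_def if_distrib if_distribR cong: if_cong)
  \<comment> \<open>With zero diagonal only the cross terms survive, and this t turns them into -2
    |X_ij|^2.\<close>
  define t where "t = - X $$ (i, j)"
  have "qf n X (\<lambda>k. e j k + t * e i k) = t * X $$ (j, i) + cnj t * X $$ (i, j)"
    unfolding qf_shift[OF X] using ij assms(2) by (simp add: qf_eq_cip_mv e1 mve)
  also have "\<dots> = - 2 * complex_of_real ((cmod (X $$ (i, j)))\<^sup>2)"
    using hermitianD[OF h ij] by (simp add: t_def mult.commute of_real_cmod_square)
  finally have "0 \<le> - 2 * complex_of_real ((cmod (X $$ (i, j)))\<^sup>2)"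
    using assms(1) by (metis psd_iff_qf)
  then show "X $$ (i, j) = 0\<^sub>m n n $$ (i, j)" using ij by (simp add: less_eq_complex_def)
qed

text \<open>A Cholesky decomposition: each Schur complement clears one nonzero diagonal entry and,
  being positive itself, cannot revive a cleared one. Claims about positive matrices thereby reduce
  to rank-one matrices by induction over \<open>rcone\<close>.\<close>

lemma psd_imp_rcone: "psd n X \<Longrightarrow> X \<in> rcone n UNIV"
proof (induction "card {i. i < n \<and> X $$ (i, i) \<noteq> 0}" arbitrary: X rule: less_induct)
  case less
  note X = psd_carrier[OF less.prems]
  show ?case
  proof (cases "\<forall>i<n. X $$ (i, i) = 0")
    case True
    then show ?thesis using psd_diag_zero[OF less.prems] by (simp add: rcone_zero)
  next
    case False
    then obtain p where p: "p < n" "X $$ (p, p) \<noteq> 0" by blast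
    define c where "c = Re (X $$ (p, p))"
    define R where "R = complex_of_real (1 / c) \<cdot>\<^sub>m ro n (\<lambda>i. X $$ (i, p))"
    note sc = psd_schur_complement[OF less.prems p, folded c_def]
    have psdY: "psd n (X - R)" unfolding R_def using sc by blast
    have R: "R = ro n (\<lambda>i. complex_of_real (sqrt (1 / c)) * X $$ (i, p))"
      unfolding R_def using sc(1) by (intro ro_scale[symmetric]) simp
    have diag: "0 \<le> Y $$ (i, i)" if "psd n Y" "i < n" for Y i
    proof -
      have "trp n Y (ro n (\<lambda>k. if k = i then 1 else 0)) = Y $$ (i, i)"
        unfolding trp_ro qf_def by (rule sesqui_unit) fact+
      then show ?thesis using that by (metis psd_iff_qf trp_ro)
    qed
    have le: "(X - R) $$ (i, i) = 0" if "X $$ (i, i) = 0" "i < n" for i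
    proof -
      have Ri: "0 \<le> R $$ (i, i)" using that(2) unfolding R by (intro diag[OF psd_ro]) auto
      have "0 \<le> (X - R) $$ (i, i)" using psdY that(2) by (rule diag)
      moreover have "(X - R) $$ (i, i) = - R $$ (i, i)" using that X by (simp add: R_def)
      ultimately show ?thesis using Ri by (auto simp: less_eq_complex_def complex_eq_iff)
    qed
    have "cnj (X $$ (p, p)) = X $$ (p, p)"
      using hermitianD[OF psd_hermitian[OF less.prems]] p by blast
    then have "X $$ (p, p) = complex_of_real c" by (simp add: c_def complex_eq_iff)
    then have Yp: "(X - R) $$ (p, p) = 0" using p X sc(1) by (simp add: R_def)
    have "card {i. i < n \<and> (X - R) $$ (i, i) \<noteq> 0} < card {i. i < n \<and> X $$ (i, i) \<noteq> 0}"
      by (rule psubset_card_mono) (use le Yp p in auto)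
    from less.hyps[OF this psdY] have "(X - R) + R \<in> rcone n UNIV"
      unfolding R by (rule rcone.rcone_step) simp
    moreover have "(X - R) + R = X" using X by (intro eq_matI) (auto simp: R_def)
    ultimately show ?thesis by simp
  qed
qed

section \<open>Compactness and the spectral theorem\<close>

lemma continuous_coord: "continuous_on S (\<lambda>v :: nat \<Rightarrow> complex. v i)"
  using continuous_on_subset[OF continuous_on_product_coordinates subset_UNIV] .

lemma continuous_qf: "continuous_on S (\<lambda>v. qf n X v)"
  unfolding qf_def by (intro continuous_intros continuous_coord)

lemma continuous_nrm: "continuous_on S (\<lambda>v. nrm n v)"
  unfolding nrm_def by (intro continuous_intros continuous_coord)

lemma continuous_cip: "continuous_on S (\<lambda>v. cip n u v)"
  unfolding cip_def by (intro continuous_intros continuous_coord)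

text \<open>A compact set containing the unit disc; a square is convenient because it is the image
  of a product of two intervals.\<close>

definition csquare :: "complex set" where
  "csquare = {z. \<bar>Re z\<bar> \<le> 1 \<and> \<bar>Im z\<bar> \<le> 1}"

lemma compact_csquare: "compact csquare"
proof -
  have "csquare = (\<lambda>(x, y). complex_of_real x + \<i> * complex_of_real y) ` ({-1..1} \<times> {-1..1})"
  proof (intro equalityI subsetI)
    fix z assume "z \<in> csquare"
    then have "(Re z, Im z) \<in> {-1..1} \<times> {-1..1}" by (auto simp: csquare_def)
    moreover have "z = (\<lambda>(x, y). complex_of_real x + \<i> * complex_of_real y) (Re z, Im z)"
      by (simp add: complex_eq_iff)
    ultimately show "z \<in> (\<lambda>(x, y). complex_of_real x + \<i> * complex_of_real y) ` ({-1..1} \<times> {-1..1})"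
      by blast
  qed (auto simp: csquare_def)
  also have "compact \<dots>"
    unfolding case_prod_beta
    by (intro compact_continuous_image compact_Times continuous_intros) auto
  finally show ?thesis .
qed

lemma csquareI: "cmod z \<le> 1 \<Longrightarrow> z \<in> csquare"
  using abs_Re_le_cmod[of z] abs_Im_le_cmod[of z] by (auto simp: csquare_def)

text \<open>Tychonoff: infinitely many coordinates cost nothing, so vectors and whole families of
  vectors can stay total functions on the naturals.\<close>

lemma compact_polysquare: "compact (PiE UNIV (\<lambda>_. csquare) :: (nat \<Rightarrow> complex) set)"
proof -
  have "compactin (product_topology (\<lambda>_. euclidean) UNIV) (PiE UNIV (\<lambda>_. csquare) :: (nat \<Rightarrow> complex) set)"
    by (subst compactin_PiE) (auto simp: compact_csquare)
  then show ?thesis by (simp add: euclidean_product_topology)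
qed

definition onsys :: "nat \<Rightarrow> nat \<Rightarrow> (nat \<Rightarrow> nat \<Rightarrow> complex) \<Rightarrow> bool" where
  "onsys n k u \<longleftrightarrow> (\<forall>a<k. \<forall>b<k. cip n (u a) (u b) = (if a = b then 1 else 0))"

lemma nrm_scale: "nrm n (\<lambda>i. c * v i) = (cmod c)\<^sup>2 * nrm n v"
  by (simp add: nrm_def norm_mult power_mult_distrib sum_distrib_left)

lemma cip_scale: "cip n u (\<lambda>i. c * v i) = c * cip n u v"
  by (simp add: cip_def sum_distrib_left mult_ac)

lemma qf_scale: "qf n X (\<lambda>i. c * v i) = complex_of_real ((cmod c)\<^sup>2) * qf n X v"
  unfolding mult_cnj_self[symmetric] qf_def sum_distrib_left by (intro sum.cong) (auto simp: mult_ac)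

lemma cip_cong: "(\<And>i. i < n \<Longrightarrow> v i = w i) \<Longrightarrow> cip n u v = cip n u w"
  by (simp add: cip_def)

lemma nrm_cong: "(\<And>i. i < n \<Longrightarrow> v i = w i) \<Longrightarrow> nrm n v = nrm n w"
  by (simp add: nrm_def)

lemma qf_cong: "(\<And>i. i < n \<Longrightarrow> v i = w i) \<Longrightarrow> qf n X v = qf n X w"
  by (simp add: qf_def)

text \<open>The Rayleigh quotient on the orthogonal complement of u_0, ..., u_(k-1). The maximum is
  taken over unit vectors that vanish from n on, which keeps them in the compact product of squares;
  homogeneity extends the bound to every w.\<close>

lemma exists_rayleigh_max:
  assumes "k < n"
  shows "\<exists>v. nrm n v = 1 \<and> (\<forall>a<k. cip n (u a) v = 0) \<and>
    (\<forall>w. (\<forall>a<k. cip n (u a) w = 0) \<longrightarrow> Re (qf n X w) \<le> Re (qf n X v) * nrm n w)"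
proof -
  define C where "C = PiE UNIV (\<lambda>_. csquare) \<inter> ({v :: nat \<Rightarrow> complex. nrm n v = 1} \<inter>
     (\<Inter>i\<in>{n..}. {v. v i = 0}) \<inter> (\<Inter>a\<in>{..<k}. {v. cip n (u a) v = 0}))"
  have "closed {v :: nat \<Rightarrow> complex. nrm n v = 1}" "closed {v. cip n (u a) v = 0}" for a
    by (intro closed_Collect_eq continuous_nrm continuous_cip continuous_on_const)+
  moreover have "closed {v :: nat \<Rightarrow> complex. v i = 0}" for i
    by (intro closed_Collect_eq continuous_coord continuous_on_const)
  ultimately have "compact C"
    unfolding C_def by (intro compact_Int_closed compact_polysquare closed_Int closed_INT) auto
  have inC: "(\<lambda>i. if i < n then complex_of_real (1 / sqrt (nrm n w)) * w i else 0) \<in> C"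
    (is "?w \<in> C") if w: "nrm n w \<noteq> 0" "\<forall>a<k. cip n (u a) w = 0" for w
  proof -
    have pos: "0 < nrm n w" using w nrm_nonneg[of n w] by linarith
    have "nrm n ?w = nrm n (\<lambda>i. complex_of_real (1 / sqrt (nrm n w)) * w i)"
      by (rule nrm_cong) simp
    also have "\<dots> = 1" unfolding nrm_scale using pos by (simp add: norm_divide power_divide)
    finally have n1: "nrm n ?w = 1" .
    have "cip n (u a) ?w = 0" if "a < k" for a
    proof -
      have "cip n (u a) ?w = cip n (u a) (\<lambda>i. complex_of_real (1 / sqrt (nrm n w)) * w i)"
        by (rule cip_cong) simp
      then show ?thesis unfolding cip_scale using w that by simp
    qed
    moreover have "cmod (?w i) \<le> 1" for i
    proof (cases "i < n")
      case True
      then have "(cmod (?w i))\<^sup>2 \<le> nrm n ?w"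
        unfolding nrm_def by (intro member_le_sum) auto
      then show ?thesis using n1 by (simp add: abs_square_le_1)
    qed simp
    ultimately show ?thesis using n1 csquareI unfolding C_def by auto
  qed
  \<comment> \<open>k linear conditions on n > k coordinates leave a nonzero solution, so the set of
    candidates is not empty.\<close>
  have "\<exists>c. (\<exists>i\<in>{..<n}. c i \<noteq> 0) \<and> (\<forall>a<k. (\<Sum>i\<in>{..<n}. c i * cnj (u a i)) = 0)"
    by (rule linear_dependence) (use assms in auto)
  then obtain c where c: "\<exists>i<n. c i \<noteq> 0" "\<forall>a<k. cip n (u a) c = 0"
    by (auto simp: cip_def mult.commute)
  from c(1) have "nrm n c \<noteq> 0" by (auto simp: nrm_eq_0_iff)
  with inC c(2) have "C \<noteq> {}" by blast
  moreover have "continuous_on C (\<lambda>v. Re (qf n X v))"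
    by (intro continuous_intros continuous_qf)
  ultimately obtain v where v: "v \<in> C" "\<And>w. w \<in> C \<Longrightarrow> Re (qf n X w) \<le> Re (qf n X v)"
    using continuous_attains_sup[OF \<open>compact C\<close>] by blast
  have "Re (qf n X w) \<le> Re (qf n X v) * nrm n w" if w: "\<forall>a<k. cip n (u a) w = 0" for w
  proof (cases "nrm n w = 0")
    case True
    then have "qf n X w = qf n X (\<lambda>_. 0)" by (intro qf_cong) (auto simp: nrm_eq_0_iff)
    then show ?thesis using True by (simp add: qf_def)
  next
    case False
    then have pos: "0 < nrm n w" using nrm_nonneg[of n w] by linarith
    have "Re (qf n X (\<lambda>i. if i < n then complex_of_real (1 / sqrt (nrm n w)) * w i else 0)) \<le> Re (qf n X v)"
      using v(2) inC False w by blast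
    also have "qf n X (\<lambda>i. if i < n then complex_of_real (1 / sqrt (nrm n w)) * w i else 0)
        = qf n X (\<lambda>i. complex_of_real (1 / sqrt (nrm n w)) * w i)"
      by (rule qf_cong) simp
    also have "\<dots> = complex_of_real (1 / nrm n w) * qf n X w"
      unfolding qf_scale using pos by (simp add: norm_divide power_divide)
    finally show ?thesis using pos by (simp add: field_simps)
  qed
  moreover have "nrm n v = 1" "\<forall>a<k. cip n (u a) v = 0" using v(1) by (auto simp: C_def)
  ultimately show ?thesis by blast
qed

text \<open>First-order optimality. N = r - X is nonnegative on the complement and its form vanishes
  at the maximiser v, so moving from v to v - s w with w = N v gives 2 |w|^2 \<le> s <w, N w> for
  all s > 0, hence w = 0. The move stays in the complement because the u_a are eigenvectors.\<close>

lemma hermitian_eigenvector: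
  assumes h: "hermitian n X" and "k < n"
    and ev: "\<And>a i. a < k \<Longrightarrow> i < n \<Longrightarrow> mv n X (u a) i = complex_of_real (l a) * u a i"
  shows "\<exists>v r. nrm n v = 1 \<and> (\<forall>a<k. cip n (u a) v = 0) \<and> 
     (\<forall>i<n. mv n X v i = complex_of_real r * v i)"
proof -
  have X: "X \<in> carrier_mat n n" using h by (simp add: hermitian_def)
  obtain v where v: "nrm n v = 1" "\<And>a. a < k \<Longrightarrow> cip n (u a) v = 0"
    and vmax: "\<And>w. (\<forall>a<k. cip n (u a) w = 0) \<Longrightarrow> Re (qf n X w) \<le> Re (qf n X v) * nrm n w"
    using exists_rayleigh_max[OF \<open>k < n\<close>, of u X] by blast
  define r where "r = Re (qf n X v)"
  define N where "N = complex_of_real r \<cdot>\<^sub>m 1\<^sub>m n - X"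
  have N: "N \<in> carrier_mat n n" unfolding N_def by (rule minus_carrier_mat[OF X])
  have hN: "hermitian n N"
    using X hermitianD[OF h] by (auto simp: hermitian_def N_def)
  have mvN: "mv n N w i = complex_of_real r * w i - mv n X w i" if "i < n" for w i
  proof -
    have "mv n N w i = (\<Sum>j<n. (if j = i then complex_of_real r * w j else 0) - X $$ (i, j) * w j)"
      unfolding mv_def using that X by (intro sum.cong) (auto simp: N_def algebra_simps)
    then show ?thesis using that by (simp add: sum_subtractf mv_def)
  qed
  have qfN: "qf n N w = complex_of_real (r * nrm n w) - qf n X w" for w
    using X by (simp add: N_def qf_minus qf_smult)
  have pos: "0 \<le> Re (qf n N w)" if "\<forall>a<k. cip n (u a) w = 0" for w
    using vmax[OF that] by (simp add: qfN r_def)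
  have Nv: "Re (qf n N v) = 0" by (simp add: qfN v r_def)
  define w where "w = mv n N v"
  have worth: "cip n (u a) w = 0" if "a < k" for a
  proof -
    have "cip n (u a) w = cip n (mv n N (u a)) v"
      unfolding w_def by (rule cip_mv_hermitian[OF hN])
    also have "\<dots> = (\<Sum>i<n. complex_of_real (r - l a) * (cnj (u a i) * v i))"
      unfolding cip_def by (intro sum.cong) (auto simp: mvN ev that algebra_simps)
    also have "\<dots> = complex_of_real (r - l a) * cip n (u a) v"
      by (simp add: cip_def sum_distrib_left)
    finally show ?thesis using v(2)[OF that] by simp
  qed
  have "2 * nrm n w \<le> s * Re (qf n N w)" if "0 < s" for s :: real
  proof -
    have "cip n (u a) (\<lambda>i. v i + complex_of_real (- s) * w i) = 0" if "a < k" for a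
    proof -
      have "cip n (u a) (\<lambda>i. v i + complex_of_real (- s) * w i)
         = cip n (u a) v + complex_of_real (- s) * cip n (u a) w"
        unfolding cip_def sum_distrib_left sum.distrib[symmetric]
        by (intro sum.cong) (auto simp: algebra_simps)
      then show ?thesis using worth v(2) that by simp
    qed
    then have "0 \<le> Re (qf n N (\<lambda>i. v i + complex_of_real (- s) * w i))"
      by (intro pos) auto
    also have "qf n N (\<lambda>i. v i + complex_of_real (- s) * w i) = qf n N v
       + complex_of_real (s * s) * qf n N w - complex_of_real s * (cip n v (mv n N w) + cip n w w)"
      unfolding qf_shift[OF N] w_def by (simp add: algebra_simps)
    also have "cip n v (mv n N w) = cip n w w"
      unfolding cip_mv_hermitian[OF hN] w_def ..
    finally have "0 \<le> s * (s * Re (qf n N w) - 2 * nrm n w)"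
      by (simp add: Nv cip_self algebra_simps)
    then show ?thesis using that by (simp add: zero_le_mult_iff)
  qed
  then have "2 * nrm n w \<le> 0"
  proof -
    assume b: "\<And>s::real. 0 < s \<Longrightarrow> 2 * nrm n w \<le> s * Re (qf n N w)"
    show ?thesis
    proof (rule ccontr)
      assume "\<not> ?thesis"
      then have p: "0 < nrm n w" by simp
      from b[of 1] p have q: "0 < Re (qf n N w)" by linarith
      from b[of "nrm n w / Re (qf n N w)"] p q show False by simp
    qed
  qed
  then have "nrm n w = 0" using nrm_nonneg[of n w] by linarith
  then have "\<forall>i<n. mv n X v i = complex_of_real r * v i"
    using mvN by (auto simp: w_def nrm_eq_0_iff)
  then show ?thesis using v by blast
qed

lemma hermitian_eigensystem:
  assumes h: "hermitian n X"
  shows "k \<le> n \<Longrightarrow> \<exists>u (l :: nat \<Rightarrow> real). onsys n k u \<and>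
     (\<forall>a<k. \<forall>i<n. mv n X (u a) i = complex_of_real (l a) * u a i)"
proof (induction k)
  case (Suc k)
  then obtain u l where u: "onsys n k u"
    "\<And>a i. a < k \<Longrightarrow> i < n \<Longrightarrow> mv n X (u a) i = complex_of_real (l a) * u a i" by auto
  obtain v r where v: "nrm n v = 1" "\<forall>a<k. cip n (u a) v = 0"
     "\<forall>i<n. mv n X v i = complex_of_real r * v i"
    using hermitian_eigenvector[OF h, of k u l] u(2) Suc.prems by auto
  have "cip n v (u a) = 0" if "a < k" for a
    using v(2) that cip_cnj[of n "u a" v] by simp
  then have "onsys n (Suc k) (u(k := v))"
    using u(1) v by (auto simp: onsys_def less_Suc_eq cip_self)
  moreover have "\<forall>a<Suc k. \<forall>i<n. mv n X ((u(k := v)) a) i = complex_of_real ((l(k := r)) a) * (u(k := v)) a i"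
    using u(2) v(3) by (auto simp: less_Suc_eq)
  ultimately show ?case by blast
qed (simp add: onsys_def)

definition spec :: "nat \<Rightarrow> (nat \<Rightarrow> real) \<Rightarrow> (nat \<Rightarrow> nat \<Rightarrow> complex) \<Rightarrow> complex mat" where
  "spec n l u = mat_sum n n (\<lambda>a. complex_of_real (l a) \<cdot>\<^sub>m ro n (u a))"

lemma spec_carrier [simp]: "spec n l u \<in> carrier_mat n n"
  and index_spec: "i < n \<Longrightarrow> j < n \<Longrightarrow> spec n l u $$ (i, j) = (\<Sum>a<n. complex_of_real (l a) * (u a i * cnj (u a j)))"
  by (auto simp: spec_def)

text \<open>Orthonormality provides a left inverse of a square matrix; it is a right inverse too,
  which is completeness.\<close>

lemma onsys_complete:
  assumes "onsys n n u" "i < n" "j < n"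
  shows "(\<Sum>a<n. u a i * cnj (u a j)) = (if i = j then 1 else 0)"
proof -
  define U where "U = mat n n (\<lambda>(i, a). u a i)"
  define V where "V = mat n n (\<lambda>(a, i). cnj (u a i))"
  have "V * U = 1\<^sub>m n"
    using assms(1) by (intro eq_matI)
      (auto simp: U_def V_def scalar_prod_def onsys_def cip_def lessThan_atLeast0)
  then have "U * V = 1\<^sub>m n"
    by (intro mat_mult_left_right_inverse[of V n U]) (auto simp: U_def V_def)
  then have "(U * V) $$ (i, j) = 1\<^sub>m n $$ (i, j)" by simp
  then show ?thesis using assms(2,3)
    by (simp add: U_def V_def scalar_prod_def lessThan_atLeast0)
qed

lemma eq_spec_if_eigen:
  assumes "onsys n n u" "X \<in> carrier_mat n n"
    and "\<And>a i. a < n \<Longrightarrow> i < n \<Longrightarrow> mv n X (u a) i = complex_of_real (l a) * u a i"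
  shows "X = spec n l u"
proof (rule eq_matI)
  fix i j assume "i < dim_row (spec n l u)" "j < dim_col (spec n l u)"
  then have ij: "i < n" "j < n" by (auto simp: spec_def)
  have "X $$ (i, j) = (\<Sum>k<n. X $$ (i, k) * (if k = j then 1 else 0))"
    using ij by (simp add: if_distrib cong: if_cong)
  also have "\<dots> = (\<Sum>k<n. X $$ (i, k) * (\<Sum>a<n. u a k * cnj (u a j)))"
    using onsys_complete[OF assms(1)] ij by simp
  also have "\<dots> = (\<Sum>k<n. \<Sum>a<n. X $$ (i, k) * u a k * cnj (u a j))"
    by (simp add: sum_distrib_left mult.assoc)
  also have "\<dots> = (\<Sum>a<n. \<Sum>k<n. X $$ (i, k) * u a k * cnj (u a j))"
    by (rule sum.swap)
  also have "\<dots> = (\<Sum>a<n. mv n X (u a) i * cnj (u a j))"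
    by (simp add: mv_def sum_distrib_right)
  also have "\<dots> = spec n l u $$ (i, j)"
    using ij by (simp add: index_spec assms(3) mult.assoc)
  finally show "X $$ (i, j) = spec n l u $$ (i, j)" .
qed (use assms in \<open>auto simp: spec_def\<close>)

theorem hermitian_spectral:
  assumes "hermitian n X"
  obtains u l where "onsys n n u" "X = spec n l u"
proof -
  obtain u l where "onsys n n u" "\<forall>a<n. \<forall>i<n. mv n X (u a) i = complex_of_real (l a) * u a i"
    using hermitian_eigensystem[OF assms, of n] by blast
  then show ?thesis using that eq_spec_if_eigen assms by (metis hermitian_def)
qed

lemma mv_spec:
  assumes "onsys n n u" "a < n" "i < n"
  shows "mv n (spec n l u) (u a) i = complex_of_real (l a) * u a i"
proof -
  have "mv n (spec n l u) (u a) i = (\<Sum>j<n. \<Sum>b<n. complex_of_real (l b) * u b i * (cnj (u b j) * u a j))"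
    using assms by (simp add: mv_def index_spec sum_distrib_left sum_distrib_right mult_ac)
  also have "\<dots> = (\<Sum>b<n. \<Sum>j<n. complex_of_real (l b) * u b i * (cnj (u b j) * u a j))"
    by (rule sum.swap)
  also have "\<dots> = (\<Sum>b<n. complex_of_real (l b) * u b i * cip n (u b) (u a))"
    by (simp add: sum_distrib_left cip_def)
  also have "\<dots> = (\<Sum>b<n. if b = a then complex_of_real (l b) * u b i else 0)"
    using assms by (intro sum.cong) (auto simp: onsys_def)
  finally show ?thesis using assms by simp
qed

lemma mv_mult:
  assumes "X \<in> carrier_mat n n" "Y \<in> carrier_mat n n" "i < n"
  shows "mv n (X * Y) v i = mv n X (mv n Y v) i"
proof -
  have "mv n (X * Y) v i = (\<Sum>j<n. \<Sum>k<n. X $$ (i, k) * Y $$ (k, j) * v j)"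
    using assms by (simp add: mv_def scalar_prod_def sum_distrib_right lessThan_atLeast0)
  also have "\<dots> = (\<Sum>k<n. \<Sum>j<n. X $$ (i, k) * Y $$ (k, j) * v j)"
    by (rule sum.swap)
  finally show ?thesis by (simp add: mv_def sum_distrib_left mult.assoc)
qed

lemma mv_cong: "(\<And>i. i < n \<Longrightarrow> v i = w i) \<Longrightarrow> mv n X v i = mv n X w i"
  by (simp add: mv_def)

lemma mv_scale: "mv n X (\<lambda>i. c * v i) i = c * mv n X v i"
  by (simp add: mv_def sum_distrib_left mult_ac)

lemma spec_mult:
  assumes "onsys n n u"
  shows "spec n l u * spec n m u = spec n (\<lambda>a. l a * m a) u"
proof (rule eq_spec_if_eigen[OF assms])
  fix a i assume ai: "a < n" "i < n"
  have "mv n (spec n l u * spec n m u) (u a) i = mv n (spec n l u) (mv n (spec n m u) (u a)) i"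
    using ai by (intro mv_mult) auto
  also have "\<dots> = mv n (spec n l u) (\<lambda>i. complex_of_real (m a) * u a i) i"
    using mv_spec[OF assms] ai by (intro mv_cong) auto
  also have "\<dots> = complex_of_real (l a * m a) * u a i"
    using mv_spec[OF assms] ai by (simp add: mv_scale)
  finally show "mv n (spec n l u * spec n m u) (u a) i = complex_of_real (l a * m a) * u a i" .
qed (rule mult_carrier_mat[OF spec_carrier spec_carrier])

section \<open>Positive square roots, absolute value and trace norm\<close>

lemma psd_spec:
  assumes "\<And>a. a < n \<Longrightarrow> 0 \<le> l a"
  shows "psd n (spec n l u)"
  unfolding spec_def
  using rcone_mat_sum[of n "\<lambda>a. complex_of_real (l a) \<cdot>\<^sub>m ro n (u a)" n UNIV] assms
  by (metis psd_imp_rcone psd_ro psd_smult rcone_psd)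

text \<open>If \<open>Q\<close> is positive and \<open>Q\<^sup>2 v = c\<^sup>2 v\<close>, then \<open>w = Q v - c v\<close> satisfies \<open>(Q + c) w = 0\<close>, which
  forces \<open>w = 0\<close>. This yields the uniqueness of the positive square root.\<close>

lemma psd_sqrt_eigen:
  assumes Q: "psd n Q" and "0 \<le> c"
    and ev: "\<And>i. i < n \<Longrightarrow> mv n (Q * Q) v i = complex_of_real (c * c) * v i"
    and "i < n"
  shows "mv n Q v i = complex_of_real c * v i"
proof -
  note QC = psd_carrier[OF Q]
  have h: "hermitian n Q" by (rule psd_hermitian[OF Q])
  have ev': "mv n Q (mv n Q v) i = complex_of_real (c * c) * v i" if "i < n" for i
    using ev[OF that] mv_mult[OF QC QC that] by simp
  define w where "w i = mv n Q v i - complex_of_real c * v i" for i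
  have Qw: "mv n Q w i = - complex_of_real c * w i" if "i < n" for i
  proof -
    have "mv n Q w i = mv n Q (mv n Q v) i - complex_of_real c * mv n Q v i"
      by (simp add: mv_def w_def sum_subtractf sum_distrib_left algebra_simps)
    then show ?thesis using ev'[OF that] by (simp add: w_def algebra_simps)
  qed
  have "nrm n w = 0"
  proof (cases "c = 0")
    case True
    have "cip n w w = cip n (mv n Q v) (mv n Q v)" using True by (simp add: w_def[abs_def])
    also have "\<dots> = cip n v (mv n Q (mv n Q v))" using cip_mv_hermitian[OF h] by simp
    also have "\<dots> = 0" using ev' True by (simp add: cip_def)
    finally show ?thesis by (simp add: cip_self)
  next
    case False
    have "qf n Q w = cip n w (\<lambda>i. - complex_of_real c * w i)"
      unfolding qf_eq_cip_mv by (rule cip_cong) (rule Qw)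
    also have "\<dots> = complex_of_real (- c * nrm n w)"
      unfolding cip_scale by (simp add: cip_self)
    finally have "0 \<le> complex_of_real (- c * nrm n w)"
      using Q by (metis psd_iff_qf)
    then have "c * nrm n w \<le> 0" by (simp only: nonneg_of_real_complex)
    then show ?thesis using False \<open>0 \<le> c\<close> nrm_nonneg[of n w]
      by (metis mult_le_0_iff order.antisym order_antisym_conv)
  qed
  then show ?thesis using \<open>i < n\<close> by (simp add: nrm_eq_0_iff w_def)
qed

lemma mat_adjoint_hermitian:
  assumes "hermitian n X" shows "mat_adjoint X = X"
  using assms hermitianD[OF assms]
  by (intro eq_matI) (auto simp: mat_adjoint_def mat_of_rows_def hermitian_def)

text \<open>The eigenvectors of P are eigenvectors of Q Q, and \<open>psd_sqrt_eigen\<close> takes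
  the root for Q itself.\<close>

lemma psd_sqrt_unique:
  assumes Q: "psd n Q" and P: "psd n P" and eq: "Q * Q = P * P"
  shows "Q = P"
proof -
  obtain u l where u: "onsys n n u" and Pu: "P = spec n l u"
    using hermitian_spectral[OF psd_hermitian[OF P]] .
  have l: "0 \<le> l a" if "a < n" for a
  proof -
    have "qf n P (u a) = cip n (u a) (\<lambda>i. complex_of_real (l a) * u a i)"
      unfolding qf_eq_cip_mv Pu by (rule cip_cong) (rule mv_spec[OF u that])
    also have "\<dots> = complex_of_real (l a)"
      using u that by (simp add: cip_scale onsys_def)
    finally show ?thesis using P by (metis psd_iff_qf nonneg_of_real_complex)
  qed
  have "Q = spec n l u"
  proof (rule eq_spec_if_eigen[OF u psd_carrier[OF Q]])
    fix a i assume ai: "a < n" "i < n"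
    show "mv n Q (u a) i = complex_of_real (l a) * u a i"
    proof (rule psd_sqrt_eigen[OF Q l])
      fix i assume "i < n"
      then show "mv n (Q * Q) (u a) i = complex_of_real (l a * l a) * u a i"
        using ai by (simp add: eq Pu spec_mult[OF u] mv_spec[OF u])
    qed (use ai in auto)
  qed
  then show ?thesis using Pu by simp
qed

text \<open>Evaluates the definite description in \<open>abs_mat\<close>: any positive root of X X
  that can be exhibited is the absolute value.\<close>

lemma abs_mat_eqI:
  assumes "hermitian n X" "psd n P" "P * P = X * X"
  shows "abs_mat X = P"
  unfolding abs_mat_def
proof (rule the_equality)
  have d: "dim_col X = n" using assms(1) by (auto simp: hermitian_def)
  show "psd (dim_col X) P \<and> P * P = mat_adjoint X * X"
    unfolding d mat_adjoint_hermitian[OF assms(1)] assms(3) using assms(2) by blast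
  fix Q assume "psd (dim_col X) Q \<and> Q * Q = mat_adjoint X * X"
  then have "psd n Q" "Q * Q = P * P"
    unfolding d mat_adjoint_hermitian[OF assms(1)] assms(3) by blast+
  then show "Q = P" using assms(2) psd_sqrt_unique by blast
qed

lemma abs_mat_hermitian:
  assumes "hermitian n X"
  shows "psd n (abs_mat X)" "psd n (abs_mat X + X)" "psd n (abs_mat X - X)"
proof -
  obtain u l where u: "onsys n n u" and Xu: "X = spec n l u"
    using hermitian_spectral[OF assms] .
  have eq: "abs_mat X = spec n (\<lambda>a. \<bar>l a\<bar>) u"
    by (rule abs_mat_eqI[OF assms]) (auto intro: psd_spec simp: Xu spec_mult[OF u])
  show "psd n (abs_mat X)" unfolding eq by (rule psd_spec) simp
  have "spec n (\<lambda>a. \<bar>l a\<bar>) u + spec n l u = spec n (\<lambda>a. \<bar>l a\<bar> + l a) u"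
    by (intro eq_matI) (auto simp: spec_def sum.distrib algebra_simps)
  then show "psd n (abs_mat X + X)" unfolding eq unfolding Xu by (simp add: psd_spec)
  have "spec n (\<lambda>a. \<bar>l a\<bar>) u - spec n l u = spec n (\<lambda>a. \<bar>l a\<bar> - l a) u"
    by (intro eq_matI) (auto simp: spec_def sum_subtractf algebra_simps)
  then show "psd n (abs_mat X - X)" unfolding eq unfolding Xu by (simp add: psd_spec)
qed

lemma trp_psd_nonneg:
  assumes "psd n X" "psd n Y" shows "0 \<le> trp n X Y"
  using psd_imp_rcone[OF assms(2)]
proof (induction rule: rcone.induct)
  case (rcone_step Y v)
  then show ?case using assms(1) rcone_carrier[OF rcone_step(1)]
    by (simp add: trp_add_right trp_ro psd_iff_qf)
qed simp

lemma trace_psd_nonneg: "psd n X \<Longrightarrow> 0 \<le> trace_mat X"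
  using trp_psd_nonneg[of n X "1\<^sub>m n"] by (simp add: psd_one psd_carrier)

lemma trace_norm_nonneg: "hermitian n X \<Longrightarrow> 0 \<le> trace_norm X"
  using trace_psd_nonneg[OF abs_mat_hermitian(1)] by (simp add: trace_norm_def less_eq_complex_def)

text \<open>Both T (|X| + X) and (1 - T) (|X| - X) have nonnegative trace. Adding the two, with tr X
  = 0, gives 2 tr(T X) + tr |X| \<ge> 0, hence the factor 1/2.\<close>

lemma trp_ge_neg_trace_norm:
  assumes h: "hermitian n X" and tr: "trace_mat X = 0" and T: "psd n T" "psd n (1\<^sub>m n - T)"
  shows "- (1 / 2 * trace_norm X) \<le> Re (trp n T X)"
proof -
  define A where "A = abs_mat X"
  note ps = abs_mat_hermitian[OF h, folded A_def]
  have C: "A \<in> carrier_mat n n" "X \<in> carrier_mat n n" "T \<in> carrier_mat n n"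
    using ps(1) h T by (auto simp: psd_carrier hermitian_def)
  have "0 \<le> Re (trp n T (A + X))" "0 \<le> Re (trp n (1\<^sub>m n - T) (A - X))"
    using trp_psd_nonneg[OF T(1) ps(2)] trp_psd_nonneg[OF T(2) ps(3)]
    by (auto simp: less_eq_complex_def)
  then show ?thesis
    using C by (simp add: trp_add_right trp_minus_right trp_minus_left trace_norm_def tr flip: A_def)
qed

section \<open>The cone of separable operators\<close>

definition pv :: "nat \<Rightarrow> (nat \<Rightarrow> complex) \<Rightarrow> (nat \<Rightarrow> complex) \<Rightarrow> nat \<Rightarrow> complex" where
  "pv dB a b i = a (i div dB) * b (i mod dB)"

text \<open>Unnormalised separable operators. Working in the cone avoids normalising each term;
  \<open>sep_states_iff\<close> restores the states by a condition on the trace.\<close>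

definition sepcone :: "nat \<Rightarrow> nat \<Rightarrow> complex mat set" where
  "sepcone dA dB = rcone (dA * dB) {pv dB a b |a b. True}"

lemma sum_divmod: "(\<Sum>i<m * k. g i) = (\<Sum>a<m. \<Sum>b<k. g (a * k + b))" for g :: "nat \<Rightarrow> 'a :: comm_monoid_add"
proof -
  have "(\<Sum>b<k. g (a * k + b)) = sum g {a * k..<a * k + k}" for a
    by (rule sum.reindex_bij_witness[of _ "\<lambda>i. i - a * k" "\<lambda>b. a * k + b"]) auto
  then show ?thesis by (simp add: sum.nat_group)
qed

lemma pair_index_less: "a < p \<Longrightarrow> b < q \<Longrightarrow> a * q + b < p * q" for a b p q :: nat
proof -
  assume "a < p" "b < q"
  then have "a * q + b < Suc a * q" by simp
  also have "\<dots> \<le> p * q" using \<open>a < p\<close> by (intro mult_right_mono) auto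
  finally show ?thesis .
qed

lemma pv_index: "b < dB \<Longrightarrow> pv dB x y (a * dB + b) = x a * y b"
  by (simp add: pv_def)

lemma nrm_pv: "nrm (dA * dB) (pv dB a b) = nrm dA a * nrm dB b"
  by (simp add: nrm_def sum_divmod pv_index norm_mult power_mult_distrib sum_product)

lemma cip_pv: "cip (dA * dB) (pv dB a b) (pv dB c d) = cip dA a c * cip dB b d"
  by (simp add: cip_def sum_divmod pv_index sum_product mult_ac)

lemma div_mod_less: "i < m * k \<Longrightarrow> i div k < m" "i < m * k \<Longrightarrow> i mod k < k" for i m k :: nat
  by (auto simp: less_mult_imp_div_less intro!: mod_less_divisor gr0I)

lemma tensor_ro: "tensor_mat (ro dA a) (ro dB b) = ro (dA * dB) (pv dB a b)"
  by (intro eq_matI) (auto simp: tensor_mat_def pv_def div_mod_less[of _ dA dB] mult_ac)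

lemma tensor_carrier [simp]:
  "X \<in> carrier_mat m m \<Longrightarrow> Y \<in> carrier_mat k k \<Longrightarrow> tensor_mat X Y \<in> carrier_mat (m * k) (m * k)"
  by (auto simp: tensor_mat_def)

lemma tensor_add_left:
  "X \<in> carrier_mat m m \<Longrightarrow> X' \<in> carrier_mat m m \<Longrightarrow> Y \<in> carrier_mat k k \<Longrightarrow>
   tensor_mat (X + X') Y = tensor_mat X Y + tensor_mat X' Y"
  by (intro eq_matI) (auto simp: tensor_mat_def div_mod_less[of _ m k] algebra_simps)

lemma tensor_add_right:
  "X \<in> carrier_mat m m \<Longrightarrow> Y \<in> carrier_mat k k \<Longrightarrow> Y' \<in> carrier_mat k k \<Longrightarrow>
   tensor_mat X (Y + Y') = tensor_mat X Y + tensor_mat X Y'"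
  by (intro eq_matI) (auto simp: tensor_mat_def div_mod_less[of _ m k] algebra_simps)

lemma tensor_zero: 
  "Y \<in> carrier_mat k k \<Longrightarrow> tensor_mat (0\<^sub>m m m) Y = 0\<^sub>m (m * k) (m * k)"
  "X \<in> carrier_mat m m \<Longrightarrow> tensor_mat X (0\<^sub>m k k) = 0\<^sub>m (m * k) (m * k)"
  by (intro eq_matI; auto simp: tensor_mat_def div_mod_less[of _ m k])+

lemma trace_tensor:
  assumes "X \<in> carrier_mat m m" "Y \<in> carrier_mat k k"
  shows "trace_mat (tensor_mat X Y) = trace_mat X * trace_mat Y"
  using assms by (auto simp: trace_mat_def tensor_mat_def sum_divmod sum_product pair_index_less
      intro!: sum.cong)

lemma sepcone_carrier: "X \<in> sepcone dA dB \<Longrightarrow> X \<in> carrier_mat (dA * dB) (dA * dB)"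
  unfolding sepcone_def by (rule rcone_carrier)

lemma sepcone_psd: "X \<in> sepcone dA dB \<Longrightarrow> psd (dA * dB) X"
  unfolding sepcone_def by (rule rcone_psd)

lemma sepcone_ro: "ro (dA * dB) (pv dB a b) \<in> sepcone dA dB"
  unfolding sepcone_def by (rule rcone_ro) blast

lemma sepcone_zero: "0\<^sub>m (dA * dB) (dA * dB) \<in> sepcone dA dB"
  unfolding sepcone_def by (rule rcone_zero)

lemma sepcone_add: "X \<in> sepcone dA dB \<Longrightarrow> Y \<in> sepcone dA dB \<Longrightarrow> X + Y \<in> sepcone dA dB"
  unfolding sepcone_def by (rule rcone_add)

lemma pv_scale: "(\<lambda>i. c * pv dB a b i) = pv dB (\<lambda>i. c * a i) b"
  by (simp add: pv_def fun_eq_iff)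

lemma sepcone_smult: "X \<in> sepcone dA dB \<Longrightarrow> 0 \<le> c \<Longrightarrow> complex_of_real c \<cdot>\<^sub>m X \<in> sepcone dA dB"
  unfolding sepcone_def by (rule rcone_smult) (use pv_scale in blast)+

lemma sepcone_mat_sum:
  "(\<And>x. x < k \<Longrightarrow> F x \<in> sepcone dA dB) \<Longrightarrow> mat_sum (dA * dB) k F \<in> sepcone dA dB"
  unfolding sepcone_def by (rule rcone_mat_sum)

lemma sepcone_tensor:
  assumes "psd dA X" "psd dB Y"
  shows "tensor_mat X Y \<in> sepcone dA dB"
  using psd_imp_rcone[OF assms(1)]
proof (induction rule: rcone.induct)
  case (rcone_step X a)
  have "tensor_mat (ro dA a) Y \<in> sepcone dA dB"
    using psd_imp_rcone[OF assms(2)]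
  proof (induction rule: rcone.induct)
    case (rcone_step Y b)
    then show ?case
      using rcone_carrier[OF rcone_step(1)]
      by (simp add: tensor_add_right[OF ro_carrier _ ro_carrier] tensor_ro sepcone_add sepcone_ro)
  qed (simp add: tensor_zero(2)[OF ro_carrier] sepcone_zero)
  then show ?case
    using rcone_step rcone_carrier[OF rcone_step(1)] psd_carrier[OF assms(2)]
    by (simp add: tensor_add_left sepcone_add)
qed (simp add: tensor_zero(1)[OF psd_carrier[OF assms(2)]] sepcone_zero)

lemma tensor_one: "tensor_mat (1\<^sub>m m) (1\<^sub>m k) = 1\<^sub>m (m * k)"
proof (rule eq_matI)
  fix i j assume "i < dim_row (1\<^sub>m (m * k) :: complex mat)" "j < dim_col (1\<^sub>m (m * k) :: complex mat)"
  then have ij: "i < m * k" "j < m * k" by auto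
  have "i = j \<longleftrightarrow> i div k = j div k \<and> i mod k = j mod k"
    by (metis div_mod_decomp)
  then show "tensor_mat (1\<^sub>m m) (1\<^sub>m k) $$ (i, j) = 1\<^sub>m (m * k) $$ (i, j)"
    using ij by (auto simp: tensor_mat_def div_mod_less[of _ m k])
qed (auto simp: tensor_mat_def)

lemma sepcone_one: "1\<^sub>m (dA * dB) \<in> sepcone dA dB"
  using sepcone_tensor[OF psd_one psd_one, of dA dB] by (simp add: tensor_one)

lemma sepcone_trace:
  assumes "X \<in> sepcone dA dB"
  shows "trace_mat X = complex_of_real (Re (trace_mat X))" "0 \<le> Re (trace_mat X)"
  using trace_psd_nonneg[OF sepcone_psd[OF assms]] by (auto simp: nonneg_complex_iff)

lemma sepcone_imp_sum:
  assumes "X \<in> sepcone dA dB"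
  obtains k a b where "X = mat_sum (dA * dB) k (\<lambda>x. ro (dA * dB) (pv dB (a x) (b x)))"
proof -
  obtain k V where V: "\<forall>x<k. V x \<in> {pv dB a b |a b. True}"
    and X: "X = mat_sum (dA * dB) k (\<lambda>x. ro (dA * dB) (V x))"
    using rcone_imp_sum[OF assms[unfolded sepcone_def]] by blast
  have "\<exists>ab. x < k \<longrightarrow> V x = pv dB (fst ab) (snd ab)" for x
  proof (cases "x < k")
    case True
    with V obtain a b where "V x = pv dB a b" by blast
    then show ?thesis by (intro exI[of _ "(a, b)"]) simp
  qed auto
  then have "\<exists>f. \<forall>x. x < k \<longrightarrow> V x = pv dB (fst (f x)) (snd (f x))"
    by (intro choice allI)
  then obtain f where f: "\<forall>x. x < k \<longrightarrow> V x = pv dB (fst (f x)) (snd (f x))" ..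
  define a where "a x = fst (f x)" for x
  define b where "b x = snd (f x)" for x
  have ab: "V x = pv dB (a x) (b x)" if "x < k" for x
    using f that by (simp add: a_def b_def)
  have "X = mat_sum (dA * dB) k (\<lambda>x. ro (dA * dB) (pv dB (a x) (b x)))"
    unfolding X by (intro eq_matI) (auto simp: ab)
  then show ?thesis by (rule that)
qed

lemma density_ro_unit: "0 < n \<Longrightarrow> density_op n (ro n (\<lambda>i. if i = 0 then 1 else 0))"
proof -
  assume "0 < n"
  have "nrm n (\<lambda>i. if i = 0 then 1 else 0) = (\<Sum>i<n. if i = 0 then 1 else 0)"
    unfolding nrm_def by (intro sum.cong) auto
  also have "\<dots> = 1" using \<open>0 < n\<close> by simp
  finally show ?thesis by (simp add: density_op_def psd_ro trace_ro)
qed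

lemma density_ro_normalized:
  assumes "nrm n v \<noteq> 0"
  shows "density_op n (complex_of_real (1 / nrm n v) \<cdot>\<^sub>m ro n v)"
  unfolding density_op_def
proof
  show "psd n (complex_of_real (1 / nrm n v) \<cdot>\<^sub>m ro n v)"
    by (rule psd_smult[OF psd_ro]) simp
  have "trace_mat (complex_of_real (1 / nrm n v) \<cdot>\<^sub>m ro n v) = complex_of_real (1 / nrm n v * nrm n v)"
    unfolding trace_smult[OF ro_carrier] trace_ro by simp
  then show "trace_mat (complex_of_real (1 / nrm n v) \<cdot>\<^sub>m ro n v) = 1"
    using assms by simp
qed

lemma sep_states_iff: "\<sigma> \<in> sep_states dA dB \<longleftrightarrow> \<sigma> \<in> sepcone dA dB \<and> trace_mat \<sigma> = 1"
proof
  assume "\<sigma> \<in> sep_states dA dB"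
  then obtain k p \<alpha> \<beta> where 1: "\<And>x. x < k \<Longrightarrow> 0 \<le> p x \<and> density_op dA (\<alpha> x) \<and> density_op dB (\<beta> x)"
    and 2: "(\<Sum>x<k. p x) = (1 :: real)"
    and s: "\<sigma> = mat_sum (dA * dB) k (\<lambda>x. complex_of_real (p x) \<cdot>\<^sub>m tensor_mat (\<alpha> x) (\<beta> x))"
    unfolding sep_states_def by blast
  have car: "tensor_mat (\<alpha> x) (\<beta> x) \<in> carrier_mat (dA * dB) (dA * dB)" if "x < k" for x
    using 1[OF that] by (auto simp: density_op_def psd_carrier)
  have "trace_mat (tensor_mat (\<alpha> x) (\<beta> x)) = 1" if "x < k" for x
    using 1[OF that] by (simp add: density_op_def psd_carrier trace_tensor[of _ dA _ dB])
  then have "trace_mat \<sigma> = (\<Sum>x<k. complex_of_real (p x))"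
    unfolding s using car by (subst trace_mat_sum) (auto simp: trace_smult[OF car] intro!: sum.cong)
  moreover have "\<sigma> \<in> sepcone dA dB"
    unfolding s using 1 by (intro sepcone_mat_sum sepcone_smult sepcone_tensor) (auto simp: density_op_def)
  ultimately show "\<sigma> \<in> sepcone dA dB \<and> trace_mat \<sigma> = 1"
    using 2 by (simp flip: of_real_sum)
next
  assume \<sigma>: "\<sigma> \<in> sepcone dA dB \<and> trace_mat \<sigma> = 1"
  then obtain k a b where s: "\<sigma> = mat_sum (dA * dB) k (\<lambda>x. ro (dA * dB) (pv dB (a x) (b x)))"
    using sepcone_imp_sum by blast
  have "dA * dB \<noteq> 0"
  proof
    assume "dA * dB = 0"
    then have "\<sigma> \<in> carrier_mat 0 0" using sepcone_carrier[of \<sigma> dA dB] \<sigma> by metis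
    then have "trace_mat \<sigma> = 0" by (simp add: trace_mat_def)
    then show False using \<sigma> by simp
  qed
  then have pos: "0 < dA" "0 < dB" by auto
  define p where "p x = nrm dA (a x) * nrm dB (b x)" for x
  \<comment> \<open>A term of weight zero is the zero matrix, but its factors must still be states,
    so a basis state stands in for them; this is why the dimensions were shown to be
    positive.\<close>
  define \<alpha> where "\<alpha> x = (if p x = 0 then ro dA (\<lambda>i. if i = 0 then 1 else 0)
     else complex_of_real (1 / nrm dA (a x)) \<cdot>\<^sub>m ro dA (a x))" for x
  define \<beta> where "\<beta> x = (if p x = 0 then ro dB (\<lambda>i. if i = 0 then 1 else 0)
     else complex_of_real (1 / nrm dB (b x)) \<cdot>\<^sub>m ro dB (b x))" for x
  have d: "0 \<le> p x \<and> density_op dA (\<alpha> x) \<and> density_op dB (\<beta> x)" for x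
  proof (cases "p x = 0")
    case True
    then show ?thesis using density_ro_unit[OF pos(1)] density_ro_unit[OF pos(2)]
      by (simp add: \<alpha>_def \<beta>_def)
  next
    case False
    then have "nrm dA (a x) \<noteq> 0" "nrm dB (b x) \<noteq> 0" by (auto simp: p_def)
    then show ?thesis using density_ro_normalized False by (simp add: \<alpha>_def \<beta>_def p_def)
  qed
  have summand: "ro (dA * dB) (pv dB (a x) (b x)) = complex_of_real (p x) \<cdot>\<^sub>m tensor_mat (\<alpha> x) (\<beta> x)" for x
  proof (rule eq_matI)
    fix i j assume "i < dim_row (complex_of_real (p x) \<cdot>\<^sub>m tensor_mat (\<alpha> x) (\<beta> x))"
      "j < dim_col (complex_of_real (p x) \<cdot>\<^sub>m tensor_mat (\<alpha> x) (\<beta> x))"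
    then have ij: "i < dA * dB" "j < dA * dB" 
      by (auto simp: tensor_mat_def \<alpha>_def \<beta>_def split: if_splits)
    show "ro (dA * dB) (pv dB (a x) (b x)) $$ (i, j) = (complex_of_real (p x) \<cdot>\<^sub>m tensor_mat (\<alpha> x) (\<beta> x)) $$ (i, j)"
    proof (cases "p x = 0")
      case True
      then have "nrm (dA * dB) (pv dB (a x) (b x)) = 0" by (simp add: nrm_pv p_def)
      then have "pv dB (a x) (b x) i = 0" using ij by (simp add: nrm_eq_0_iff)
      then show ?thesis using ij True by (simp add: tensor_mat_def \<alpha>_def \<beta>_def)
    next
      case False
      then have "nrm dA (a x) \<noteq> 0" "nrm dB (b x) \<noteq> 0" by (auto simp: p_def)
      then show ?thesis using ij False
        by (simp add: tensor_mat_def \<alpha>_def \<beta>_def pv_def div_mod_less[of _ dA dB] p_def)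
    qed
  qed (auto simp: tensor_mat_def \<alpha>_def \<beta>_def)
  have "trace_mat \<sigma> = complex_of_real (\<Sum>x<k. p x)"
    unfolding s by (subst trace_mat_sum) (auto simp: trace_ro nrm_pv p_def)
  then have "complex_of_real (\<Sum>x<k. p x) = complex_of_real 1" using \<sigma> by simp
  then have "(\<Sum>x<k. p x) = 1" by (simp only: of_real_eq_iff)
  moreover have "\<sigma> = mat_sum (dA * dB) k (\<lambda>x. complex_of_real (p x) \<cdot>\<^sub>m tensor_mat (\<alpha> x) (\<beta> x))"
    unfolding s summand ..
  ultimately show "\<sigma> \<in> sep_states dA dB" unfolding sep_states_def using d
    by (intro CollectI exI[of _ k] exI[of _ p] exI[of _ \<alpha>] exI[of _ \<beta>] conjI allI impI; (assumption | blast))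
qed

lemma sep_states_carrier: "\<sigma> \<in> sep_states dA dB \<Longrightarrow> \<sigma> \<in> carrier_mat (dA * dB) (dA * dB)"
  by (simp add: sep_states_iff sepcone_carrier)

lemma sep_states_psd: "\<sigma> \<in> sep_states dA dB \<Longrightarrow> psd (dA * dB) \<sigma>"
  by (simp add: sep_states_iff sepcone_psd)

lemma sep_states_mixed:
  assumes "0 < dA * dB"
  shows "complex_of_real (1 / real (dA * dB)) \<cdot>\<^sub>m 1\<^sub>m (dA * dB) \<in> sep_states dA dB"
proof -
  have "trace_mat (complex_of_real (1 / real (dA * dB)) \<cdot>\<^sub>m 1\<^sub>m (dA * dB)) = 1"
    using assms by (simp add: trace_smult[OF one_carrier_mat])
  then show ?thesis by (simp only: sep_states_iff) (intro conjI sepcone_smult sepcone_one, auto)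
qed

text \<open>In dimension zero there are no states, so the cone on the left is empty while
  \<open>sepcone\<close> contains the zero matrix; hence the assumption.\<close>

lemma cone_of_sep_states:
  assumes "0 < dA * dB"
  shows "cone_of (sep_states dA dB) = sepcone dA dB"
proof (intro equalityI subsetI)
  fix X assume "X \<in> cone_of (sep_states dA dB)"
  then show "X \<in> sepcone dA dB"
    by (auto simp: cone_of_def sep_states_iff intro: sepcone_smult)
next
  fix X assume X: "X \<in> sepcone dA dB"
  note tr = sepcone_trace[OF X] and XC = sepcone_carrier[OF X]
  show "X \<in> cone_of (sep_states dA dB)"
  proof (cases "Re (trace_mat X) = 0")
    \<comment> \<open>A positive matrix of trace zero vanishes; it is written as zero times the
      maximally mixed state.\<close>
    case True
    have "0 \<le> X $$ (i, i)" if "i < dA * dB" for i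
    proof -
      have "0 \<le> qf (dA * dB) X (\<lambda>k. if k = i then 1 else 0)"
        using sepcone_psd[OF X] by (simp add: psd_iff_qf)
      then show ?thesis using sesqui_unit[OF that that, of X] by (simp add: qf_def)
    qed
    moreover have "(\<Sum>i<dA * dB. X $$ (i, i)) = 0"
    proof -
      have "trace_mat X = 0" by (metis tr(1) True of_real_0)
      then show ?thesis using XC by (simp add: trace_mat_def)
    qed
    ultimately have "X $$ (i, i) = 0" if "i < dA * dB" for i
      using that by (subst (asm) sum_nonneg_eq_0_iff) auto
    then have "X = 0\<^sub>m (dA * dB) (dA * dB)" using psd_diag_zero[OF sepcone_psd[OF X]] by blast
    also have "\<dots> = complex_of_real 0 \<cdot>\<^sub>m (complex_of_real (1 / real (dA * dB)) \<cdot>\<^sub>m 1\<^sub>m (dA * dB))"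
      by (intro eq_matI) auto
    finally show ?thesis unfolding cone_of_def using sep_states_mixed[OF assms] by blast
  next
    case False
    define c where "c = Re (trace_mat X)"
    have c: "0 < c" using False tr by (simp add: c_def)
    have "trace_mat (complex_of_real (1 / c) \<cdot>\<^sub>m X) = complex_of_real (1 / c) * complex_of_real c"
      using XC tr(1) by (simp add: trace_smult c_def)
    also have "\<dots> = 1" using c by simp
    finally have "complex_of_real (1 / c) \<cdot>\<^sub>m X \<in> sep_states dA dB"
      using sepcone_smult[OF X, of "1 / c"] c by (simp add: sep_states_iff)
    moreover have "X = complex_of_real c \<cdot>\<^sub>m (complex_of_real (1 / c) \<cdot>\<^sub>m X)"
      using c by (intro eq_matI) auto
    ultimately show ?thesis unfolding cone_of_def using c by (intro CollectI exI[of _ c] exI[of _ "complex_of_real (1 / c) \<cdot>\<^sub>m X"]) auto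
  qed
qed

section \<open>Compactness of the set of separable states\<close>

lemma mat_sum_drop_zero:
  assumes "p < Suc k" "\<And>x. F x \<in> carrier_mat n n" "F p = 0\<^sub>m n n"
  shows "mat_sum n (Suc k) F = mat_sum n k (F(p := F k))"
proof (rule eq_matI)
  fix i j assume "i < dim_row (mat_sum n k (F(p := F k)))" "j < dim_col (mat_sum n k (F(p := F k)))"
  then have ij: "i < n" "j < n" by auto
  have z: "F p $$ (i, j) = 0" using assms(3) ij by simp
  have "(\<Sum>x<Suc k. F x $$ (i, j)) = (\<Sum>x<k. (F(p := F k)) x $$ (i, j))"
  proof (cases "p = k")
    case True
    then show ?thesis using z by simp
  next
    case False
    then have p: "p \<in> {..<k}" using assms(1) by auto
    have "(\<Sum>x<k. (F(p := F k)) x $$ (i, j)) = F k $$ (i, j) + (\<Sum>x\<in>{..<k} - {p}. F x $$ (i, j))"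
      using p by (simp add: sum.remove)
    moreover have "(\<Sum>x<k. F x $$ (i, j)) = F p $$ (i, j) + (\<Sum>x\<in>{..<k} - {p}. F x $$ (i, j))"
      using p by (simp add: sum.remove)
    ultimately show ?thesis using z by simp
  qed
  then show "mat_sum n (Suc k) F $$ (i, j) = mat_sum n k (F(p := F k)) $$ (i, j)"
    using ij by simp
qed auto

text \<open>More than 2 n^2 terms satisfy a real linear relation in their 2 n^2 real coordinates. It
  is subtracted with the largest factor that keeps all coefficients nonnegative; one term then
  disappears.\<close>

lemma rcone_caratheodory_step:
  assumes G: "\<And>c v. v \<in> G \<Longrightarrow> (\<lambda>i. complex_of_real c * v i) \<in> G"
    and V: "\<And>x. x < Suc k \<Longrightarrow> V x \<in> G" and k: "2 * (n * n) \<le> k"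
  shows "\<exists>W. (\<forall>x<k. W x \<in> G) \<and> mat_sum n (Suc k) (\<lambda>x. ro n (V x)) = mat_sum n k (\<lambda>x. ro n (W x))"
proof -
  \<comment> \<open>Coordinates 2 (r n + s) and 2 (r n + s) + 1 are the real and the imaginary part
    of entry (r, s).\<close>
  define f where "f x j = (let z = ro n (V x) $$ (j div 2 div n, j div 2 mod n) in
    if even j then Re z else Im z)" for x j
  obtain c0 :: "nat \<Rightarrow> real" where c0: "\<exists>x\<in>{..<Suc k}. c0 x \<noteq> 0" "\<forall>j<2 * (n * n). (\<Sum>x\<in>{..<Suc k}. c0 x * f x j) = 0"
    using linear_dependence[of "{..<Suc k}" "2 * (n * n)" f] k by auto
  \<comment> \<open>A change of sign, if necessary, makes some coefficient positive, so that the
    maximum m below is positive.\<close>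
  have "\<exists>c :: nat \<Rightarrow> real. (\<exists>x<Suc k. 0 < c x) \<and> (\<forall>j<2 * (n * n). (\<Sum>x<Suc k. c x * f x j) = 0)"
  proof (cases "\<exists>x<Suc k. 0 < c0 x")
    case False
    then have "\<exists>x<Suc k. 0 < - c0 x" using c0(1) by force
    moreover have "\<forall>j<2 * (n * n). (\<Sum>x<Suc k. - c0 x * f x j) = 0"
      using c0(2) by (simp only: mult_minus_left sum_negf) simp
    ultimately show ?thesis by (intro exI[of _ "\<lambda>x. - c0 x"]) blast
  qed (use c0 in blast)
  then obtain c where c: "\<exists>x<Suc k. 0 < c x" "\<And>j. j < 2 * (n * n) \<Longrightarrow> (\<Sum>x<Suc k. c x * f x j) = 0"
    by blast
  have rel: "(\<Sum>x<Suc k. complex_of_real (c x) * ro n (V x) $$ (r, s)) = 0" if rs: "r < n" "s < n" for r s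
  proof -
    define j where "j = 2 * (r * n + s)"
    have "r * n + s < n * n" using rs by (intro pair_index_less)
    then have j: "j < 2 * (n * n)" "Suc j < 2 * (n * n)" by (auto simp: j_def)
    have "f x j = Re (ro n (V x) $$ (r, s))" "f x (Suc j) = Im (ro n (V x) $$ (r, s))" for x
      using rs by (simp_all add: f_def j_def)
    then have "(\<Sum>x<Suc k. c x * Re (ro n (V x) $$ (r, s))) = 0"
      "(\<Sum>x<Suc k. c x * Im (ro n (V x) $$ (r, s))) = 0"
      using c(2)[OF j(1)] c(2)[OF j(2)] by simp_all
    then show ?thesis by (simp only: complex_eq_iff Re_sum Im_sum) simp
  qed
  define m where "m = Max (c ` {..<Suc k})"
  have cm: "c x \<le> m" if "x < Suc k" for x unfolding m_def using that by (intro Max_ge) auto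
  have "m \<in> c ` {..<Suc k}" unfolding m_def by (rule Max_in) auto
  then obtain p where p: "p < Suc k" "c p = m" by auto
  have m: "0 < m" using c(1) cm by fastforce
  \<comment> \<open>Subtracting 1/m times the relation leaves the weights 1 - c_x / m, which are
    nonnegative and vanish at the maximising index p.\<close>
  define F where "F x = (if x < Suc k then complex_of_real (1 - c x / m) \<cdot>\<^sub>m ro n (V x) else 0\<^sub>m n n)" for x
  have F: "F x \<in> carrier_mat n n" for x by (simp add: F_def)
  have Fp: "F p = 0\<^sub>m n n" using p m by (intro eq_matI) (auto simp: F_def)
  have "mat_sum n (Suc k) (\<lambda>x. ro n (V x)) = mat_sum n (Suc k) F"
  proof (rule eq_matI)
    fix r s assume "r < dim_row (mat_sum n (Suc k) F)" "s < dim_col (mat_sum n (Suc k) F)"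
    then have rs: "r < n" "s < n" by auto
    have "(\<Sum>x<Suc k. F x $$ (r, s)) = (\<Sum>x<Suc k. ro n (V x) $$ (r, s) -
       complex_of_real (1 / m) * (complex_of_real (c x) * ro n (V x) $$ (r, s)))"
      using rs by (intro sum.cong) (auto simp: F_def algebra_simps)
    also have "\<dots> = (\<Sum>x<Suc k. ro n (V x) $$ (r, s))"
      unfolding sum_subtractf sum_distrib_left[symmetric] rel[OF rs] by simp
    finally show "mat_sum n (Suc k) (\<lambda>x. ro n (V x)) $$ (r, s) = mat_sum n (Suc k) F $$ (r, s)"
      using rs by simp
  qed auto
  also have "\<dots> = mat_sum n k (F(p := F k))"
    using p(1) F Fp by (rule mat_sum_drop_zero)
  also have "\<exists>W. (\<forall>x<k. W x \<in> G) \<and> mat_sum n k (F(p := F k)) = mat_sum n k (\<lambda>x. ro n (W x))"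
  proof -
    have ex: "\<exists>v\<in>G. F x = ro n v" if "x < Suc k" for x
    proof (rule bexI)
      have "0 \<le> 1 - c x / m" using cm[OF that] m by simp
      then show "F x = ro n (\<lambda>i. complex_of_real (sqrt (1 - c x / m)) * V x i)"
        using that by (simp add: F_def ro_scale)
      show "(\<lambda>i. complex_of_real (sqrt (1 - c x / m)) * V x i) \<in> G" using G V[OF that] by blast
    qed
    have "\<exists>v. x < k \<longrightarrow> v \<in> G \<and> (F(p := F k)) x = ro n v" for x
      using ex[of x] ex[of k] by (cases "x < k") auto
    then obtain W where W: "\<forall>x. x < k \<longrightarrow> W x \<in> G \<and> (F(p := F k)) x = ro n (W x)"
      using choice[of "\<lambda>x v. x < k \<longrightarrow> v \<in> G \<and> (F(p := F k)) x = ro n v"] by blast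
    then have "mat_sum n k (F(p := F k)) = mat_sum n k (\<lambda>x. ro n (W x))"
      by (intro eq_matI) (auto intro!: sum.cong simp del: fun_upd_apply)
    then show ?thesis using W by blast
  qed
  finally show ?thesis .
qed

text \<open>A number of terms that depends on n alone lets one compact parameter space cover all
  separable states. Short sums are padded with zero vectors, which lie in G by scaling.\<close>

lemma rcone_caratheodory:
  assumes G: "\<And>c v. v \<in> G \<Longrightarrow> (\<lambda>i. complex_of_real c * v i) \<in> G" and "G \<noteq> {}"
    and X: "X \<in> rcone n G"
  shows "\<exists>V. (\<forall>x<2 * (n * n). V x \<in> G) \<and> X = mat_sum n (2 * (n * n)) (\<lambda>x. ro n (V x))"
proof -
  define N where "N = 2 * (n * n)"
  obtain k V where V: "\<forall>x<k. V x \<in> G" "X = mat_sum n k (\<lambda>x. ro n (V x))"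
    using rcone_imp_sum[OF X] by blast
  have z: "(\<lambda>_. 0) \<in> G" using \<open>G \<noteq> {}\<close> G[of _ 0] by auto
  show ?thesis unfolding N_def[symmetric] using V
  proof (induction k arbitrary: V)
    case 0
    then show ?case using z by (intro exI[of _ "\<lambda>_ _. 0"]) (auto intro!: eq_matI)
  next
    case (Suc k)
    show ?case
    proof (cases "N \<le> k")
      case True
      have "\<exists>W. (\<forall>x<k. W x \<in> G) \<and> mat_sum n (Suc k) (\<lambda>x. ro n (V x)) = mat_sum n k (\<lambda>x. ro n (W x))"
        using G True Suc.prems(1) unfolding N_def by (intro rcone_caratheodory_step) auto
      then show ?thesis using Suc.IH Suc.prems(2) by auto
    next
      case False
      define W where "W x = (if x < Suc k then V x else (\<lambda>_. 0))" for x
      have "mat_sum n (Suc k) (\<lambda>x. ro n (V x)) = mat_sum n N (\<lambda>x. ro n (W x))"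
      proof (rule eq_matI)
        fix r s assume "r < dim_row (mat_sum n N (\<lambda>x. ro n (W x)))" "s < dim_col (mat_sum n N (\<lambda>x. ro n (W x)))"
        then have rs: "r < n" "s < n" by auto
        have "(\<Sum>x<Suc k. ro n (V x) $$ (r, s)) = (\<Sum>x<N. ro n (W x) $$ (r, s))"
          using False rs by (intro sum.mono_neutral_cong_left) (auto simp: W_def)
        then show "mat_sum n (Suc k) (\<lambda>x. ro n (V x)) $$ (r, s) = mat_sum n N (\<lambda>x. ro n (W x)) $$ (r, s)"
          using rs by simp
      qed auto
      then show ?thesis using Suc.prems z by (intro exI[of _ W]) (auto simp: W_def)
    qed
  qed
qed

text \<open>A point \<open>g\<close> of the parameter space lists the coordinates of the vectors
  \<open>a\<^sub>0, b\<^sub>0, a\<^sub>1, b\<^sub>1, \<dots>\<close>.\<close>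

definition decode :: "nat \<Rightarrow> nat \<Rightarrow> (nat \<Rightarrow> complex) \<Rightarrow> complex mat" where
  "decode dA dB g = mat_sum (dA * dB) (2 * ((dA * dB) * (dA * dB)))
     (\<lambda>x. ro (dA * dB) (pv dB (\<lambda>i. g (prod_encode (2 * x, i))) (\<lambda>i. g (prod_encode (2 * x + 1, i)))))"

definition params :: "nat \<Rightarrow> nat \<Rightarrow> (nat \<Rightarrow> complex) set" where
  "params dA dB = PiE UNIV (\<lambda>_. csquare) \<inter> {g. trace_mat (decode dA dB g) = 1}"

lemma decode_carrier [simp]: "decode dA dB g \<in> carrier_mat (dA * dB) (dA * dB)"
  by (simp add: decode_def)

lemma continuous_decode: "i < dA * dB \<Longrightarrow> j < dA * dB \<Longrightarrow> continuous_on S (\<lambda>g. decode dA dB g $$ (i, j))"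
  unfolding decode_def by (simp add: pv_def) (intro continuous_intros continuous_coord)

lemma continuous_trp_decode: "continuous_on S (\<lambda>g. trp (dA * dB) (decode dA dB g) Y)"
  unfolding trp_def by (intro continuous_intros continuous_decode) auto

lemma compact_params: "compact (params dA dB)"
proof -
  have "trace_mat (decode dA dB g) = trp (dA * dB) (decode dA dB g) (1\<^sub>m (dA * dB))" for g
    by simp
  then have "closed {g. trace_mat (decode dA dB g) = 1}"
    by (simp only:) (intro closed_Collect_eq continuous_trp_decode continuous_on_const)
  then show ?thesis unfolding params_def by (intro compact_Int_closed compact_polysquare)
qed

text \<open>A bound on |a|^2 |b|^2 bounds neither factor. Moving the norm of b into a leaves the
  product vector unchanged and bounds both; entries outside the dimensions are set to zero.\<close>

lemma normalized_product_vector: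
  assumes "nrm dA a * nrm dB b \<le> 1"
  shows "\<exists>a' b'. (\<forall>i. cmod (a' i) \<le> 1) \<and> (\<forall>i. cmod (b' i) \<le> 1) \<and>
     ro (dA * dB) (pv dB a' b') = ro (dA * dB) (pv dB a b)"
proof (cases "nrm dB b = 0")
  case True
  then have "nrm (dA * dB) (pv dB a b) = 0" by (simp add: nrm_pv)
  then have "ro (dA * dB) (pv dB (\<lambda>_. 0) (\<lambda>_. 0)) = ro (dA * dB) (pv dB a b)"
    by (intro eq_matI) (auto simp: nrm_eq_0_iff pv_def)
  then show ?thesis by (intro exI[of _ "\<lambda>_. 0"]) auto
next
  case False
  define s where "s = sqrt (nrm dB b)"
  have s: "0 < s" "s\<^sup>2 = nrm dB b" using False nrm_nonneg[of dB b] by (auto simp: s_def less_le)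
  define a' where "a' i = (if i < dA then complex_of_real s * a i else 0)" for i
  define b' where "b' i = (if i < dB then complex_of_real (1 / s) * b i else 0)" for i
  have le: "cmod (v i) \<le> 1" if "nrm n v \<le> 1" "i < n" for n v i
  proof -
    have "(cmod (v i))\<^sup>2 \<le> nrm n v" unfolding nrm_def using that by (intro member_le_sum) auto
    then have "(cmod (v i))\<^sup>2 \<le> 1" using that(1) by linarith
    then show ?thesis by (simp add: abs_square_le_1)
  qed
  have "nrm dA a' = nrm dA (\<lambda>i. complex_of_real s * a i)" by (rule nrm_cong) (simp add: a'_def)
  also have "\<dots> \<le> 1" unfolding nrm_scale using assms s by (simp add: mult.commute)
  finally have 1: "nrm dA a' \<le> 1" .
  have "nrm dB b' = nrm dB (\<lambda>i. complex_of_real (1 / s) * b i)" by (rule nrm_cong) (simp add: b'_def)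
  also have "\<dots> \<le> 1" unfolding nrm_scale using s by (simp add: norm_divide power_divide flip: s(2))
  finally have 2: "nrm dB b' \<le> 1" .
  have "pv dB a' b' i = pv dB a b i" if "i < dA * dB" for i
    using div_mod_less[OF that] s by (simp add: pv_def a'_def b'_def)
  then have "ro (dA * dB) (pv dB a' b') = ro (dA * dB) (pv dB a b)"
    by (intro eq_matI) auto
  moreover have "cmod (a' i) \<le> 1" for i using le[OF 1] by (cases "i < dA") (auto simp: a'_def)
  moreover have "cmod (b' i) \<le> 1" for i using le[OF 2] by (cases "i < dB") (auto simp: b'_def)
  ultimately show ?thesis by blast
qed

text \<open>The traces of the terms are nonnegative and add up to 1, so each is at most 1 and its
  rescaled vectors fit into the squares.\<close>

lemma decode_params: "decode dA dB ` params dA dB = sep_states dA dB"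
proof (intro equalityI subsetI)
  fix \<sigma> assume "\<sigma> \<in> decode dA dB ` params dA dB"
  then show "\<sigma> \<in> sep_states dA dB"
    unfolding sep_states_iff params_def decode_def by (auto intro!: sepcone_mat_sum sepcone_ro)
next
  fix \<sigma> assume \<sigma>: "\<sigma> \<in> sep_states dA dB"
  define n where "n = dA * dB"
  define N where "N = 2 * (n * n)"
  have "\<exists>V. (\<forall>x<N. V x \<in> {pv dB a b |a b. True}) \<and> \<sigma> = mat_sum n N (\<lambda>x. ro n (V x))"
    unfolding N_def
  proof (rule rcone_caratheodory)
    show "\<sigma> \<in> rcone n {pv dB a b |a b. True}"
      using \<sigma> by (simp add: sep_states_iff sepcone_def n_def)
  qed (use pv_scale in blast)+
  then obtain V where V: "\<And>x. x < N \<Longrightarrow> V x \<in> {pv dB a b |a b. True}" "\<sigma> = mat_sum n N (\<lambda>x. ro n (V x))"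
    by blast
  have tr: "(\<Sum>x<N. nrm n (V x)) = 1"
  proof -
    have "trace_mat \<sigma> = complex_of_real (\<Sum>x<N. nrm n (V x))"
      unfolding V(2) by (subst trace_mat_sum) (auto simp: trace_ro)
    then have "complex_of_real (\<Sum>x<N. nrm n (V x)) = complex_of_real 1" using \<sigma> by (simp add: sep_states_iff)
    then show ?thesis by (simp only: of_real_eq_iff)
  qed
  have "\<exists>ab. x < N \<longrightarrow> (\<forall>i. cmod (fst ab i) \<le> 1) \<and> (\<forall>i. cmod (snd ab i) \<le> 1) \<and>
     ro n (pv dB (fst ab) (snd ab)) = ro n (V x)" for x
  proof (cases "x < N")
    case True
    then obtain a b where ab: "V x = pv dB a b" using V(1) by blast
    have "nrm n (V x) \<le> 1" unfolding tr[symmetric] using True by (intro member_le_sum) auto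
    then have "nrm dA a * nrm dB b \<le> 1" by (simp add: ab n_def nrm_pv)
    from normalized_product_vector[OF this] obtain a' b' where
      "\<forall>i. cmod (a' i) \<le> 1" "\<forall>i. cmod (b' i) \<le> 1" "ro n (pv dB a' b') = ro n (V x)"
      unfolding n_def ab by blast
    then show ?thesis by (intro exI[of _ "(a', b')"]) simp
  qed simp
  then have "\<exists>h. \<forall>x. x < N \<longrightarrow> (\<forall>i. cmod (fst (h x) i) \<le> 1) \<and> (\<forall>i. cmod (snd (h x) i) \<le> 1) \<and>
     ro n (pv dB (fst (h x)) (snd (h x))) = ro n (V x)"
    by (intro choice allI)
  then obtain h where h: "\<And>x i. x < N \<Longrightarrow> cmod (fst (h x) i) \<le> 1" "\<And>x i. x < N \<Longrightarrow> cmod (snd (h x) i) \<le> 1"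
    "\<And>x. x < N \<Longrightarrow> ro n (pv dB (fst (h x)) (snd (h x))) = ro n (V x)" by blast
  \<comment> \<open>Inverse of the indexing in \<open>decode\<close>: even blocks hold the first
    factors, odd blocks the second ones.\<close>
  define g where "g t = (case prod_decode t of (y, i) \<Rightarrow> if y div 2 < N then
     (if even y then fst (h (y div 2)) i else snd (h (y div 2)) i) else 0)" for t
  have "cmod (g t) \<le> 1" for t
    using h(1,2) by (cases "prod_decode t") (simp add: g_def)
  then have g: "g \<in> PiE UNIV (\<lambda>_. csquare)" by (auto intro: csquareI)
  have "g (prod_encode (2 * x, i)) = fst (h x) i" "g (prod_encode (2 * x + 1, i)) = snd (h x) i"
    if "x < N" for x i using that by (simp_all add: g_def)
  then have "decode dA dB g = mat_sum n N (\<lambda>x. ro n (V x))"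
    unfolding decode_def n_def[symmetric] N_def[symmetric] using h(3)
    by (intro eq_matI) (auto simp del: index_ro intro!: sum.cong)
  then have "decode dA dB g = \<sigma>" using V by simp
  moreover from this g have "g \<in> params dA dB"
    using \<sigma> by (simp add: params_def sep_states_iff)
  ultimately show "\<sigma> \<in> decode dA dB ` params dA dB" by blast
qed

text \<open>The form in which compactness of the separable states enters below: a cover by open
  half-spaces has a finite subcover. It yields the minimum in the robustness, the minimax statement
  and strict positivity.\<close>

lemma sep_states_finite_cover:
  fixes \<alpha> :: "'i \<Rightarrow> real" and Y :: "'i \<Rightarrow> complex mat"
  assumes "\<And>\<sigma>. \<sigma> \<in> sep_states dA dB \<Longrightarrow> \<exists>i\<in>I. 0 < \<alpha> i + Re (trp (dA * dB) \<sigma> (Y i))"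
  shows "\<exists>J\<subseteq>I. finite J \<and> (\<forall>\<sigma>\<in>sep_states dA dB. \<exists>i\<in>J. 0 < \<alpha> i + Re (trp (dA * dB) \<sigma> (Y i)))"
proof -
  define U where "U i = {g. 0 < \<alpha> i + Re (trp (dA * dB) (decode dA dB g) (Y i))}" for i
  have "open (U i)" for i
    unfolding U_def by (intro open_Collect_less continuous_intros continuous_trp_decode)
  moreover have "params dA dB \<subseteq> (\<Union>i\<in>I. U i)"
    using assms unfolding decode_params[symmetric] by (auto simp: U_def)
  ultimately obtain J where "J \<subseteq> I" "finite J" "params dA dB \<subseteq> (\<Union>i\<in>J. U i)"
    using compactE_image[OF compact_params] by metis
  then show ?thesis
    unfolding decode_params[symmetric] by (intro exI[of _ J]) (auto simp: U_def)
qed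

section \<open>The Loewner order and the minimum in the robustness\<close>

lemma loewner_le_iff:
  assumes "psd n X" "psd n Y"
  shows "loewner_le n X Y \<longleftrightarrow> (\<forall>v. Re (qf n X v) \<le> Re (qf n Y v))"
proof -
  note C = psd_carrier[OF assms(1)] psd_carrier[OF assms(2)]
  have "qf n (Y - X) v = complex_of_real (Re (qf n Y v) - Re (qf n X v))" for v
    using assms C by (auto simp: psd_iff_qf qf_minus nonneg_complex_iff)
  then show ?thesis
    using C by (simp add: loewner_le_def psd_iff_qf minus_carrier_mat del: of_real_diff)
qed

lemma qf_le_trace:
  assumes "psd n X" shows "Re (qf n X v) \<le> Re (trace_mat X) * nrm n v"
  using psd_imp_rcone[OF assms]
proof (induction rule: rcone.induct)
  case (rcone_step X u)
  have "(cmod (cip n u v))\<^sup>2 \<le> nrm n u * nrm n v"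
  proof -
    have "cmod (cip n u v) \<le> (\<Sum>i<n. \<bar>cmod (u i)\<bar> * \<bar>cmod (v i)\<bar>)"
      unfolding cip_def by (rule order.trans[OF norm_sum]) (simp add: norm_mult)
    also have "\<dots> \<le> L2_set (\<lambda>i. cmod (u i)) {..<n} * L2_set (\<lambda>i. cmod (v i)) {..<n}"
      by (rule L2_set_mult_ineq)
    finally have "(cmod (cip n u v))\<^sup>2 \<le> (L2_set (\<lambda>i. cmod (u i)) {..<n} * L2_set (\<lambda>i. cmod (v i)) {..<n})\<^sup>2"
      by (intro power_mono) auto
    then show ?thesis by (simp add: L2_set_def nrm_def power_mult_distrib sum_nonneg)
  qed
  then show ?case using rcone_step rcone_carrier[OF rcone_step(1)]
    by (simp add: qf_add qf_ro trace_add[of _ n] trace_ro distrib_right)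
qed simp

lemma cauchy_schwarz: "(cmod (cip n u v))\<^sup>2 \<le> nrm n u * nrm n v"
  using qf_le_trace[OF psd_ro, of n u v] by (simp add: qf_ro trace_ro)

definition robust_feasible :: "nat \<Rightarrow> nat \<Rightarrow> complex mat \<Rightarrow> real \<Rightarrow> bool" where
  "robust_feasible dA dB \<rho> r \<longleftrightarrow> 0 \<le> r \<and>
     (\<exists>\<sigma>\<in>sep_states dA dB. loewner_le (dA * dB) \<rho> (complex_of_real (1 + r) \<cdot>\<^sub>m \<sigma>))"

text \<open>\<open>LEAST\<close> over the reals is meaningful only if the infimum r0 is feasible.
  Otherwise each separable \<sigma> is violated by some vector v even at 1 + r0 + e for some e > 0.
  Finitely many pairs (v, e) suffice for all \<sigma>, and their smallest e makes r0 + e infeasible,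
  against the choice of r0.\<close>

lemma robustness_attained:
  assumes \<rho>: "density_op (dA * dB) \<rho>"
  shows "robust_feasible dA dB \<rho> (robustness_g dA dB \<rho>)"
    and "robust_feasible dA dB \<rho> r \<Longrightarrow> robustness_g dA dB \<rho> \<le> r"
proof -
  define n where "n = dA * dB"
  have ps: "psd n \<rho>" and tr: "trace_mat \<rho> = 1" using \<rho> by (auto simp: density_op_def n_def)
  have n: "0 < n"
  proof (rule ccontr)
    assume "\<not> 0 < n"
    then show False using psd_carrier[OF ps] tr by (simp add: trace_mat_def)
  qed
  have feas_iff: "robust_feasible dA dB \<rho> r \<longleftrightarrow> 0 \<le> r \<and>
     (\<exists>\<sigma>\<in>sep_states dA dB. \<forall>v. Re (qf n \<rho> v) \<le> (1 + r) * Re (qf n \<sigma> v))" for r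
  proof -
    have "loewner_le n \<rho> (complex_of_real (1 + r) \<cdot>\<^sub>m \<sigma>) \<longleftrightarrow> (\<forall>v. Re (qf n \<rho> v) \<le> (1 + r) * Re (qf n \<sigma> v))"
      if "\<sigma> \<in> sep_states dA dB" "0 \<le> r" for \<sigma>
    proof -
      have "psd n \<sigma>" using that sep_states_psd by (simp add: n_def)
      moreover from this have "psd n (complex_of_real (1 + r) \<cdot>\<^sub>m \<sigma>)"
        using that by (intro psd_smult) auto
      ultimately show ?thesis
        using loewner_le_iff[OF ps] psd_carrier[of n \<sigma>] by (simp add: qf_smult del: of_real_add)
    qed
    then show ?thesis unfolding robust_feasible_def n_def[symmetric] by blast
  qed
  have mono: "robust_feasible dA dB \<rho> r'" if "robust_feasible dA dB \<rho> r" "r \<le> r'" for r r'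
  proof -
    have r: "0 \<le> r" and "\<exists>\<sigma>\<in>sep_states dA dB. \<forall>v. Re (qf n \<rho> v) \<le> (1 + r) * Re (qf n \<sigma> v)"
      using conjunct1[OF that(1)[unfolded feas_iff]] conjunct2[OF that(1)[unfolded feas_iff]] .
    then obtain \<sigma> where \<sigma>: "\<sigma> \<in> sep_states dA dB" "\<forall>v. Re (qf n \<rho> v) \<le> (1 + r) * Re (qf n \<sigma> v)"
      by (elim bexE)
    have "Re (qf n \<rho> v) \<le> (1 + r') * Re (qf n \<sigma> v)" for v
    proof -
      have "0 \<le> Re (qf n \<sigma> v)" using sep_states_psd[OF \<sigma>(1)] by (auto simp: psd_iff_qf n_def less_eq_complex_def)
      then have "(1 + r) * Re (qf n \<sigma> v) \<le> (1 + r') * Re (qf n \<sigma> v)"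
        using that(2) by (intro mult_right_mono) auto
      then show ?thesis using \<sigma>(2)[rule_format, of v] by linarith
    qed
    then show ?thesis unfolding feas_iff using \<sigma>(1) r that(2) by (intro conjI bexI[of _ \<sigma>]) auto
  qed
  define R where "R = {r. robust_feasible dA dB \<rho> r}"
  have "robust_feasible dA dB \<rho> (real n)"
    unfolding feas_iff
  proof (intro conjI bexI[of _ "complex_of_real (1 / real n) \<cdot>\<^sub>m 1\<^sub>m n"] allI)
    show "complex_of_real (1 / real n) \<cdot>\<^sub>m 1\<^sub>m n \<in> sep_states dA dB"
      using sep_states_mixed n unfolding n_def by blast
    fix v
    have "Re (qf n \<rho> v) \<le> nrm n v" using qf_le_trace[OF ps, of v] tr by simp
    also have "\<dots> \<le> (1 + real n) * (1 / real n * nrm n v)"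
      using n by (simp add: field_simps)
    finally show "Re (qf n \<rho> v) \<le> (1 + real n) * Re (qf n (complex_of_real (1 / real n) \<cdot>\<^sub>m 1\<^sub>m n) v)"
      by (simp add: qf_smult)
  qed simp
  then have "real n \<in> R" by (simp add: R_def)
  then have R: "R \<noteq> {}" "bdd_below R"
  proof -
    show "bdd_below R" by (rule bdd_belowI[of _ 0]) (auto simp: R_def robust_feasible_def)
  qed blast
  define r0 where "r0 = Inf R"
  have r0: "0 \<le> r0" unfolding r0_def using R(1) by (intro cInf_greatest) (auto simp: R_def robust_feasible_def)
  have "robust_feasible dA dB \<rho> r0"
  proof (rule ccontr)
    assume not: "\<not> robust_feasible dA dB \<rho> r0"
    define I where "I = (UNIV :: (nat \<Rightarrow> complex) set) \<times> {0 :: real<..}"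
    define \<alpha> where "\<alpha> i = Re (qf n \<rho> (fst i))" for i :: "(nat \<Rightarrow> complex) \<times> real"
    define Y where "Y i = complex_of_real (- (1 + r0 + snd i)) \<cdot>\<^sub>m ro n (fst i)" for i :: "(nat \<Rightarrow> complex) \<times> real"
    have val: "\<alpha> i + Re (trp n \<sigma> (Y i)) = Re (qf n \<rho> (fst i)) - (1 + r0 + snd i) * Re (qf n \<sigma> (fst i))" for i \<sigma>
      unfolding \<alpha>_def Y_def trp_smult_right[OF ro_carrier] trp_ro
      by (simp add: algebra_simps del: of_real_add of_real_minus)
    have "\<exists>i\<in>I. 0 < \<alpha> i + Re (trp n \<sigma> (Y i))" if \<sigma>: "\<sigma> \<in> sep_states dA dB" for \<sigma>
    proof -
      obtain v where v: "(1 + r0) * Re (qf n \<sigma> v) < Re (qf n \<rho> v)"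
        using not \<sigma> r0 unfolding feas_iff by (meson not_le)
      define q where "q = Re (qf n \<sigma> v)"
      have q: "0 \<le> q" using sep_states_psd[OF \<sigma>] by (auto simp: psd_iff_qf n_def less_eq_complex_def q_def)
      \<comment> \<open>With e (q + 1) equal to the violation at r0, raising r0 by e still leaves a
        violation of e; the summand 1 covers q = 0.\<close>
      define e where "e = (Re (qf n \<rho> v) - (1 + r0) * q) / (q + 1)"
      have e: "0 < e" using v q by (simp add: e_def q_def)
      have "e * (q + 1) = Re (qf n \<rho> v) - (1 + r0) * q" using q by (simp add: e_def)
      then have "0 < Re (qf n \<rho> v) - (1 + r0 + e) * q" using e by (simp add: algebra_simps)
      then show ?thesis using e by (intro bexI[of _ "(v, e)"]) (auto simp: I_def val q_def)
    qed
    from sep_states_finite_cover[of dA dB I \<alpha> Y, folded n_def, OF this] obtain J where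
      J: "J \<subseteq> I" "finite J" "\<And>\<sigma>. \<sigma> \<in> sep_states dA dB \<Longrightarrow> \<exists>i\<in>J. 0 < \<alpha> i + Re (trp n \<sigma> (Y i))"
      by blast
    have "J \<noteq> {}" using J(3) sep_states_mixed[of dA dB] n by (auto simp: n_def)
    define e where "e = Min (snd ` J)"
    have "e \<in> snd ` J" unfolding e_def using \<open>J \<noteq> {}\<close> J(2) by (intro Min_in) auto
    then have e: "0 < e" using J(1) by (auto simp: I_def)
    have "\<not> robust_feasible dA dB \<rho> (r0 + e)"
    proof
      assume "robust_feasible dA dB \<rho> (r0 + e)"
      then obtain \<sigma> where \<sigma>: "\<sigma> \<in> sep_states dA dB" "\<forall>v. Re (qf n \<rho> v) \<le> (1 + (r0 + e)) * Re (qf n \<sigma> v)"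
        unfolding feas_iff by (elim conjE bexE)
      obtain i where i: "i \<in> J" "0 < Re (qf n \<rho> (fst i)) - (1 + r0 + snd i) * Re (qf n \<sigma> (fst i))"
        using J(3)[OF \<sigma>(1)] val by auto
      have "e \<le> snd i" unfolding e_def using J(2) i by (intro Min_le) auto
      moreover have "0 \<le> Re (qf n \<sigma> (fst i))"
        using sep_states_psd[OF \<sigma>(1)] by (auto simp: psd_iff_qf n_def less_eq_complex_def)
      ultimately have "(1 + (r0 + e)) * Re (qf n \<sigma> (fst i)) \<le> (1 + r0 + snd i) * Re (qf n \<sigma> (fst i))"
        by (intro mult_right_mono) auto
      then show False using i(2) \<sigma>(2)[rule_format, of "fst i"] by linarith
    qed
    moreover obtain r where "r \<in> R" "r < r0 + e"
      using cInf_lessD[OF R(1), of "r0 + e"] e by (auto simp: r0_def)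
    ultimately show False using mono[of r "r0 + e"] by (auto simp: R_def)
  qed
  moreover have le: "r0 \<le> r" if "robust_feasible dA dB \<rho> r" for r
    unfolding r0_def using that R(2) by (intro cInf_lower) (auto simp: R_def)
  ultimately have "robustness_g dA dB \<rho> = r0"
    unfolding robustness_g_def robust_feasible_def[symmetric] by (intro Least_equality)
  then show "robust_feasible dA dB \<rho> (robustness_g dA dB \<rho>)"
    and "robust_feasible dA dB \<rho> r \<Longrightarrow> robustness_g dA dB \<rho> \<le> r"
    using \<open>robust_feasible dA dB \<rho> r0\<close> le by auto
qed

section \<open>A minimax theorem for finitely covered affine families\<close>

text \<open>The image of S under (f, g) is convex and misses the open negative quadrant, so a line
  through the origin separates the two. The ratio s of its coefficients is the supremum of -g / f
  over points with g < 0, and \<open>key\<close> says that these ratios stay below g / (-f) at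
  points with f < 0.\<close>

lemma minimax_two:
  fixes f g :: "'a \<Rightarrow> real" and mix :: "real \<Rightarrow> 'a \<Rightarrow> 'a \<Rightarrow> 'a"
  assumes mix: "\<And>x y t. x \<in> S \<Longrightarrow> y \<in> S \<Longrightarrow> 0 \<le> t \<Longrightarrow> t \<le> 1 \<Longrightarrow> mix t x y \<in> S"
    and f: "\<And>x y t. x \<in> S \<Longrightarrow> y \<in> S \<Longrightarrow> 0 \<le> t \<Longrightarrow> t \<le> 1 \<Longrightarrow> f (mix t x y) = t * f x + (1 - t) * f y"
    and g: "\<And>x y t. x \<in> S \<Longrightarrow> y \<in> S \<Longrightarrow> 0 \<le> t \<Longrightarrow> t \<le> 1 \<Longrightarrow> g (mix t x y) = t * g x + (1 - t) * g y"
    and cov: "\<And>x. x \<in> S \<Longrightarrow> 0 \<le> f x \<or> 0 \<le> g x"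
  shows "\<exists>t. 0 \<le> t \<and> t \<le> 1 \<and> (\<forall>x\<in>S. 0 \<le> t * f x + (1 - t) * g x)"
proof -
  consider "\<forall>x\<in>S. 0 \<le> f x" | "\<forall>x\<in>S. 0 \<le> g x" | a b where "a \<in> S" "f a < 0" "b \<in> S" "g b < 0"
    by force
  then show ?thesis
  proof cases
    case 1
    then show ?thesis by (intro exI[of _ 1]) auto
  next
    case 2
    then show ?thesis by (intro exI[of _ 0]) auto
  next
    case (3 a0 b0)
    have key: "(- f a) * (- g b) \<le> f b * g a" if ab: "a \<in> S" "f a < 0" "b \<in> S" "g b < 0" for a b
    proof -
      have fb: "0 \<le> f b" using cov[OF ab(3)] ab(4) by auto
      \<comment> \<open>The point of the segment from a to b at which f vanishes; the claim is that
        g is nonnegative there.\<close>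
      define w where "w = f b / (f b - f a)"
      have d: "0 < f b - f a" using fb ab(2) by simp
      have w: "0 \<le> w" "w \<le> 1" using fb d ab(2) by (auto simp: w_def)
      define z where "z = mix w a b"
      have wd: "w * (f b - f a) = f b" using d by (simp add: w_def)
      have "f z = 0" using f[OF ab(1,3) w] wd by (simp add: z_def algebra_simps)
      show ?thesis
      proof (cases "0 \<le> g z")
        case True
        then have "0 \<le> (f b - f a) * (w * g a + (1 - w) * g b)"
          using g[OF ab(1,3) w] d by (simp add: z_def)
        also have "\<dots> = (w * (f b - f a)) * g a + ((f b - f a) - w * (f b - f a)) * g b"
          by (simp add: algebra_simps)
        also have "\<dots> = f b * g a - f a * g b" unfolding wd by (simp add: algebra_simps)
        finally show ?thesis by simp
      next
        case False
        txt \<open>Moving slightly towards \<open>a\<close> from \<open>z\<close> would make both functions negative.\<close>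
        have ga: "0 \<le> g a" using cov[OF ab(1)] ab(2) by auto
        define D where "D = g a - g z"
        define e where "e = - g z / (2 * D)"
        have gd: "0 < D" "- g z \<le> D" using False ga by (simp_all add: D_def)
        have e: "0 < e" "e \<le> 1" using False gd by (auto simp: e_def field_simps)
        have z: "z \<in> S" unfolding z_def using ab w by (intro mix) auto
        have "f (mix e a z) < 0" using f[OF ab(1) z, of e] e \<open>f z = 0\<close> ab(2) by (simp add: mult_pos_neg)
        moreover have "g (mix e a z) = e * D + g z"
          using g[OF ab(1) z, of e] e by (simp add: D_def algebra_simps)
        then have "g (mix e a z) = g z / 2" using gd by (simp add: e_def)
        ultimately show ?thesis using cov[OF mix[OF ab(1) z, of e]] e False by auto
      qed
    qed
    have fpos: "0 < f b" if "b \<in> S" "g b < 0" for b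
    proof -
      have "0 < (- f a0) * (- g b)" using 3 that by (simp add: mult_neg_neg)
      then have "0 < f b * g a0" using key[OF 3(1,2) that] by linarith
      moreover have "0 \<le> f b" using cov[OF that(1)] that(2) by auto
      ultimately show ?thesis by (auto simp: zero_less_mult_iff)
    qed
    define R where "R = (\<lambda>b. - g b / f b) ` {b \<in> S. g b < 0}"
    have up: "- g b / f b \<le> g a / (- f a)" if "a \<in> S" "f a < 0" "b \<in> S" "g b < 0" for a b
      using key[OF that] fpos[OF that(3,4)] that(2) by (simp add: field_simps)
    have R: "R \<noteq> {}" "bdd_above R" 
    proof -
      show "R \<noteq> {}" using 3 by (auto simp: R_def)
      show "bdd_above R" using up[OF 3(1,2)] by (intro bdd_aboveI[of _ "g a0 / (- f a0)"]) (auto simp: R_def)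
    qed
    define s where "s = Sup R"
    have s1: "- g b / f b \<le> s" if "b \<in> S" "g b < 0" for b
      unfolding s_def using that R by (intro cSup_upper) (auto simp: R_def)
    have s2: "s \<le> g a / (- f a)" if "a \<in> S" "f a < 0" for a
      unfolding s_def using up[OF that] R by (intro cSup_least) (auto simp: R_def)
    have "0 < - g b0 / f b0" using 3 fpos[OF 3(3,4)] by (intro divide_pos_pos) auto
    then have s: "0 < s" using s1[OF 3(3,4)] by linarith
    have nonneg: "0 \<le> s * f x + g x" if x: "x \<in> S" for x
    proof (cases "f x < 0")
      case True
      then show ?thesis using s2[OF x True] by (simp add: field_simps)
    next
      case False
      show ?thesis
      proof (cases "g x < 0")
        case True
        then show ?thesis using s1[OF x True] fpos[OF x True] by (simp add: field_simps)
      qed (use False s in auto)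
    qed
    show ?thesis
    proof (intro exI[of _ "s / (1 + s)"] conjI ballI)
      fix x assume "x \<in> S"
      have "1 - s / (1 + s) = 1 / (1 + s)" using s by (simp add: field_simps)
      then have "s / (1 + s) * f x + (1 - s / (1 + s)) * g x = (s * f x + g x) / (1 + s)"
        by (simp only:) (simp add: add_divide_distrib)
      then show "0 \<le> s / (1 + s) * f x + (1 - s / (1 + s)) * g x"
        using nonneg[OF \<open>x \<in> S\<close>] s by simp
    qed (use s in auto)
  qed
qed

text \<open>Where the functional j is negative, the remaining ones cover, and the induction
  hypothesis for that smaller convex set supplies one h; \<open>minimax_two\<close> then merges j
  and h on all of S. Combinations of functionals are realised inside F, and those of points by an
  abstract \<open>mix\<close>, since matrices of all sizes share one type.\<close>

lemma minimax_finite: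
  fixes val :: "'f \<Rightarrow> 'a \<Rightarrow> real" and mix :: "real \<Rightarrow> 'a \<Rightarrow> 'a \<Rightarrow> 'a"
  assumes "finite J" "J \<noteq> {}" "J \<subseteq> F"
    and mix: "\<And>x y t. x \<in> S \<Longrightarrow> y \<in> S \<Longrightarrow> 0 \<le> t \<Longrightarrow> t \<le> 1 \<Longrightarrow> mix t x y \<in> S"
    and aff: "\<And>h x y t. h \<in> F \<Longrightarrow> x \<in> S \<Longrightarrow> y \<in> S \<Longrightarrow> 0 \<le> t \<Longrightarrow> t \<le> 1 \<Longrightarrow>
      val h (mix t x y) = t * val h x + (1 - t) * val h y"
    and comb: "\<And>h h' t. h \<in> F \<Longrightarrow> h' \<in> F \<Longrightarrow> 0 \<le> t \<Longrightarrow> t \<le> 1 \<Longrightarrow>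
      \<exists>h''\<in>F. \<forall>x\<in>S. val h'' x = t * val h x + (1 - t) * val h' x"
    and cov: "\<And>x. x \<in> S \<Longrightarrow> \<exists>h\<in>J. 0 \<le> val h x"
  shows "\<exists>h\<in>F. \<forall>x\<in>S. 0 \<le> val h x"
  using assms
proof (induction J arbitrary: S rule: finite_ne_induct)
  case (singleton h)
  show ?case
  proof (intro bexI[of _ h] ballI)
    fix x assume "x \<in> S"
    from singleton.prems(5)[OF this] show "0 \<le> val h x" by blast
  qed (use singleton.prems(1) in blast)
next
  case (insert j J)
  note mix = insert.prems(2) and aff = insert.prems(3) and comb = insert.prems(4) and cov = insert.prems(5)
  define S' where "S' = {x \<in> S. val j x < 0}"
  have j: "j \<in> F" "J \<subseteq> F" using insert.prems(1) by auto
  have neg: "t * p + (1 - t) * q < 0" if "p < 0" "q < 0" "0 \<le> t" "t \<le> 1" for p q t :: real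
  proof (cases "t = 0")
    case False
    then have "t * p < 0" using that by (simp add: mult_pos_neg)
    moreover have "(1 - t) * q \<le> 0" using that by (simp add: mult_nonneg_nonpos)
    ultimately show ?thesis by linarith
  qed (use that in simp)
  have "\<exists>h\<in>F. \<forall>x\<in>S'. 0 \<le> val h x"
  proof (rule insert.IH[OF j(2)])
    fix x y t assume "x \<in> S'" "y \<in> S'" "0 \<le> t" "t \<le> (1::real)"
    then show "mix t x y \<in> S'" using mix[of x y t] aff[OF j(1), of x y t] neg
      by (auto simp: S'_def)
  next
    fix h h' t assume "h \<in> F" "h' \<in> F" "0 \<le> t" "t \<le> (1::real)"
    then show "\<exists>h''\<in>F. \<forall>x\<in>S'. val h'' x = t * val h x + (1 - t) * val h' x"
      using comb[of h h' t] by (auto simp: S'_def)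
  next
    fix x assume "x \<in> S'"
    then show "\<exists>h\<in>J. 0 \<le> val h x" using cov[of x] by (auto simp: S'_def)
  qed (auto simp: S'_def intro: aff)
  then obtain h where h: "h \<in> F" "\<And>x. x \<in> S' \<Longrightarrow> 0 \<le> val h x" by blast
  have "\<exists>t. 0 \<le> t \<and> t \<le> 1 \<and> (\<forall>x\<in>S. 0 \<le> t * val j x + (1 - t) * val h x)"
  proof (rule minimax_two[where mix = mix])
    fix x assume "x \<in> S"
    then show "0 \<le> val j x \<or> 0 \<le> val h x" using h(2)[of x] by (force simp: S'_def)
  qed (use mix aff j h in auto)
  then obtain t where t: "0 \<le> t" "t \<le> 1" "\<forall>x\<in>S. 0 \<le> t * val j x + (1 - t) * val h x" by blast
  from comb[OF j(1) h(1) t(1,2)] t(3) show ?case by metis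
qed

section \<open>A variational formula for the Piani relative entropy\<close>

text \<open>For positive p and q this is ln x \<le> x - 1 at x = c q / p; equality at c = p / q
  makes the bound tight.\<close>

lemma rel_entr_term_ge:
  assumes "0 \<le> p" "0 \<le> q" "0 < c"
  shows "ereal ((p * ln c + p - c * q) / ln 2) \<le> rel_entr_term p q"
proof (cases "p = 0 \<or> q = 0")
  case True
  then show ?thesis using assms by (auto simp: rel_entr_term_def divide_nonpos_pos)
next
  case False
  then have pq: "0 < p" "0 < q" using assms by auto
  have "ln (c * q / p) \<le> c * q / p - 1"
    using pq assms by (intro ln_le_minus_one) auto
  then have "ln c + ln q - ln p \<le> c * q / p - 1"
    using pq assms by (simp add: ln_mult ln_div)
  then have "p * (ln c + ln q - ln p) \<le> p * (c * q / p - 1)"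
    using pq by (intro mult_left_mono) auto
  also have "\<dots> = c * q - p" using pq by (simp add: field_simps)
  finally have "p * ln c + p - c * q \<le> p * (ln p - ln q)"
    by (simp add: algebra_simps)
  then have "(p * ln c + p - c * q) / ln 2 \<le> p * (ln p - ln q) / ln 2"
    by (intro divide_right_mono) auto
  then show ?thesis using pq by (simp add: rel_entr_term_def log_def ln_div)
qed

text \<open>The weight of an outcome stands for a guess at its likelihood ratio tr(\<rho> E_x) /
  tr(\<sigma> E_x). It is fixed before \<sigma>, which makes the resulting bound affine in
  \<sigma>.\<close>

definition WM :: "nat \<Rightarrow> nat \<Rightarrow> (nat \<times> (nat \<Rightarrow> complex mat) \<times> (nat \<Rightarrow> real)) set" where
  "WM dA dB = {(k, E, c). (\<forall>x<k. E x \<in> sepcone dA dB \<and> 0 < c x) \<and> mat_sum (dA * dB) k E = 1\<^sub>m (dA * dB)}"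

text \<open>The value at \<open>\<sigma>\<close> of the variational expression whose supremum over all weighted measurements is
  the Piani relative entropy, in nats.\<close>

definition gain :: "nat \<Rightarrow> complex mat \<Rightarrow> nat \<times> (nat \<Rightarrow> complex mat) \<times> (nat \<Rightarrow> real) \<Rightarrow> complex mat \<Rightarrow> real" where
  "gain n \<rho> = (\<lambda>(k, E, c) \<sigma>. (\<Sum>x<k. Re (trp n \<rho> (E x)) * ln (c x)) + 1 - (\<Sum>x<k. c x * Re (trp n \<sigma> (E x))))"

lemma measurement_probabilities:
  assumes "\<forall>x<k. E x \<in> sepcone dA dB" "mat_sum (dA * dB) k E = 1\<^sub>m (dA * dB)"
    and "density_op (dA * dB) \<rho>"
  shows "x < k \<Longrightarrow> 0 \<le> Re (trp (dA * dB) \<rho> (E x))" "(\<Sum>x<k. Re (trp (dA * dB) \<rho> (E x))) = 1"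
proof -
  have ps: "psd (dA * dB) \<rho>" "trace_mat \<rho> = 1" using assms(3) by (auto simp: density_op_def)
  show "0 \<le> Re (trp (dA * dB) \<rho> (E x))" if "x < k"
    using trp_psd_nonneg[OF ps(1) sepcone_psd[of "E x"]] assms(1) that by (auto simp: less_eq_complex_def)
  have "(\<Sum>x<k. trp (dA * dB) \<rho> (E x)) = 1"
    unfolding trp_mat_sum_right[symmetric] assms(2) using ps psd_carrier[OF ps(1)] by simp
  then show "(\<Sum>x<k. Re (trp (dA * dB) \<rho> (E x))) = 1" by (simp flip: Re_sum)
qed

lemma sep_states_density: "\<sigma> \<in> sep_states dA dB \<Longrightarrow> density_op (dA * dB) \<sigma>"
  by (simp add: density_op_def sep_states_psd) (simp add: sep_states_iff)

lemma density_dim_pos: "density_op n \<rho> \<Longrightarrow> 0 < n"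
proof (rule ccontr)
  assume "density_op n \<rho>" "\<not> 0 < n"
  then have "\<rho> \<in> carrier_mat 0 0" "trace_mat \<rho> = 1" by (auto simp: density_op_def psd_carrier)
  then show False by (simp add: trace_mat_def)
qed

lemma SEP_iff:
  assumes "0 < dA * dB"
  shows "(k, E) \<in> SEP dA dB \<longleftrightarrow> (\<forall>x<k. E x \<in> sepcone dA dB) \<and> mat_sum (dA * dB) k E = 1\<^sub>m (dA * dB)"
  unfolding SEP_def cone_of_sep_states[OF assms] by simp

lemma D_SEP_ge_gain:
  assumes \<rho>: "density_op (dA * dB) \<rho>" and \<sigma>: "\<sigma> \<in> sep_states dA dB" and h: "h \<in> WM dA dB"
  shows "ereal (gain (dA * dB) \<rho> h \<sigma> / ln 2) \<le> D_SEP dA dB \<rho> \<sigma>"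
proof -
  obtain k E c where hh: "h = (k, E, c)" by (cases h)
  have E: "\<forall>x<k. E x \<in> sepcone dA dB" "mat_sum (dA * dB) k E = 1\<^sub>m (dA * dB)" and c: "\<And>x. x < k \<Longrightarrow> 0 < c x"
    using h by (auto simp: WM_def hh)
  note p = measurement_probabilities[OF E \<rho>] and q = measurement_probabilities[OF E sep_states_density[OF \<sigma>]]
  let ?p = "\<lambda>x. Re (trp (dA * dB) \<rho> (E x))" and ?q = "\<lambda>x. Re (trp (dA * dB) \<sigma> (E x))"
  have "gain (dA * dB) \<rho> h \<sigma> / ln 2 = (\<Sum>x<k. (?p x * ln (c x) + ?p x - c x * ?q x) / ln 2)"
    using p(2) by (simp add: gain_def hh sum.distrib sum_subtractf flip: sum_divide_distrib)
  then have "ereal (gain (dA * dB) \<rho> h \<sigma> / ln 2) = (\<Sum>x<k. ereal ((?p x * ln (c x) + ?p x - c x * ?q x) / ln 2))"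
    by (simp only: sum_ereal)
  also have "\<dots> \<le> (\<Sum>x<k. rel_entr_term (?p x) (?q x))"
    using p q c by (intro sum_mono rel_entr_term_ge) auto
  also have "\<dots> = (\<Sum>x<k. rel_entr_term (Re (trace_mat (\<rho> * E x))) (Re (trace_mat (\<sigma> * E x))))"
    using E(1) \<rho> sep_states_carrier[OF \<sigma>]
    by (intro sum.cong refl) (simp add: trace_mult_eq_trp[of _ "dA * dB"] sepcone_carrier density_op_def psd_carrier)
  also have "\<dots> \<le> D_SEP dA dB \<rho> \<sigma>"
  proof -
    have "(k, E) \<in> SEP dA dB" using SEP_iff[OF density_dim_pos[OF \<rho>]] E by blast
    then show ?thesis unfolding D_SEP_def by (intro SUP_upper2[of "(k, E)"]) auto
  qed
  finally show ?thesis .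
qed

text \<open>The optimal weight p / q is not always a positive real: for p = 0 it is replaced by a
  small e, at a cost of at most e in total, and for q = 0 < p by a huge number. The strict
  inequality leaves room for both.\<close>

lemma D_SEP_less_gain:
  assumes \<rho>: "density_op (dA * dB) \<rho>" and \<sigma>: "\<sigma> \<in> sep_states dA dB"
    and less: "ereal (v / ln 2) < D_SEP dA dB \<rho> \<sigma>"
  shows "\<exists>h\<in>WM dA dB. v < gain (dA * dB) \<rho> h \<sigma>"
proof -
  define n where "n = dA * dB"
  obtain k E where SEP: "(k, E) \<in> SEP dA dB" and
    v: "ereal (v / ln 2) < (\<Sum>x<k. rel_entr_term (Re (trace_mat (\<rho> * E x))) (Re (trace_mat (\<sigma> * E x))))"
    using less unfolding D_SEP_def by (auto simp: less_SUP_iff)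
  have E: "\<forall>x<k. E x \<in> sepcone dA dB" "mat_sum (dA * dB) k E = 1\<^sub>m (dA * dB)"
    using SEP SEP_iff[OF density_dim_pos[OF \<rho>]] by blast+
  define p where "p x = Re (trp n \<rho> (E x))" for x
  define q where "q x = Re (trp n \<sigma> (E x))" for x
  have p: "\<And>x. x < k \<Longrightarrow> 0 \<le> p x" "(\<Sum>x<k. p x) = 1"
    and q: "\<And>x. x < k \<Longrightarrow> 0 \<le> q x" "(\<Sum>x<k. q x) = 1"
    using measurement_probabilities[OF E \<rho>] measurement_probabilities[OF E sep_states_density[OF \<sigma>]]
    by (auto simp: p_def q_def n_def)
  have "(\<Sum>x<k. rel_entr_term (Re (trace_mat (\<rho> * E x))) (Re (trace_mat (\<sigma> * E x)))) = (\<Sum>x<k. rel_entr_term (p x) (q x))"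
    using E(1) \<rho> sep_states_carrier[OF \<sigma>]
    by (intro sum.cong refl) (simp add: p_def q_def n_def trace_mult_eq_trp[of _ "dA * dB"] sepcone_carrier density_op_def psd_carrier)
  with v have v: "ereal (v / ln 2) < (\<Sum>x<k. rel_entr_term (p x) (q x))" by simp
  have "\<exists>c. (\<forall>x<k. 0 < c x) \<and> v < (\<Sum>x<k. p x * ln (c x) - c x * q x + q x)"
  proof (cases "\<exists>y<k. p y \<noteq> 0 \<and> q y = 0")
    case True
    then obtain y where y: "y < k" "0 < p y" "q y = 0" using p(1) by force
    \<comment> \<open>All other outcomes contribute zero, and y contributes |v| + 1 > v because q y
      = 0.\<close>
    define c where "c x = (if x = y then exp ((\<bar>v\<bar> + 1) / p y) else 1)" for x
    have "(\<Sum>x<k. p x * ln (c x) - c x * q x + q x) = (\<Sum>x<k. if x = y then \<bar>v\<bar> + 1 else 0)"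
      using y by (intro sum.cong) (auto simp: c_def)
    also have "\<dots> = \<bar>v\<bar> + 1" using y by simp
    finally show ?thesis by (intro exI[of _ c]) (auto simp: c_def)
  next
    case False
    then have pos: "0 < p x \<Longrightarrow> 0 < q x" if "x < k" for x using q(1)[OF that] that by (force simp: less_le)
    define r where "r x = (if p x = 0 then 0 else p x * ln (p x / q x))" for x
    have "(\<Sum>x<k. rel_entr_term (p x) (q x)) = (\<Sum>x<k. ereal (r x / ln 2))"
      using False by (intro sum.cong) (auto simp: rel_entr_term_def r_def log_def)
    then have "v / ln 2 < (\<Sum>x<k. r x) / ln 2"
      using v by (simp add: sum_divide_distrib)
    then have gap: "v < (\<Sum>x<k. r x)" by (simp add: divide_less_cancel)
    define e where "e = ((\<Sum>x<k. r x) - v) / 2"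
    have e: "0 < e" using gap by (simp add: e_def)
    define c where "c x = (if p x = 0 then e else p x / q x)" for x
    have cpos: "0 < c x" if "x < k" for x
      using p(1)[OF that] pos[OF that] e by (auto simp: c_def less_le)
    have "r x - p x + q x - e * q x \<le> p x * ln (c x) - c x * q x + q x" if "x < k" for x
    proof (cases "p x = 0")
      case False
      then have "0 < q x" using pos[OF that] p(1)[OF that] by auto
      then show ?thesis using False e by (simp add: c_def r_def)
    qed (simp add: c_def r_def)
    then have "(\<Sum>x<k. r x - p x + q x - e * q x) \<le> (\<Sum>x<k. p x * ln (c x) - c x * q x + q x)"
      by (intro sum_mono) auto
    moreover have "(\<Sum>x<k. r x - p x + q x - e * q x) = (\<Sum>x<k. r x) - e"
      using p(2) q(2) by (simp add: sum.distrib sum_subtractf flip: sum_distrib_left)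
    moreover have "v < (\<Sum>x<k. r x) - e" using gap by (simp add: e_def field_simps)
    ultimately have "v < (\<Sum>x<k. p x * ln (c x) - c x * q x + q x)" by linarith
    then show ?thesis using cpos by blast
  qed
  then obtain c where c: "\<forall>x<k. 0 < c x" "v < (\<Sum>x<k. p x * ln (c x) - c x * q x + q x)" by blast
  have "gain n \<rho> (k, E, c) \<sigma> = (\<Sum>x<k. p x * ln (c x) - c x * q x + q x)"
    using q(2) by (simp add: gain_def p_def q_def sum.distrib sum_subtractf)
  then show ?thesis using c E by (intro bexI[of _ "(k, E, c)"]) (auto simp: WM_def n_def)
qed

section \<open>Mixtures of states and of weighted measurements\<close>

lemma gain_affine_form:
  "gain n \<rho> (k, E, c) \<sigma> = ((\<Sum>x<k. Re (trp n \<rho> (E x)) * ln (c x)) + 1)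
     + Re (trp n \<sigma> (mat_sum n k (\<lambda>x. complex_of_real (- c x) \<cdot>\<^sub>m E x)))"
  if "\<And>x. x < k \<Longrightarrow> E x \<in> carrier_mat n n"
proof -
  have "Re (trp n \<sigma> (mat_sum n k (\<lambda>x. complex_of_real (- c x) \<cdot>\<^sub>m E x))) = (\<Sum>x<k. - (c x * Re (trp n \<sigma> (E x))))"
    unfolding trp_mat_sum_right Re_sum using that
    by (intro sum.cong) (auto simp: trp_smult_right simp del: of_real_minus)
  then show ?thesis by (simp add: gain_def sum_negf)
qed

lemma WM_carrier: "(k, E, c) \<in> WM dA dB \<Longrightarrow> x < k \<Longrightarrow> E x \<in> carrier_mat (dA * dB) (dA * dB)"
  by (auto simp: WM_def sepcone_carrier)

definition mix_mat :: "real \<Rightarrow> complex mat \<Rightarrow> complex mat \<Rightarrow> complex mat" where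
  "mix_mat t X Y = complex_of_real t \<cdot>\<^sub>m X + complex_of_real (1 - t) \<cdot>\<^sub>m Y"

lemma mix_mat_sep_states:
  assumes "\<sigma> \<in> sep_states dA dB" "\<tau> \<in> sep_states dA dB" "0 \<le> t" "t \<le> 1"
  shows "mix_mat t \<sigma> \<tau> \<in> sep_states dA dB"
proof -
  have "trace_mat (mix_mat t \<sigma> \<tau>) = 1"
    unfolding mix_mat_def using assms
    by (subst trace_add[of _ "dA * dB"]) (auto simp: trace_smult[OF sep_states_carrier] sep_states_carrier sep_states_iff)
  then show ?thesis using assms
    by (auto simp: sep_states_iff mix_mat_def intro!: sepcone_add sepcone_smult simp del: of_real_diff)
qed

lemma trp_mix_mat:
  assumes "X \<in> carrier_mat n n" "Y \<in> carrier_mat n n"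
  shows "Re (trp n (mix_mat t X Y) Z) = t * Re (trp n X Z) + (1 - t) * Re (trp n Y Z)"
  unfolding mix_mat_def using assms
  by (simp add: trp_add_left trp_smult_left del: of_real_diff)

lemma gain_mix:
  assumes "h \<in> WM dA dB" "\<sigma> \<in> sep_states dA dB" "\<tau> \<in> sep_states dA dB"
  shows "gain (dA * dB) \<rho> h (mix_mat t \<sigma> \<tau>) = t * gain (dA * dB) \<rho> h \<sigma> + (1 - t) * gain (dA * dB) \<rho> h \<tau>"
proof -
  obtain k E c where h: "h = (k, E, c)" by (cases h)
  have eq: "gain (dA * dB) \<rho> (k, E, c) s = ((\<Sum>x<k. Re (trp (dA * dB) \<rho> (E x)) * ln (c x)) + 1)
     + Re (trp (dA * dB) s (mat_sum (dA * dB) k (\<lambda>x. complex_of_real (- c x) \<cdot>\<^sub>m E x)))" for s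
    by (rule gain_affine_form) (rule WM_carrier[OF assms(1)[unfolded h]])
  show ?thesis unfolding h eq
      trp_mix_mat[OF sep_states_carrier[OF assms(2)] sep_states_carrier[OF assms(3)]]
    by (simp add: algebra_simps)
qed

lemma sum_append: "(\<Sum>x<k + l. if x < k then f x else g (x - k)) = (\<Sum>x<k. f x) + (\<Sum>x<l. g x)"
  for f g :: "nat \<Rightarrow> 'a :: comm_monoid_add"
  by (induction l) (simp_all add: add.assoc)

text \<open>Toss a coin between the two measurements and remember the result: the effects are scaled
  by t and 1 - t and listed one after the other, and each outcome keeps its weight.\<close>

lemma gain_comb:
  assumes "h \<in> WM dA dB" "h' \<in> WM dA dB" "0 \<le> t" "t \<le> 1"
  shows "\<exists>h''\<in>WM dA dB. \<forall>\<sigma>. gain (dA * dB) \<rho> h'' \<sigma> = t * gain (dA * dB) \<rho> h \<sigma> + (1 - t) * gain (dA * dB) \<rho> h' \<sigma>"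
proof -
  define n where "n = dA * dB"
  obtain k E c where h: "h = (k, E, c)" by (cases h)
  obtain l F d where h': "h' = (l, F, d)" by (cases h')
  define G where "G x = (if x < k then complex_of_real t \<cdot>\<^sub>m E x else complex_of_real (1 - t) \<cdot>\<^sub>m F (x - k))" for x
  define e where "e x = (if x < k then c x else d (x - k))" for x
  have E: "\<And>x. x < k \<Longrightarrow> E x \<in> sepcone dA dB" "\<And>x. x < k \<Longrightarrow> 0 < c x" "mat_sum n k E = 1\<^sub>m n"
    and F: "\<And>x. x < l \<Longrightarrow> F x \<in> sepcone dA dB" "\<And>x. x < l \<Longrightarrow> 0 < d x" "mat_sum n l F = 1\<^sub>m n"
    using assms by (auto simp: h h' WM_def n_def)
  have EC: "x < k \<Longrightarrow> E x \<in> carrier_mat n n" and FC: "x < l \<Longrightarrow> F x \<in> carrier_mat n n" for x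
    using E F sepcone_carrier by (auto simp: n_def)
  have G: "G x \<in> sepcone dA dB \<and> 0 < e x" if "x < k + l" for x
    using that E(1,2)[of x] F(1,2)[of "x - k"] assms(3,4)
    by (auto simp: G_def e_def simp del: of_real_diff intro!: sepcone_smult)
  have "mat_sum n (k + l) G = 1\<^sub>m n"
  proof (rule eq_matI)
    fix i j assume "i < dim_row (1\<^sub>m n)" "j < dim_col (1\<^sub>m n)"
    then have ij: "i < n" "j < n" by auto
    have "(\<Sum>x<k + l. G x $$ (i, j)) = (\<Sum>x<k + l. if x < k then complex_of_real t * E x $$ (i, j)
        else complex_of_real (1 - t) * F (x - k) $$ (i, j))"
    proof (intro sum.cong refl)
      fix x assume "x \<in> {..<k + l}"
      then have "x < k \<or> x - k < l" by auto
      then show "G x $$ (i, j) = (if x < k then complex_of_real t * E x $$ (i, j)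
        else complex_of_real (1 - t) * F (x - k) $$ (i, j))"
        using EC[of x] FC[of "x - k"] ij by (cases "x < k") (auto simp: G_def simp del: of_real_diff)
    qed
    also have "\<dots> = complex_of_real t * (\<Sum>x<k. E x $$ (i, j)) + complex_of_real (1 - t) * (\<Sum>x<l. F x $$ (i, j))"
      unfolding sum_append[of k "\<lambda>x. complex_of_real t * E x $$ (i, j)" "\<lambda>x. complex_of_real (1 - t) * F x $$ (i, j)"]
      by (simp add: sum_distrib_left)
    also have "(\<Sum>x<k. E x $$ (i, j)) = 1\<^sub>m n $$ (i, j)" using E(3) ij by (metis index_mat_sum)
    also have "(\<Sum>x<l. F x $$ (i, j)) = 1\<^sub>m n $$ (i, j)" using F(3) ij by (metis index_mat_sum)
    finally show "mat_sum n (k + l) G $$ (i, j) = 1\<^sub>m n $$ (i, j)"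
      using ij by (simp add: algebra_simps)
  qed auto
  then have in_WM: "(k + l, G, e) \<in> WM dA dB" using G by (auto simp: WM_def n_def)
  have trG: "(\<Sum>x<k + l. Re (trp n \<tau> (G x)) * w x) = t * (\<Sum>x<k. Re (trp n \<tau> (E x)) * w x)
     + (1 - t) * (\<Sum>x<l. Re (trp n \<tau> (F x)) * w (k + x))" for \<tau> and w :: "nat \<Rightarrow> real"
  proof -
    have "(\<Sum>x<k + l. Re (trp n \<tau> (G x)) * w x) = (\<Sum>x<k + l. if x < k then t * (Re (trp n \<tau> (E x)) * w x)
        else (1 - t) * (Re (trp n \<tau> (F (x - k))) * w (k + (x - k))))"
    proof (intro sum.cong refl)
      fix x assume "x \<in> {..<k + l}"
      then have "x < k \<or> x - k < l" by auto
      then show "Re (trp n \<tau> (G x)) * w x = (if x < k then t * (Re (trp n \<tau> (E x)) * w x)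
        else (1 - t) * (Re (trp n \<tau> (F (x - k))) * w (k + (x - k))))"
        using EC[of x] FC[of "x - k"] by (cases "x < k") (auto simp: G_def trp_smult_right simp del: of_real_diff)
    qed
    also have "\<dots> = t * (\<Sum>x<k. Re (trp n \<tau> (E x)) * w x) + (1 - t) * (\<Sum>x<l. Re (trp n \<tau> (F x)) * w (k + x))"
      unfolding sum_append[of k "\<lambda>x. t * (Re (trp n \<tau> (E x)) * w x)" "\<lambda>x. (1 - t) * (Re (trp n \<tau> (F x)) * w (k + x))"]
      by (simp add: sum_distrib_left)
    finally show ?thesis .
  qed
  have "gain n \<rho> (k + l, G, e) \<sigma> = t * gain n \<rho> h \<sigma> + (1 - t) * gain n \<rho> h' \<sigma>" for \<sigma>
  proof -
    have 1: "(\<Sum>x<k + l. Re (trp n \<rho> (G x)) * ln (e x)) = t * (\<Sum>x<k. Re (trp n \<rho> (E x)) * ln (c x))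
     + (1 - t) * (\<Sum>x<l. Re (trp n \<rho> (F x)) * ln (d x))"
      unfolding trG by (simp add: e_def)
    have 2: "(\<Sum>x<k + l. Re (trp n \<sigma> (G x)) * e x) = t * (\<Sum>x<k. Re (trp n \<sigma> (E x)) * c x)
     + (1 - t) * (\<Sum>x<l. Re (trp n \<sigma> (F x)) * d x)"
      unfolding trG by (simp add: e_def)
    show ?thesis unfolding gain_def h h' case_prod_conv mult.commute[of "e _"] mult.commute[of "c _"]
        mult.commute[of "d _"] 1 2
      by (simp add: algebra_simps)
  qed
  then show ?thesis using in_WM by (auto simp: n_def)
qed

text \<open>Minimax gives one weighted measurement of gain at least v at every separable \<sigma>,
  that is, with sum c q at most M = L + 1 - v. Dividing the weights by M normalises this bound to 1
  and lowers L by ln M \<le> M - 1 = L - v, so v survives.\<close>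

lemma D_SEP_S_minimax:
  assumes \<rho>: "density_op (dA * dB) \<rho>" and less: "ereal (v / ln 2) < D_SEP_S dA dB \<rho>"
  shows "\<exists>k E c. (k, E, c) \<in> WM dA dB \<and> (\<forall>\<sigma>\<in>sep_states dA dB. (\<Sum>x<k. c x * Re (trp (dA * dB) \<sigma> (E x))) \<le> 1) \<and>
     v \<le> (\<Sum>x<k. Re (trp (dA * dB) \<rho> (E x)) * ln (c x))"
proof -
  define n where "n = dA * dB"
  have n: "0 < n" using density_dim_pos[OF \<rho>] by (simp add: n_def)
  define val where "val h \<sigma> = gain n \<rho> h \<sigma> - v" for h \<sigma>
  define \<alpha> where "\<alpha> h = (case h of (k, E, c) \<Rightarrow> (\<Sum>x<k. Re (trp n \<rho> (E x)) * ln (c x)) + 1 - v)"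
    for h :: "nat \<times> (nat \<Rightarrow> complex mat) \<times> (nat \<Rightarrow> real)"
  define Y where "Y h = (case h of (k, E, c) \<Rightarrow> mat_sum n k (\<lambda>x. complex_of_real (- c x) \<cdot>\<^sub>m E x))"
    for h :: "nat \<times> (nat \<Rightarrow> complex mat) \<times> (nat \<Rightarrow> real)"
  have form: "\<alpha> h + Re (trp n \<sigma> (Y h)) = val h \<sigma>" if "h \<in> WM dA dB" for h \<sigma>
  proof -
    obtain k E c where h: "h = (k, E, c)" by (cases h)
    show ?thesis using gain_affine_form[OF WM_carrier[OF that[unfolded h]], folded n_def]
      by (simp add: h \<alpha>_def Y_def val_def)
  qed
  have "\<exists>h\<in>WM dA dB. 0 < \<alpha> h + Re (trp n \<sigma> (Y h))" if "\<sigma> \<in> sep_states dA dB" for \<sigma>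
  proof -
    have "ereal (v / ln 2) < D_SEP dA dB \<rho> \<sigma>"
      using less that unfolding D_SEP_S_def by (metis INF_lower less_le_trans)
    from D_SEP_less_gain[OF \<rho> that this] obtain h where "h \<in> WM dA dB" "v < gain n \<rho> h \<sigma>"
      unfolding n_def by blast
    then show ?thesis using form[of h \<sigma>] by (intro bexI[of _ h]) (auto simp: val_def)
  qed
  from sep_states_finite_cover[of dA dB "WM dA dB" \<alpha> Y, folded n_def, OF this] obtain J where
    J: "J \<subseteq> WM dA dB" "finite J" "\<And>\<sigma>. \<sigma> \<in> sep_states dA dB \<Longrightarrow> \<exists>h\<in>J. 0 < \<alpha> h + Re (trp n \<sigma> (Y h))" by blast
  have "J \<noteq> {}" using J(3) sep_states_mixed n by (fastforce simp: n_def)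
  have "\<exists>h\<in>WM dA dB. \<forall>\<sigma>\<in>sep_states dA dB. 0 \<le> val h \<sigma>"
  proof (rule minimax_finite[OF J(2) \<open>J \<noteq> {}\<close> J(1), where mix = mix_mat])
    fix h \<sigma> \<tau> and t :: real assume "h \<in> WM dA dB" "\<sigma> \<in> sep_states dA dB" "\<tau> \<in> sep_states dA dB"
    then show "val h (mix_mat t \<sigma> \<tau>) = t * val h \<sigma> + (1 - t) * val h \<tau>"
      using gain_mix[of h dA dB \<sigma> \<tau> \<rho> t] by (simp add: val_def n_def algebra_simps)
  next
    fix h h' and t :: real assume "h \<in> WM dA dB" "h' \<in> WM dA dB" "0 \<le> t" "t \<le> 1"
    from gain_comb[OF this, of \<rho>] obtain h'' where "h'' \<in> WM dA dB"
      "\<forall>\<sigma>. gain n \<rho> h'' \<sigma> = t * gain n \<rho> h \<sigma> + (1 - t) * gain n \<rho> h' \<sigma>" by (auto simp: n_def)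
    then show "\<exists>h''\<in>WM dA dB. \<forall>x\<in>sep_states dA dB. val h'' x = t * val h x + (1 - t) * val h' x"
      by (intro bexI[of _ h'']) (auto simp: val_def algebra_simps)
  next
    fix \<sigma> assume "\<sigma> \<in> sep_states dA dB"
    then show "\<exists>h\<in>J. 0 \<le> val h \<sigma>" using J(1,3) form by (metis less_imp_le subsetD)
  qed (use mix_mat_sep_states in auto)
  then obtain k E c where h: "(k, E, c) \<in> WM dA dB" and pos: "\<And>\<sigma>. \<sigma> \<in> sep_states dA dB \<Longrightarrow> 0 \<le> val (k, E, c) \<sigma>"
    by auto
  define L where "L = (\<Sum>x<k. Re (trp n \<rho> (E x)) * ln (c x))"
  define M where "M = L + 1 - v"
  have E: "\<forall>x<k. E x \<in> sepcone dA dB" "mat_sum (dA * dB) k E = 1\<^sub>m (dA * dB)" and c: "\<And>x. x < k \<Longrightarrow> 0 < c x"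
    using h by (auto simp: WM_def)
  have le: "(\<Sum>x<k. c x * Re (trp n \<sigma> (E x))) \<le> M" if "\<sigma> \<in> sep_states dA dB" for \<sigma>
    using pos[OF that] by (simp add: val_def gain_def M_def L_def)
  obtain \<sigma>0 where \<sigma>0: "\<sigma>0 \<in> sep_states dA dB" using sep_states_mixed n unfolding n_def by blast
  note q = measurement_probabilities[OF E sep_states_density[OF \<sigma>0], folded n_def]
  \<comment> \<open>The weights are positive and the effects sum to 1, so not all outcomes can have
    probability zero in a state.\<close>
  have "0 < M"
  proof (rule ccontr)
    assume "\<not> 0 < M"
    moreover have "0 \<le> (\<Sum>x<k. c x * Re (trp n \<sigma>0 (E x)))"
      using c q(1) by (intro sum_nonneg mult_nonneg_nonneg) (auto intro: less_imp_le)
    ultimately have "(\<Sum>x<k. c x * Re (trp n \<sigma>0 (E x))) = 0" using le[OF \<sigma>0] by linarith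
    moreover have "0 \<le> c x * Re (trp n \<sigma>0 (E x))" if "x \<in> {..<k}" for x
      using c q(1) that by (intro mult_nonneg_nonneg) (auto intro: less_imp_le)
    ultimately have "\<forall>x\<in>{..<k}. c x * Re (trp n \<sigma>0 (E x)) = 0"
      by (subst (asm) sum_nonneg_eq_0_iff) auto
    then have "\<forall>x\<in>{..<k}. Re (trp n \<sigma>0 (E x)) = 0"
      using c by (metis lessThan_iff mult_eq_0_iff less_irrefl)
    then show False using q(2) by simp
  qed
  define d where "d x = c x / M" for x
  have "(k, E, d) \<in> WM dA dB" using h c \<open>0 < M\<close> by (auto simp: WM_def d_def)
  moreover have "(\<Sum>x<k. d x * Re (trp n \<sigma> (E x))) \<le> 1" if "\<sigma> \<in> sep_states dA dB" for \<sigma>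
  proof -
    have "(\<Sum>x<k. d x * Re (trp n \<sigma> (E x))) = (\<Sum>x<k. c x * Re (trp n \<sigma> (E x))) / M"
      by (simp add: d_def sum_divide_distrib)
    then show ?thesis using le[OF that] \<open>0 < M\<close> by simp
  qed
  moreover have "v \<le> (\<Sum>x<k. Re (trp n \<rho> (E x)) * ln (d x))"
  proof -
    have "(\<Sum>x<k. Re (trp n \<rho> (E x)) * ln (d x)) = (\<Sum>x<k. Re (trp n \<rho> (E x)) * ln (c x) - Re (trp n \<rho> (E x)) * ln M)"
    proof (intro sum.cong refl)
      fix x assume "x \<in> {..<k}"
      then have "0 < c x" using c by simp
      then show "Re (trp n \<rho> (E x)) * ln (d x) = Re (trp n \<rho> (E x)) * ln (c x) - Re (trp n \<rho> (E x)) * ln M"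
        using \<open>0 < M\<close> by (simp add: d_def ln_div algebra_simps)
    qed
    also have "\<dots> = L - ln M"
      using measurement_probabilities(2)[OF E \<rho>] by (simp add: L_def n_def sum_subtractf flip: sum_distrib_right)
    finally show ?thesis using ln_le_minus_one[OF \<open>0 < M\<close>] by (simp add: M_def)
  qed
  ultimately show ?thesis unfolding n_def by blast
qed

section \<open>Strict positivity for entangled states\<close>

lemma psd_one_minus_ro:
  assumes "nrm n a \<le> 1" shows "psd n (1\<^sub>m n - ro n a)"
  unfolding psd_iff_qf
proof (intro conjI allI)
  fix v
  have "(cmod (cip n a v))\<^sup>2 \<le> nrm n a * nrm n v" by (rule cauchy_schwarz)
  also have "\<dots> \<le> 1 * nrm n v" using assms by (intro mult_right_mono) auto
  finally have "0 \<le> complex_of_real (nrm n v - (cmod (cip n a v))\<^sup>2)"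
    by (simp only: nonneg_of_real_complex)
  then show "0 \<le> qf n (1\<^sub>m n - ro n a) v" 
    unfolding qf_minus[OF one_carrier_mat ro_carrier] qf_one qf_ro by (simp only: of_real_diff)
qed (rule minus_carrier_mat[OF ro_carrier])

text \<open>\<open>1 - \<alpha> \<otimes> \<beta> = (1 - \<alpha>) \<otimes> 1 + \<alpha> \<otimes> (1 - \<beta>)\<close>.\<close>

lemma sepcone_one_minus_ro:
  assumes "nrm dA a \<le> 1" "nrm dB b \<le> 1"
  shows "1\<^sub>m (dA * dB) - ro (dA * dB) (pv dB a b) \<in> sepcone dA dB"
proof -
  have C: "1\<^sub>m dA - ro dA a \<in> carrier_mat dA dA" "1\<^sub>m dB - ro dB b \<in> carrier_mat dB dB"
    by (rule minus_carrier_mat[OF ro_carrier])+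
  have "ro dB b + (1\<^sub>m dB - ro dB b) = 1\<^sub>m dB" by (intro eq_matI) auto
  then have 1: "tensor_mat (ro dA a) (ro dB b) + tensor_mat (ro dA a) (1\<^sub>m dB - ro dB b) = tensor_mat (ro dA a) (1\<^sub>m dB)"
    using tensor_add_right[OF ro_carrier[of dA a] ro_carrier[of dB b] C(2)] by simp
  have "ro dA a + (1\<^sub>m dA - ro dA a) = 1\<^sub>m dA" by (intro eq_matI) auto
  then have 2: "tensor_mat (ro dA a) (1\<^sub>m dB) + tensor_mat (1\<^sub>m dA - ro dA a) (1\<^sub>m dB) = 1\<^sub>m (dA * dB)"
    using tensor_add_left[OF ro_carrier[of dA a] C(1) one_carrier_mat[of dB]] tensor_one by simp
  have "1\<^sub>m (dA * dB) - ro (dA * dB) (pv dB a b)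
      = tensor_mat (1\<^sub>m dA - ro dA a) (1\<^sub>m dB) + tensor_mat (ro dA a) (1\<^sub>m dB - ro dB b)"
  proof -
    define P where "P = tensor_mat (ro dA a) (ro dB b)"
    define Q where "Q = tensor_mat (ro dA a) (1\<^sub>m dB - ro dB b)"
    define R where "R = tensor_mat (1\<^sub>m dA - ro dA a) (1\<^sub>m dB)"
    have car: "P \<in> carrier_mat (dA * dB) (dA * dB)" "Q \<in> carrier_mat (dA * dB) (dA * dB)" "R \<in> carrier_mat (dA * dB) (dA * dB)"
      unfolding P_def Q_def R_def using C by (auto intro!: tensor_carrier)
    have "1\<^sub>m (dA * dB) = (P + Q) + R" using 1 2 by (simp add: P_def Q_def R_def)
    then have "1\<^sub>m (dA * dB) - P = R + Q" using car by (intro eq_matI) auto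
    then show ?thesis by (simp add: P_def Q_def R_def tensor_ro)
  qed
  then show ?thesis using assms
    by (simp add: sepcone_add sepcone_tensor psd_one_minus_ro psd_one psd_ro)
qed

lemma qf_pv:
  "qf (dA * dB) X (pv dB a b) = (\<Sum>i<dA. \<Sum>k<dB. \<Sum>j<dA. \<Sum>l<dB.
     cnj (a i) * cnj (b k) * X $$ (i * dB + k, j * dB + l) * (a j * b l))"
  by (simp add: qf_def sum_divmod pv_index)

text \<open>Product states are tomographically complete: for fixed b the form is quadratic in a and
  determines a matrix, whose entries are in turn quadratic forms in b.\<close>

lemma product_qf_eq_imp_eq:
  assumes X: "X \<in> carrier_mat (dA * dB) (dA * dB)" and Y: "Y \<in> carrier_mat (dA * dB) (dA * dB)"
    and eq: "\<And>a b. qf (dA * dB) X (pv dB a b) = qf (dA * dB) Y (pv dB a b)"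
  shows "X = Y"
proof (rule eq_matI)
  define slice where "slice Z b = mat dA dA (\<lambda>(i, j). \<Sum>k<dB. \<Sum>l<dB. cnj (b k) * Z $$ (i * dB + k, j * dB + l) * b l)"
    for Z :: "complex mat" and b
  have slice: "qf dA (slice Z b) a = qf (dA * dB) Z (pv dB a b)" for Z a b
  proof -
    have "qf dA (slice Z b) a = (\<Sum>i<dA. \<Sum>j<dA. \<Sum>k<dB. \<Sum>l<dB.
       cnj (a i) * cnj (b k) * Z $$ (i * dB + k, j * dB + l) * (a j * b l))"
      by (simp add: qf_def slice_def sum_distrib_left sum_distrib_right mult_ac)
    also have "\<dots> = qf (dA * dB) Z (pv dB a b)"
      unfolding qf_pv by (intro sum.cong refl sum.swap)
    finally show ?thesis .
  qed
  have slice_eq: "slice X b = slice Y b" for b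
    by (rule qf_eq_imp_eq[of _ dA]) (simp_all add: slice eq, simp_all add: slice_def)
  fix r s assume "r < dim_row Y" "s < dim_col Y"
  then have rs: "r < dA * dB" "s < dA * dB" using Y by auto
  define i where "i = r div dB"
  define j where "j = s div dB"
  have ij: "i < dA" "j < dA" using rs by (auto simp: i_def j_def less_mult_imp_div_less)
  define sub where "sub Z = mat dB dB (\<lambda>(k, l). Z $$ (i * dB + k, j * dB + l))" for Z :: "complex mat"
  have "qf dB (sub Z) b = slice Z b $$ (i, j)" for Z b
    using ij by (simp add: qf_def sub_def slice_def)
  then have "sub X = sub Y"
    using slice_eq by (intro qf_eq_imp_eq[of _ dB]) (auto simp: sub_def)
  moreover have "Z $$ (r, s) = sub Z $$ (r mod dB, s mod dB)" for Z
    using div_mod_less[OF rs(1)] div_mod_less[OF rs(2)] by (simp add: sub_def i_def j_def)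
  ultimately show "X $$ (r, s) = Y $$ (r, s)" by metis
qed (use assms in auto)

text \<open>Some product vector has different expectations in \<rho> and \<sigma>; scaled down, its
  projector and the complement form a separable measurement. Weight 1 + s on the outcome F that
  \<rho> favours has gain p ln(1 + s) - s q, which is positive for small s since p > q.\<close>

lemma exists_distinguishing_measurement:
  assumes \<rho>: "density_op (dA * dB) \<rho>" and \<sigma>: "\<sigma> \<in> sep_states dA dB" and ne: "\<rho> \<noteq> \<sigma>"
  shows "\<exists>h\<in>WM dA dB. 0 < gain (dA * dB) \<rho> h \<sigma>"
proof -
  define n where "n = dA * dB"
  have C: "\<rho> \<in> carrier_mat n n" "\<sigma> \<in> carrier_mat n n" and tr: "trace_mat \<rho> = 1" "trace_mat \<sigma> = 1"
    using \<rho> sep_states_density[OF \<sigma>] by (auto simp: density_op_def psd_carrier n_def)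
  obtain a b where ab: "qf n \<rho> (pv dB a b) \<noteq> qf n \<sigma> (pv dB a b)"
    using product_qf_eq_imp_eq[of \<rho> dA dB \<sigma>] C ne unfolding n_def by blast
  \<comment> \<open>Adding 1 under the root bounds the rescaled norm by 1 without treating the zero
    vector apart.\<close>
  define t where "t = 1 / sqrt (1 + nrm dA a)"
  define u where "u = 1 / sqrt (1 + nrm dB b)"
  have tu: "t \<noteq> 0" "u \<noteq> 0" using nrm_nonneg[of dA a] nrm_nonneg[of dB b]
    by (auto simp: t_def u_def add_nonneg_eq_0_iff)
  define a' where "a' i = complex_of_real t * a i" for i
  define b' where "b' i = complex_of_real u * b i" for i
  have small: "nrm m (\<lambda>i. complex_of_real (1 / sqrt (1 + nrm m v)) * v i) \<le> 1" for m v
    unfolding nrm_scale using nrm_nonneg[of m v]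
    by (simp add: norm_divide power_divide divide_le_eq not_less)
  have "nrm dA a' \<le> 1" "nrm dB b' \<le> 1"
    using small[of dA a] small[of dB b] by (simp_all add: a'_def[abs_def] b'_def[abs_def] t_def u_def)
  define E where "E = ro n (pv dB a' b')"
  have E: "E \<in> sepcone dA dB" "1\<^sub>m n - E \<in> sepcone dA dB"
    unfolding E_def n_def using sepcone_ro sepcone_one_minus_ro \<open>nrm dA a' \<le> 1\<close> \<open>nrm dB b' \<le> 1\<close> by auto
  have EC: "E \<in> carrier_mat n n" by (simp add: E_def)
  have pv': "pv dB a' b' = (\<lambda>i. complex_of_real (t * u) * pv dB a b i)"
    by (simp add: pv_def a'_def b'_def fun_eq_iff)
  have trpE: "trp n Z E = complex_of_real ((t * u)\<^sup>2) * qf n Z (pv dB a b)" for Z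
    unfolding E_def trp_ro pv' qf_scale by (simp only: norm_of_real power2_abs)
  have "trp n \<rho> E \<noteq> trp n \<sigma> E" unfolding trpE using ab tu by simp
  moreover have "Im (trp n \<rho> E) = 0" "Im (trp n \<sigma> E) = 0"
    using trp_psd_nonneg[OF _ sepcone_psd[OF E(1)]] \<rho> sep_states_psd[OF \<sigma>]
    by (auto simp: density_op_def n_def less_eq_complex_def)
  ultimately have neq: "Re (trp n \<rho> E) \<noteq> Re (trp n \<sigma> E)" by (simp add: complex_eq_iff)
  have "\<exists>F. F \<in> sepcone dA dB \<and> 1\<^sub>m n - F \<in> sepcone dA dB \<and> Re (trp n \<sigma> F) < Re (trp n \<rho> F)"
  proof (cases "Re (trp n \<sigma> E) < Re (trp n \<rho> E)")
    case False
    have "1\<^sub>m n - (1\<^sub>m n - E) = E" using EC by (intro eq_matI) auto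
    moreover have "Re (trp n \<sigma> (1\<^sub>m n - E)) < Re (trp n \<rho> (1\<^sub>m n - E))"
      using False neq C tr EC by (simp add: trp_minus_right)
    ultimately show ?thesis using E by (intro exI[of _ "1\<^sub>m n - E"]) auto
  qed (use E in blast)
  then obtain F where F: "F \<in> sepcone dA dB" "1\<^sub>m n - F \<in> sepcone dA dB" "Re (trp n \<sigma> F) < Re (trp n \<rho> F)" by blast
  have FC: "F \<in> carrier_mat n n" using sepcone_carrier[OF F(1)] by (simp add: n_def)
  define p where "p = Re (trp n \<rho> F)"
  define q where "q = Re (trp n \<sigma> F)"
  have "0 \<le> q" using trp_psd_nonneg[OF sep_states_psd[OF \<sigma>] sepcone_psd[OF F(1)]] by (auto simp: q_def n_def less_eq_complex_def)
  have p: "0 < p" "q < p" using F(3) \<open>0 \<le> q\<close> by (auto simp: p_def q_def)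
  \<comment> \<open>By ln(1 + s) \<ge> s - s^2 the gain is at least s (p - s p - q), so s p \<le> (p
    - q) / 2 suffices.\<close>
  define s where "s = min 1 ((p - q) / (2 * p))"
  have s: "0 < s" "s \<le> 1" using p by (auto simp: s_def)
  have sp: "s * p \<le> (p - q) / 2"
  proof -
    have "s * p \<le> (p - q) / (2 * p) * p" using p by (intro mult_right_mono) (auto simp: s_def)
    then show ?thesis using p by simp
  qed
  have "s - s\<^sup>2 \<le> ln (1 + s)" using ln_one_plus_pos_lower_bound[of s] s by simp
  then have "p * (s - s\<^sup>2) \<le> p * ln (1 + s)" using p by (intro mult_left_mono) auto
  moreover have "0 < p * (s - s\<^sup>2) - s * q"
  proof -
    have "p * (s - s\<^sup>2) - s * q = s * (p - s * p - q)" by (simp add: power2_eq_square algebra_simps)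
    moreover have "0 < p - s * p - q" using sp p by simp
    ultimately show ?thesis using s by simp
  qed
  ultimately have pos: "0 < p * ln (1 + s) - s * q" by linarith
  define G where "G x = (if x = 0 then F else 1\<^sub>m n - F)" for x :: nat
  define c where "c x = (if x = 0 then 1 + s else 1)" for x :: nat
  have "mat_sum n 2 G = 1\<^sub>m n"
    using FC by (intro eq_matI) (auto simp: numeral_2_eq_2 G_def)
  then have "(2, G, c) \<in> WM dA dB"
    using F s by (auto simp: WM_def G_def c_def n_def)
  moreover have "gain n \<rho> (2, G, c) \<sigma> = p * ln (1 + s) - s * q"
  proof -
    have "Re (trp n \<sigma> (1\<^sub>m n - F)) = 1 - q" using C FC tr by (simp add: trp_minus_right q_def)
    then show ?thesis by (simp add: gain_def numeral_2_eq_2 G_def c_def p_def q_def algebra_simps)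
  qed
  ultimately show ?thesis using pos unfolding n_def by (intro bexI[of _ "(2, G, c)"]) auto
qed

text \<open>A measurement chosen for one \<sigma> is only known to have positive gain at that
  \<sigma>. Half of its gain is recorded as a threshold that persists nearby; the smallest threshold
  in a finite subcover bounds the infimum away from 0.\<close>

lemma D_SEP_S_pos:
  assumes \<rho>: "density_op (dA * dB) \<rho>" and ent: "\<rho> \<notin> sep_states dA dB"
  shows "0 < D_SEP_S dA dB \<rho>"
proof -
  define n where "n = dA * dB"
  have n: "0 < n" using density_dim_pos[OF \<rho>] by (simp add: n_def)
  define I where "I = WM dA dB \<times> {0 :: real<..}"
  define \<alpha> where "\<alpha> i = (case i of ((k, E, c), g) \<Rightarrow> (\<Sum>x<k. Re (trp n \<rho> (E x)) * ln (c x)) + 1 - g)"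
    for i :: "(nat \<times> (nat \<Rightarrow> complex mat) \<times> (nat \<Rightarrow> real)) \<times> real"
  define Y where "Y i = (case i of ((k, E, c), g) \<Rightarrow> mat_sum n k (\<lambda>x. complex_of_real (- c x) \<cdot>\<^sub>m E x))"
    for i :: "(nat \<times> (nat \<Rightarrow> complex mat) \<times> (nat \<Rightarrow> real)) \<times> real"
  have form: "\<alpha> (h, g) + Re (trp n \<sigma> (Y (h, g))) = gain n \<rho> h \<sigma> - g" if "h \<in> WM dA dB" for h g \<sigma>
  proof -
    obtain k E c where h: "h = (k, E, c)" by (cases h)
    show ?thesis using gain_affine_form[OF WM_carrier[OF that[unfolded h]], folded n_def]
      by (simp add: h \<alpha>_def Y_def)
  qed
  have "\<exists>i\<in>I. 0 < \<alpha> i + Re (trp n \<sigma> (Y i))" if "\<sigma> \<in> sep_states dA dB" for \<sigma>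
  proof -
    have "\<rho> \<noteq> \<sigma>" using ent that by blast
    from exists_distinguishing_measurement[OF \<rho> that this] obtain h
      where h: "h \<in> WM dA dB" "0 < gain n \<rho> h \<sigma>" unfolding n_def by blast
    then show ?thesis using form[OF h(1), of "gain n \<rho> h \<sigma> / 2" \<sigma>]
      by (intro bexI[of _ "(h, gain n \<rho> h \<sigma> / 2)"]) (auto simp: I_def)
  qed
  from sep_states_finite_cover[of dA dB I \<alpha> Y, folded n_def, OF this] obtain J where
    J: "J \<subseteq> I" "finite J" "\<And>\<sigma>. \<sigma> \<in> sep_states dA dB \<Longrightarrow> \<exists>i\<in>J. 0 < \<alpha> i + Re (trp n \<sigma> (Y i))" by blast
  have "J \<noteq> {}" using J(3) sep_states_mixed n by (fastforce simp: n_def)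
  define g where "g = Min (snd ` J)"
  have "g \<in> snd ` J" unfolding g_def using \<open>J \<noteq> {}\<close> J(2) by (intro Min_in) auto
  then have g: "0 < g" using J(1) by (auto simp: I_def)
  have "ereal (g / ln 2) \<le> D_SEP_S dA dB \<rho>"
    unfolding D_SEP_S_def
  proof (rule INF_greatest)
    fix \<sigma> assume \<sigma>: "\<sigma> \<in> sep_states dA dB"
    obtain i where i: "i \<in> J" "0 < \<alpha> i + Re (trp n \<sigma> (Y i))" using J(3)[OF \<sigma>] by blast
    obtain h r where hr: "i = (h, r)" by (cases i)
    have h: "h \<in> WM dA dB" using i(1) J(1) by (auto simp: hr I_def)
    have "g \<le> r" unfolding g_def using i(1) J(2) by (intro Min_le) (auto simp: hr rev_image_eqI)
    then have "g \<le> gain n \<rho> h \<sigma>" using i(2) form[OF h] by (simp add: hr)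
    then have "ereal (g / ln 2) \<le> ereal (gain n \<rho> h \<sigma> / ln 2)" by (simp add: divide_right_mono)
    also have "\<dots> \<le> D_SEP dA dB \<rho> \<sigma>" using D_SEP_ge_gain[OF \<rho> \<sigma> h] by (simp add: n_def)
    finally show "ereal (g / ln 2) \<le> D_SEP dA dB \<rho> \<sigma>" .
  qed
  moreover have "0 < ereal (g / ln 2)" using g by simp
  ultimately show ?thesis by (rule less_le_trans[rotated])
qed

section \<open>Tensor products of bipartite operators\<close>

lemma bip_carrier [simp]: 
  "bip_tensor dA dB dC dD X Y \<in> carrier_mat ((dA * dC) * (dB * dD)) ((dA * dC) * (dB * dD))"
  by (simp add: bip_tensor_def)

lemma dim_bip [simp]:
  "dim_row (bip_tensor dA dB dC dD X Y) = (dA * dC) * (dB * dD)"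
  "dim_col (bip_tensor dA dB dC dD X Y) = (dA * dC) * (dB * dD)"
  by (simp_all add: bip_tensor_def)

lemma index_bip:
  assumes "r < (dA * dC) * (dB * dD)" "s < (dA * dC) * (dB * dD)"
  shows "bip_tensor dA dB dC dD X Y $$ (r, s) =
    X $$ (idx1 dB dC dD r, idx1 dB dC dD s) * Y $$ (idx2 dB dC dD r, idx2 dB dC dD s)"
  using assms by (simp add: bip_tensor_def)

lemma idx_bounds:
  assumes i: "i < (dA * dC) * (dB * dD)"
  shows "idx1 dB dC dD i < dA * dB" "idx2 dB dC dD i < dC * dD"
    "idx1 dB dC dD i div dB = i div (dB * dD) div dC" "idx1 dB dC dD i mod dB = i mod (dB * dD) div dD"
    "idx2 dB dC dD i div dD = i div (dB * dD) mod dC" "idx2 dB dC dD i mod dD = i mod (dB * dD) mod dD"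
proof -
  have 5: "i div (dB * dD) < dA * dC" and 6: "i mod (dB * dD) < dB * dD" using div_mod_less[OF i] .
  have 1: "i div (dB * dD) div dC < dA" "i div (dB * dD) mod dC < dC" using div_mod_less[OF 5] .
  have 2: "i mod (dB * dD) div dD < dB" "i mod (dB * dD) mod dD < dD" using div_mod_less[OF 6] .
  show "idx1 dB dC dD i < dA * dB" "idx2 dB dC dD i < dC * dD"
    unfolding idx1_def idx2_def using 1 2 by (auto intro: pair_index_less)
  show "idx1 dB dC dD i div dB = i div (dB * dD) div dC" "idx1 dB dC dD i mod dB = i mod (dB * dD) div dD"
    "idx2 dB dC dD i div dD = i div (dB * dD) mod dC" "idx2 dB dC dD i mod dD = i mod (dB * dD) mod dD"
    unfolding idx1_def idx2_def using 1 2 by simp_all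
qed

lemma idx_of_digits:
  assumes "a < dA" "c < dC" "b < dB" "d < dD"
  shows "idx1 dB dC dD ((a * dC + c) * (dB * dD) + (b * dD + d)) = a * dB + b"
    "idx2 dB dC dD ((a * dC + c) * (dB * dD) + (b * dD + d)) = c * dD + d"
proof -
  have "b * dD + d < dB * dD" using assms by (intro pair_index_less)
  moreover have "(x * m + y) div m = x" "(x * m + y) mod m = y" if "y < m" for x m y :: nat
    using that by auto
  ultimately have "((a * dC + c) * (dB * dD) + (b * dD + d)) div (dB * dD) = a * dC + c"
    "((a * dC + c) * (dB * dD) + (b * dD + d)) mod (dB * dD) = b * dD + d" by blast+
  then show "idx1 dB dC dD ((a * dC + c) * (dB * dD) + (b * dD + d)) = a * dB + b"
    "idx2 dB dC dD ((a * dC + c) * (dB * dD) + (b * dD + d)) = c * dD + d"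
    unfolding idx1_def idx2_def using assms by simp_all
qed

text \<open>The two index maps together enumerate all pairs once; reordering four digits reduces
  traces and forms of \<open>bip_tensor\<close> to sums over pairs.\<close>

lemma sum_bip:
  fixes f :: "nat \<Rightarrow> nat \<Rightarrow> 'a :: comm_monoid_add"
  shows "(\<Sum>i<(dA * dC) * (dB * dD). f (idx1 dB dC dD i) (idx2 dB dC dD i)) = (\<Sum>p<dA * dB. \<Sum>q<dC * dD. f p q)"
proof -
  have "(\<Sum>i<(dA * dC) * (dB * dD). f (idx1 dB dC dD i) (idx2 dB dC dD i))
      = (\<Sum>a<dA. \<Sum>c<dC. \<Sum>b<dB. \<Sum>d<dD. f (a * dB + b) (c * dD + d))"
    unfolding sum_divmod using idx_of_digits by (intro sum.cong refl) auto
  also have "\<dots> = (\<Sum>a<dA. \<Sum>b<dB. \<Sum>c<dC. \<Sum>d<dD. f (a * dB + b) (c * dD + d))"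
    by (intro sum.cong refl sum.swap)
  finally show ?thesis unfolding sum_divmod .
qed

lemma trp_bip:
  "trp ((dA * dC) * (dB * dD)) (bip_tensor dA dB dC dD X Y) (bip_tensor dA dB dC dD Z W)
   = trp (dA * dB) X Z * trp (dC * dD) Y W"
proof -
  define N where "N = (dA * dC) * (dB * dD)"
  define f where "f p' q' p q = X $$ (p', p) * Z $$ (p, p') * (Y $$ (q', q) * W $$ (q, q'))" for p' q' p q
  define g where "g p' q' = (\<Sum>p<dA * dB. \<Sum>q<dC * dD. f p' q' p q)" for p' q'
  have "trp N (bip_tensor dA dB dC dD X Y) (bip_tensor dA dB dC dD Z W) =
    (\<Sum>r<N. \<Sum>s<N. f (idx1 dB dC dD r) (idx2 dB dC dD r) (idx1 dB dC dD s) (idx2 dB dC dD s))"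
    unfolding trp_def N_def by (intro sum.cong refl) (simp add: index_bip f_def mult_ac)
  also have "\<dots> = (\<Sum>r<N. g (idx1 dB dC dD r) (idx2 dB dC dD r))"
    unfolding N_def g_def by (rule sum.cong[OF refl]) (rule sum_bip)
  also have "\<dots> = (\<Sum>p'<dA * dB. \<Sum>q'<dC * dD. g p' q')"
    unfolding N_def by (rule sum_bip)
  also have "\<dots> = (\<Sum>p'<dA * dB. \<Sum>q'<dC * dD. \<Sum>p<dA * dB. \<Sum>q<dC * dD. X $$ (p', p) * Z $$ (p, p') *
       (Y $$ (q', q) * W $$ (q, q')))"
    unfolding g_def f_def ..
  also have "\<dots> = trp (dA * dB) X Z * trp (dC * dD) Y W"
    unfolding trp_def sum_product ..
  finally show ?thesis by (simp add: N_def)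
qed

lemma bip_ro:
  "bip_tensor dA dB dC dD (ro (dA * dB) u) (ro (dC * dD) v)
   = ro ((dA * dC) * (dB * dD)) (\<lambda>i. u (idx1 dB dC dD i) * v (idx2 dB dC dD i))"
  by (intro eq_matI) (auto simp: index_bip idx_bounds[of _ dA dC dB dD])

text \<open>Regrouping from A:B and C:D to AC:BD keeps product vectors product, which is why tensor
  products of separable operators stay separable.\<close>

lemma bip_ro_pv:
  "bip_tensor dA dB dC dD (ro (dA * dB) (pv dB a b)) (ro (dC * dD) (pv dD c d))
   = ro ((dA * dC) * (dB * dD)) (pv (dB * dD) (pv dC a c) (pv dD b d))"
  unfolding bip_ro by (intro eq_matI) (auto simp: pv_def idx_bounds[of _ dA dC dB dD])

lemma bip_add_left:
  "X \<in> carrier_mat (dA * dB) (dA * dB) \<Longrightarrow> X' \<in> carrier_mat (dA * dB) (dA * dB) \<Longrightarrow>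
   bip_tensor dA dB dC dD (X + X') Y = bip_tensor dA dB dC dD X Y + bip_tensor dA dB dC dD X' Y"
  by (intro eq_matI) (auto simp: index_bip idx_bounds[of _ dA dC dB dD] algebra_simps)

lemma bip_add_right:
  "Y \<in> carrier_mat (dC * dD) (dC * dD) \<Longrightarrow> Y' \<in> carrier_mat (dC * dD) (dC * dD) \<Longrightarrow>
   bip_tensor dA dB dC dD X (Y + Y') = bip_tensor dA dB dC dD X Y + bip_tensor dA dB dC dD X Y'"
  by (intro eq_matI) (auto simp: index_bip idx_bounds[of _ dA dC dB dD] algebra_simps)

lemma bip_zero:
  "bip_tensor dA dB dC dD (0\<^sub>m (dA * dB) (dA * dB)) Y = 0\<^sub>m ((dA * dC) * (dB * dD)) ((dA * dC) * (dB * dD))"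
  "bip_tensor dA dB dC dD X (0\<^sub>m (dC * dD) (dC * dD)) = 0\<^sub>m ((dA * dC) * (dB * dD)) ((dA * dC) * (dB * dD))"
  by (intro eq_matI; auto simp: index_bip idx_bounds[of _ dA dC dB dD])+

lemma bip_mat_sum:
  "bip_tensor dA dB dC dD (mat_sum (dA * dB) k E) (mat_sum (dC * dD) l F)
   = mat_sum ((dA * dC) * (dB * dD)) (k * l) (\<lambda>y. bip_tensor dA dB dC dD (E (y div l)) (F (y mod l)))"
proof (intro eq_matI)
  fix r s assume "r < dim_row (mat_sum ((dA * dC) * (dB * dD)) (k * l) (\<lambda>y. bip_tensor dA dB dC dD (E (y div l)) (F (y mod l))))"
    "s < dim_col (mat_sum ((dA * dC) * (dB * dD)) (k * l) (\<lambda>y. bip_tensor dA dB dC dD (E (y div l)) (F (y mod l))))"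
  then have rs: "r < (dA * dC) * (dB * dD)" "s < (dA * dC) * (dB * dD)" by auto
  show "bip_tensor dA dB dC dD (mat_sum (dA * dB) k E) (mat_sum (dC * dD) l F) $$ (r, s)
     = mat_sum ((dA * dC) * (dB * dD)) (k * l) (\<lambda>y. bip_tensor dA dB dC dD (E (y div l)) (F (y mod l))) $$ (r, s)"
    using rs idx_bounds(1,2)[OF rs(1)] idx_bounds(1,2)[OF rs(2)]
    by (simp add: index_bip sum_divmod sum_product)
qed auto

lemma bip_psd:
  assumes "psd (dA * dB) X" "psd (dC * dD) Y"
  shows "psd ((dA * dC) * (dB * dD)) (bip_tensor dA dB dC dD X Y)"
  using psd_imp_rcone[OF assms(1)]
proof (induction rule: rcone.induct)
  case (rcone_step X u)
  have "psd ((dA * dC) * (dB * dD)) (bip_tensor dA dB dC dD (ro (dA * dB) u) Y)"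
    using psd_imp_rcone[OF assms(2)]
  proof (induction rule: rcone.induct)
    case (rcone_step Y v)
    then show ?case
      using bip_add_right[OF rcone_carrier[OF rcone_step(1)] ro_carrier] by (simp add: bip_ro psd_add psd_ro)
  qed (simp add: bip_zero psd_zero)
  then show ?case
    using rcone_step bip_add_left[OF rcone_carrier[OF rcone_step(1)] ro_carrier] by (simp add: psd_add)
qed (simp add: bip_zero psd_zero)

lemma bip_sepcone:
  assumes "X \<in> sepcone dA dB" "Y \<in> sepcone dC dD"
  shows "bip_tensor dA dB dC dD X Y \<in> sepcone (dA * dC) (dB * dD)"
  using assms(1)[unfolded sepcone_def]
proof (induction rule: rcone.induct)
  case (rcone_step X u)
  then obtain a b where u: "u = pv dB a b" by blast
  have "bip_tensor dA dB dC dD (ro (dA * dB) u) Y \<in> sepcone (dA * dC) (dB * dD)"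
    using assms(2)[unfolded sepcone_def]
  proof (induction rule: rcone.induct)
    case (rcone_step Y v)
    then obtain c d where v: "v = pv dD c d" by blast
    show ?case
      using bip_add_right[OF rcone_carrier[OF rcone_step(1)] ro_carrier] rcone_step(3)
      by (simp add: sepcone_add u v bip_ro_pv sepcone_ro)
  qed (simp add: bip_zero sepcone_zero)
  then show ?case
    using rcone_step bip_add_left[OF rcone_carrier[OF rcone_step(1)] ro_carrier] by (simp add: sepcone_add)
qed (simp add: bip_zero sepcone_zero)

lemma bip_one: "bip_tensor dA dB dC dD (1\<^sub>m (dA * dB)) (1\<^sub>m (dC * dD)) = 1\<^sub>m ((dA * dC) * (dB * dD))"
  using bip_tensor_tensor_mat[of "1\<^sub>m dA" dA "1\<^sub>m dB" dB "1\<^sub>m dC" dC "1\<^sub>m dD" dD]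
  by (simp add: tensor_one)

lemma bip_density:
  assumes "density_op (dA * dB) X" "density_op (dC * dD) Y"
  shows "density_op ((dA * dC) * (dB * dD)) (bip_tensor dA dB dC dD X Y)"
proof -
  have C: "X \<in> carrier_mat (dA * dB) (dA * dB)" "Y \<in> carrier_mat (dC * dD) (dC * dD)"
    using assms by (auto simp: density_op_def psd_carrier)
  have "trace_mat (bip_tensor dA dB dC dD X Y) = trp ((dA * dC) * (dB * dD)) (bip_tensor dA dB dC dD X Y) (1\<^sub>m ((dA * dC) * (dB * dD)))"
    by simp
  also have "\<dots> = trace_mat X * trace_mat Y"
    unfolding bip_one[symmetric] trp_bip using C by simp
  finally show ?thesis using assms by (auto simp: density_op_def bip_psd)
qed

lemma bip_power_density:
  assumes "density_op (dA * dB) \<rho>"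
  shows "density_op (dA ^ n * dB ^ n) (bip_power dA dB \<rho> n)"
proof (induction n)
  case 0
  then show ?case by (simp add: density_op_def psd_one)
next
  case (Suc n)
  from bip_density[OF assms this] show ?case by simp
qed

text \<open>\<open>bip_power\<close> adds one copy at a time; associativity is what allows cutting n
  copies into blocks of any length. The proof is arithmetic with mixed-radix digits of the
  index.\<close>

lemma bip_assoc:
  "bip_tensor dA dB (dC * dE) (dD * dF) X (bip_tensor dC dD dE dF Y Z)
   = bip_tensor (dA * dC) (dB * dD) dE dF (bip_tensor dA dB dC dD X Y) Z"
proof (rule eq_matI)
  define M where "M = (dA * dC * dE) * (dB * dD * dF)"
  have dig: "m mod (p * q) div q = m div q mod p" "m mod (p * q) mod q = m mod q" for m p q :: nat
  proof -
    have "m mod (p * q) = q * (m div q mod p) + m mod q"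
      using mod_mult2_eq[of m q p] by (simp add: mult.commute)
    then show "m mod (p * q) div q = m div q mod p" "m mod (p * q) mod q = m mod q"
      by (cases "q = 0"; simp)+
  qed
  have dig3: "m mod (p * (u * q)) div q mod u = m div q mod u" for m p q u :: nat
    using dig(1)[of m "p * u" q] dig(2)[of "m div q" p u] by (simp add: mult.assoc)
  have dig4: "m mod (p * (u * q)) mod q = m mod q" for m p q u :: nat
    using dig(2)[of m "p * u" q] by (simp add: mult.assoc)
  have i: "idx1 dB (dC * dE) (dD * dF) r = idx1 dB dC dD (idx1 (dB * dD) dE dF r)"
    "idx1 dD dE dF (idx2 dB (dC * dE) (dD * dF) r) = idx2 dB dC dD (idx1 (dB * dD) dE dF r)"
    "idx2 dD dE dF (idx2 dB (dC * dE) (dD * dF) r) = idx2 (dB * dD) dE dF r"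
    "idx2 dB (dC * dE) (dD * dF) r < dC * dE * (dD * dF)"
    "idx1 (dB * dD) dE dF r < dA * dC * (dB * dD)"
    if r: "r < M" for r
  proof -
    have r1: "r < (dA * (dC * dE)) * (dB * (dD * dF))" and r2: "r < (dA * dC * dE) * (dB * dD * dF)"
      using r by (simp_all add: M_def mult.assoc)
    note b1 = idx_bounds[OF r1] and b2 = idx_bounds[OF r2]
    show 1: "idx2 dB (dC * dE) (dD * dF) r < dC * dE * (dD * dF)" "idx1 (dB * dD) dE dF r < dA * dC * (dB * dD)"
      using b1(2) b2(1) by auto
    show "idx1 dB (dC * dE) (dD * dF) r = idx1 dB dC dD (idx1 (dB * dD) dE dF r)"
      unfolding idx1_def[of dB dC dD] b2(3,4) unfolding idx1_def
      by (simp add: mult.assoc div_mult2_eq[of _ dE dC] mult.commute[of dC dE] dig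
          div_mult2_eq[of _ dF dD] mult.commute[of dD dF])
    show "idx1 dD dE dF (idx2 dB (dC * dE) (dD * dF) r) = idx2 dB dC dD (idx1 (dB * dD) dE dF r)"
      unfolding idx2_def[of dB dC dD] b2(3,4) unfolding idx1_def[of dD dE dF] b1(5,6)
      by (simp add: mult.assoc dig dig3 dig4)
    show "idx2 dD dE dF (idx2 dB (dC * dE) (dD * dF) r) = idx2 (dB * dD) dE dF r"
      unfolding idx2_def[of dD dE dF] b1(5,6) unfolding idx2_def
      by (simp add: mult.assoc dig dig4)
  qed
  fix r s assume "r < dim_row (bip_tensor (dA * dC) (dB * dD) dE dF (bip_tensor dA dB dC dD X Y) Z)"
    "s < dim_col (bip_tensor (dA * dC) (dB * dD) dE dF (bip_tensor dA dB dC dD X Y) Z)"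
  then have rs: "r < M" "s < M" by (simp_all add: M_def)
  have 1: "r < (dA * (dC * dE)) * (dB * (dD * dF))" "s < (dA * (dC * dE)) * (dB * (dD * dF))"
    and 2: "r < (dA * dC * dE) * (dB * dD * dF)" "s < (dA * dC * dE) * (dB * dD * dF)"
    using rs by (simp_all add: M_def mult.assoc)
  show "bip_tensor dA dB (dC * dE) (dD * dF) X (bip_tensor dC dD dE dF Y Z) $$ (r, s)
    = bip_tensor (dA * dC) (dB * dD) dE dF (bip_tensor dA dB dC dD X Y) Z $$ (r, s)"
    unfolding index_bip[OF 1] index_bip[OF 2] index_bip[OF i(4)[OF rs(1)] i(4)[OF rs(2)]]
      index_bip[OF i(5)[OF rs(1)] i(5)[OF rs(2)]] i(1,2,3)[OF rs(1)] i(1,2,3)[OF rs(2)]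
    by (simp add: mult.assoc)
qed (simp_all add: mult.assoc)

lemma bip_one_left:
  assumes "Y \<in> carrier_mat (dC * dD) (dC * dD)"
  shows "bip_tensor 1 1 dC dD (1\<^sub>m 1) Y = Y"
proof (rule eq_matI)
  fix r s assume "r < dim_row Y" "s < dim_col Y"
  then have rs: "r < dC * dD" "s < dC * dD" using assms by auto
  have "idx1 1 dC dD i = 0 \<and> idx2 1 dC dD i = i" if "i < dC * dD" for i
    using div_mod_less[OF that] by (simp add: idx1_def idx2_def)
  then show "bip_tensor 1 1 dC dD (1\<^sub>m 1) Y $$ (r, s) = Y $$ (r, s)"
    using rs by (simp add: bip_tensor_def)
qed (use assms in auto)

lemma bip_one_right:
  assumes "X \<in> carrier_mat (dA * dB) (dA * dB)"
  shows "bip_tensor dA dB 1 1 X (1\<^sub>m 1) = X"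
proof (rule eq_matI)
  fix r s assume "r < dim_row X" "s < dim_col X"
  then have rs: "r < dA * dB" "s < dA * dB" using assms by auto
  have "idx1 dB 1 1 i = i \<and> idx2 dB 1 1 i = 0" for i
    by (simp add: idx1_def idx2_def)
  then show "bip_tensor dA dB 1 1 X (1\<^sub>m 1) $$ (r, s) = X $$ (r, s)"
    using rs by (simp add: bip_tensor_def)
qed (use assms in auto)

lemma bip_power_carrier: "bip_power dA dB X n \<in> carrier_mat (dA ^ n * dB ^ n) (dA ^ n * dB ^ n)"
  by (cases n) (simp_all add: bip_tensor_def)

lemma bip_power_add:
  "bip_power dA dB X (k + n) = bip_tensor (dA ^ k) (dB ^ k) (dA ^ n) (dB ^ n) (bip_power dA dB X k) (bip_power dA dB X n)"
proof (induction k)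
  case 0
  then show ?case using bip_one_left[OF bip_power_carrier] by simp
next
  case (Suc k)
  then show ?case by (simp add: power_add bip_assoc)
qed

lemma bip_power_1: "X \<in> carrier_mat (dA * dB) (dA * dB) \<Longrightarrow> bip_power dA dB X 1 = X"
  using bip_one_right by simp

section \<open>Multiplicativity of weighted measurements\<close>

text \<open>Contracting a product vector of AC:BD with a product vector of A:B leaves a product
  vector of C:D, although a may be entangled inside AC and b inside BD.\<close>

lemma qf_bip_ro:
  "qf ((dA * dC) * (dB * dD)) (bip_tensor dA dB dC dD (ro (dA * dB) (pv dB x y)) W) (pv (dB * dD) a b)
   = qf (dC * dD) W (pv dD (\<lambda>c. \<Sum>i<dA. cnj (x i) * a (i * dC + c)) (\<lambda>d. \<Sum>k<dB. cnj (y k) * b (k * dD + d)))"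
proof -
  define N where "N = (dA * dC) * (dB * dD)"
  define u where "u = pv dB x y"
  define g where "g p q = a (p div dB * dC + q div dD) * b (p mod dB * dD + q mod dD)" for p q
  have g: "pv (dB * dD) a b r = g (idx1 dB dC dD r) (idx2 dB dC dD r)" if "r < N" for r
  proof -
    have "r < (dA * dC) * (dB * dD)" using that by (simp add: N_def)
    note b = idx_bounds[OF this]
    show ?thesis unfolding g_def b(3-6) pv_def by simp
  qed
  \<comment> \<open>The partial inner product with u; it factorises at the end because u is a
    product.\<close>
  define z where "z q = (\<Sum>p<dA * dB. cnj (u p) * g p q)" for q
  define f where "f p' q' p q = cnj (g p' q') * u p' * W $$ (q', q) * (cnj (u p) * g p q)" for p' q' p q
  define h where "h p' q' = (\<Sum>p<dA * dB. \<Sum>q<dC * dD. f p' q' p q)" for p' q'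
  have "qf N (bip_tensor dA dB dC dD (ro (dA * dB) u) W) (pv (dB * dD) a b) =
    (\<Sum>r<N. \<Sum>s<N. f (idx1 dB dC dD r) (idx2 dB dC dD r) (idx1 dB dC dD s) (idx2 dB dC dD s))"
    unfolding qf_def
  proof (intro sum.cong refl)
    fix r s assume "r \<in> {..<N}" "s \<in> {..<N}"
    then have rs: "r < N" "s < N" by auto
    then have rs': "r < (dA * dC) * (dB * dD)" "s < (dA * dC) * (dB * dD)" by (auto simp: N_def)
    show "cnj (pv (dB * dD) a b r) * bip_tensor dA dB dC dD (ro (dA * dB) u) W $$ (r, s) * pv (dB * dD) a b s =
      f (idx1 dB dC dD r) (idx2 dB dC dD r) (idx1 dB dC dD s) (idx2 dB dC dD s)"
      unfolding g[OF rs(1)] g[OF rs(2)] index_bip[OF rs'] f_def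
      using idx_bounds(1)[OF rs'(1)] idx_bounds(1)[OF rs'(2)] by (simp add: mult_ac)
  qed
  also have "\<dots> = (\<Sum>r<N. h (idx1 dB dC dD r) (idx2 dB dC dD r))"
    unfolding N_def h_def by (rule sum.cong[OF refl]) (rule sum_bip)
  also have "\<dots> = (\<Sum>p'<dA * dB. \<Sum>q'<dC * dD. h p' q')"
    unfolding N_def by (rule sum_bip)
  also have "\<dots> = (\<Sum>p'<dA * dB. \<Sum>q'<dC * dD. \<Sum>p<dA * dB. \<Sum>q<dC * dD. cnj (g p' q') * u p' * 
       W $$ (q', q) * (cnj (u p) * g p q))"
    unfolding h_def f_def ..
  also have "\<dots> = (\<Sum>q'<dC * dD. \<Sum>p'<dA * dB. \<Sum>q<dC * dD. \<Sum>p<dA * dB. cnj (g p' q') * u p' * 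
       W $$ (q', q) * (cnj (u p) * g p q))"
    by (subst sum.swap) (intro sum.cong refl sum.swap)
  also have "\<dots> = (\<Sum>q'<dC * dD. \<Sum>p'<dA * dB. \<Sum>q<dC * dD. cnj (g p' q') * u p' * (W $$ (q', q) * z q))"
    unfolding z_def sum_distrib_left by (simp add: mult_ac)
  also have "\<dots> = (\<Sum>q'<dC * dD. (\<Sum>p'<dA * dB. cnj (g p' q') * u p') * (\<Sum>q<dC * dD. W $$ (q', q) * z q))"
    by (simp add: sum_product)
  also have "\<dots> = qf (dC * dD) W z"
  proof -
    have "(\<Sum>p'<dA * dB. cnj (g p' q') * u p') = cnj (z q')" for q'
      by (simp add: z_def mult.commute)
    then show ?thesis by (simp add: qf_def sum_distrib_left mult.assoc)
  qed
  finally have 1: "qf N (bip_tensor dA dB dC dD (ro (dA * dB) u) W) (pv (dB * dD) a b) = qf (dC * dD) W z" .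
  have "z q = pv dD (\<lambda>c. \<Sum>i<dA. cnj (x i) * a (i * dC + c)) (\<lambda>d. \<Sum>k<dB. cnj (y k) * b (k * dD + d)) q" for q
    unfolding z_def sum_divmod u_def pv_def[of dD] sum_product
    by (intro sum.cong refl) (simp add: pv_index g_def mult_ac)
  then have "z = pv dD (\<lambda>c. \<Sum>i<dA. cnj (x i) * a (i * dC + c)) (\<lambda>d. \<Sum>k<dB. cnj (y k) * b (k * dD + d))" ..
  then show ?thesis using 1 by (simp add: N_def u_def)
qed

text \<open>The maximal expectation of a separable operator in product states does not increase when it is
  tensored with an operator whose maximal expectation is at most one: contracting \<open>W\<close> term by term
  with a product vector leaves product vectors on the remaining factors.\<close>

lemma qf_bip_le:
  assumes W: "W \<in> sepcone dA dB" 
    and V: "\<And>c d. Re (qf (dC * dD) V (pv dD c d)) \<le> nrm dC c * nrm dD d"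
  shows "Re (qf ((dA * dC) * (dB * dD)) (bip_tensor dA dB dC dD W V) (pv (dB * dD) a b))
    \<le> (\<Sum>c<dC. \<Sum>d<dD. Re (qf (dA * dB) W (pv dB (\<lambda>i. a (i * dC + c)) (\<lambda>k. b (k * dD + d)))))"
  using W[unfolded sepcone_def]
proof (induction rule: rcone.induct)
  case rcone_zero
  then show ?case by (simp add: bip_zero)
next
  case (rcone_step W u)
  then obtain x y where u: "u = pv dB x y" by blast
  note WC = rcone_carrier[OF rcone_step(1)]
  define a' where "a' c = (\<Sum>i<dA. cnj (x i) * a (i * dC + c))" for c
  define b' where "b' d = (\<Sum>k<dB. cnj (y k) * b (k * dD + d))" for d
  have "Re (qf ((dA * dC) * (dB * dD)) (bip_tensor dA dB dC dD (ro (dA * dB) u) V) (pv (dB * dD) a b))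
     \<le> nrm dC a' * nrm dD b'"
    unfolding u qf_bip_ro a'_def[abs_def] b'_def[abs_def] by (rule V)
  also have "\<dots> = (\<Sum>c<dC. \<Sum>d<dD. (cmod (a' c))\<^sup>2 * (cmod (b' d))\<^sup>2)"
    by (simp add: nrm_def sum_product)
  also have "\<dots> = (\<Sum>c<dC. \<Sum>d<dD. Re (qf (dA * dB) (ro (dA * dB) u) (pv dB (\<lambda>i. a (i * dC + c)) (\<lambda>k. b (k * dD + d)))))"
    unfolding u qf_ro cip_pv by (simp add: cip_def a'_def b'_def norm_mult power_mult_distrib)
  finally show ?case using rcone_step(3)
    unfolding bip_add_left[OF WC ro_carrier] qf_add[OF bip_carrier bip_carrier] qf_add[OF WC ro_carrier]
    by (simp add: sum.distrib)
qed

lemma sum_nrm_slices: "(\<Sum>c<dC. nrm dA (\<lambda>i. a (i * dC + c))) = nrm (dA * dC) a"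
  unfolding nrm_def sum_divmod by (rule sum.swap)

text \<open>Applied to the slices of a and b, the bound for W leaves squared norms that add up to
  those of a and b.\<close>

lemma product_bound_bip:
  assumes W: "W \<in> sepcone dA dB" "\<And>a b. Re (qf (dA * dB) W (pv dB a b)) \<le> nrm dA a * nrm dB b"
    and V: "\<And>c d. Re (qf (dC * dD) V (pv dD c d)) \<le> nrm dC c * nrm dD d"
  shows "Re (qf ((dA * dC) * (dB * dD)) (bip_tensor dA dB dC dD W V) (pv (dB * dD) a b))
    \<le> nrm (dA * dC) a * nrm (dB * dD) b"
proof -
  have "Re (qf ((dA * dC) * (dB * dD)) (bip_tensor dA dB dC dD W V) (pv (dB * dD) a b))
    \<le> (\<Sum>c<dC. \<Sum>d<dD. Re (qf (dA * dB) W (pv dB (\<lambda>i. a (i * dC + c)) (\<lambda>k. b (k * dD + d)))))"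
    using W(1) V by (rule qf_bip_le)
  also have "\<dots> \<le> (\<Sum>c<dC. \<Sum>d<dD. nrm dA (\<lambda>i. a (i * dC + c)) * nrm dB (\<lambda>k. b (k * dD + d)))"
    by (intro sum_mono W(2))
  also have "\<dots> = nrm (dA * dC) a * nrm (dB * dD) b"
    by (simp add: sum_nrm_slices flip: sum_product)
  finally show ?thesis .
qed

text \<open>The weighted sum of the effects has expectation at most one in every separable state, while
  \<open>\<theta>\<close> bounds the moment of order \<open>-s\<close> of the weights under \<open>\<rho>\<close>. Both bounds are multiplicative
  under tensor products, so that Markov's inequality gives a Chernoff bound.\<close>

definition esys :: "nat \<Rightarrow> nat \<Rightarrow> complex mat \<Rightarrow> real \<Rightarrow> real \<Rightarrow> bool" where
  "esys dA dB \<rho> s \<theta> \<longleftrightarrow> (\<exists>k E c. (k, E, c) \<in> WM dA dB \<and>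
     (\<forall>a b. Re (qf (dA * dB) (mat_sum (dA * dB) k (\<lambda>x. complex_of_real (c x) \<cdot>\<^sub>m E x)) (pv dB a b))
        \<le> nrm dA a * nrm dB b) \<and>
     (\<Sum>x<k. c x powr (- s) * Re (trp (dA * dB) \<rho> (E x))) \<le> \<theta>)"

text \<open>The trivial measurement; it takes care of the copies left over when n is divided into
  blocks.\<close>

lemma esys_one:
  assumes "density_op (dA * dB) \<rho>" shows "esys dA dB \<rho> s 1"
proof -
  have C: "\<rho> \<in> carrier_mat (dA * dB) (dA * dB)" using assms by (simp add: density_op_def psd_carrier)
  have m: "mat_sum (dA * dB) 1 (\<lambda>_. 1\<^sub>m (dA * dB)) = 1\<^sub>m (dA * dB)" by (intro eq_matI) auto
  have m': "mat_sum (dA * dB) 1 (\<lambda>x. complex_of_real 1 \<cdot>\<^sub>m 1\<^sub>m (dA * dB)) = 1\<^sub>m (dA * dB)" by (intro eq_matI) auto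
  show ?thesis unfolding esys_def
  proof (intro exI[of _ 1] exI[of _ "\<lambda>_. 1\<^sub>m (dA * dB)"] exI[of _ "\<lambda>_. 1"] conjI allI)
    show "(1, \<lambda>_. 1\<^sub>m (dA * dB), \<lambda>_. 1) \<in> WM dA dB"
      using m by (simp add: WM_def sepcone_one)
    show "Re (qf (dA * dB) (mat_sum (dA * dB) 1 (\<lambda>x. complex_of_real 1 \<cdot>\<^sub>m 1\<^sub>m (dA * dB))) (pv dB a b))
        \<le> nrm dA a * nrm dB b" for a b
      unfolding m' by (simp add: nrm_pv)
    show "(\<Sum>x<(1::nat). 1 powr - s * Re (trp (dA * dB) \<rho> (1\<^sub>m (dA * dB)))) \<le> 1"
      using assms C by (simp add: density_op_def)
  qed
qed

lemma esys_tensor: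
  assumes \<rho>: "density_op (dA * dB) \<rho>" "esys dA dB \<rho> s \<theta>" and \<tau>: "density_op (dC * dD) \<tau>" "esys dC dD \<tau> s \<eta>"
  shows "esys (dA * dC) (dB * dD) (bip_tensor dA dB dC dD \<rho> \<tau>) s (\<theta> * \<eta>)"
proof -
  define N where "N = (dA * dC) * (dB * dD)"
  obtain k E c where E: "(k, E, c) \<in> WM dA dB"
    "\<And>a b. Re (qf (dA * dB) (mat_sum (dA * dB) k (\<lambda>x. complex_of_real (c x) \<cdot>\<^sub>m E x)) (pv dB a b)) \<le> nrm dA a * nrm dB b"
    "(\<Sum>x<k. c x powr (- s) * Re (trp (dA * dB) \<rho> (E x))) \<le> \<theta>"
    using \<rho>(2) unfolding esys_def by auto
  obtain l F d where F: "(l, F, d) \<in> WM dC dD"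
    "\<And>a b. Re (qf (dC * dD) (mat_sum (dC * dD) l (\<lambda>x. complex_of_real (d x) \<cdot>\<^sub>m F x)) (pv dD a b)) \<le> nrm dC a * nrm dD b"
    "(\<Sum>x<l. d x powr (- s) * Re (trp (dC * dD) \<tau> (F x))) \<le> \<eta>"
    using \<tau>(2) unfolding esys_def by auto
  have E': "\<forall>x<k. E x \<in> sepcone dA dB" "mat_sum (dA * dB) k E = 1\<^sub>m (dA * dB)" "\<And>x. x < k \<Longrightarrow> 0 < c x"
    and F': "\<forall>x<l. F x \<in> sepcone dC dD" "mat_sum (dC * dD) l F = 1\<^sub>m (dC * dD)" "\<And>x. x < l \<Longrightarrow> 0 < d x"
    using E(1) F(1) by (auto simp: WM_def)
  define G where "G y = bip_tensor dA dB dC dD (E (y div l)) (F (y mod l))" for y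
  define e where "e y = c (y div l) * d (y mod l)" for y
  have "mat_sum N (k * l) G = 1\<^sub>m N"
    using bip_mat_sum[of dA dB dC dD k E l F] by (simp add: E' F' bip_one N_def G_def[abs_def])
  then have WM: "(k * l, G, e) \<in> WM (dA * dC) (dB * dD)"
    using E' F' by (auto simp: WM_def N_def G_def e_def div_mod_less[of _ k l] intro!: bip_sepcone)
  have "mat_sum N (k * l) (\<lambda>y. complex_of_real (e y) \<cdot>\<^sub>m G y) =
    mat_sum N (k * l) (\<lambda>y. bip_tensor dA dB dC dD (complex_of_real (c (y div l)) \<cdot>\<^sub>m E (y div l)) (complex_of_real (d (y mod l)) \<cdot>\<^sub>m F (y mod l)))"
  proof (rule eq_matI)
    fix i j assume "i < dim_row (mat_sum N (k * l) (\<lambda>y. bip_tensor dA dB dC dD (complex_of_real (c (y div l)) \<cdot>\<^sub>m E (y div l)) (complex_of_real (d (y mod l)) \<cdot>\<^sub>m F (y mod l))))"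
      "j < dim_col (mat_sum N (k * l) (\<lambda>y. bip_tensor dA dB dC dD (complex_of_real (c (y div l)) \<cdot>\<^sub>m E (y div l)) (complex_of_real (d (y mod l)) \<cdot>\<^sub>m F (y mod l))))"
    then have ij: "i < N" "j < N" by auto
    then have ij': "i < (dA * dC) * (dB * dD)" "j < (dA * dC) * (dB * dD)" by (auto simp: N_def)
    note b = idx_bounds(1,2)[OF ij'(1)] idx_bounds(1,2)[OF ij'(2)]
    have "(complex_of_real (e y) \<cdot>\<^sub>m G y) $$ (i, j) = bip_tensor dA dB dC dD (complex_of_real (c (y div l)) \<cdot>\<^sub>m E (y div l)) (complex_of_real (d (y mod l)) \<cdot>\<^sub>m F (y mod l)) $$ (i, j)"
      if "y \<in> {..<k * l}" for y
    proof -
      have "y < k * l" using that by simp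
      from div_mod_less[OF this] have "E (y div l) \<in> carrier_mat (dA * dB) (dA * dB)" "F (y mod l) \<in> carrier_mat (dC * dD) (dC * dD)"
        using E'(1) F'(1) sepcone_carrier by auto
      then show ?thesis using b ij' by (simp add: G_def e_def index_bip)
    qed
    then show "mat_sum N (k * l) (\<lambda>y. complex_of_real (e y) \<cdot>\<^sub>m G y) $$ (i, j) = mat_sum N (k * l) (\<lambda>y. bip_tensor dA dB dC dD (complex_of_real (c (y div l)) \<cdot>\<^sub>m E (y div l)) (complex_of_real (d (y mod l)) \<cdot>\<^sub>m F (y mod l))) $$ (i, j)"
      unfolding index_mat_sum[OF ij] by (intro sum.cong refl)
  qed auto
  also have "\<dots> = bip_tensor dA dB dC dD (mat_sum (dA * dB) k (\<lambda>x. complex_of_real (c x) \<cdot>\<^sub>m E x))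
     (mat_sum (dC * dD) l (\<lambda>x. complex_of_real (d x) \<cdot>\<^sub>m F x))"
    unfolding bip_mat_sum N_def ..
  finally have W: "mat_sum N (k * l) (\<lambda>y. complex_of_real (e y) \<cdot>\<^sub>m G y) = \<dots>" .
  have bound: "Re (qf N (mat_sum N (k * l) (\<lambda>y. complex_of_real (e y) \<cdot>\<^sub>m G y)) (pv (dB * dD) a b)) \<le> nrm (dA * dC) a * nrm (dB * dD) b" for a b
    unfolding W unfolding N_def
  proof (rule product_bound_bip)
    show "mat_sum (dA * dB) k (\<lambda>x. complex_of_real (c x) \<cdot>\<^sub>m E x) \<in> sepcone dA dB"
      using E'(1,3) by (intro sepcone_mat_sum sepcone_smult) (auto intro: less_imp_le)
  qed (rule E(2) F(2))+
  have trG: "Re (trp N (bip_tensor dA dB dC dD \<rho> \<tau>) (G y)) = Re (trp (dA * dB) \<rho> (E (y div l))) * Re (trp (dC * dD) \<tau> (F (y mod l)))"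
    if "y < k * l" for y
  proof -
    note dm = div_mod_less[OF that]
    have "psd (dA * dB) (E (y div l))" "psd (dC * dD) (F (y mod l))"
      using E'(1) F'(1) dm by (auto intro: sepcone_psd)
    then have "Im (trp (dA * dB) \<rho> (E (y div l))) = 0" "Im (trp (dC * dD) \<tau> (F (y mod l))) = 0"
      using \<rho>(1) \<tau>(1) trp_psd_nonneg[of "dA * dB" \<rho> "E (y div l)"] trp_psd_nonneg[of "dC * dD" \<tau> "F (y mod l)"]
      by (auto simp: density_op_def less_eq_complex_def)
    then show ?thesis unfolding N_def G_def trp_bip by simp
  qed
  note p = measurement_probabilities(1)[OF E'(1,2) \<rho>(1)] and q = measurement_probabilities(1)[OF F'(1,2) \<tau>(1)]
  have "(\<Sum>y<k * l. e y powr (- s) * Re (trp N (bip_tensor dA dB dC dD \<rho> \<tau>) (G y)))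
    = (\<Sum>y<k * l. (c (y div l) powr (- s) * Re (trp (dA * dB) \<rho> (E (y div l)))) * (d (y mod l) powr (- s) * Re (trp (dC * dD) \<tau> (F (y mod l)))))"
    using E'(3) F'(3) div_mod_less[of _ k l]
    by (intro sum.cong refl) (simp add: trG e_def powr_mult less_imp_le)
  also have "\<dots> = (\<Sum>x<k. c x powr (- s) * Re (trp (dA * dB) \<rho> (E x))) * (\<Sum>x<l. d x powr (- s) * Re (trp (dC * dD) \<tau> (F x)))"
    unfolding sum_divmod sum_product by (intro sum.cong refl) simp
  also have "\<dots> \<le> \<theta> * \<eta>"
  proof (intro mult_mono E(3) F(3))
    have "0 \<le> (\<Sum>x<k. c x powr (- s) * Re (trp (dA * dB) \<rho> (E x)))"
      using p by (intro sum_nonneg mult_nonneg_nonneg) auto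
    then show "0 \<le> \<theta>" using E(3) by linarith
    show "0 \<le> (\<Sum>x<l. d x powr (- s) * Re (trp (dC * dD) \<tau> (F x)))"
      using q by (intro sum_nonneg mult_nonneg_nonneg) auto
  qed
  finally show ?thesis using WM bound unfolding esys_def N_def by blast
qed

lemma esys_power:
  assumes \<rho>: "density_op (dA * dB) \<rho>" and e: "esys (dA ^ k) (dB ^ k) (bip_power dA dB \<rho> k) s \<theta>"
  shows "esys (dA ^ (j * k + r)) (dB ^ (j * k + r)) (bip_power dA dB \<rho> (j * k + r)) s (\<theta> ^ j)"
proof (induction j)
  case 0
  then show ?case using esys_one[OF bip_power_density[OF \<rho>]] by simp
next
  case (Suc j)
  have "Suc j * k + r = k + (j * k + r)" by simp
  show ?case
    unfolding \<open>Suc j * k + r = k + (j * k + r)\<close> bip_power_add[of dA dB \<rho> k "j * k + r"]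
      power_add[of _ k "j * k + r"] power_Suc[of \<theta>]
    by (rule esys_tensor[OF bip_power_density[OF \<rho>] e bip_power_density[OF \<rho>] Suc])
qed

section \<open>Tests distinguishing a state from all separable states\<close>

text \<open>For x = -y < 0 the claim follows from e^y \<ge> 1 + y and (1 + y) (1 - y + y^2) = 1 +
  y^3 \<ge> 1.\<close>

lemma exp_le_quadratic:
  fixes x :: real assumes "\<bar>x\<bar> \<le> 1" shows "exp x \<le> 1 + x + x\<^sup>2"
proof (cases "0 \<le> x")
  case True
  then show ?thesis using exp_bound[of x] assms by simp
next
  case False
  define y where "y = - x"
  have y: "0 < y" using False by (simp add: y_def)
  have "(1 + y) * (1 - y + y\<^sup>2) = 1 + y ^ 3" by (simp add: power2_eq_square power3_eq_cube algebra_simps)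
  then have "1 \<le> (1 + y) * (1 - y + y\<^sup>2)" using y by simp
  also have "\<dots> \<le> exp y * (1 - y + y\<^sup>2)"
  proof (rule mult_right_mono)
    have "0 \<le> (1 - y)\<^sup>2 + y" using y by simp
    then show "0 \<le> 1 - y + y\<^sup>2" by (simp add: power2_eq_square algebra_simps)
  qed (rule exp_ge_add_one_self)
  finally have "exp (- y) * 1 \<le> exp (- y) * (exp y * (1 - y + y\<^sup>2))"
    by (intro mult_left_mono) auto
  then show ?thesis by (simp add: y_def exp_minus mult.assoc[symmetric])
qed

lemma Re_qf_weighted_sum:
  assumes "\<And>x. x < k \<Longrightarrow> E x \<in> carrier_mat n n"
  shows "Re (qf n (mat_sum n k (\<lambda>x. complex_of_real (c x) \<cdot>\<^sub>m E x)) v) = (\<Sum>x<k. c x * Re (qf n (E x) v))"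
  unfolding qf_mat_sum Re_sum using assms by (intro sum.cong) (auto simp: qf_smult)

text \<open>To first order in s the moment of order -s is 1 - s m, where the mean m of the
  log-weights under \<rho> is at least v. A small s makes the quadratic term cost no more than the
  margin v - v'.\<close>

lemma D_SEP_S_esys:
  assumes \<rho>: "density_op (dA * dB) \<rho>" and less: "ereal (v / ln 2) < D_SEP_S dA dB \<rho>" and v': "v' < v"
  shows "\<exists>s>0. esys dA dB \<rho> s (exp (- (s * v')))"
proof -
  define n where "n = dA * dB"
  obtain k E c where WM: "(k, E, c) \<in> WM dA dB"
    and sep: "\<And>\<sigma>. \<sigma> \<in> sep_states dA dB \<Longrightarrow> (\<Sum>x<k. c x * Re (trp n \<sigma> (E x))) \<le> 1"
    and v: "v \<le> (\<Sum>x<k. Re (trp n \<rho> (E x)) * ln (c x))"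
    using D_SEP_S_minimax[OF \<rho> less] unfolding n_def by blast
  have E: "\<forall>x<k. E x \<in> sepcone dA dB" "mat_sum (dA * dB) k E = 1\<^sub>m (dA * dB)" and c: "\<And>x. x < k \<Longrightarrow> 0 < c x"
    using WM by (auto simp: WM_def)
  have EC: "E x \<in> carrier_mat n n" if "x < k" for x using E(1) that sepcone_carrier by (auto simp: n_def)
  define p where "p x = Re (trp n \<rho> (E x))" for x
  define l where "l x = ln (c x)" for x
  have p: "\<And>x. x < k \<Longrightarrow> 0 \<le> p x" "(\<Sum>x<k. p x) = 1"
    using measurement_probabilities[OF E \<rho>] by (auto simp: p_def n_def)
  \<comment> \<open>The constraint on states is homogeneous and so extends to product vectors of any
    length; the zero vector cannot be normalised and is treated apart.\<close>
  have bound: "Re (qf n (mat_sum n k (\<lambda>x. complex_of_real (c x) \<cdot>\<^sub>m E x)) (pv dB a b)) \<le> nrm dA a * nrm dB b" for a b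
  proof (cases "nrm dA a * nrm dB b = 0")
    case True
    then have "nrm n (pv dB a b) = 0" by (simp add: n_def nrm_pv)
    then have "qf n (mat_sum n k (\<lambda>x. complex_of_real (c x) \<cdot>\<^sub>m E x)) (pv dB a b)
        = qf n (mat_sum n k (\<lambda>x. complex_of_real (c x) \<cdot>\<^sub>m E x)) (\<lambda>_. 0)"
      by (intro qf_cong) (auto simp: nrm_eq_0_iff)
    also have "\<dots> = 0" by (simp add: qf_def)
    finally show ?thesis using True by simp
  next
    case False
    define m where "m = nrm dA a * nrm dB b"
    have m: "0 < m" using False nrm_nonneg[of dA a] nrm_nonneg[of dB b] by (simp add: m_def less_le)
    define \<sigma> where "\<sigma> = complex_of_real (1 / m) \<cdot>\<^sub>m ro n (pv dB a b)"
    have "trace_mat \<sigma> = complex_of_real (1 / m * m)"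
      unfolding \<sigma>_def trace_smult[OF ro_carrier] trace_ro by (simp add: n_def nrm_pv m_def)
    then have "trace_mat \<sigma> = 1" using m by simp
    moreover have "\<sigma> \<in> sepcone dA dB"
      unfolding \<sigma>_def n_def using m by (intro sepcone_smult sepcone_ro) auto
    ultimately have "(\<Sum>x<k. c x * Re (trp n \<sigma> (E x))) \<le> 1" by (intro sep) (simp add: sep_states_iff)
    also have "(\<Sum>x<k. c x * Re (trp n \<sigma> (E x))) = (\<Sum>x<k. c x * Re (qf n (E x) (pv dB a b))) / m"
      unfolding \<sigma>_def trp_smult_left[OF ro_carrier] trp_commute[of n "ro n _"] trp_ro
      by (simp add: sum_divide_distrib)
    finally show ?thesis using m EC by (simp add: Re_qf_weighted_sum m_def)
  qed
  define R where "R = 1 + (\<Sum>x<k. \<bar>l x\<bar>)"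
  have R: "1 \<le> R" by (simp add: R_def sum_nonneg)
  have lR: "\<bar>l x\<bar> \<le> R" if "x < k" for x
  proof -
    have "\<bar>l x\<bar> \<le> (\<Sum>x<k. \<bar>l x\<bar>)" using that by (intro member_le_sum) auto
    then show ?thesis by (simp add: R_def)
  qed
  \<comment> \<open>s R \<le> 1 puts the exponents into the range of
    \<open>exp_le_quadratic\<close>; s R^2 \<le> v - v' pays for the quadratic term.\<close>
  define s where "s = min (1 / R) ((v - v') / R\<^sup>2)"
  have s: "0 < s" using R v' by (simp add: s_def)
  have s1: "s * R \<le> 1"
  proof -
    have "s * R \<le> 1 / R * R" using R by (intro mult_right_mono) (auto simp: s_def)
    then show ?thesis using R by simp
  qed
  have s2: "s * R\<^sup>2 \<le> v - v'"
  proof -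
    have "s * R\<^sup>2 \<le> (v - v') / R\<^sup>2 * R\<^sup>2" by (intro mult_right_mono) (auto simp: s_def)
    then show ?thesis using R by simp
  qed
  have term_le: "c x powr (- s) * p x \<le> p x - s * (p x * l x) + s\<^sup>2 * R\<^sup>2 * p x" if x: "x < k" for x
  proof -
    have sl: "\<bar>s * l x\<bar> \<le> s * R" using lR[OF x] s by (simp add: abs_mult mult_left_mono)
    have "c x powr (- s) = exp (- (s * l x))"
      using c[OF x] by (simp add: powr_def l_def)
    also have "\<dots> \<le> 1 + - (s * l x) + (- (s * l x))\<^sup>2"
      using sl s1 by (intro exp_le_quadratic) auto
    also have "(- (s * l x))\<^sup>2 \<le> s\<^sup>2 * R\<^sup>2"
    proof -
      have "(- (s * l x))\<^sup>2 = \<bar>s * l x\<bar>\<^sup>2" by simp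
      also have "\<dots> \<le> (s * R)\<^sup>2" using sl by (intro power_mono) auto
      finally show ?thesis by (simp add: power_mult_distrib)
    qed
    finally have "c x powr (- s) \<le> 1 - s * l x + s\<^sup>2 * R\<^sup>2" by simp
    then have "c x powr (- s) * p x \<le> (1 - s * l x + s\<^sup>2 * R\<^sup>2) * p x"
      using p(1)[OF x] by (intro mult_right_mono) auto
    then show ?thesis by (simp add: algebra_simps)
  qed
  have "(\<Sum>x<k. c x powr (- s) * p x) \<le> (\<Sum>x<k. p x - s * (p x * l x) + s\<^sup>2 * R\<^sup>2 * p x)"
    using term_le by (intro sum_mono) auto
  also have "\<dots> = 1 - s * (\<Sum>x<k. p x * l x) + s\<^sup>2 * R\<^sup>2"
    using p(2) by (simp add: sum.distrib sum_subtractf flip: sum_distrib_left)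
  also have "\<dots> \<le> 1 - s * v + s * (v - v')"
  proof -
    have "s * v \<le> s * (\<Sum>x<k. p x * l x)" using v s by (intro mult_left_mono) (auto simp: p_def l_def)
    moreover have "s * (s * R\<^sup>2) \<le> s * (v - v')" using s2 s by (intro mult_left_mono) auto
    ultimately show ?thesis by (simp add: power2_eq_square mult.assoc)
  qed
  also have "\<dots> = 1 + - (s * v')" by (simp add: algebra_simps)
  also have "\<dots> \<le> exp (- (s * v'))" by (rule exp_ge_add_one_self)
  finally have "(\<Sum>x<k. c x powr (- s) * Re (trp n \<rho> (E x))) \<le> exp (- (s * v'))" by (simp add: p_def)
  then show ?thesis using s WM bound unfolding esys_def n_def by blast
qed

lemma sepcone_trp_le:
  assumes W: "W \<in> carrier_mat (dA * dB) (dA * dB)"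
    and le: "\<And>a b. Re (qf (dA * dB) W (pv dB a b)) \<le> C * (nrm dA a * nrm dB b)"
    and X: "X \<in> sepcone dA dB"
  shows "Re (trp (dA * dB) X W) \<le> C * Re (trace_mat X)"
  using X[unfolded sepcone_def]
proof (induction rule: rcone.induct)
  case (rcone_step X u)
  then obtain a b where u: "u = pv dB a b" by blast
  have "trp (dA * dB) (ro (dA * dB) u) W = qf (dA * dB) W u"
    using trp_commute trp_ro by metis
  then show ?case using rcone_step(3) le[of a b] rcone_carrier[OF rcone_step(1)]
    by (simp add: trp_add_left trace_add[of _ "dA * dB"] trace_ro u nrm_pv algebra_simps)
qed simp

text \<open>A likelihood threshold test: T collects the effects of weight at least \<tau>. Markov's
  inequality is used twice, through 1 \<le> c / \<tau> on the effects in T for separable states and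
  through 1 \<le> (\<tau> / c)^s on the others for \<rho>.\<close>

lemma esys_test:
  assumes \<rho>: "density_op (dA * dB) \<rho>" and e: "esys dA dB \<rho> s \<theta>" and \<tau>: "0 < \<tau>" and s: "0 < s"
  shows "\<exists>T. T \<in> sepcone dA dB \<and> 1\<^sub>m (dA * dB) - T \<in> sepcone dA dB \<and>
     (\<forall>\<sigma>\<in>sep_states dA dB. Re (trp (dA * dB) T \<sigma>) \<le> 1 / \<tau>) \<and>
     Re (trp (dA * dB) (1\<^sub>m (dA * dB) - T) \<rho>) \<le> \<tau> powr s * \<theta>"
proof -
  define n where "n = dA * dB"
  obtain k E c where WM: "(k, E, c) \<in> WM dA dB"
    and bd: "\<And>a b. Re (qf n (mat_sum n k (\<lambda>x. complex_of_real (c x) \<cdot>\<^sub>m E x)) (pv dB a b)) \<le> nrm dA a * nrm dB b"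
    and mom: "(\<Sum>x<k. c x powr (- s) * Re (trp n \<rho> (E x))) \<le> \<theta>"
    using e unfolding esys_def n_def by blast
  have E: "\<forall>x<k. E x \<in> sepcone dA dB" "mat_sum (dA * dB) k E = 1\<^sub>m (dA * dB)" and c: "\<And>x. x < k \<Longrightarrow> 0 < c x"
    using WM by (auto simp: WM_def)
  have EC: "E x \<in> carrier_mat n n" if "x < k" for x using E(1) that sepcone_carrier by (auto simp: n_def)
  define P where "P x = (if \<tau> \<le> c x then E x else 0\<^sub>m n n)" for x
  define Q where "Q x = (if \<tau> \<le> c x then 0\<^sub>m n n else E x)" for x
  define T where "T = mat_sum n k P"
  have T: "T \<in> sepcone dA dB"
    unfolding T_def n_def P_def using E(1) by (intro sepcone_mat_sum) (auto simp: sepcone_zero)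
  have "mat_sum n k Q \<in> sepcone dA dB"
    unfolding n_def Q_def using E(1) by (intro sepcone_mat_sum) (auto simp: sepcone_zero)
  moreover have T': "1\<^sub>m n - T = mat_sum n k Q"
  proof (rule eq_matI)
    fix i j assume "i < dim_row (mat_sum n k Q)" "j < dim_col (mat_sum n k Q)"
    then have ij: "i < n" "j < n" by auto
    have "1\<^sub>m n $$ (i, j) = (\<Sum>x<k. E x $$ (i, j))" using E(2) ij by (metis index_mat_sum n_def)
    also have "\<dots> = (\<Sum>x<k. P x $$ (i, j) + Q x $$ (i, j))"
      using ij by (intro sum.cong) (auto simp: P_def Q_def)
    finally show "(1\<^sub>m n - T) $$ (i, j) = mat_sum n k Q $$ (i, j)"
      using ij by (simp add: T_def sum.distrib)
  qed (auto simp: T_def)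
  moreover have "Re (trp n T \<sigma>) \<le> 1 / \<tau>" if \<sigma>: "\<sigma> \<in> sep_states dA dB" for \<sigma>
  proof -
    define W where "W = mat_sum n k (\<lambda>x. complex_of_real (c x) \<cdot>\<^sub>m E x)"
    note q = measurement_probabilities(1)[OF E sep_states_density[OF \<sigma>], folded n_def]
    have "Re (trp n \<sigma> W) \<le> 1 * Re (trace_mat \<sigma>)"
      unfolding n_def using bd \<sigma> by (intro sepcone_trp_le) (auto simp: W_def n_def sep_states_iff)
    then have W1: "Re (trp n \<sigma> W) \<le> 1" using \<sigma> by (simp add: sep_states_iff)
    have W2: "Re (trp n \<sigma> W) = (\<Sum>x<k. c x * Re (trp n \<sigma> (E x)))"
      unfolding W_def trp_mat_sum_right Re_sum using EC by (intro sum.cong) (auto simp: trp_smult_right)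
    have "\<tau> * Re (trp n T \<sigma>) = (\<Sum>x<k. \<tau> * Re (trp n \<sigma> (P x)))"
      by (simp add: T_def trp_mat_sum_left sum_distrib_left trp_commute[of n "P _" \<sigma>])
    also have "\<dots> \<le> (\<Sum>x<k. c x * Re (trp n \<sigma> (E x)))"
    proof (rule sum_mono)
      fix x assume "x \<in> {..<k}"
      then show "\<tau> * Re (trp n \<sigma> (P x)) \<le> c x * Re (trp n \<sigma> (E x))"
        using c[of x] q[of x] by (auto simp: P_def intro!: mult_right_mono)
    qed
    finally show ?thesis using W1 W2 \<tau> by (simp add: field_simps)
  qed
  moreover have "Re (trp n (1\<^sub>m n - T) \<rho>) \<le> \<tau> powr s * \<theta>"
  proof -
    note p = measurement_probabilities(1)[OF E \<rho>, folded n_def]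
    have "Re (trp n (1\<^sub>m n - T) \<rho>) = (\<Sum>x<k. Re (trp n \<rho> (Q x)))"
      unfolding T' by (simp add: trp_mat_sum_left trp_commute[of n "Q _" \<rho>])
    also have "\<dots> \<le> (\<Sum>x<k. \<tau> powr s * (c x powr (- s) * Re (trp n \<rho> (E x))))"
    proof (rule sum_mono)
      fix x assume x: "x \<in> {..<k}"
      show "Re (trp n \<rho> (Q x)) \<le> \<tau> powr s * (c x powr (- s) * Re (trp n \<rho> (E x)))"
      proof (cases "\<tau> \<le> c x")
        case True
        then show ?thesis using p[of x] x by (simp add: Q_def)
      next
        case False
        have cx: "0 < c x" using c x by simp
        have "c x powr s \<le> \<tau> powr s" using False cx s by (intro powr_mono2) auto
        then have "1 \<le> \<tau> powr s * c x powr (- s)" using cx by (simp add: powr_minus field_simps)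
        then have "1 * Re (trp n \<rho> (E x)) \<le> \<tau> powr s * c x powr (- s) * Re (trp n \<rho> (E x))"
          using p[of x] x by (intro mult_right_mono) auto
        then show ?thesis using False by (simp add: Q_def mult.assoc)
      qed
    qed
    also have "\<dots> \<le> \<tau> powr s * \<theta>"
      unfolding sum_distrib_left[symmetric] using mom by (intro mult_left_mono) auto
    finally show ?thesis .
  qed
  ultimately show ?thesis using T unfolding n_def by (intro exI[of _ T]) auto
qed

section \<open>Maximally entangled states and isotropic operators\<close>

text \<open>The maximally entangled vector in local dimension d, in the index convention of
  \<open>tensor_mat\<close>.\<close>

definition phi :: "nat \<Rightarrow> nat \<Rightarrow> complex" where
  "phi d i = (if i div d = i mod d then complex_of_real (1 / sqrt (real d)) else 0)"

lemma nrm_phi: "0 < d \<Longrightarrow> nrm (d * d) (phi d) = 1"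
proof -
  assume d: "0 < d"
  have "nrm (d * d) (phi d) = (\<Sum>a<d. \<Sum>b<d. if b = a then 1 / real d else 0)"
    unfolding nrm_def sum_divmod by (intro sum.cong refl) (auto simp: phi_def norm_divide power_divide)
  then show ?thesis using d by simp
qed

lemma cip_phi_pv: "0 < d \<Longrightarrow> cip (d * d) (phi d) (pv d a b) = complex_of_real (1 / sqrt (real d)) * (\<Sum>i<d. a i * b i)"
proof -
  have "cip (d * d) (phi d) (pv d a b) = (\<Sum>i<d. \<Sum>j<d. if j = i then complex_of_real (1 / sqrt (real d)) * (a i * b i) else 0)"
    unfolding cip_def sum_divmod by (intro sum.cong refl) (auto simp: phi_def pv_index)
  then show ?thesis by (simp add: sum_distrib_left)
qed

text \<open>The amplitude is the bilinear sum of a_i b_i divided by sqrt d; conjugating a turns it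
  into an inner product, and Cauchy-Schwarz applies. The factor 1 / d is the largest overlap of a
  product state with \<Phi>.\<close>

lemma qf_phi_pv: "0 < d \<Longrightarrow> Re (qf (d * d) (ro (d * d) (phi d)) (pv d a b)) \<le> 1 / real d * (nrm d a * nrm d b)"
proof -
  assume d: "0 < d"
  have "(cmod (\<Sum>i<d. a i * b i))\<^sup>2 = (cmod (cip d (\<lambda>i. cnj (a i)) b))\<^sup>2" by (simp add: cip_def)
  also have "\<dots> \<le> nrm d (\<lambda>i. cnj (a i)) * nrm d b" by (rule cauchy_schwarz)
  also have "\<dots> = nrm d a * nrm d b" by (simp add: nrm_def)
  finally have "1 / real d * (cmod (\<Sum>i<d. a i * b i))\<^sup>2 \<le> 1 / real d * (nrm d a * nrm d b)"
    by (intro mult_left_mono) auto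
  moreover have "Re (qf (d * d) (ro (d * d) (phi d)) (pv d a b)) = 1 / real d * (cmod (\<Sum>i<d. a i * b i))\<^sup>2"
    unfolding qf_ro cip_phi_pv[OF d] by (simp add: norm_mult norm_divide power_mult_distrib power_divide)
  ultimately show ?thesis by simp
qed

lemma Phi2_eq: "Phi2 = ro (2 * 2) (phi 2)"
proof (rule eq_matI)
  have c: "i < 4 \<Longrightarrow> i = 0 \<or> i = 1 \<or> i = 2 \<or> i = 3" for i :: nat by auto
  have k: "Phi2_ket $ i = phi 2 i" if "i < 4" for i
    using c[OF that] by (auto simp: Phi2_ket_def phi_def)
  fix i j assume "i < dim_row (ro (2 * 2) (phi 2))" "j < dim_col (ro (2 * 2) (phi 2))"
  then show "Phi2 $$ (i, j) = ro (2 * 2) (phi 2) $$ (i, j)"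
    using k by (simp add: Phi2_def)
qed (auto simp: Phi2_def)

text \<open>Two local indices coincide iff their digits do, so the condition defining
  \<open>phi (2 * q)\<close> splits into those of \<open>phi 2\<close> and
  \<open>phi q\<close>.\<close>

lemma bip_power_Phi2: "bip_power 2 2 Phi2 m = ro (2 ^ m * 2 ^ m) (phi (2 ^ m))"
proof (induction m)
  case 0
  then show ?case by (intro eq_matI) (auto simp: phi_def)
next
  case (Suc m)
  define q where "q = (2::nat) ^ m"
  have "phi 2 (idx1 2 q q i) * phi q (idx2 2 q q i) = phi (2 * q) i" if i: "i < (2 * q) * (2 * q)" for i
  proof -
    note b = idx_bounds(3-6)[OF i]
    have "i div (2 * q) = i mod (2 * q) \<longleftrightarrow> i div (2 * q) div q = i mod (2 * q) div q \<and> i div (2 * q) mod q = i mod (2 * q) mod q"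
      by (metis div_mod_decomp)
    then show ?thesis unfolding phi_def b by (auto simp: real_sqrt_mult simp flip: of_real_mult)
  qed
  then have "ro ((2 * q) * (2 * q)) (\<lambda>i. phi 2 (idx1 2 q q i) * phi q (idx2 2 q q i)) = ro ((2 * q) * (2 * q)) (phi (2 * q))"
    by (intro eq_matI) auto
  then show ?case using bip_ro[of 2 2 q q "phi 2" "phi q"] Suc by (simp add: Phi2_eq q_def)
qed

section \<open>Averages over finitely many phases\<close>

lemma sum_roots_of_unity:
  fixes M :: int and N :: nat
  assumes "\<bar>M\<bar> < int N"
  shows "(\<Sum>t<N. cis (2 * pi * real t * real_of_int M / real N)) = (if M = 0 then of_nat N else 0)"
proof (cases "M = 0")
  case False
  have N: "0 < N" using assms by (cases N) auto
  define z where "z = cis (2 * pi * real_of_int M / real N)"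
  have pow: "z ^ t = cis (2 * pi * real t * real_of_int M / real N)" for t
    unfolding z_def DeMoivre by (simp add: mult_ac)
  have "z ^ N = cis (2 * pi * real_of_int M)" unfolding pow using N by (simp add: mult_ac)
  also have "\<dots> = 1" by (rule cis_multiple_2pi) simp
  finally have zN: "z ^ N = 1" .
  \<comment> \<open>z = 1 would make N divide M, against 0 < |M| < N.\<close>
  have "z \<noteq> 1"
  proof
    assume "z = 1"
    then have "cos (2 * pi * real_of_int M / real N) = 1" by (simp add: z_def complex_eq_iff)
    then obtain j :: int where "2 * pi * real_of_int M / real N = real_of_int j * 2 * pi"
      using cos_one_2pi_int by auto
    then have "real_of_int M = real_of_int j * real N" using N by (simp add: field_simps)
    then have "real_of_int M = real_of_int (j * int N)" by simp
    then have M: "M = j * int N" by (simp only: of_int_eq_iff)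
    then have "j \<noteq> 0" using False by auto
    then have "1 * int N \<le> \<bar>j\<bar> * int N" by (intro mult_right_mono) auto
    then have "int N \<le> \<bar>M\<bar>" using M by (simp add: abs_mult)
    then show False using assms by simp
  qed
  then have "(\<Sum>t<N. z ^ t) = 0" using zN by (simp add: geometric_sum)
  then show ?thesis using False by (simp add: pow)
qed simp

text \<open>Compare the smallest exponents of the two sides. If they differ, division by the smaller
  power leaves 1 + 3^r, which is 1 or 2 modulo 3, on one side and a multiple of 3 on the
  other.\<close>

lemma three_powers_Sidon:
  fixes i j k l :: nat
  assumes "(3::nat) ^ i + 3 ^ l = 3 ^ j + 3 ^ k"
  shows "(i = j \<and> k = l) \<or> (i = k \<and> j = l)"
proof -
  have base: "i = j" if eq: "(3::nat) ^ i + 3 ^ l = 3 ^ j + 3 ^ k" and le: "i \<le> l" "j \<le> k" "i \<le> j" for i j k l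
  proof (rule ccontr)
    assume "i \<noteq> j"
    then obtain p q r where j: "j = i + Suc p" and k: "k = i + Suc q" and l: "l = i + r"
      using le by (metis le_neq_implies_less less_imp_Suc_add le_iff_add add_Suc_right order_trans less_le_trans)
    have "(3::nat) ^ i * (1 + 3 ^ r) = 3 ^ i * (3 * (3 ^ p + 3 ^ q))"
      using eq unfolding j k l by (simp add: power_add algebra_simps)
    then have "(1::nat) + 3 ^ r = 3 * (3 ^ p + 3 ^ q)" by (subst (asm) mult_left_cancel) auto
    then have "((1::nat) + 3 ^ r) mod 3 = 0" by simp
    moreover have "((1::nat) + 3 ^ r) mod 3 \<noteq> 0" by (cases r) (auto simp: mod_add_right_eq[symmetric])
    ultimately show False by simp
  qed
  have main: "i = j \<and> k = l" if eq: "(3::nat) ^ i + 3 ^ l = 3 ^ j + 3 ^ k" and le: "i \<le> l" "j \<le> k" for i j k l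
  proof -
    have "i = j" using base[OF eq le] base[OF eq[symmetric] le(2,1)] by linarith
    then show ?thesis using eq by simp
  qed
  have eqs: "(3::nat) ^ i + 3 ^ l = 3 ^ k + 3 ^ j" "(3::nat) ^ l + 3 ^ i = 3 ^ j + 3 ^ k" "(3::nat) ^ l + 3 ^ i = 3 ^ k + 3 ^ j"
    using assms by simp_all
  show ?thesis
    using main[OF assms] main[OF eqs(1)] main[OF eqs(2)] main[OF eqs(3)] by (metis nat_le_linear)
qed

text \<open>Phases with exponents \<open>3\<^sup>i\<close> form a Sidon set, so that averaging over \<open>t\<close> keeps exactly the
  contributions in which the two pairs of indices agree.\<close>

definition phase :: "nat \<Rightarrow> nat \<Rightarrow> nat \<Rightarrow> complex" where
  "phase d t i = cis (2 * pi * real t * real (3 ^ i) / real (2 * 3 ^ d + 1))"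

lemma sum_phases:
  assumes "i < d" "j < d" "k < d" "l < d"
  shows "(\<Sum>t<2 * 3 ^ d + 1. phase d t i * cnj (phase d t j) * cnj (phase d t k) * phase d t l)
    = (if (i = j \<and> k = l) \<or> (i = k \<and> j = l) then of_nat (2 * 3 ^ d + 1) else 0)"
proof -
  \<comment> \<open>The frequencies 3^x with x < d are below 3^d, so M lies strictly between -N and
    N and vanishes modulo N only if it is 0.\<close>
  define N where "N = (2 * 3 ^ d + 1 :: nat)"
  define M where "M = int (3 ^ i) + int (3 ^ l) - int (3 ^ j) - int (3 ^ k)"
  have le: "(3::nat) ^ x \<le> 3 ^ d" if "x < d" for x using that by (intro power_increasing) auto
  have "\<bar>M\<bar> < int N"
    using le[OF assms(1)] le[OF assms(2)] le[OF assms(3)] le[OF assms(4)]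
    unfolding M_def N_def by linarith
  moreover have "phase d t i * cnj (phase d t j) * cnj (phase d t k) * phase d t l = cis (2 * pi * real t * real_of_int M / real N)" for t
  proof -
    have "phase d t i * cnj (phase d t j) * cnj (phase d t k) * phase d t l =
      cis (2 * pi * real t * real (3 ^ i) / real N + - (2 * pi * real t * real (3 ^ j) / real N)
        + - (2 * pi * real t * real (3 ^ k) / real N) + 2 * pi * real t * real (3 ^ l) / real N)"
      unfolding phase_def N_def cis_cnj cis_mult ..
    also have "2 * pi * real t * real (3 ^ i) / real N + - (2 * pi * real t * real (3 ^ j) / real N)
        + - (2 * pi * real t * real (3 ^ k) / real N) + 2 * pi * real t * real (3 ^ l) / real N
      = 2 * pi * real t * real_of_int M / real N"
      unfolding M_def by (simp add: algebra_simps add_divide_distrib diff_divide_distrib)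
    finally show ?thesis .
  qed
  moreover have "M = 0 \<longleftrightarrow> (i = j \<and> k = l) \<or> (i = k \<and> j = l)"
  proof
    assume "M = 0"
    then have "int (3 ^ i + 3 ^ l) = int (3 ^ j + 3 ^ k)" unfolding M_def by simp
    then show "(i = j \<and> k = l) \<or> (i = k \<and> j = l)" by (intro three_powers_Sidon) (simp only: of_nat_eq_iff)
  qed (auto simp: M_def)
  ultimately show ?thesis
    using sum_roots_of_unity[of M N] by (simp add: N_def)
qed

text \<open>An average of product operators built from a phase vector and its conjugate, twisted by
  the character s of Z_d. On the span of the vectors |jj> it is d times the projector onto the
  maximally entangled vector with phases exp(2 pi \<i> s j / d); on the other basis vectors it is
  the identity.\<close>

definition twirl :: "nat \<Rightarrow> nat \<Rightarrow> complex mat" where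
  "twirl d s = complex_of_real (1 / real (2 * 3 ^ d + 1)) \<cdot>\<^sub>m mat_sum (d * d) (2 * 3 ^ d + 1)
     (\<lambda>t. ro (d * d) (pv d (phase d t) (\<lambda>i. cis (2 * pi * real s * real i / real d) * cnj (phase d t i))))"

lemma twirl_sepcone: "twirl d s \<in> sepcone d d"
  unfolding twirl_def by (intro sepcone_smult sepcone_mat_sum sepcone_ro) auto

lemma index_twirl:
  assumes rs: "r < d * d" "q < d * d"
  shows "twirl d s $$ (r, q) = (if (r div d = r mod d \<and> q div d = q mod d) \<or> r = q
    then cis (2 * pi * real s * real_of_int (int (r mod d) - int (q mod d)) / real d) else 0)"
proof -
  define N where "N = (2 * 3 ^ d + 1 :: nat)"
  have N0: "N \<noteq> 0" by (simp add: N_def)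
  note b = div_mod_less[OF rs(1)] div_mod_less[OF rs(2)]
  have rq: "r = q \<longleftrightarrow> r div d = q div d \<and> r mod d = q mod d" by (metis div_mod_decomp)
  define w where "w = cis (2 * pi * real s * real_of_int (int (r mod d) - int (q mod d)) / real d)"
  have w: "cis (2 * pi * real s * real (r mod d) / real d) * cnj (cis (2 * pi * real s * real (q mod d) / real d)) = w"
    unfolding w_def cis_cnj cis_mult by (simp add: algebra_simps diff_divide_distrib)
  have "(\<Sum>t<N. ro (d * d) (pv d (phase d t) (\<lambda>i. cis (2 * pi * real s * real i / real d) * cnj (phase d t i))) $$ (r, q))
    = (\<Sum>t<N. w * (phase d t (r div d) * cnj (phase d t (r mod d)) * cnj (phase d t (q div d)) * phase d t (q mod d)))"
    using rs by (intro sum.cong refl) (simp add: pv_def mult_ac flip: w)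
  also have "\<dots> = w * (if (r div d = r mod d \<and> q div d = q mod d) \<or> r = q then of_nat N else 0)"
    unfolding sum_distrib_left[symmetric] N_def sum_phases[OF b(1,2,3,4)] rq by auto
  finally have "(\<Sum>t<N. ro (d * d) (pv d (phase d t) (\<lambda>i. cis (2 * pi * real s * real i / real d) * cnj (phase d t i))) $$ (r, q))
    = w * (if (r div d = r mod d \<and> q div d = q mod d) \<or> r = q then of_nat N else 0)" .
  moreover have "complex_of_real (1 / real N) * (w * of_nat N) = w"
    using N0 by simp
  ultimately show ?thesis
    using rs unfolding twirl_def w_def[symmetric] N_def[symmetric] by simp
qed

lemma diag_sepcone:
  "mat (d * d) (d * d) (\<lambda>(r, q). if r = q \<and> P r then 1 else 0) \<in> sepcone d d"
proof -
  define F where "F y = (if P y then ro (d * d) (pv d (\<lambda>i. if i = y div d then 1 else 0) (\<lambda>i. if i = y mod d then 1 else 0)) else 0\<^sub>m (d * d) (d * d))" for y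
  have "mat (d * d) (d * d) (\<lambda>(r, q). if r = q \<and> P r then 1 else 0) = mat_sum (d * d) (d * d) F"
  proof (rule eq_matI)
    fix r q assume "r < dim_row (mat_sum (d * d) (d * d) F)" "q < dim_col (mat_sum (d * d) (d * d) F)"
    then have rq: "r < d * d" "q < d * d" by auto
    have eq: "(x div d = y div d \<and> x mod d = y mod d) \<longleftrightarrow> x = y" for x y by (metis div_mod_decomp)
    have "pv d (\<lambda>i. if i = y div d then 1 else 0) (\<lambda>i. if i = y mod d then 1 else 0) x = (if x = y then 1 else 0)" for x y
      using eq[of x y] by (auto simp: pv_def)
    then have "F y $$ (r, q) = (if y = r then (if r = q \<and> P r then 1 else 0) else 0)" for y
      using rq by (auto simp: F_def)
    then have "(\<Sum>y<d * d. F y $$ (r, q)) = (if r = q \<and> P r then 1 else 0)" using rq by simp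
    then show "mat (d * d) (d * d) (\<lambda>(r, q). if r = q \<and> P r then 1 else 0) $$ (r, q) = mat_sum (d * d) (d * d) F $$ (r, q)"
      using rq by simp
  qed auto
  also have "\<dots> \<in> sepcone d d"
    by (intro sepcone_mat_sum) (auto simp: F_def sepcone_ro sepcone_zero)
  finally show ?thesis .
qed

lemma index_Phi:
  assumes "0 < d" "r < d * d" "q < d * d"
  shows "complex_of_real (real d) * ro (d * d) (phi d) $$ (r, q) = (if r div d = r mod d \<and> q div d = q mod d then 1 else 0)"
proof -
  have "complex_of_real (real d * (1 / sqrt (real d) * (1 / sqrt (real d)))) = 1"
    using assms(1) by simp
  then have "complex_of_real (real d) * (complex_of_real (1 / sqrt (real d)) * complex_of_real (1 / sqrt (real d))) = 1"
    by (simp only: of_real_mult)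
  then show ?thesis using assms by (auto simp: phi_def simp del: of_real_divide)
qed

text \<open>The average with s = 0 is d \<Phi> plus the identity off the span of the |jj>; a
  separable diagonal matrix completes the identity.\<close>

lemma one_plus_Phi_sepcone:
  assumes d: "0 < d"
  shows "1\<^sub>m (d * d) + complex_of_real (real d) \<cdot>\<^sub>m ro (d * d) (phi d) \<in> sepcone d d"
proof -
  define D where "D = mat (d * d) (d * d) (\<lambda>(r, q). if r = q \<and> r div d = r mod d then 1 else 0 :: complex)"
  have "1\<^sub>m (d * d) + complex_of_real (real d) \<cdot>\<^sub>m ro (d * d) (phi d) = twirl d 0 + D"
  proof (rule eq_matI)
    fix r q assume "r < dim_row (twirl d 0 + D)" "q < dim_col (twirl d 0 + D)"
    then have rq: "r < d * d" "q < d * d" by (auto simp: D_def)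
    show "(1\<^sub>m (d * d) + complex_of_real (real d) \<cdot>\<^sub>m ro (d * d) (phi d)) $$ (r, q) = (twirl d 0 + D) $$ (r, q)"
      using rq index_Phi[OF d rq] sepcone_carrier[OF twirl_sepcone[of d 0]]
      by (auto simp: index_twirl D_def simp del: index_ro)
  qed (auto simp: D_def sepcone_carrier[OF twirl_sepcone[of d 0], THEN carrier_matD(1)]
      sepcone_carrier[OF twirl_sepcone[of d 0], THEN carrier_matD(2)])
  moreover have "D \<in> sepcone d d" unfolding D_def by (rule diag_sepcone)
  ultimately show ?thesis by (simp add: sepcone_add twirl_sepcone)
qed

text \<open>The maximally entangled vectors with phases s = 0, ..., d - 1 form a basis of the span
  of the |jj>, so the averages with s \<ge> 1 add up to d times the complement of \<Phi> there.
  Elsewhere they add up to d - 1 times the identity, and the diagonal matrix D supplies the missing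
  1.\<close>

lemma one_minus_Phi_sepcone:
  assumes d: "0 < d"
  shows "1\<^sub>m (d * d) - ro (d * d) (phi d) \<in> sepcone d d"
proof -
  define D where "D = mat (d * d) (d * d) (\<lambda>(r, q). if r = q \<and> r div d \<noteq> r mod d then 1 else 0 :: complex)"
  define S where "S = mat_sum (d * d) (d - 1) (\<lambda>s. twirl d (Suc s))"
  have S: "S \<in> sepcone d d" unfolding S_def by (intro sepcone_mat_sum twirl_sepcone)
  have D: "D \<in> sepcone d d" unfolding D_def by (rule diag_sepcone)
  have "1\<^sub>m (d * d) - ro (d * d) (phi d) = complex_of_real (1 / real d) \<cdot>\<^sub>m (S + D)"
  proof (rule eq_matI)
    fix r q assume "r < dim_row (complex_of_real (1 / real d) \<cdot>\<^sub>m (S + D))" "q < dim_col (complex_of_real (1 / real d) \<cdot>\<^sub>m (S + D))"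
    then have rq: "r < d * d" "q < d * d" by (auto simp: D_def)
    note b = div_mod_less[OF rq(1)] div_mod_less[OF rq(2)]
    have eq: "r = q \<longleftrightarrow> r div d = q div d \<and> r mod d = q mod d" by (metis div_mod_decomp)
    define C where "C \<longleftrightarrow> (r div d = r mod d \<and> q div d = q mod d) \<or> r = q"
    define M where "M = int (r mod d) - int (q mod d)"
    have "(\<Sum>s<d. cis (2 * pi * real s * real_of_int M / real d)) = (if M = 0 then of_nat d else 0)"
    proof (rule sum_roots_of_unity)
      show "\<bar>M\<bar> < int d" using b(2,4) unfolding M_def by linarith
    qed
    moreover obtain d' where d': "d = Suc d'" using d by (cases d) auto
    ultimately have sum: "(\<Sum>s<d - 1. cis (2 * pi * real (Suc s) * real_of_int M / real d)) = (if M = 0 then of_nat d else 0) - 1"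
      unfolding d' sum.lessThan_Suc_shift by (simp add: algebra_simps split: if_splits)
    have "S $$ (r, q) = (\<Sum>s<d - 1. if C then cis (2 * pi * real (Suc s) * real_of_int M / real d) else 0)"
      unfolding C_def M_def using rq by (simp add: S_def index_twirl del: of_nat_Suc)
    also have "\<dots> = (if C then (if M = 0 then of_nat d else 0) - 1 else 0)"
      using sum by simp
    finally have Srq: "S $$ (r, q) = (if C then (if M = 0 then of_nat d else 0) - 1 else 0)" .
    have M0: "M = 0 \<longleftrightarrow> r mod d = q mod d" by (auto simp: M_def)
    have SD: "S $$ (r, q) + D $$ (r, q) = (if r = q then of_nat d else 0) - complex_of_real (real d) * ro (d * d) (phi d) $$ (r, q)"
      unfolding index_Phi[OF d rq] Srq using rq eq by (auto simp: D_def C_def M0)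
    have "complex_of_real (1 / real d) * (S $$ (r, q) + D $$ (r, q)) = (if r = q then 1 else 0) - ro (d * d) (phi d) $$ (r, q)"
      unfolding SD using d by (auto simp: field_simps simp del: index_ro)
    then show "(1\<^sub>m (d * d) - ro (d * d) (phi d)) $$ (r, q) = (complex_of_real (1 / real d) \<cdot>\<^sub>m (S + D)) $$ (r, q)"
      using rq by (simp add: S_def D_def del: index_ro)
  qed (auto simp: D_def)
  then show ?thesis using S D by (simp only:) (intro sepcone_smult sepcone_add, auto)
qed

section \<open>Measure-and-prepare channels with isotropic outputs\<close>

lemma sum_swap4:
  "(\<Sum>a\<in>A. \<Sum>u\<in>U. \<Sum>b\<in>B. \<Sum>v\<in>V. f a u b v) = (\<Sum>u\<in>U. \<Sum>v\<in>V. \<Sum>a\<in>A. \<Sum>b\<in>B. f a u b v)"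
  for f :: "_ \<Rightarrow> _ \<Rightarrow> _ \<Rightarrow> _ \<Rightarrow> 'a :: comm_monoid_add"
proof -
  have "(\<Sum>a\<in>A. \<Sum>u\<in>U. \<Sum>b\<in>B. \<Sum>v\<in>V. f a u b v) = (\<Sum>u\<in>U. \<Sum>a\<in>A. \<Sum>v\<in>V. \<Sum>b\<in>B. f a u b v)"
    by (subst sum.swap) (intro sum.cong refl sum.swap)
  also have "\<dots> = (\<Sum>u\<in>U. \<Sum>v\<in>V. \<Sum>a\<in>A. \<Sum>b\<in>B. f a u b v)"
    by (intro sum.cong[OF refl] sum.swap)
  finally show ?thesis .
qed

lemma ampliation_carrier [simp]: "ampliation n m k \<Xi> X \<in> carrier_mat (m * k) (m * k)"
  by (simp add: ampliation_def)

lemma dim_ampliation [simp]: "dim_row (ampliation n m k \<Xi> X) = m * k" "dim_col (ampliation n m k \<Xi> X) = m * k"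
  by (simp_all add: ampliation_def)

lemma ampliation_add:
  assumes "\<And>Y. Y \<in> carrier_mat n n \<Longrightarrow> \<Xi> Y \<in> carrier_mat m m" "\<And>Y. Y \<in> carrier_mat n n \<Longrightarrow> \<Upsilon> Y \<in> carrier_mat m m"
  shows "ampliation n m k (\<lambda>Y. \<Xi> Y + \<Upsilon> Y) X = ampliation n m k \<Xi> X + ampliation n m k \<Upsilon> X"
proof (rule eq_matI)
  fix r s assume "r < dim_row (ampliation n m k \<Xi> X + ampliation n m k \<Upsilon> X)" "s < dim_col (ampliation n m k \<Xi> X + ampliation n m k \<Upsilon> X)"
  then have rs: "r < m * k" "s < m * k" by auto
  define Y where "Y = mat n n (\<lambda>(i, j). X $$ (i * k + r mod k, j * k + s mod k))"
  have "Y \<in> carrier_mat n n" by (simp add: Y_def)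
  then show "ampliation n m k (\<lambda>Y. \<Xi> Y + \<Upsilon> Y) X $$ (r, s) = (ampliation n m k \<Xi> X + ampliation n m k \<Upsilon> X) $$ (r, s)"
    using assms[of Y] rs div_mod_less[OF rs(1)] div_mod_less[OF rs(2)]
    by (simp add: ampliation_def Y_def[symmetric])
qed auto

text \<open>For rank-one effect and rank-one output the map has a single Kraus operator. The form of
  the output at w is therefore the form of X at the image of w under the adjoint of that operator,
  and positivity is inherited.\<close>

lemma ampliation_ro:
  "qf (m * k) (ampliation n m k (\<lambda>Y. trp n (ro n t) Y \<cdot>\<^sub>m ro m f) X) w
   = qf (n * k) X (\<lambda>r. t (r div k) * (\<Sum>a<m. cnj (f a) * w (a * k + r mod k)))"
proof -
  define y where "y v = (\<Sum>a<m. cnj (f a) * w (a * k + v))" for v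
  define G where "G u v = (\<Sum>i<n. \<Sum>j<n. cnj (t i) * X $$ (i * k + u, j * k + v) * t j)" for u v
  have ent: "ampliation n m k (\<lambda>Y. trp n (ro n t) Y \<cdot>\<^sub>m ro m f) X $$ (a * k + u, b * k + v) = G u v * (f a * cnj (f b))"
    if "a < m" "u < k" "b < m" "v < k" for a u b v
  proof -
    have "a * k + u < m * k" "b * k + v < m * k" using that by (auto intro: pair_index_less)
    moreover have "trp n (ro n t) (mat n n (\<lambda>(i, j). X $$ (i * k + u, j * k + v))) = G u v"
      unfolding trp_commute[of n "ro n t"] trp_ro by (simp add: qf_def G_def)
    ultimately show ?thesis using that by (simp add: ampliation_def)
  qed
  have "qf (m * k) (ampliation n m k (\<lambda>Y. trp n (ro n t) Y \<cdot>\<^sub>m ro m f) X) w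
    = (\<Sum>a<m. \<Sum>u<k. \<Sum>b<m. \<Sum>v<k. cnj (w (a * k + u)) * (G u v * (f a * cnj (f b))) * w (b * k + v))"
    unfolding qf_def sum_divmod using ent by (intro sum.cong refl) simp
  also have "\<dots> = (\<Sum>u<k. \<Sum>v<k. \<Sum>a<m. \<Sum>b<m. cnj (w (a * k + u)) * (G u v * (f a * cnj (f b))) * w (b * k + v))"
    by (rule sum_swap4)
  also have "\<dots> = (\<Sum>u<k. \<Sum>v<k. cnj (y u) * G u v * y v)"
  proof (intro sum.cong refl)
    fix u v
    have "cnj (y u) * G u v * y v = G u v * ((\<Sum>a<m. f a * cnj (w (a * k + u))) * (\<Sum>b<m. cnj (f b) * w (b * k + v)))"
      by (simp add: y_def mult_ac)
    also have "\<dots> = (\<Sum>a<m. \<Sum>b<m. cnj (w (a * k + u)) * (G u v * (f a * cnj (f b))) * w (b * k + v))"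
      unfolding sum_product unfolding sum_distrib_left by (intro sum.cong refl) (simp add: mult_ac)
    finally show "(\<Sum>a<m. \<Sum>b<m. cnj (w (a * k + u)) * (G u v * (f a * cnj (f b))) * w (b * k + v)) = cnj (y u) * G u v * y v" ..
  qed
  finally have 1: "qf (m * k) (ampliation n m k (\<lambda>Y. trp n (ro n t) Y \<cdot>\<^sub>m ro m f) X) w = (\<Sum>u<k. \<Sum>v<k. cnj (y u) * G u v * y v)" .
  have "qf (n * k) X (\<lambda>r. t (r div k) * y (r mod k))
    = (\<Sum>i<n. \<Sum>u<k. \<Sum>j<n. \<Sum>v<k. cnj (t i * y u) * X $$ (i * k + u, j * k + v) * (t j * y v))"
    unfolding qf_def sum_divmod by (intro sum.cong refl) simp
  also have "\<dots> = (\<Sum>u<k. \<Sum>v<k. \<Sum>i<n. \<Sum>j<n. cnj (t i * y u) * X $$ (i * k + u, j * k + v) * (t j * y v))"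
    by (rule sum_swap4)
  also have "\<dots> = (\<Sum>u<k. \<Sum>v<k. cnj (y u) * G u v * y v)"
    unfolding G_def sum_distrib_left sum_distrib_right by (intro sum.cong refl) (simp add: mult_ac)
  finally show ?thesis using 1 by (simp add: y_def)
qed

lemma ampliation_psd:
  assumes T: "psd n T" and P: "psd m P" and X: "psd (n * k) X"
  shows "psd (m * k) (ampliation n m k (\<lambda>Y. trp n T Y \<cdot>\<^sub>m P) X)"
  using psd_imp_rcone[OF T]
proof (induction rule: rcone.induct)
  case rcone_zero
  have "ampliation n m k (\<lambda>Y. trp n (0\<^sub>m n n) Y \<cdot>\<^sub>m P) X = 0\<^sub>m (m * k) (m * k)"
    using psd_carrier[OF P] by (intro eq_matI) (auto simp: ampliation_def div_mod_less[of _ m k])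
  then show ?case by (simp add: psd_zero)
next
  case (rcone_step T t)
  have ro_case: "psd (m * k) (ampliation n m k (\<lambda>Y. trp n (ro n t) Y \<cdot>\<^sub>m P) X)"
    using psd_imp_rcone[OF P]
  proof (induction rule: rcone.induct)
    case rcone_zero
    have "ampliation n m k (\<lambda>Y. trp n (ro n t) Y \<cdot>\<^sub>m 0\<^sub>m m m) X = 0\<^sub>m (m * k) (m * k)"
      by (intro eq_matI) (auto simp: ampliation_def div_mod_less[of _ m k])
    then show ?case by (simp add: psd_zero)
  next
    case (rcone_step P f)
    have "psd (m * k) (ampliation n m k (\<lambda>Y. trp n (ro n t) Y \<cdot>\<^sub>m ro m f) X)"
      using X by (simp add: psd_iff_qf ampliation_ro)
    moreover have "(\<lambda>Y. trp n (ro n t) Y \<cdot>\<^sub>m (P + ro m f)) = (\<lambda>Y. trp n (ro n t) Y \<cdot>\<^sub>m P + trp n (ro n t) Y \<cdot>\<^sub>m ro m f)"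
      using rcone_carrier[OF rcone_step(1)] by (simp add: add_smult_distrib_left_mat[OF _ ro_carrier])
    ultimately show ?case using rcone_step(3) rcone_carrier[OF rcone_step(1)]
      by (simp add: ampliation_add psd_add)
  qed
  have "ampliation n m k (\<lambda>Y. trp n (T + ro n t) Y \<cdot>\<^sub>m P) X
      = ampliation n m k (\<lambda>Y. trp n T Y \<cdot>\<^sub>m P + trp n (ro n t) Y \<cdot>\<^sub>m P) X"
    using rcone_carrier[OF rcone_step(1)] psd_carrier[OF P]
    by (simp add: trp_add_left add_smult_distrib_right_mat)
  also have "\<dots> = ampliation n m k (\<lambda>Y. trp n T Y \<cdot>\<^sub>m P) X + ampliation n m k (\<lambda>Y. trp n (ro n t) Y \<cdot>\<^sub>m P) X"
    using psd_carrier[OF P] by (intro ampliation_add) auto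
  finally show ?case using rcone_step(3) ro_case by (simp add: psd_add)
qed

text \<open>Testing against rank-one operators determines Z, which settles uniqueness in the
  definite description.\<close>

lemma adjoint_map_eqI:
  assumes X: "X \<in> carrier_mat N N" and \<Xi>: "\<And>Y. Y \<in> carrier_mat n n \<Longrightarrow> \<Xi> Y \<in> carrier_mat N N"
    and Z: "Z \<in> carrier_mat n n" and eq: "\<And>Y. Y \<in> carrier_mat n n \<Longrightarrow> trp N X (\<Xi> Y) = trp n Z Y"
  shows "adjoint_map n \<Xi> X = Z"
  unfolding adjoint_map_def
proof (rule the_equality)
  have tr: "trace_mat (X * \<Xi> Y) = trp n Z Y" if "Y \<in> carrier_mat n n" for Y
    using trace_mult_eq_trp[OF X \<Xi>[OF that]] eq[OF that] by simp
  show "Z \<in> carrier_mat n n \<and> (\<forall>Y\<in>carrier_mat n n. trace_mat (X * \<Xi> Y) = trace_mat (Z * Y))"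
    using tr Z by (simp add: trace_mult_eq_trp[OF Z])
  fix Z' assume Z': "Z' \<in> carrier_mat n n \<and> (\<forall>Y\<in>carrier_mat n n. trace_mat (X * \<Xi> Y) = trace_mat (Z' * Y))"
  show "Z' = Z"
  proof (rule qf_eq_imp_eq[of _ n])
    fix v
    have "trace_mat (X * \<Xi> (ro n v)) = trace_mat (Z' * ro n v)" using Z' ro_carrier by blast
    then show "qf n Z' v = qf n Z v"
      using tr[OF ro_carrier] Z' trace_mult_eq_trp[of Z' n "ro n v"] by (simp add: trp_ro)
  qed (use Z Z' in auto)
qed

text \<open>For \<open>d = 1\<close> there is no state orthogonal to \<open>\<Phi>\<close>, and the value is a convention.\<close>

definition psi_perp :: "nat \<Rightarrow> complex mat" where
  "psi_perp d = (if d = 1 then ro (d * d) (phi d) else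
     complex_of_real (1 / real (d * d - 1)) \<cdot>\<^sub>m (1\<^sub>m (d * d) - ro (d * d) (phi d)))"

definition measure_prepare :: "nat \<Rightarrow> complex mat \<Rightarrow> nat \<Rightarrow> complex mat \<Rightarrow> complex mat" where
  "measure_prepare n T d X = trp n T X \<cdot>\<^sub>m ro (d * d) (phi d) + trp n (1\<^sub>m n - T) X \<cdot>\<^sub>m psi_perp d"

lemma one_minus_ro_carrier [simp]: "1\<^sub>m n - ro n v \<in> carrier_mat n n"
  by (rule minus_carrier_mat[OF ro_carrier])

lemma psi_perp_carrier [simp]: "psi_perp d \<in> carrier_mat (d * d) (d * d)"
  by (simp add: psi_perp_def)

lemma dim_psi_perp [simp]: "dim_row (psi_perp d) = d * d" "dim_col (psi_perp d) = d * d"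
  using psi_perp_carrier[of d] by (auto simp del: psi_perp_carrier)

lemma psd_psi_perp: "0 < d \<Longrightarrow> psd (d * d) (psi_perp d)"
proof -
  assume "0 < d"
  then have "psd (d * d) (1\<^sub>m (d * d) - ro (d * d) (phi d))" by (intro psd_one_minus_ro) (simp add: nrm_phi)
  then have "psd (d * d) (complex_of_real (1 / real (d * d - 1)) \<cdot>\<^sub>m (1\<^sub>m (d * d) - ro (d * d) (phi d)))"
    by (rule psd_smult) (rule divide_nonneg_nonneg[OF zero_le_one of_nat_0_le_iff])
  moreover have "psd (d * d) (ro (d * d) (phi d))" by (rule psd_ro)
  ultimately show ?thesis unfolding psi_perp_def by presburger
qed

lemma trace_psi_perp:
  assumes d: "0 < d" shows "trace_mat (psi_perp d) = 1"
proof (cases "d = 1")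
  case True
  then show ?thesis using nrm_phi[OF d] by (simp add: psi_perp_def trace_ro)
next
  case False
  then have "1 < d" using d by simp
  then have d1: "1 < d * d" using one_less_mult[of d d] by simp
  have "trace_mat (1\<^sub>m (d * d) - ro (d * d) (phi d)) = of_nat (d * d) - 1"
    unfolding trace_minus[OF one_carrier_mat ro_carrier] trace_ro nrm_phi[OF d] by simp
  also have "\<dots> = complex_of_nat (d * d - 1)" using d \<open>1 < d\<close> by (subst of_nat_diff) simp_all
  also have "\<dots> = complex_of_real (real (d * d - 1))" by (rule of_real_of_nat_eq[symmetric])
  finally have "trace_mat (1\<^sub>m (d * d) - ro (d * d) (phi d)) = complex_of_real (real (d * d - 1))" .
  then have "trace_mat (psi_perp d) = complex_of_real (1 / real (d * d - 1) * real (d * d - 1))"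
    using False unfolding psi_perp_def by (simp only: if_False trace_smult[OF one_minus_ro_carrier] of_real_mult)
  then show ?thesis using d1 by simp
qed

lemma measure_prepare_carrier [simp]: "measure_prepare n T d X \<in> carrier_mat (d * d) (d * d)"
  by (simp add: measure_prepare_def)

lemma trp_one_minus:
  assumes "T \<in> carrier_mat n n" "X \<in> carrier_mat n n"
  shows "trp n (1\<^sub>m n - T) X = trace_mat X - trp n T X"
  using assms by (simp add: trp_minus_left)

lemma channel_measure_prepare:
  assumes T: "psd n T" "psd n (1\<^sub>m n - T)" and d: "0 < d"
  shows "channel n (d * d) (measure_prepare n T d)"
  unfolding channel_def
proof (intro conjI)
  have TC: "T \<in> carrier_mat n n" "1\<^sub>m n - T \<in> carrier_mat n n" using T by (auto simp: psd_carrier)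
  show "linear_op n (d * d) (measure_prepare n T d)"
    unfolding linear_op_def
  proof (intro conjI ballI allI)
    fix X Y :: "complex mat" assume "X \<in> carrier_mat n n" "Y \<in> carrier_mat n n"
    then show "measure_prepare n T d (X + Y) = measure_prepare n T d X + measure_prepare n T d Y"
      by (intro eq_matI) (auto simp: measure_prepare_def trp_add_right algebra_simps)
  next
    fix c and X :: "complex mat" assume "X \<in> carrier_mat n n"
    then show "measure_prepare n T d (c \<cdot>\<^sub>m X) = c \<cdot>\<^sub>m measure_prepare n T d X"
      by (intro eq_matI) (auto simp: measure_prepare_def trp_smult_right algebra_simps)
  qed simp
  show "completely_positive n (d * d) (measure_prepare n T d)"
    unfolding completely_positive_def
  proof (intro allI impI)
    fix k X assume X: "psd (n * k) X"
    have "ampliation n (d * d) k (measure_prepare n T d) X =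
      ampliation n (d * d) k (\<lambda>Y. trp n T Y \<cdot>\<^sub>m ro (d * d) (phi d)) X + ampliation n (d * d) k (\<lambda>Y. trp n (1\<^sub>m n - T) Y \<cdot>\<^sub>m psi_perp d) X"
      unfolding measure_prepare_def[abs_def] by (intro ampliation_add) auto
    then show "psd (d * d * k) (ampliation n (d * d) k (measure_prepare n T d) X)"
      using ampliation_psd[OF T(1) psd_ro X] ampliation_psd[OF T(2) psd_psi_perp[OF d] X] by (simp add: psd_add)
  qed
  show "trace_preserving n (measure_prepare n T d)"
    unfolding trace_preserving_def
  proof
    fix X :: "complex mat" assume X: "X \<in> carrier_mat n n"
    have "trace_mat (measure_prepare n T d X) = trp n T X + trp n (1\<^sub>m n - T) X"
      unfolding measure_prepare_def using trace_psi_perp[OF d] nrm_phi[OF d]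
      by (simp add: trace_add[of _ "d * d"] trace_smult[OF ro_carrier] trace_smult[OF psi_perp_carrier] trace_ro)
    then show "trace_mat (measure_prepare n T d X) = trace_mat X"
      using trp_one_minus[OF TC(1) X] by simp
  qed
qed

text \<open>1 + d \<Phi> and 1 - \<Phi> are separable and span the isotropic operators. The
  coefficient x is fixed by the overlap with \<Phi>, on which 1 + d \<Phi> takes the value d + 1;
  for d > 1 the coefficient y of the other is nonnegative exactly when q \<le> 1 / d.\<close>

lemma isotropic_sepcone:
  assumes d: "0 < d" and q: "0 \<le> q" "q \<le> 1 / real d"
  shows "complex_of_real q \<cdot>\<^sub>m ro (d * d) (phi d) + complex_of_real (1 - q) \<cdot>\<^sub>m psi_perp d \<in> sepcone d d"
proof (cases "d = 1")
  case True
  have "1\<^sub>m (1 * 1) = ro (1 * 1) (phi 1)" by (intro eq_matI) (auto simp: phi_def)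
  then have "ro (d * d) (phi d) \<in> sepcone d d" using sepcone_one[of 1 1] True by simp
  then show ?thesis using q True
    by (auto simp: psi_perp_def simp del: of_real_diff intro!: sepcone_add sepcone_smult)
next
  case False
  then have "1 < d" using d by simp
  then have d1: "1 < d" "1 < d * d" using one_less_mult[of d d] by simp_all
  \<comment> \<open>w is the coefficient of 1 - \<Phi> in the given state; comparing the multiples
    of the identity forces x + y = w.\<close>
  define w where "w = (1 - q) / real (d * d - 1)"
  define x where "x = q / (real d + 1)"
  define y where "y = w - x"
  have dd: "real (d * d - 1) = (real d + 1) * (real d - 1)"
    using d1 by (simp add: of_nat_diff algebra_simps)
  have pos: "0 < real d - 1" "0 < real d + 1" using d1 by auto
  have "x = q * (real d - 1) / ((real d + 1) * (real d - 1))" using pos by (simp add: x_def)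
  then have "y = (1 - q - q * (real d - 1)) / ((real d + 1) * (real d - 1))"
    unfolding y_def w_def dd by (simp only: diff_divide_distrib)
  also have "1 - q - q * (real d - 1) = 1 - q * real d" by (simp add: algebra_simps)
  finally have "y = (1 - q * real d) / ((real d + 1) * (real d - 1))" .
  moreover have "q * real d \<le> 1" using q(2) d by (simp add: field_simps)
  ultimately have y: "0 \<le> y" using pos by simp
  have x: "0 \<le> x" using q pos by (simp add: x_def)
  have "x * (real d + 1) = q" using pos by (simp add: x_def)
  then have xq: "x * real d - y = q - w" by (simp add: y_def algebra_simps)
  have "complex_of_real q \<cdot>\<^sub>m ro (d * d) (phi d) + complex_of_real (1 - q) \<cdot>\<^sub>m psi_perp d
     = complex_of_real x \<cdot>\<^sub>m (1\<^sub>m (d * d) + complex_of_real (real d) \<cdot>\<^sub>m ro (d * d) (phi d))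
      + complex_of_real y \<cdot>\<^sub>m (1\<^sub>m (d * d) - ro (d * d) (phi d))" (is "?L = ?R")
  proof (rule eq_matI)
    fix i j assume "i < dim_row ?R" "j < dim_col ?R"
    then have ij: "i < d * d" "j < d * d" by auto
    define f where "f = ro (d * d) (phi d) $$ (i, j)"
    define e where "e = (if i = j then 1 else 0 :: complex)"
    have 1: "?L $$ (i, j) = complex_of_real q * f + complex_of_real w * (e - f)"
      using ij False by (simp add: psi_perp_def f_def e_def w_def del: index_ro)
    have 2: "?R $$ (i, j) = complex_of_real x * (e + complex_of_real (real d) * f) + complex_of_real y * (e - f)"
      using ij by (simp add: f_def e_def del: index_ro)
    have "complex_of_real (x * real d - y) = complex_of_real (q - w)" using xq by simp
    then have "complex_of_real x * complex_of_real (real d) - complex_of_real y = complex_of_real q - complex_of_real w"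
      by (simp only: of_real_mult of_real_diff)
    then have "(complex_of_real x * complex_of_real (real d) - complex_of_real y) * f = (complex_of_real q - complex_of_real w) * f"
      by (rule arg_cong)
    moreover have "complex_of_real x + complex_of_real y = complex_of_real w" by (simp add: y_def)
    then have "(complex_of_real x + complex_of_real y) * e = complex_of_real w * e" by (rule arg_cong)
    ultimately show "?L $$ (i, j) = ?R $$ (i, j)" unfolding 1 2 by (simp add: algebra_simps)
  qed (auto simp: psi_perp_def)
  then show ?thesis
    by (simp only: sepcone_add[OF sepcone_smult[OF one_plus_Phi_sepcone[OF d] x]
          sepcone_smult[OF one_minus_Phi_sepcone[OF d] y]])
qed

lemma density_one_minus_probability:
  assumes "density_op n \<sigma>" "psd n T"
  shows "trp n T \<sigma> = complex_of_real (Re (trp n T \<sigma>))" "0 \<le> Re (trp n T \<sigma>)"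
    "trp n (1\<^sub>m n - T) \<sigma> = complex_of_real (1 - Re (trp n T \<sigma>))"
proof -
  have "0 \<le> trp n T \<sigma>" using trp_psd_nonneg assms by (auto simp: density_op_def)
  then show 1: "trp n T \<sigma> = complex_of_real (Re (trp n T \<sigma>))" "0 \<le> Re (trp n T \<sigma>)"
    by (auto simp: nonneg_complex_iff)
  have "trp n (1\<^sub>m n - T) \<sigma> = 1 - trp n T \<sigma>"
    using assms by (simp add: trp_one_minus psd_carrier density_op_def)
  then show "trp n (1\<^sub>m n - T) \<sigma> = complex_of_real (1 - Re (trp n T \<sigma>))" using 1 by simp
qed

lemma robustness_sep_zero:
  assumes "\<sigma> \<in> sep_states dA dB" shows "robustness_g dA dB \<sigma> \<le> 0"
proof -
  have "complex_of_real (1 + 0) \<cdot>\<^sub>m \<sigma> - \<sigma> = 0\<^sub>m (dA * dB) (dA * dB)"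
    using sep_states_carrier[OF assms] by (intro eq_matI) auto
  then have "robust_feasible dA dB \<sigma> 0"
    unfolding robust_feasible_def loewner_le_def using assms by (intro conjI bexI[of _ \<sigma>]) (auto simp: psd_zero)
  then show ?thesis using robustness_attained(2)[OF sep_states_density[OF assms]] by blast
qed

text \<open>Forwards, a separable \<sigma> gives the isotropic state with q = tr(T \<sigma>).
  Backwards, with \<psi> = \<open>psi_perp d\<close>, the adjoint sends X to tr(X \<Phi>) T + tr(X
  \<psi>) (1 - T), and both effects lie in the cone.\<close>

lemma measure_prepare_DNE:
  assumes n: "0 < dA * dB" and d: "0 < d" and \<delta>: "0 \<le> \<delta>"
    and T: "T \<in> sepcone dA dB" "1\<^sub>m (dA * dB) - T \<in> sepcone dA dB"
    and small: "\<And>\<sigma>. \<sigma> \<in> sep_states dA dB \<Longrightarrow> Re (trp (dA * dB) T \<sigma>) \<le> 1 / real d"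
  shows "measure_prepare (dA * dB) T d \<in> DNE_g \<delta> dA dB d d"
proof -
  define n where "n = dA * dB"
  have psT: "psd n T" "psd n (1\<^sub>m n - T)" using T sepcone_psd by (auto simp: n_def)
  have TC: "T \<in> carrier_mat n n" "1\<^sub>m n - T \<in> carrier_mat n n" using psT by (auto simp: psd_carrier)
  have "robustness_g d d (measure_prepare n T d \<sigma>) \<le> \<delta>" if \<sigma>: "\<sigma> \<in> sep_states dA dB" for \<sigma>
  proof -
    note pr = density_one_minus_probability[OF sep_states_density[OF \<sigma>, folded n_def] psT(1)]
    have eq: "measure_prepare n T d \<sigma> = complex_of_real (Re (trp n T \<sigma>)) \<cdot>\<^sub>m ro (d * d) (phi d)
       + complex_of_real (1 - Re (trp n T \<sigma>)) \<cdot>\<^sub>m psi_perp d"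
      unfolding measure_prepare_def pr(3) by (subst pr(1)) (rule refl)
    have "measure_prepare n T d \<sigma> \<in> sepcone d d"
      unfolding eq using d pr(2) small[OF \<sigma>] by (intro isotropic_sepcone) (auto simp: n_def)
    moreover have "trace_mat (measure_prepare n T d \<sigma>) = 1"
      using channel_measure_prepare[OF psT d] sep_states_carrier[OF \<sigma>] \<sigma>
      by (simp add: channel_def trace_preserving_def n_def sep_states_iff)
    ultimately have "measure_prepare n T d \<sigma> \<in> sep_states d d" by (simp add: sep_states_iff)
    then show ?thesis using robustness_sep_zero \<delta> by fastforce
  qed
  moreover have "adjoint_map n (measure_prepare n T d) \<sigma> \<in> cone_of (sep_states dA dB)" if \<sigma>: "\<sigma> \<in> sep_states d d" for \<sigma>
  proof -
    define a where "a = trp (d * d) \<sigma> (ro (d * d) (phi d))"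
    define b where "b = trp (d * d) \<sigma> (psi_perp d)"
    have "0 \<le> a" "0 \<le> b"
      unfolding a_def b_def using trp_psd_nonneg[OF sep_states_psd[OF \<sigma>]] psd_ro psd_psi_perp[OF d] by blast+
    then have ab: "a = complex_of_real (Re a)" "b = complex_of_real (Re b)" "0 \<le> Re a" "0 \<le> Re b"
      by (auto simp: nonneg_complex_iff)
    have "adjoint_map n (measure_prepare n T d) \<sigma> = a \<cdot>\<^sub>m T + b \<cdot>\<^sub>m (1\<^sub>m n - T)"
    proof (rule adjoint_map_eqI[of _ "d * d"])
      fix Y :: "complex mat" assume "Y \<in> carrier_mat n n"
      show "trp (d * d) \<sigma> (measure_prepare n T d Y) = trp n (a \<cdot>\<^sub>m T + b \<cdot>\<^sub>m (1\<^sub>m n - T)) Y"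
        unfolding measure_prepare_def a_def b_def using TC
        by (simp add: trp_add_right trp_add_left trp_smult_right trp_smult_left)
    qed (use sep_states_carrier[OF \<sigma>] TC in auto)
    moreover have "complex_of_real (Re a) \<cdot>\<^sub>m T + complex_of_real (Re b) \<cdot>\<^sub>m (1\<^sub>m n - T) \<in> sepcone dA dB"
      using ab(3,4) T by (auto simp: n_def intro!: sepcone_add sepcone_smult)
    ultimately show ?thesis using ab(1,2) cone_of_sep_states[OF n] by simp
  qed
  ultimately show ?thesis
    using channel_measure_prepare[OF psT d] by (auto simp: DNE_g_def n_def)
qed

lemma mult_ro_orthogonal:
  "ro n u * (1\<^sub>m n - ro n u) = complex_of_real (1 - nrm n u) \<cdot>\<^sub>m ro n u"
  "(1\<^sub>m n - ro n u) * ro n u = complex_of_real (1 - nrm n u) \<cdot>\<^sub>m ro n u"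
proof -
  have sq: "ro n u * ro n u = complex_of_real (nrm n u) \<cdot>\<^sub>m ro n u"
  proof (rule eq_matI)
    fix i j assume "i < dim_row (complex_of_real (nrm n u) \<cdot>\<^sub>m ro n u)" "j < dim_col (complex_of_real (nrm n u) \<cdot>\<^sub>m ro n u)"
    then have ij: "i < n" "j < n" by auto
    have "(ro n u * ro n u) $$ (i, j) = (\<Sum>k<n. u i * cnj (u k) * (u k * cnj (u j)))"
      using ij by (simp add: scalar_prod_def lessThan_atLeast0)
    also have "\<dots> = u i * cnj (u j) * cip n u u"
      by (simp add: cip_def sum_distrib_left mult_ac)
    finally show "(ro n u * ro n u) $$ (i, j) = (complex_of_real (nrm n u) \<cdot>\<^sub>m ro n u) $$ (i, j)"
      using ij by (simp add: cip_self mult_ac)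
  qed auto
  have e: "ro n u - complex_of_real (nrm n u) \<cdot>\<^sub>m ro n u = complex_of_real (1 - nrm n u) \<cdot>\<^sub>m ro n u"
    by (intro eq_matI) (auto simp: algebra_simps)
  show "ro n u * (1\<^sub>m n - ro n u) = complex_of_real (1 - nrm n u) \<cdot>\<^sub>m ro n u"
    using mult_minus_distrib_mat[OF ro_carrier[of n u] one_carrier_mat[of n] ro_carrier[of n u]] by (simp add: sq e)
  show "(1\<^sub>m n - ro n u) * ro n u = complex_of_real (1 - nrm n u) \<cdot>\<^sub>m ro n u"
    using minus_mult_distrib_mat[OF one_carrier_mat[of n] ro_carrier[of n u] ro_carrier[of n u]] by (simp add: sq e)
qed

lemma trace_norm_zero: "trace_norm (0\<^sub>m n n) = 0"
proof -
  have "hermitian n (0\<^sub>m n n)" by (simp add: hermitian_def)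
  then have "abs_mat (0\<^sub>m n n) = 0\<^sub>m n n" by (rule abs_mat_eqI) (auto simp: psd_zero)
  then show ?thesis by (simp add: trace_norm_def)
qed

text \<open>With error probability p and \<psi> = \<open>psi_perp d\<close> the difference is p
  (\<psi> - \<Phi>). For d > 1 the two states are orthogonal, so its absolute value is p (\<psi> +
  \<Phi>), of trace 2 p. For d = 1 they coincide and the difference is zero.\<close>

lemma trace_norm_measure_prepare:
  assumes \<rho>: "density_op n \<rho>" and T: "psd n T" "psd n (1\<^sub>m n - T)" and d: "0 < d"
  shows "1 / 2 * trace_norm (measure_prepare n T d \<rho> - ro (d * d) (phi d)) \<le> Re (trp n (1\<^sub>m n - T) \<rho>)"
proof -
  note pr = density_one_minus_probability[OF \<rho> T(1)]
  define F where "F = ro (d * d) (phi d)"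
  define p where "p = Re (trp n (1\<^sub>m n - T) \<rho>)"
  have "0 \<le> p" using density_one_minus_probability(2)[OF \<rho> T(2)] by (simp add: p_def)
  have tp: "trp n (1\<^sub>m n - T) \<rho> = complex_of_real p" using density_one_minus_probability(1)[OF \<rho> T(2)] by (simp add: p_def)
  then have tq: "trp n T \<rho> = complex_of_real (1 - p)" using pr(1,3) by (simp add: p_def)
  have FC: "F \<in> carrier_mat (d * d) (d * d)" by (simp add: F_def)
  have diff: "measure_prepare n T d \<rho> - F = complex_of_real p \<cdot>\<^sub>m (psi_perp d - F)"
    unfolding measure_prepare_def tp tq F_def[symmetric]
    using FC psi_perp_carrier[of d] by (intro eq_matI) (auto simp: algebra_simps simp del: psi_perp_carrier)
  show ?thesis
  proof (cases "d = 1")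
    case True
    then have "measure_prepare n T d \<rho> - F = 0\<^sub>m (d * d) (d * d)"
      unfolding diff by (intro eq_matI) (auto simp: psi_perp_def F_def)
    then show ?thesis using \<open>0 \<le> p\<close> by (simp add: trace_norm_zero F_def p_def)
  next
    case False
    define c where "c = 1 / real (d * d - 1)"
    define Q where "Q = 1\<^sub>m (d * d) - F"
    have QC: "Q \<in> carrier_mat (d * d) (d * d)" by (simp add: Q_def F_def)
    have G: "psi_perp d = complex_of_real c \<cdot>\<^sub>m Q" using False by (simp add: psi_perp_def c_def Q_def F_def)
    have z: "F * Q = 0\<^sub>m (d * d) (d * d)" "Q * F = 0\<^sub>m (d * d) (d * d)"
      unfolding F_def Q_def mult_ro_orthogonal nrm_phi[OF d] by (intro eq_matI; auto)+
    define S where "S = psi_perp d"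
    have SC: "S \<in> carrier_mat (d * d) (d * d)" by (simp add: S_def)
    have zS: "F * S = 0\<^sub>m (d * d) (d * d)" "S * F = 0\<^sub>m (d * d) (d * d)"
      unfolding S_def G using z FC QC by (auto simp: mult_smult_distrib[OF FC QC] mult_smult_assoc_mat[OF QC FC] intro!: eq_matI)
    have hS: "hermitian (d * d) S" "hermitian (d * d) F"
      using psd_hermitian[OF psd_psi_perp[OF d]] psd_hermitian[OF psd_ro] by (simp_all add: S_def F_def)
    define X where "X = complex_of_real p \<cdot>\<^sub>m (S - F)"
    define P where "P = complex_of_real p \<cdot>\<^sub>m (S + F)"
    have hX: "hermitian (d * d) X"
      using hermitianD[OF hS(1)] hermitianD[OF hS(2)] SC FC by (auto simp: hermitian_def X_def)
    have psP: "psd (d * d) P"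
      unfolding P_def S_def F_def using \<open>0 \<le> p\<close> by (intro psd_smult psd_add psd_psi_perp[OF d] psd_ro)
    \<comment> \<open>The two squares differ in the cross terms only, and these vanish by
      orthogonality.\<close>
    have sq: "(S - F) * (S - F) = (S + F) * (S + F)"
    proof -
      have "(S - F) * (S - F) = (S * S - F * S) - (S * F - F * F)"
        unfolding mult_minus_distrib_mat[OF minus_carrier_mat[OF FC] SC FC]
          minus_mult_distrib_mat[OF SC FC SC] minus_mult_distrib_mat[OF SC FC FC] ..
      moreover have "(S + F) * (S + F) = (S * S + F * S) + (S * F + F * F)"
        unfolding mult_add_distrib_mat[OF add_carrier_mat[OF FC] SC FC]
          add_mult_distrib_mat[OF SC FC SC] add_mult_distrib_mat[OF SC FC FC] ..
      moreover have "S * S \<in> carrier_mat (d * d) (d * d)" "F * F \<in> carrier_mat (d * d) (d * d)"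
        using SC FC by auto
      moreover have "(A - 0\<^sub>m N N) - (0\<^sub>m N N - B) = (A + 0\<^sub>m N N) + (0\<^sub>m N N + B)"
        if "A \<in> carrier_mat N N" "B \<in> carrier_mat N N" for A B :: "complex mat" and N
        using that by (intro eq_matI) auto
      ultimately show ?thesis unfolding zS by metis
    qed
    have "P * P = X * X"
    proof -
      have C: "S - F \<in> carrier_mat (d * d) (d * d)" "S + F \<in> carrier_mat (d * d) (d * d)"
        using SC FC by (auto simp: minus_carrier_mat)
      show ?thesis unfolding P_def X_def
        using sq C by (simp add: mult_smult_distrib[of _ "d * d" "d * d" _ "d * d"] mult_smult_assoc_mat[of _ "d * d" "d * d" _ "d * d"])
    qed
    with abs_mat_eqI[OF hX psP] have "abs_mat X = P" by blast
    then have "trace_norm X = 2 * p"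
      unfolding trace_norm_def P_def using SC FC trace_psi_perp[OF d] nrm_phi[OF d]
      by (simp add: trace_smult[of _ "d * d"] trace_add[of _ "d * d"] S_def F_def trace_ro)
    then show ?thesis using diff by (simp add: X_def S_def F_def p_def)
  qed
qed

section \<open>One-shot bounds\<close>

definition mat_unit :: "nat \<Rightarrow> nat \<Rightarrow> nat \<Rightarrow> complex mat" where
  "mat_unit n i j = mat n n (\<lambda>(r, s). if r = i \<and> s = j then 1 else 0)"

lemma linear_op_mat_sum:
  assumes "linear_op n m \<Xi>" "\<And>x. x < k \<Longrightarrow> F x \<in> carrier_mat n n"
  shows "\<Xi> (mat_sum n k F) = mat_sum m k (\<lambda>x. \<Xi> (F x))"
  using assms(2)
proof (induction k)
  case 0
  have "\<Xi> (0\<^sub>m n n) \<in> carrier_mat m m" using assms(1) by (simp add: linear_op_def)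
  moreover have "0 \<cdot>\<^sub>m 0\<^sub>m n n = (0\<^sub>m n n :: complex mat)" by (intro eq_matI) auto
  then have "\<Xi> (0\<^sub>m n n) = 0 \<cdot>\<^sub>m \<Xi> (0\<^sub>m n n)"
    using assms(1) unfolding linear_op_def by (metis zero_carrier_mat)
  moreover have "0 \<cdot>\<^sub>m W = 0\<^sub>m m m" if "W \<in> carrier_mat m m" for W :: "complex mat"
    using that by (intro eq_matI) auto
  ultimately have "\<Xi> (0\<^sub>m n n) = 0\<^sub>m m m" by (rule_tac trans) blast+
  then show ?case by simp
next
  case (Suc k)
  have F: "F k \<in> carrier_mat n n" using Suc.prems by simp
  then have "\<Xi> (F k) \<in> carrier_mat m m" using assms(1) by (simp add: linear_op_def)
  then show ?case
    using Suc F assms(1) by (simp add: mat_sum_Suc linear_op_def)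
qed

lemma adjoint_map_exists:
  assumes lin: "linear_op n N \<Xi>" and X: "X \<in> carrier_mat N N"
  shows "adjoint_map n \<Xi> X \<in> carrier_mat n n"
    and "Y \<in> carrier_mat n n \<Longrightarrow> trp N X (\<Xi> Y) = trp n (adjoint_map n \<Xi> X) Y"
proof -
  \<comment> \<open>Entry (i, j) is read off on the matrix unit (j, i), since tr(Z Y) pairs
    transposed positions.\<close>
  define Z where "Z = mat n n (\<lambda>(i, j). trp N X (\<Xi> (mat_unit n j i)))"
  have car: "\<Xi> Y \<in> carrier_mat N N" if "Y \<in> carrier_mat n n" for Y
    using lin that by (simp add: linear_op_def)
  have U: "mat_unit n i j \<in> carrier_mat n n" for i j by (simp add: mat_unit_def)
  have eq: "trp N X (\<Xi> Y) = trp n Z Y" if Y: "Y \<in> carrier_mat n n" for Y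
  proof -
    define F where "F y = Y $$ (y div n, y mod n) \<cdot>\<^sub>m mat_unit n (y div n) (y mod n)" for y
    have F: "F y \<in> carrier_mat n n" for y by (simp add: F_def U)
    have "Y = mat_sum n (n * n) F"
    proof (rule eq_matI)
      fix i j assume "i < dim_row (mat_sum n (n * n) F)" "j < dim_col (mat_sum n (n * n) F)"
      then have ij: "i < n" "j < n" by auto
      have "(\<Sum>y<n * n. F y $$ (i, j)) = (\<Sum>a<n. \<Sum>b<n. if a = i then (if b = j then Y $$ (a, b) else 0) else 0)"
        unfolding sum_divmod using ij by (intro sum.cong refl) (auto simp: F_def mat_unit_def)
      also have "\<dots> = (\<Sum>a<n. if a = i then Y $$ (a, j) else 0)" using ij by (intro sum.cong) auto
      also have "\<dots> = Y $$ (i, j)" using ij by simp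
      finally show "Y $$ (i, j) = mat_sum n (n * n) F $$ (i, j)" using ij by simp
    qed (use Y in auto)
    then have "\<Xi> Y = \<Xi> (mat_sum n (n * n) F)" by (rule arg_cong)
    also have "\<dots> = mat_sum N (n * n) (\<lambda>y. \<Xi> (F y))" by (rule linear_op_mat_sum[OF lin F])
    finally have "trp N X (\<Xi> Y) = (\<Sum>y<n * n. trp N X (\<Xi> (F y)))" by (simp add: trp_mat_sum_right)
    also have "\<dots> = (\<Sum>y<n * n. Y $$ (y div n, y mod n) * trp N X (\<Xi> (mat_unit n (y div n) (y mod n))))"
    proof (intro sum.cong refl)
      fix y
      have "\<Xi> (F y) = Y $$ (y div n, y mod n) \<cdot>\<^sub>m \<Xi> (mat_unit n (y div n) (y mod n))"
        using lin U by (simp add: F_def linear_op_def)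
      then show "trp N X (\<Xi> (F y)) = Y $$ (y div n, y mod n) * trp N X (\<Xi> (mat_unit n (y div n) (y mod n)))"
        using car[OF U] by (simp add: trp_smult_right)
    qed
    also have "\<dots> = (\<Sum>a<n. \<Sum>b<n. Y $$ (a, b) * trp N X (\<Xi> (mat_unit n a b)))"
      unfolding sum_divmod by (intro sum.cong refl) simp
    also have "\<dots> = trp n Y Z" by (simp add: trp_def Z_def)
    finally show ?thesis by (simp add: trp_commute)
  qed
  have "adjoint_map n \<Xi> X = Z"
    by (rule adjoint_map_eqI[OF X car _ eq]) (auto simp: Z_def)
  then show "adjoint_map n \<Xi> X \<in> carrier_mat n n"
    and "Y \<in> carrier_mat n n \<Longrightarrow> trp N X (\<Xi> Y) = trp n (adjoint_map n \<Xi> X) Y"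
    using eq by (auto simp: Z_def)
qed

lemma channel_density:
  assumes "channel n m \<Xi>" "density_op n \<rho>" shows "density_op m (\<Xi> \<rho>)"
proof -
  have \<rho>: "\<rho> \<in> carrier_mat n n" "psd n \<rho>" using assms(2) by (auto simp: density_op_def psd_carrier)
  have "\<Xi> \<rho> \<in> carrier_mat m m" using assms(1) \<rho> by (simp add: channel_def linear_op_def)
  moreover have "mat n n (\<lambda>(i, j). \<rho> $$ (i, j)) = \<rho>" using \<rho> by (intro eq_matI) auto
  ultimately have "ampliation n m 1 \<Xi> \<rho> = \<Xi> \<rho>"
    unfolding ampliation_def by (intro eq_matI) auto
  moreover have "psd (m * 1) (ampliation n m 1 \<Xi> \<rho>)"
  proof -
    have "psd (n * 1) \<rho>" using \<rho>(2) by simp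
    then show ?thesis using assms(1) unfolding channel_def completely_positive_def by blast
  qed
  ultimately show ?thesis
    using assms \<rho> by (simp add: density_op_def channel_def trace_preserving_def)
qed

lemma D_SEP_S_nonneg:
  assumes \<rho>: "density_op (dA * dB) \<rho>" shows "0 \<le> D_SEP_S dA dB \<rho>"
  unfolding D_SEP_S_def
proof (rule INF_greatest)
  fix \<sigma> assume \<sigma>: "\<sigma> \<in> sep_states dA dB"
  have m: "mat_sum (dA * dB) (Suc 0) (\<lambda>_. 1\<^sub>m (dA * dB)) = 1\<^sub>m (dA * dB)" by (intro eq_matI) auto
  then have "(Suc 0, \<lambda>_. 1\<^sub>m (dA * dB), \<lambda>_. 1) \<in> WM dA dB" by (simp add: WM_def sepcone_one)
  from D_SEP_ge_gain[OF \<rho> \<sigma> this]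
  show "0 \<le> D_SEP dA dB \<rho> \<sigma>"
    using \<sigma> sep_states_carrier[OF \<sigma>] by (simp add: gain_def sep_states_iff zero_ereal_def)
qed

text \<open>For the maximally mixed \<sigma>, tr(\<rho> E) \<le> tr E = n tr(\<sigma> E), so every
  likelihood ratio is at most n. Finiteness of the entropy makes \<open>rate\<close> faithful and
  \<open>achievable\<close> finite.\<close>

lemma D_SEP_S_le:
  assumes \<rho>: "density_op (dA * dB) \<rho>" shows "D_SEP_S dA dB \<rho> \<le> ereal (log 2 (real (dA * dB)))"
proof -
  define n where "n = dA * dB"
  have n: "0 < n" using density_dim_pos[OF \<rho>] by (simp add: n_def)
  have \<rho>': "psd n \<rho>" "trace_mat \<rho> = 1" "\<rho> \<in> carrier_mat n n"
    using \<rho> by (auto simp: density_op_def n_def psd_carrier)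
  define \<sigma> where "\<sigma> = complex_of_real (1 / real n) \<cdot>\<^sub>m 1\<^sub>m n"
  have \<sigma>: "\<sigma> \<in> sep_states dA dB" using sep_states_mixed n by (simp add: \<sigma>_def n_def)
  have co: "psd n (1\<^sub>m n - \<rho>)"
  proof -
    have "loewner_le n \<rho> (1\<^sub>m n)"
      using loewner_le_iff[OF \<rho>'(1) psd_one] qf_le_trace[OF \<rho>'(1)] \<rho>'(2) by simp
    then show ?thesis by (simp add: loewner_le_def)
  qed
  have "D_SEP dA dB \<rho> \<sigma> \<le> ereal (log 2 (real n))"
    unfolding D_SEP_def
  proof (rule SUP_least)
    fix kE assume "kE \<in> SEP dA dB"
    then obtain k E where kE: "kE = (k, E)" "(k, E) \<in> SEP dA dB" by (cases kE) auto
    then have E: "\<forall>x<k. E x \<in> sepcone dA dB" "mat_sum (dA * dB) k E = 1\<^sub>m (dA * dB)"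
      using SEP_iff n unfolding n_def by blast+
    note p = measurement_probabilities[OF E \<rho>] and q = measurement_probabilities[OF E sep_states_density[OF \<sigma>]]
    have EC: "E x \<in> carrier_mat n n" if "x < k" for x using E(1) that sepcone_carrier by (auto simp: n_def)
    have le: "rel_entr_term (Re (trace_mat (\<rho> * E x))) (Re (trace_mat (\<sigma> * E x))) \<le> ereal (Re (trp n \<rho> (E x)) * log 2 (real n))"
      if x: "x < k" for x
    proof -
      define a where "a = Re (trp n \<rho> (E x))"
      define b where "b = Re (trp n \<sigma> (E x))"
      have ab: "0 \<le> a" "0 \<le> b" using p(1)[OF x] q(1)[OF x] by (auto simp: a_def b_def n_def)
      have "0 \<le> trp n (1\<^sub>m n - \<rho>) (E x)" using trp_psd_nonneg[OF co] E(1) x sepcone_psd by (auto simp: n_def)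
      then have "a \<le> Re (trace_mat (E x))"
        using \<rho>'(3) EC[OF x] by (simp add: trp_minus_left a_def less_eq_complex_def)
      moreover have "Re (trace_mat (E x)) = real n * b"
        unfolding b_def \<sigma>_def trp_smult_left[OF one_carrier_mat] using n EC[OF x] by simp
      ultimately have abn: "a \<le> real n * b" by simp
      have "rel_entr_term a b \<le> ereal (a * log 2 (real n))"
      proof (cases "a = 0")
        case False
        then have "0 < a" using ab by simp
        then have "0 < b" using abn ab n by (cases "b = 0") auto
        then have "log 2 (a / b) \<le> log 2 (real n)"
          using abn \<open>0 < a\<close> n by (subst log_le_cancel_iff) (auto simp: field_simps)
        then show ?thesis using \<open>0 < a\<close> \<open>0 < b\<close> by (simp add: rel_entr_term_def)
      qed (simp add: rel_entr_term_def)
      then show ?thesis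
        using EC[OF x] \<rho>'(3) sep_states_carrier[OF \<sigma>] by (simp add: trace_mult_eq_trp[of _ n] a_def b_def n_def)
    qed
    have "(\<Sum>x<k. rel_entr_term (Re (trace_mat (\<rho> * E x))) (Re (trace_mat (\<sigma> * E x))))
       \<le> (\<Sum>x<k. ereal (Re (trp n \<rho> (E x)) * log 2 (real n)))"
      using le by (intro sum_mono) auto
    also have "\<dots> = ereal (log 2 (real n))"
      using p(2) by (simp add: n_def flip: sum_distrib_right)
    finally show "(case kE of (k, E) \<Rightarrow> \<Sum>x<k. rel_entr_term (Re (trace_mat (\<rho> * E x))) (Re (trace_mat (\<sigma> * E x))))
       \<le> ereal (log 2 (real n))" by (simp add: kE)
  qed
  then show ?thesis using \<sigma> unfolding D_SEP_S_def n_def by (metis INF_lower order_trans)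
qed

text \<open>The adjoint of a dually non-entangling map pulls the two-outcome separable measurement
  \<open>{(1 + d \<Phi>) / (d + 1), d (1 - \<Phi>) / (d + 1)}\<close> back to a separable measurement.\<close>

lemma DNE_converse:
  assumes \<rho>: "density_op (dA * dB) \<rho>" and \<Theta>: "\<Theta> \<in> DNE_g \<delta> dA dB d d" and d: "0 < d" and \<delta>: "0 \<le> \<delta>"
    and e: "1 / 2 * trace_norm (\<Theta> \<rho> - ro (d * d) (phi d)) \<le> e"
  shows "ereal ((1 - e) * log 2 (real d) - (2 + log 2 (1 + \<delta>))) \<le> D_SEP_S dA dB \<rho>"
proof -
  define n where "n = dA * dB"
  define N where "N = d * d"
  define F where "F = ro N (phi d)"
  have n: "0 < n" using density_dim_pos[OF \<rho>] by (simp add: n_def)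
  have FC: "F \<in> carrier_mat N N" and QC: "1\<^sub>m N - F \<in> carrier_mat N N" by (simp_all add: F_def)
  have psF: "psd N F" "psd N (1\<^sub>m N - F)"
    unfolding F_def N_def by (auto intro!: psd_ro psd_one_minus_ro simp: nrm_phi[OF d])
  have ch: "channel n N \<Theta>" and rob: "\<And>\<sigma>. \<sigma> \<in> sep_states dA dB \<Longrightarrow> robustness_g d d (\<Theta> \<sigma>) \<le> \<delta>"
    and adj: "\<And>X. X \<in> sep_states d d \<Longrightarrow> adjoint_map n \<Theta> X \<in> cone_of (sep_states dA dB)"
    using \<Theta> by (auto simp: DNE_g_def n_def N_def)
  have lin: "linear_op n N \<Theta>" and tp: "\<And>X. X \<in> carrier_mat n n \<Longrightarrow> trace_mat (\<Theta> X) = trace_mat X"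
    using ch by (auto simp: channel_def trace_preserving_def)
  have \<Theta>C: "\<Theta> X \<in> carrier_mat N N" if "X \<in> carrier_mat n n" for X using lin that by (simp add: linear_op_def)
  note \<Theta>\<rho> = channel_density[OF ch \<rho>[folded n_def]]
  have \<Theta>\<rho>C: "\<Theta> \<rho> \<in> carrier_mat N N" using \<Theta>\<rho> by (simp add: density_op_def psd_carrier)
  have trF: "trace_mat F = 1" using nrm_phi[OF d] by (simp add: F_def trace_ro N_def)
  have FF: "trp N F F = 1"
    using nrm_phi[OF d] unfolding F_def trp_ro by (simp add: qf_ro cip_self N_def)
  define t where "t = 1 / 2 * trace_norm (\<Theta> \<rho> - F)"
  have hX: "hermitian N (\<Theta> \<rho> - F)"
  proof -
    have "hermitian N (\<Theta> \<rho>)" "hermitian N F" using \<Theta>\<rho> psF psd_hermitian by (auto simp: density_op_def)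
    note h = hermitianD[OF this(1)] hermitianD[OF this(2)]
    show ?thesis using h \<Theta>\<rho>C FC by (auto simp: hermitian_def)
  qed
  have t: "0 \<le> t" "t \<le> e" using trace_norm_nonneg[OF hX] e by (auto simp: t_def F_def N_def)
  have "trace_mat (\<Theta> \<rho> - F) = 0" using \<Theta>\<rho> \<Theta>\<rho>C FC trF by (simp add: trace_minus[of _ N] density_op_def)
  from trp_ge_neg_trace_norm[OF hX this psF]
  have f: "1 - t \<le> Re (trp N F (\<Theta> \<rho>))"
    using \<Theta>\<rho>C FC FF by (simp add: trp_minus_right t_def)
  \<comment> \<open>\<Theta> \<sigma> lies below 1 + r times a separable state with r \<le>
    \<delta>, and that state has overlap at most 1 / d with \<Phi>.\<close>
  have q: "Re (trp N F (\<Theta> \<sigma>)) \<le> (1 + \<delta>) / real d" if \<sigma>: "\<sigma> \<in> sep_states dA dB" for \<sigma>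
  proof -
    note ds = channel_density[OF ch sep_states_density[OF \<sigma>, folded n_def]]
    have ds': "density_op (d * d) (\<Theta> \<sigma>)" using ds by (simp add: N_def)
    obtain \<sigma>' where r: "0 \<le> robustness_g d d (\<Theta> \<sigma>)" and \<sigma>': "\<sigma>' \<in> sep_states d d"
      and le: "loewner_le N (\<Theta> \<sigma>) (complex_of_real (1 + robustness_g d d (\<Theta> \<sigma>)) \<cdot>\<^sub>m \<sigma>')"
      using robustness_attained(1)[OF ds'] unfolding robust_feasible_def N_def by blast
    define r where "r = robustness_g d d (\<Theta> \<sigma>)"
    have r0: "0 \<le> r" "r \<le> \<delta>" using r rob[OF \<sigma>] by (auto simp: r_def)
    have s'C: "\<sigma>' \<in> carrier_mat N N" using sep_states_carrier[OF \<sigma>'] by (simp add: N_def)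
    have le': "Re (qf N (\<Theta> \<sigma>) (phi d)) \<le> (1 + r) * Re (qf N \<sigma>' (phi d))"
    proof -
      have "psd N (\<Theta> \<sigma>)" using ds by (simp add: density_op_def)
      moreover have "psd N (complex_of_real (1 + r) \<cdot>\<^sub>m \<sigma>')"
        using sep_states_psd[OF \<sigma>'] r0 by (intro psd_smult) (auto simp: N_def)
      ultimately have "Re (qf N (\<Theta> \<sigma>) (phi d)) \<le> Re (qf N (complex_of_real (1 + r) \<cdot>\<^sub>m \<sigma>') (phi d))"
        using le loewner_le_iff unfolding r_def by blast
      then show ?thesis using s'C by (simp add: qf_smult del: of_real_add)
    qed
    have "Re (trp N \<sigma>' F) \<le> 1 / real d * Re (trace_mat \<sigma>')"
      unfolding N_def F_def using qf_phi_pv[OF d] \<sigma>' by (intro sepcone_trp_le) (auto simp: sep_states_iff)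
    then have "Re (qf N \<sigma>' (phi d)) \<le> 1 / real d" using \<sigma>' by (simp add: F_def trp_ro sep_states_iff)
    then have "(1 + r) * Re (qf N \<sigma>' (phi d)) \<le> (1 + r) * (1 / real d)"
      using r0 by (intro mult_left_mono) auto
    also have "\<dots> \<le> (1 + \<delta>) * (1 / real d)" using r0 by (intro mult_right_mono) auto
    finally show ?thesis using le' unfolding F_def trp_commute[of N "ro N (phi d)"] trp_ro by simp
  qed
  \<comment> \<open>Normalised so that the two effects sum to 1 and \<Phi> gives the first outcome
    with certainty: c1 (1 + d) = 1 and c2 = c1 d.\<close>
  define c1 where "c1 = 1 / (real d + 1)"
  define c2 where "c2 = real d / (real d + 1)"
  define F1 where "F1 = complex_of_real c1 \<cdot>\<^sub>m (1\<^sub>m N + complex_of_real (real d) \<cdot>\<^sub>m F)"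
  define F2 where "F2 = complex_of_real c2 \<cdot>\<^sub>m (1\<^sub>m N - F)"
  have F12: "F1 \<in> sepcone d d" "F2 \<in> sepcone d d"
    unfolding F1_def F2_def F_def N_def using one_plus_Phi_sepcone[OF d] one_minus_Phi_sepcone[OF d]
    by (simp_all add: sepcone_smult c1_def c2_def del: of_real_divide)
  have F12C: "F1 \<in> carrier_mat N N" "F2 \<in> carrier_mat N N" using FC QC by (auto simp: F1_def F2_def)
  have val: "Re (trp N F1 Y) = c1 * (Re (trace_mat Y) + real d * Re (trp N F Y))"
    "Re (trp N F2 Y) = c2 * (Re (trace_mat Y) - Re (trp N F Y))" if "Y \<in> carrier_mat N N" for Y
    unfolding F1_def F2_def using that FC QC
    by (simp_all add: trp_smult_left trp_add_left trp_minus_left del: of_real_of_nat_eq of_real_divide)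
  have cc: "c1 + c2 = 1" "c1 * real d = c2" "0 < c1" "0 \<le> c2"
    using d by (auto simp: c1_def c2_def field_simps)
  \<comment> \<open>The hypothesis on the adjoint speaks of states; homogeneity extends it to the
    cone.\<close>
  have pull: "adjoint_map n \<Theta> X \<in> sepcone dA dB" if X: "X \<in> sepcone d d" for X
  proof -
    obtain c \<sigma> where c: "0 \<le> c" "\<sigma> \<in> sep_states d d" "X = complex_of_real c \<cdot>\<^sub>m \<sigma>"
      using X cone_of_sep_states[of d d] d unfolding cone_of_def by force
    have sC: "\<sigma> \<in> carrier_mat N N" using sep_states_carrier[OF c(2)] by (simp add: N_def)
    have "adjoint_map n \<Theta> X = complex_of_real c \<cdot>\<^sub>m adjoint_map n \<Theta> \<sigma>"
    proof (rule adjoint_map_eqI[of _ N])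
      fix Y :: "complex mat" assume Y: "Y \<in> carrier_mat n n"
      show "trp N X (\<Theta> Y) = trp n (complex_of_real c \<cdot>\<^sub>m adjoint_map n \<Theta> \<sigma>) Y"
        using adjoint_map_exists[OF lin sC] Y sC by (simp add: c(3) trp_smult_left)
    qed (use c sC \<Theta>C adjoint_map_exists(1)[OF lin sC] in auto)
    then show ?thesis using adj[OF c(2)] c(1) cone_of_sep_states[of dA dB] n
      by (simp add: sepcone_smult n_def)
  qed
  define E where "E x = adjoint_map n \<Theta> (if x = 0 then F1 else F2)" for x :: nat
  note A1 = adjoint_map_exists[OF lin F12C(1)] and A2 = adjoint_map_exists[OF lin F12C(2)]
  have sumE: "mat_sum n 2 E = 1\<^sub>m n"
  proof (rule qf_eq_imp_eq[of _ n])
    fix v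
    have "qf n (mat_sum n 2 E) v = trp n (adjoint_map n \<Theta> F1) (ro n v) + trp n (adjoint_map n \<Theta> F2) (ro n v)"
      by (simp add: qf_mat_sum numeral_2_eq_2 E_def trp_ro)
    also have "\<dots> = trp N F1 (\<Theta> (ro n v)) + trp N F2 (\<Theta> (ro n v))"
      using A1(2)[OF ro_carrier] A2(2)[OF ro_carrier] by simp
    also have "\<dots> = trp N (F1 + F2) (\<Theta> (ro n v))" using F12C by (simp add: trp_add_left)
    also have "F1 + F2 = 1\<^sub>m N"
    proof (rule eq_matI)
      fix i j assume "i < dim_row (1\<^sub>m N :: complex mat)" "j < dim_col (1\<^sub>m N :: complex mat)"
      then have ij: "i < N" "j < N" by auto
      define g where "g = F $$ (i, j)"
      define o1 where "o1 = (if i = j then 1 else 0 :: complex)"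
      have "(F1 + F2) $$ (i, j) = complex_of_real c1 * (o1 + complex_of_real (real d) * g) + complex_of_real c2 * (o1 - g)"
        using ij FC QC by (simp add: F1_def F2_def g_def o1_def)
      also have "\<dots> = complex_of_real (c1 + c2) * o1 + complex_of_real (c1 * real d - c2) * g"
        by (simp add: algebra_simps)
      also have "\<dots> = o1" using cc by simp
      finally show "(F1 + F2) $$ (i, j) = 1\<^sub>m N $$ (i, j)" using ij by (simp add: o1_def)
    qed (use F12C in auto)
    also have "trp N (1\<^sub>m N) (\<Theta> (ro n v)) = trace_mat (ro n v)"
      using \<Theta>C[OF ro_carrier] tp[OF ro_carrier] by simp
    finally show "qf n (mat_sum n 2 E) v = qf n (1\<^sub>m n) v" by (simp add: trace_ro)
  qed auto
  \<comment> \<open>The overlap bound gives tr(\<sigma> E_0) \<le> 2 (1 + \<delta>) / (d + 1), so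
    with these weights each outcome subtracts at most 1/2 in \<open>gain\<close>, and together they
    are covered by its summand 1.\<close>
  define c where "c x = (if x = 0 then (real d + 1) / (4 * (1 + \<delta>)) else 1 / 2)" for x :: nat
  have "E x \<in> sepcone dA dB" for x using pull F12 by (simp add: E_def)
  moreover have "0 < c x" for x using \<delta> by (simp add: c_def add_pos_nonneg)
  ultimately have WM: "(2, E, c) \<in> WM dA dB" using sumE by (simp add: WM_def n_def)
  define p0 where "p0 = Re (trp n \<rho> (E 0))"
  have \<rho>C: "\<rho> \<in> carrier_mat n n" using \<rho> by (simp add: density_op_def psd_carrier n_def)
  note pr = measurement_probabilities[of 2 E dA dB, OF _ sumE[unfolded n_def] \<rho>]
  have pr': "0 \<le> Re (trp n \<rho> (E 1))" "Re (trp n \<rho> (E 0)) + Re (trp n \<rho> (E 1)) = 1"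
    using pr(1)[of 1] pr(2) \<open>\<And>x. E x \<in> sepcone dA dB\<close> by (auto simp: n_def numeral_2_eq_2)
  \<comment> \<open>The deficit is c2 t, since only a fraction c2 of the complement of \<Phi>
    triggers the second outcome.\<close>
  have p0: "1 - e \<le> p0"
  proof -
    have "p0 = c1 * (1 + real d * Re (trp N F (\<Theta> \<rho>)))"
      using val(1)[OF \<Theta>\<rho>C] A1(2)[OF \<rho>C] \<Theta>\<rho> by (simp add: p0_def E_def trp_commute[of n \<rho>] density_op_def)
    also have "\<dots> \<ge> c1 * (1 + real d * (1 - t))"
      using f cc by (intro mult_left_mono add_left_mono) auto
    finally have "c1 * (1 + real d * (1 - t)) \<le> p0" .
    moreover have "c1 * (1 + real d * (1 - t)) = (c1 + c1 * real d) - c1 * real d * t" by (simp add: algebra_simps)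
    moreover have "c2 * t \<le> 1 * t" using cc t by (intro mult_right_mono) auto
    ultimately show ?thesis using cc t by simp
  qed
  \<comment> \<open>K = ln(4 (1 + \<delta>)) is what the first log-weight may lose against ln d. The
    second log-weight is -ln 2 \<ge> -K, so averaging over both outcomes costs K in total.\<close>
  define K where "K = 2 * ln 2 + ln (1 + \<delta>)"
  have lnd: "0 \<le> ln (1 + \<delta>)" using \<delta> by simp
  have K: "ln 2 \<le> K" using lnd ln_gt_zero[of 2] by (simp add: K_def)
  have main: "(1 - e) * ln (real d) - K \<le> gain n \<rho> (2, E, c) \<sigma>" if \<sigma>: "\<sigma> \<in> sep_states dA dB" for \<sigma>
  proof -
    have sC: "\<sigma> \<in> carrier_mat n n" using sep_states_carrier[OF \<sigma>] by (simp add: n_def)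
    have tr\<sigma>: "trace_mat (\<Theta> \<sigma>) = 1" using tp[OF sC] \<sigma> by (simp add: sep_states_iff)
    have q0: "Re (trp n \<sigma> (E 0)) \<le> c1 * (2 * (1 + \<delta>))"
    proof -
      have "Re (trp n \<sigma> (E 0)) = c1 * (1 + real d * Re (trp N F (\<Theta> \<sigma>)))"
        using val(1)[OF \<Theta>C[OF sC]] A1(2)[OF sC] tr\<sigma> by (simp add: E_def trp_commute[of n \<sigma>])
      also have "real d * Re (trp N F (\<Theta> \<sigma>)) \<le> 1 + \<delta>"
        using q[OF \<sigma>] d by (simp add: field_simps)
      then have "c1 * (1 + real d * Re (trp N F (\<Theta> \<sigma>))) \<le> c1 * (2 * (1 + \<delta>))"
        using cc \<delta> by (intro mult_left_mono) auto
      finally show ?thesis .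
    qed
    have "c 0 * Re (trp n \<sigma> (E 0)) \<le> c 0 * (c1 * (2 * (1 + \<delta>)))"
      using q0 \<delta> by (intro mult_left_mono) (auto simp: c_def)
    also have "\<dots> = 1 / 2"
    proof -
      have "real d + 1 \<noteq> 0" "1 + \<delta> \<noteq> 0" using \<delta> by auto
      moreover have "x / (4 * y) * (1 / x * (2 * y)) = 1 / 2" if "x \<noteq> 0" "y \<noteq> 0" for x y :: real
        using that by (simp add: field_simps)
      ultimately show ?thesis by (simp only: c_def c1_def if_True refl)
    qed
    finally have a0: "c 0 * Re (trp n \<sigma> (E 0)) \<le> 1 / 2" .
    note sq = measurement_probabilities[of 2 E dA dB, OF _ sumE[unfolded n_def] sep_states_density[OF \<sigma>]]
    have "Re (trp n \<sigma> (E 1)) \<le> 1"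
      using sq(1)[of 0] sq(2) \<open>\<And>x. E x \<in> sepcone dA dB\<close> by (auto simp: n_def numeral_2_eq_2)
    then have a1: "c 1 * Re (trp n \<sigma> (E 1)) \<le> 1 / 2" by (simp add: c_def)
    have "ln (real d) - K \<le> ln (c 0)"
    proof -
      have "ln (c 0) = ln (real d + 1) - ln (4 * (1 + \<delta>))" unfolding c_def using \<delta> d by (simp add: ln_div)
      moreover have "ln (4 * (1 + \<delta>)) = ln 4 + ln (1 + \<delta>)" using \<delta> by (intro ln_mult_pos) auto
      moreover have "ln (4 :: real) = 2 * ln 2" using ln_realpow[of 2 2] by simp
      moreover have "ln (real d) \<le> ln (real d + 1)" using d by simp
      ultimately show ?thesis by (simp add: K_def)
    qed
    then have "p0 * (ln (real d) - K) \<le> p0 * ln (c 0)"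
      using pr(1)[of 0] \<open>\<And>x. E x \<in> sepcone dA dB\<close> by (intro mult_left_mono) (auto simp: p0_def n_def)
    moreover have "(1 - e) * ln (real d) \<le> p0 * ln (real d)" using p0 d by (intro mult_right_mono) auto
    moreover have "Re (trp n \<rho> (E 1)) * ln 2 \<le> Re (trp n \<rho> (E 1)) * K" using K pr'(1) by (intro mult_left_mono) auto
    moreover have "p0 * K + Re (trp n \<rho> (E 1)) * K = K" using pr'(2) by (simp add: p0_def flip: distrib_right)
    ultimately have "(1 - e) * ln (real d) - K \<le> p0 * ln (c 0) - Re (trp n \<rho> (E 1)) * ln 2"
      by (simp add: right_diff_distrib)
    moreover have "gain n \<rho> (2, E, c) \<sigma> = p0 * ln (c 0) - Re (trp n \<rho> (E 1)) * ln 2 + 1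
        - (c 0 * Re (trp n \<sigma> (E 0)) + c 1 * Re (trp n \<sigma> (E 1)))"
      by (simp add: gain_def numeral_2_eq_2 p0_def c_def[of "Suc 0"] ln_div)
    ultimately show ?thesis using a0 a1 by linarith
  qed
  show ?thesis unfolding D_SEP_S_def
  proof (rule INF_greatest)
    fix \<sigma> assume \<sigma>: "\<sigma> \<in> sep_states dA dB"
    have "(1 - e) * log 2 (real d) - (2 + log 2 (1 + \<delta>)) = ((1 - e) * ln (real d) - K) / ln 2"
      by (simp add: K_def log_def field_simps)
    also have "\<dots> \<le> gain n \<rho> (2, E, c) \<sigma> / ln 2" using main[OF \<sigma>] by (intro divide_right_mono) auto
    finally have "ereal ((1 - e) * log 2 (real d) - (2 + log 2 (1 + \<delta>))) \<le> ereal (gain n \<rho> (2, E, c) \<sigma> / ln 2)" by simp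
    also have "\<dots> \<le> D_SEP dA dB \<rho> \<sigma>" using D_SEP_ge_gain[OF \<rho> \<sigma> WM] by (simp add: n_def)
    finally show "ereal ((1 - e) * log 2 (real d) - (2 + log 2 (1 + \<delta>))) \<le> D_SEP dA dB \<rho> \<sigma>" .
  qed
qed

section \<open>Achievable numbers of ebits\<close>

definition achievable :: "real \<Rightarrow> nat \<Rightarrow> nat \<Rightarrow> real \<Rightarrow> complex mat \<Rightarrow> nat set" where
  "achievable \<delta> dA dB \<epsilon> \<rho> = {m. (INF \<Theta> \<in> DNE_g \<delta> dA dB (2 ^ m) (2 ^ m).
     1 / 2 * trace_norm (\<Theta> \<rho> - bip_power 2 2 Phi2 m)) \<le> \<epsilon>}"

lemma E_oneshot_eq: "E_oneshot \<delta> dA dB \<epsilon> \<rho> = Max (achievable \<delta> dA dB \<epsilon> \<rho>)"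
  by (simp add: E_oneshot_def achievable_def)

lemma DNE_nonempty:
  assumes "0 < dA * dB" "0 < d" "0 \<le> \<delta>" shows "DNE_g \<delta> dA dB d d \<noteq> {}"
proof -
  have "1\<^sub>m (dA * dB) - 0\<^sub>m (dA * dB) (dA * dB) = (1\<^sub>m (dA * dB) :: complex mat)" by (intro eq_matI) auto
  then have "measure_prepare (dA * dB) (0\<^sub>m (dA * dB) (dA * dB)) d \<in> DNE_g \<delta> dA dB d d"
    using assms by (intro measure_prepare_DNE) (auto simp: sepcone_zero sepcone_one)
  then show ?thesis by blast
qed

text \<open>The infimum over maps need not be attained, so the converse is applied at error
  \<epsilon> + \<eta>, with \<eta> so small that \<eta> m cannot close the gap left by an assumed
  violation.\<close>

lemma achievable_upper:
  assumes \<rho>: "density_op (dA * dB) \<rho>" and \<delta>: "0 \<le> \<delta>" and m: "m \<in> achievable \<delta> dA dB \<epsilon> \<rho>"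
  shows "ereal ((1 - \<epsilon>) * real m - (2 + log 2 (1 + \<delta>))) \<le> D_SEP_S dA dB \<rho>"
proof (rule ccontr)
  assume "\<not> ?thesis"
  then have "D_SEP_S dA dB \<rho> < ereal ((1 - \<epsilon>) * real m - (2 + log 2 (1 + \<delta>)))" by simp
  then obtain z where z: "D_SEP_S dA dB \<rho> < ereal z" "z < (1 - \<epsilon>) * real m - (2 + log 2 (1 + \<delta>))"
    using ereal_dense2 by (metis less_ereal.simps(1))
  define g where "g = (1 - \<epsilon>) * real m - (2 + log 2 (1 + \<delta>)) - z"
  have g: "0 < g" using z by (simp add: g_def)
  define \<eta> where "\<eta> = g / (real m + 1)"
  have \<eta>: "0 < \<eta>" "\<eta> * real m \<le> g" using g by (auto simp: \<eta>_def field_simps)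
  have n: "0 < dA * dB" by (rule density_dim_pos[OF \<rho>])
  have "(INF \<Theta> \<in> DNE_g \<delta> dA dB (2 ^ m) (2 ^ m). 1 / 2 * trace_norm (\<Theta> \<rho> - bip_power 2 2 Phi2 m)) < \<epsilon> + \<eta>"
    using m \<eta> by (simp add: achievable_def)
  from cInf_lessD[OF _ this] DNE_nonempty[OF n _ \<delta>, of "2 ^ m"]
  obtain y where y: "y \<in> (\<lambda>\<Theta>. 1 / 2 * trace_norm (\<Theta> \<rho> - bip_power 2 2 Phi2 m)) ` DNE_g \<delta> dA dB (2 ^ m) (2 ^ m)"
    "y < \<epsilon> + \<eta>" by (metis image_is_empty zero_less_numeral zero_less_power)
  then obtain \<Theta> where \<Theta>: "\<Theta> \<in> DNE_g \<delta> dA dB (2 ^ m) (2 ^ m)" "1 / 2 * trace_norm (\<Theta> \<rho> - bip_power 2 2 Phi2 m) < \<epsilon> + \<eta>"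
    by (elim imageE) (simp only:)
  have "1 / 2 * trace_norm (\<Theta> \<rho> - ro (2 ^ m * 2 ^ m) (phi (2 ^ m))) \<le> \<epsilon> + \<eta>"
    using \<Theta>(2) by (simp add: bip_power_Phi2)
  from DNE_converse[OF \<rho> \<Theta>(1) _ \<delta> this]
  have "ereal ((1 - (\<epsilon> + \<eta>)) * real m - (2 + log 2 (1 + \<delta>))) \<le> D_SEP_S dA dB \<rho>"
    by (simp add: log_nat_power)
  moreover have "z \<le> (1 - (\<epsilon> + \<eta>)) * real m - (2 + log 2 (1 + \<delta>))"
    using \<eta> by (simp add: g_def algebra_simps)
  ultimately show False using z(1) by (metis ereal_less_eq(3) leD le_less_trans less_le_trans)
qed

text \<open>Gives \<open>Max\<close> a meaning; \<epsilon> < 1 makes the left-hand side of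
  \<open>achievable_upper\<close> grow with m.\<close>

lemma achievable_finite:
  assumes \<rho>: "density_op (dA * dB) \<rho>" and \<delta>: "0 \<le> \<delta>" and \<epsilon>: "\<epsilon> < 1"
  shows "finite (achievable \<delta> dA dB \<epsilon> \<rho>)"
proof -
  define B where "B = (log 2 (real (dA * dB)) + (2 + log 2 (1 + \<delta>))) / (1 - \<epsilon>)"
  have "real m \<le> B" if "m \<in> achievable \<delta> dA dB \<epsilon> \<rho>" for m
  proof -
    have "ereal ((1 - \<epsilon>) * real m - (2 + log 2 (1 + \<delta>))) \<le> ereal (log 2 (real (dA * dB)))"
      using achievable_upper[OF \<rho> \<delta> that] D_SEP_S_le[OF \<rho>] by (rule order_trans)
    then have "(1 - \<epsilon>) * real m \<le> log 2 (real (dA * dB)) + (2 + log 2 (1 + \<delta>))" by simp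
    then show ?thesis using \<epsilon> unfolding B_def by (simp add: pos_le_divide_eq mult.commute)
  qed
  then have "achievable \<delta> dA dB \<epsilon> \<rho> \<subseteq> {..nat \<lceil>B\<rceil>}" by (auto simp: le_nat_iff) (meson le_of_int_ceiling of_int_le_iff of_nat_le_iff order_trans linorder_le_cases real_nat_ceiling_ge)
  then show ?thesis using finite_subset by blast
qed

lemma achievableI:
  assumes \<rho>: "density_op (dA * dB) \<rho>" and \<delta>: "0 \<le> \<delta>"
    and T: "T \<in> sepcone dA dB" "1\<^sub>m (dA * dB) - T \<in> sepcone dA dB"
    and small: "\<And>\<sigma>. \<sigma> \<in> sep_states dA dB \<Longrightarrow> Re (trp (dA * dB) T \<sigma>) \<le> 1 / 2 ^ m"
    and err: "Re (trp (dA * dB) (1\<^sub>m (dA * dB) - T) \<rho>) \<le> \<epsilon>"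
  shows "m \<in> achievable \<delta> dA dB \<epsilon> \<rho>"
proof -
  define d where "d = (2::nat) ^ m"
  have d: "0 < d" by (simp add: d_def)
  define v where "v \<Theta> = 1 / 2 * trace_norm (\<Theta> \<rho> - bip_power 2 2 Phi2 m)" for \<Theta>
  have n: "0 < dA * dB" by (rule density_dim_pos[OF \<rho>])
  have mem: "measure_prepare (dA * dB) T d \<in> DNE_g \<delta> dA dB d d"
    using small by (intro measure_prepare_DNE[OF n d \<delta> T]) (simp add: d_def)
  have Phi: "bip_power 2 2 Phi2 m = ro (d * d) (phi d)" by (simp add: bip_power_Phi2 d_def)
  \<comment> \<open>Supplies the lower bound that \<open>cINF_lower\<close> asks for in a
    conditionally complete order.\<close>
  have nonneg: "0 \<le> v \<Theta>" if "\<Theta> \<in> DNE_g \<delta> dA dB d d" for \<Theta>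
  proof -
    have "density_op (d * d) (\<Theta> \<rho>)" using that \<rho> by (auto simp: DNE_g_def intro: channel_density)
    then have ps: "psd (d * d) (\<Theta> \<rho>)" by (simp add: density_op_def)
    note h = hermitianD[OF psd_hermitian[OF ps]] hermitianD[OF psd_hermitian[OF psd_ro]]
    have "hermitian (d * d) (\<Theta> \<rho> - ro (d * d) (phi d))"
      using h psd_carrier[OF ps] by (auto simp: hermitian_def simp del: index_ro)
    then show ?thesis unfolding v_def Phi using trace_norm_nonneg by simp
  qed
  have "(INF \<Theta> \<in> DNE_g \<delta> dA dB d d. v \<Theta>) \<le> v (measure_prepare (dA * dB) T d)"
    using nonneg mem by (intro cINF_lower bdd_belowI2[of _ 0]) auto
  also have "\<dots> \<le> \<epsilon>"
    unfolding v_def Phi using trace_norm_measure_prepare[OF \<rho> sepcone_psd[OF T(1)] sepcone_psd[OF T(2)] d] err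
    by (rule order_trans)
  finally show ?thesis by (simp add: achievable_def v_def d_def)
qed

lemma E_oneshot_lower:
  assumes "density_op (dA * dB) \<rho>" "0 \<le> \<delta>" "\<epsilon> < 1"
    and "T \<in> sepcone dA dB" "1\<^sub>m (dA * dB) - T \<in> sepcone dA dB"
    and "\<And>\<sigma>. \<sigma> \<in> sep_states dA dB \<Longrightarrow> Re (trp (dA * dB) T \<sigma>) \<le> 1 / 2 ^ m"
    and "Re (trp (dA * dB) (1\<^sub>m (dA * dB) - T) \<rho>) \<le> \<epsilon>"
  shows "m \<le> E_oneshot \<delta> dA dB \<epsilon> \<rho>"
  unfolding E_oneshot_eq using achievable_finite achievableI assms by (intro Max_ge) auto

lemma E_oneshot_upper:
  assumes \<rho>: "density_op (dA * dB) \<rho>" and \<delta>: "0 \<le> \<delta>" and \<epsilon>: "0 \<le> \<epsilon>" "\<epsilon> < 1"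
  shows "ereal ((1 - \<epsilon>) * real (E_oneshot \<delta> dA dB \<epsilon> \<rho>) - (2 + log 2 (1 + \<delta>))) \<le> D_SEP_S dA dB \<rho>"
proof -
  define n where "n = dA * dB"
  have C: "\<rho> \<in> carrier_mat n n" using \<rho> by (simp add: density_op_def psd_carrier n_def)
  have z: "1\<^sub>m n - 1\<^sub>m n = (0\<^sub>m n n :: complex mat)" by (intro eq_matI) auto
  \<comment> \<open>The test T = 1 shows that zero ebits are always achievable, so
    \<open>Max\<close> is taken over a nonempty set.\<close>
  have "0 \<in> achievable \<delta> dA dB \<epsilon> \<rho>"
    by (rule achievableI[OF \<rho> \<delta> sepcone_one])
      (use \<epsilon> in \<open>auto simp: z[unfolded n_def] sepcone_zero sep_states_carrier sep_states_iff sepcone_carrier\<close>)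
  then have "E_oneshot \<delta> dA dB \<epsilon> \<rho> \<in> achievable \<delta> dA dB \<epsilon> \<rho>"
    unfolding E_oneshot_eq using achievable_finite[OF \<rho> \<delta> \<epsilon>(2)] by (intro Max_in) auto
  then show ?thesis by (rule achievable_upper[OF \<rho> \<delta>])
qed

section \<open>Asymptotic rates\<close>

abbreviation D_copies :: "nat \<Rightarrow> nat \<Rightarrow> complex mat \<Rightarrow> nat \<Rightarrow> ereal" where
  "D_copies dA dB \<rho> n \<equiv> D_SEP_S (dA ^ n) (dB ^ n) (bip_power dA dB \<rho> n)"

text \<open>Nothing is lost in passing to the reals, as \<open>D_copies\<close> lies between 0 and n
  log2(dA dB). At n = 0 the division yields 0.\<close>

definition rate :: "nat \<Rightarrow> nat \<Rightarrow> complex mat \<Rightarrow> nat \<Rightarrow> real" where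
  "rate dA dB \<rho> n = real_of_ereal (D_copies dA dB \<rho> n) / real n"

lemma D_copies_bounds:
  assumes \<rho>: "density_op (dA * dB) \<rho>"
  shows "D_copies dA dB \<rho> n = ereal (real n * rate dA dB \<rho> n) \<or> n = 0"
    "0 \<le> rate dA dB \<rho> n" "rate dA dB \<rho> n \<le> log 2 (real (dA * dB))"
proof -
  note b = D_SEP_S_nonneg[OF bip_power_density[OF \<rho>, of n]] D_SEP_S_le[OF bip_power_density[OF \<rho>, of n]]
  have pos: "0 < dA * dB" by (rule density_dim_pos[OF \<rho>])
  obtain r where r: "D_copies dA dB \<rho> n = ereal r" "0 \<le> r" "r \<le> log 2 (real (dA ^ n * dB ^ n))"
    using b by (cases "D_copies dA dB \<rho> n") auto
  have "log 2 (real (dA ^ n * dB ^ n)) = real n * log 2 (real (dA * dB))"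
  proof -
    have "real (dA ^ n * dB ^ n) = real (dA * dB) ^ n" by (simp add: power_mult_distrib)
    then show ?thesis using log_nat_power[of "real (dA * dB)" 2 n] pos by (simp only: of_nat_0_less_iff)
  qed
  then have r': "r \<le> real n * log 2 (real (dA * dB))" using r by simp
  show "D_copies dA dB \<rho> n = ereal (real n * rate dA dB \<rho> n) \<or> n = 0" by (simp add: rate_def r)
  show "0 \<le> rate dA dB \<rho> n" using r by (simp add: rate_def)
  have "0 \<le> log 2 (real (dA * dB))"
  proof -
    have "real 1 \<le> real (dA * dB)" using pos by (simp only: of_nat_le_iff)
    then show ?thesis using pos by (simp del: of_nat_mult)
  qed
  then show "rate dA dB \<rho> n \<le> log 2 (real (dA * dB))"
    using r' by (cases "n = 0") (simp_all add: rate_def r field_simps)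
qed

text \<open>Chernoff-type estimate: block measurements on \<open>k\<close> copies, repeated \<open>n div k\<close> times, distinguish
  \<open>\<rho>\<^sup>n\<close> from all separable states, with vanishing error for every exponent below \<open>D\<^sub>k / k\<close>.\<close>

lemma E_oneshot_block_lower:
  assumes \<rho>: "density_op (dA * dB) \<rho>" and k: "0 < k" and v: "0 \<le> v" "ereal v < D_copies dA dB \<rho> k"
    and \<epsilon>: "0 < \<epsilon>" "\<epsilon> < 1" and \<delta>: "\<And>n. 0 \<le> \<delta> n"
  shows "eventually (\<lambda>n. real (n div k) * v - 1 \<le> real (E_oneshot (\<delta> n) (dA ^ n) (dB ^ n) \<epsilon> (bip_power dA dB \<rho> n))) sequentially"
proof -
  \<comment> \<open>Two margins are needed, v < v1 < v2: from v2 to v1 in passing from the mean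
    log-weight to a moment, and from v1 to v for the error to decay.\<close>
  obtain v2 where v2: "v < v2" "ereal v2 < D_copies dA dB \<rho> k"
    using ereal_dense2[OF v(2)] by (auto simp: less_ereal.simps)
  define v1 where "v1 = (v + v2) / 2"
  have v1: "v < v1" "v1 < v2" using v2 by (auto simp: v1_def)
  have "ereal (v2 * ln 2 / ln 2) < D_copies dA dB \<rho> k" using v2 by simp
  moreover have "v1 * ln 2 < v2 * ln 2" using v1 by simp
  ultimately obtain s where s: "0 < s" "esys (dA ^ k) (dB ^ k) (bip_power dA dB \<rho> k) s (exp (- (s * (v1 * ln 2))))"
    using D_SEP_S_esys[OF bip_power_density[OF \<rho>, of k]] by blast
  \<comment> \<open>The error factor per block: with threshold 2^m and m \<le> j v, the error bound
    of \<open>esys_test\<close> is at most z^j.\<close>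
  define z where "z = exp (- (s * ln 2 * (v1 - v)))"
  have "0 < s * ln 2 * (v1 - v)" using s v1 by simp
  then have z: "0 < z" "z < 1" by (simp_all add: z_def)
  have "(\<lambda>j. z ^ j) \<longlonglongrightarrow> 0" using z by (intro LIMSEQ_realpow_zero) auto
  then have "eventually (\<lambda>j. z ^ j < \<epsilon>) sequentially" using \<epsilon>(1) by (rule order_tendstoD(2))
  then obtain j0 where j0: "\<And>j. j0 \<le> j \<Longrightarrow> z ^ j < \<epsilon>" by (auto simp: eventually_sequentially)
  have "real (n div k) * v - 1 \<le> real (E_oneshot (\<delta> n) (dA ^ n) (dB ^ n) \<epsilon> (bip_power dA dB \<rho> n))"
    if n: "k * j0 \<le> n" for n
  proof -
    define j where "j = n div k"
    define m where "m = nat \<lfloor>real j * v\<rfloor>"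
    have "0 \<le> real j * v" using v by simp
    then have m: "real m \<le> real j * v" "real j * v - 1 \<le> real m" by (simp_all add: m_def)
    have nj: "j * k + n mod k = n" by (simp add: j_def)
    have "j0 \<le> j" using n k by (simp add: j_def less_eq_div_iff_mult_less_eq mult.commute)
    note dn = bip_power_density[OF \<rho>, of n]
    have es: "esys (dA ^ n) (dB ^ n) (bip_power dA dB \<rho> n) s (exp (- (s * (v1 * ln 2))) ^ j)"
      using esys_power[OF \<rho> s(2), of j "n mod k"] by (simp only: nj)
    obtain T where T: "T \<in> sepcone (dA ^ n) (dB ^ n)" "1\<^sub>m (dA ^ n * dB ^ n) - T \<in> sepcone (dA ^ n) (dB ^ n)"
      "\<And>\<sigma>. \<sigma> \<in> sep_states (dA ^ n) (dB ^ n) \<Longrightarrow> Re (trp (dA ^ n * dB ^ n) T \<sigma>) \<le> 1 / 2 ^ m"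
      "Re (trp (dA ^ n * dB ^ n) (1\<^sub>m (dA ^ n * dB ^ n) - T) (bip_power dA dB \<rho> n)) \<le> (2 ^ m) powr s * exp (- (s * (v1 * ln 2))) ^ j"
      using esys_test[OF dn es, of "2 ^ m"] s(1) by (metis zero_less_numeral zero_less_power)
    have "(2 ^ m) powr s * exp (- (s * (v1 * ln 2))) ^ j = exp (s * ln 2 * (real m - real j * v1))"
    proof -
      have "(2 ^ m :: real) powr s = exp (s * (real m * ln 2))" by (simp add: powr_def ln_realpow)
      then show ?thesis by (simp add: algebra_simps flip: exp_of_nat_mult exp_add)
    qed
    also have "\<dots> \<le> exp (s * ln 2 * (real j * v - real j * v1))"
      using s m(1) by simp
    also have "\<dots> = z ^ j" by (simp add: z_def algebra_simps flip: exp_of_nat_mult)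
    also have "\<dots> \<le> \<epsilon>" using j0[OF \<open>j0 \<le> j\<close>] by simp
    finally have "m \<le> E_oneshot (\<delta> n) (dA ^ n) (dB ^ n) \<epsilon> (bip_power dA dB \<rho> n)"
      using T \<epsilon> \<delta> by (intro E_oneshot_lower[OF dn]) auto
    then show ?thesis using m(2) by (simp add: j_def)
  qed
  then show ?thesis unfolding eventually_sequentially by blast
qed

section \<open>Yields per copy and the regularised entropy\<close>

definition yield :: "(nat \<Rightarrow> real) \<Rightarrow> nat \<Rightarrow> nat \<Rightarrow> complex mat \<Rightarrow> real \<Rightarrow> nat \<Rightarrow> real" where
  "yield \<delta> dA dB \<rho> \<epsilon> n = 1 / real n * real (E_oneshot (\<delta> n) (dA ^ n) (dB ^ n) \<epsilon> (bip_power dA dB \<rho> n))"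

lemma yield_lower:
  assumes \<rho>: "density_op (dA * dB) \<rho>" and k: "0 < k" and r: "r < rate dA dB \<rho> k"
    and \<epsilon>: "0 < \<epsilon>" "\<epsilon> < 1" and \<delta>: "\<And>n. 0 \<le> \<delta> n"
  shows "eventually (\<lambda>n. r \<le> yield \<delta> dA dB \<rho> \<epsilon> n) sequentially"
proof (cases "r < 0")
  case True
  then show ?thesis by (intro always_eventually allI) (simp add: yield_def less_imp_le order_trans[of r 0])
next
  case False
  define r' where "r' = (r + rate dA dB \<rho> k) / 2"
  have r': "r < r'" "r' < rate dA dB \<rho> k" "0 \<le> r'" using r False by (auto simp: r'_def)
  define v where "v = real k * r'"
  have "ereal v < D_copies dA dB \<rho> k" using D_copies_bounds(1)[OF \<rho>, of k] k r' by (auto simp: v_def)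
  from E_oneshot_block_lower[OF \<rho> k _ this \<epsilon>, of \<delta>] \<delta> r'
  have ev: "eventually (\<lambda>n. real (n div k) * v - 1 \<le> real (E_oneshot (\<delta> n) (dA ^ n) (dB ^ n) \<epsilon> (bip_power dA dB \<rho> n))) sequentially"
    by (simp add: v_def)
  \<comment> \<open>Beyond n0 the slack n (r' - r) covers an incomplete block, worth at most v, and
    the rounding loss 1.\<close>
  obtain n0 :: nat where n0: "(v + 1) / (r' - r) < real n0" using reals_Archimedean2 by blast
  have "eventually (\<lambda>n. Suc n0 \<le> n) sequentially" by (rule eventually_ge_at_top)
  with ev show ?thesis
  proof eventually_elim
    case (elim n)
    have n: "0 < real n" "real n0 \<le> real n" using elim by auto
    have "(v + 1) / (r' - r) < real n" using n0 n by linarith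
    then have 1: "v + 1 \<le> real n * (r' - r)" using r' by (simp add: pos_divide_less_eq)
    have "real n \<le> real (n div k) * real k + real k"
    proof -
      have "n = n div k * k + n mod k" by simp
      moreover have "n mod k \<le> k" using k by (simp add: less_imp_le)
      ultimately have "n \<le> n div k * k + k" by linarith
      then show ?thesis by (metis of_nat_le_iff of_nat_add of_nat_mult)
    qed
    then have "real n * r' \<le> (real (n div k) * real k + real k) * r'" using r' by (intro mult_right_mono) auto
    then have "real n * r' - v - 1 \<le> real (n div k) * v - 1" by (simp add: v_def algebra_simps)
    also have "\<dots> \<le> real n * yield \<delta> dA dB \<rho> \<epsilon> n" using elim(1) n by (simp add: yield_def)
    finally have "real n * r \<le> real n * yield \<delta> dA dB \<rho> \<epsilon> n" using 1 by (simp add: algebra_simps)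
    then show ?case using n by simp
  qed
qed

lemma yield_upper:
  assumes \<rho>: "density_op (dA * dB) \<rho>" and \<delta>: "\<And>n. 0 \<le> \<delta> n" and \<epsilon>: "0 \<le> \<epsilon>" "\<epsilon> < 1" and n: "0 < n"
  shows "(1 - \<epsilon>) * yield \<delta> dA dB \<rho> \<epsilon> n - (2 / real n + 1 / real n * log 2 (1 + \<delta> n)) \<le> rate dA dB \<rho> n"
proof -
  define x where "x = real (E_oneshot (\<delta> n) (dA ^ n) (dB ^ n) \<epsilon> (bip_power dA dB \<rho> n))"
  have "ereal ((1 - \<epsilon>) * x - (2 + log 2 (1 + \<delta> n))) \<le> D_copies dA dB \<rho> n"
    using E_oneshot_upper[OF bip_power_density[OF \<rho>, of n] \<delta> \<epsilon>] by (simp add: x_def)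
  also have "D_copies dA dB \<rho> n = ereal (real n * rate dA dB \<rho> n)" using D_copies_bounds(1)[OF \<rho>, of n] n by auto
  finally have "((1 - \<epsilon>) * x - (2 + log 2 (1 + \<delta> n))) / real n \<le> rate dA dB \<rho> n"
    using n by (simp add: divide_le_eq mult.commute)
  moreover have "((1 - \<epsilon>) * x - (2 + log 2 (1 + \<delta> n))) / real n
     = (1 - \<epsilon>) * (1 / real n * x) - (2 / real n + 1 / real n * log 2 (1 + \<delta> n))"
    by (simp add: diff_divide_distrib add_divide_distrib)
  ultimately show ?thesis by (simp add: yield_def x_def)
qed

text \<open>A supremum of bounded reals exists at once; \<open>rate_tendsto\<close> identifies it
  with the limit.\<close>

definition reg_rate :: "nat \<Rightarrow> nat \<Rightarrow> complex mat \<Rightarrow> real" where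
  "reg_rate dA dB \<rho> = (SUP k\<in>{1..}. rate dA dB \<rho> k)"

lemma rate_le_reg_rate:
  assumes "density_op (dA * dB) \<rho>" "0 < k" shows "rate dA dB \<rho> k \<le> reg_rate dA dB \<rho>"
  unfolding reg_rate_def using D_copies_bounds(3)[OF assms(1)] assms(2)
  by (intro cSUP_upper bdd_aboveI2[of _ _ "log 2 (real (dA * dB))"]) auto

lemma reg_rate_nonneg: "density_op (dA * dB) \<rho> \<Longrightarrow> 0 \<le> reg_rate dA dB \<rho>"
  using D_copies_bounds(2)[of dA dB \<rho> 1] rate_le_reg_rate[of dA dB \<rho> 1] by simp

lemma yield_ge_reg_rate:
  assumes \<rho>: "density_op (dA * dB) \<rho>" and r: "r < reg_rate dA dB \<rho>"
    and \<epsilon>: "0 < \<epsilon>" "\<epsilon> < 1" and \<delta>: "\<And>n. 0 \<le> \<delta> n"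
  shows "eventually (\<lambda>n. r \<le> yield \<delta> dA dB \<rho> \<epsilon> n) sequentially"
proof -
  have "bdd_above ((\<lambda>k. rate dA dB \<rho> k) ` {1..})"
    using D_copies_bounds(3)[OF \<rho>] by (intro bdd_aboveI2) auto
  then obtain k where "k \<in> {1..}" "r < rate dA dB \<rho> k"
    using r less_cSUP_iff[of "{1..}" "\<lambda>k. rate dA dB \<rho> k" r] unfolding reg_rate_def by auto
  then show ?thesis by (intro yield_lower[OF \<rho> _ _ \<epsilon> \<delta>]) auto
qed

text \<open>Yields link different block lengths. A good k forces the yield at every large n up to R
  - g, and the converse at that same n bounds the yield by the rate at n, up to \<epsilon> and 2 /
  n; hence the rate at n is itself close to R.\<close>

lemma rate_tendsto:
  assumes \<rho>: "density_op (dA * dB) \<rho>"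
  shows "(\<lambda>n. rate dA dB \<rho> n) \<longlonglongrightarrow> reg_rate dA dB \<rho>"
proof (rule order_tendstoI)
  fix a assume a: "reg_rate dA dB \<rho> < a"
  have "eventually (\<lambda>n. 0 < n) sequentially" by (rule eventually_gt_at_top)
  then show "eventually (\<lambda>n. rate dA dB \<rho> n < a) sequentially"
    by eventually_elim (use a rate_le_reg_rate[OF \<rho>] in \<open>meson le_less_trans\<close>)
next
  define R where "R = reg_rate dA dB \<rho>"
  have R: "0 \<le> R" using reg_rate_nonneg[OF \<rho>] by (simp add: R_def)
  fix a assume "a < reg_rate dA dB \<rho>"
  then have a: "a < R" by (simp add: R_def)
  define g where "g = (R - a) / 4"
  have g: "0 < g" using a by (simp add: g_def)
  \<comment> \<open>With \<epsilon> R \<le> g the losses from \<epsilon>, from the supremum and from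
    2 / n are at most g each, while R - a = 4 g; the denominator R + 1 covers R = 0.\<close>
  define \<epsilon> where "\<epsilon> = min (1 / 2) (g / (R + 1))"
  have \<epsilon>: "0 < \<epsilon>" "\<epsilon> < 1" using g R by (auto simp: \<epsilon>_def)
  have "\<epsilon> * (R + 1) \<le> g / (R + 1) * (R + 1)" using R by (intro mult_right_mono) (auto simp: \<epsilon>_def)
  also have "\<dots> = g" using R by simp
  finally have "\<epsilon> * R + \<epsilon> \<le> g" by (simp add: distrib_left)
  then have \<epsilon>R: "\<epsilon> * R \<le> g" using \<epsilon> by simp
  have y: "eventually (\<lambda>n. R - g \<le> yield (\<lambda>_. 0) dA dB \<rho> \<epsilon> n) sequentially"
    using g by (intro yield_ge_reg_rate[OF \<rho> _ \<epsilon>]) (auto simp: R_def)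
  have "(\<lambda>n. 2 / real n) \<longlonglongrightarrow> 0" by (rule lim_const_over_n)
  then have "eventually (\<lambda>n. 2 / real n < g) sequentially" using g by (rule order_tendstoD(2))
  moreover have "eventually (\<lambda>n. 0 < n) sequentially" by (rule eventually_gt_at_top)
  ultimately show "eventually (\<lambda>n. a < rate dA dB \<rho> n) sequentially" using y
  proof eventually_elim
    case (elim n)
    have "(1 - \<epsilon>) * (R - g) \<le> (1 - \<epsilon>) * yield (\<lambda>_. 0) dA dB \<rho> \<epsilon> n"
      using elim \<epsilon> by (intro mult_left_mono) auto
    moreover have "(1 - \<epsilon>) * yield (\<lambda>_. 0) dA dB \<rho> \<epsilon> n - 2 / real n \<le> rate dA dB \<rho> n"
      using yield_upper[OF \<rho>, of "\<lambda>_. 0" \<epsilon> n] \<epsilon> elim by simp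
    moreover have "R - g - g \<le> (1 - \<epsilon>) * (R - g)"
    proof -
      have "0 \<le> \<epsilon> * g" using \<epsilon> g by simp
      then show ?thesis using \<epsilon>R by (simp add: algebra_simps)
    qed
    moreover have "a < R - g - g - g" using g by (simp add: g_def field_simps)
    ultimately show ?case using elim(1) by linarith
  qed
qed

lemma D_SEP_reg_eq:
  assumes \<rho>: "density_op (dA * dB) \<rho>" shows "D_SEP_reg dA dB \<rho> = ereal (reg_rate dA dB \<rho>)"
proof -
  have "ereal (1 / real n) * D_copies dA dB \<rho> n = ereal (rate dA dB \<rho> n)" for n
  proof (cases "n = 0")
    case False
    then have D: "D_copies dA dB \<rho> n = ereal (real n * rate dA dB \<rho> n)"
      using D_copies_bounds(1)[OF \<rho>, of n] by blast
    show ?thesis unfolding D using False by simp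
  qed (simp add: rate_def flip: zero_ereal_def)
  then show ?thesis
    unfolding D_SEP_reg_def using rate_tendsto[OF \<rho>] by (simp add: limI)
qed

text \<open>The two one-shot bounds leave a factor 1 / (1 - \<epsilon>) between them, which the
  limit of vanishing error in \<open>E_DNE_g_eq\<close> removes.\<close>

lemma liminf_yield:
  assumes \<rho>: "density_op (dA * dB) \<rho>" and \<delta>: "\<And>n. 0 \<le> \<delta> n"
    and sub: "(\<lambda>n. 1 / real n * log 2 (1 + \<delta> n)) \<longlonglongrightarrow> 0" and \<epsilon>: "0 < \<epsilon>" "\<epsilon> < 1"
  shows "ereal (reg_rate dA dB \<rho>) \<le> liminf (\<lambda>n. ereal (yield \<delta> dA dB \<rho> \<epsilon> n))"
    "liminf (\<lambda>n. ereal (yield \<delta> dA dB \<rho> \<epsilon> n)) \<le> ereal (reg_rate dA dB \<rho> / (1 - \<epsilon>))"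
proof -
  define R where "R = reg_rate dA dB \<rho>"
  show "ereal (reg_rate dA dB \<rho>) \<le> liminf (\<lambda>n. ereal (yield \<delta> dA dB \<rho> \<epsilon> n))"
  proof (rule le_Liminf_iff[THEN iffD2], intro allI impI)
    fix y assume "y < ereal (reg_rate dA dB \<rho>)"
    then obtain r where r: "y < ereal r" "r < reg_rate dA dB \<rho>"
      using ereal_dense2 by (metis less_ereal.simps(1))
    from yield_ge_reg_rate[OF \<rho> r(2) \<epsilon>, of \<delta>] \<delta>
    have "eventually (\<lambda>n. r \<le> yield \<delta> dA dB \<rho> \<epsilon> n) sequentially" by blast
    then show "eventually (\<lambda>n. y < ereal (yield \<delta> dA dB \<rho> \<epsilon> n)) sequentially"
      by eventually_elim (use r(1) in \<open>meson ereal_less_eq(3) less_le_trans\<close>)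
  qed
  define u where "u n = (R + (2 / real n + 1 / real n * log 2 (1 + \<delta> n))) / (1 - \<epsilon>)" for n
  have "u \<longlonglongrightarrow> (R + (0 + 0)) / (1 - \<epsilon>)"
    unfolding u_def[abs_def] using \<epsilon> by (intro tendsto_intros sub lim_const_over_n) auto
  then have "(\<lambda>n. ereal (u n)) \<longlonglongrightarrow> ereal (R / (1 - \<epsilon>))" by simp
  then have lim: "liminf (\<lambda>n. ereal (u n)) = ereal (R / (1 - \<epsilon>))"
    by (intro lim_imp_Liminf) auto
  have "liminf (\<lambda>n. ereal (yield \<delta> dA dB \<rho> \<epsilon> n)) \<le> liminf (\<lambda>n. ereal (u n))"
  proof (rule Liminf_mono)
    have "eventually (\<lambda>n. 0 < n) sequentially" by (rule eventually_gt_at_top)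
    then show "eventually (\<lambda>n. ereal (yield \<delta> dA dB \<rho> \<epsilon> n) \<le> ereal (u n)) sequentially"
    proof eventually_elim
      case (elim n)
      have "(1 - \<epsilon>) * yield \<delta> dA dB \<rho> \<epsilon> n \<le> R + (2 / real n + 1 / real n * log 2 (1 + \<delta> n))"
      proof -
        have "(1 - \<epsilon>) * yield \<delta> dA dB \<rho> \<epsilon> n - (2 / real n + 1 / real n * log 2 (1 + \<delta> n)) \<le> rate dA dB \<rho> n"
          using \<delta> \<epsilon> elim by (intro yield_upper[OF \<rho>]) auto
        then show ?thesis using rate_le_reg_rate[OF \<rho> elim] by (simp add: R_def)
      qed
      then have "yield \<delta> dA dB \<rho> \<epsilon> n \<le> u n"
        using \<epsilon> unfolding u_def by (simp add: pos_le_divide_eq mult.commute)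
      then show ?case by simp
    qed
  qed
  then show "liminf (\<lambda>n. ereal (yield \<delta> dA dB \<rho> \<epsilon> n)) \<le> ereal (reg_rate dA dB \<rho> / (1 - \<epsilon>))"
    using lim by (simp add: R_def)
qed

lemma E_DNE_g_eq:
  assumes \<rho>: "density_op (dA * dB) \<rho>" and \<delta>: "\<And>n. 0 \<le> \<delta> n"
    and sub: "(\<lambda>n. 1 / real n * log 2 (1 + \<delta> n)) \<longlonglongrightarrow> 0"
  shows "E_DNE_g \<delta> dA dB \<rho> = ereal (reg_rate dA dB \<rho>)"
proof -
  define R where "R = reg_rate dA dB \<rho>"
  define L where "L \<epsilon> = liminf (\<lambda>n. ereal (yield \<delta> dA dB \<rho> \<epsilon> n))" for \<epsilon>
  have ev: "eventually (\<lambda>\<epsilon>. \<epsilon> \<in> {0<..<1}) (at_right (0 :: real))"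
    by (rule eventually_at_right_real) simp
  have "(L \<longlongrightarrow> ereal R) (at_right 0)"
  proof (rule tendsto_sandwich)
    show "eventually (\<lambda>\<epsilon>. ereal R \<le> L \<epsilon>) (at_right 0)"
      using ev by eventually_elim (use liminf_yield(1)[OF \<rho> \<delta> sub] in \<open>auto simp: L_def R_def\<close>)
    show "eventually (\<lambda>\<epsilon>. L \<epsilon> \<le> ereal (R / (1 - \<epsilon>))) (at_right 0)"
      using ev by eventually_elim (use liminf_yield(2)[OF \<rho> \<delta> sub] in \<open>auto simp: L_def R_def\<close>)
    have "((\<lambda>\<epsilon>. R / (1 - \<epsilon>)) \<longlongrightarrow> R / (1 - 0)) (at_right 0)"
      by (intro tendsto_intros) auto
    then show "((\<lambda>\<epsilon>. ereal (R / (1 - \<epsilon>))) \<longlongrightarrow> ereal R) (at_right 0)" by simp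
  qed simp
  then have "Lim (at_right 0) L = ereal R" by (intro tendsto_Lim) simp_all
  moreover have "E_DNE_g \<delta> dA dB \<rho> = Lim (at_right 0) L"
    unfolding E_DNE_g_def L_def yield_def ..
  ultimately show ?thesis by (simp add: R_def)
qed

theorem theorem1:
  fixes dA dB :: nat and \<rho> :: "complex mat"
  assumes "density_op (dA * dB) \<rho>"
  shows "E_DNE dA dB \<rho> = D_SEP_reg dA dB \<rho> \<and>
    (\<forall>\<delta> :: nat \<Rightarrow> real. (\<forall>n. 0 \<le> \<delta> n) \<and> limsup (\<lambda>n. ereal (1 / real n * log 2 (1 + \<delta> n))) = 0 \<longrightarrow>
        E_DNE_g \<delta> dA dB \<rho> = D_SEP_reg dA dB \<rho>) \<and>
    E_ADNE dA dB \<rho> = E_DNE dA dB \<rho> \<and>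
    E_DNE dA dB \<rho> = D_SEP_reg dA dB \<rho> \<and>
    (\<rho> \<notin> sep_states dA dB \<longrightarrow>
       E_DNE dA dB \<rho> \<ge> D_SEP_S dA dB \<rho> \<and> D_SEP_S dA dB \<rho> > 0)"
proof -
  note \<rho> = assms
  define R where "R = ereal (reg_rate dA dB \<rho>)"
  have reg: "D_SEP_reg dA dB \<rho> = R" using D_SEP_reg_eq[OF \<rho>] by (simp add: R_def)
  have DNE: "E_DNE dA dB \<rho> = R"
    unfolding E_DNE_def R_def by (rule E_DNE_g_eq[OF \<rho>]) auto
  have sub: "E_DNE_g \<delta> dA dB \<rho> = R"
    if \<delta>: "\<forall>n. 0 \<le> \<delta> n" and lim: "limsup (\<lambda>n. ereal (1 / real n * log 2 (1 + \<delta> n))) = 0" for \<delta> :: "nat \<Rightarrow> real"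
  proof -
    let ?x = "\<lambda>n. ereal (1 / real n * log 2 (1 + \<delta> n))"
    have "0 \<le> ?x n" for n
    proof -
      have "0 \<le> log 2 (1 + \<delta> n)" using \<delta>[rule_format, of n] by simp
      then show ?thesis by simp
    qed
    \<comment> \<open>The terms are nonnegative, so the condition on the limsup already makes them
      converge to 0.\<close>
    then have "0 \<le> liminf ?x" by (intro Liminf_bounded always_eventually) auto
    moreover have "liminf ?x \<le> limsup ?x" by (rule Liminf_le_Limsup) simp
    ultimately have "liminf ?x = 0" using lim by simp
    then have "?x \<longlonglongrightarrow> 0" using lim by (intro Liminf_eq_Limsup) auto
    then have "(\<lambda>n. 1 / real n * log 2 (1 + \<delta> n)) \<longlonglongrightarrow> 0" by (simp add: zero_ereal_def)
    then show ?thesis unfolding R_def using \<delta> by (intro E_DNE_g_eq[OF \<rho>]) auto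
  qed
  have ADNE: "E_ADNE dA dB \<rho> = R"
  proof -
    \<comment> \<open>Every null sequence gives the value R, so the supremum is over a constant; the
      zero sequence makes the index set nonempty.\<close>
    have "E_DNE_g \<delta> dA dB \<rho> = R" if \<delta>: "\<forall>n. 0 \<le> \<delta> n" "\<delta> \<longlonglongrightarrow> 0" for \<delta> :: "nat \<Rightarrow> real"
    proof -
      have "(\<lambda>n. 1 / real n * log 2 (1 + \<delta> n)) \<longlonglongrightarrow> 0 * log 2 (1 + 0)"
        using \<delta> by (intro tendsto_intros lim_const_over_n) auto
      then show ?thesis unfolding R_def using \<delta> by (intro E_DNE_g_eq[OF \<rho>]) auto
    qed
    moreover have "(\<lambda>_. 0) \<in> {\<delta>. (\<forall>n. 0 \<le> \<delta> n) \<and> \<delta> \<longlonglongrightarrow> (0 :: real)}" by simp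
    ultimately show ?thesis unfolding E_ADNE_def by (intro SUP_eq_const) auto
  qed
  \<comment> \<open>The single-copy entropy is the member k = 1 of the supremum defining
    \<open>reg_rate\<close>.\<close>
  have "D_SEP_S dA dB \<rho> \<le> R"
  proof -
    have "\<rho> \<in> carrier_mat (dA * dB) (dA * dB)" using \<rho> by (simp add: density_op_def psd_carrier)
    then have "D_SEP_S dA dB \<rho> = ereal (rate dA dB \<rho> 1)"
      using D_copies_bounds(1)[OF \<rho>, of 1] bip_power_1[of \<rho> dA dB] by simp
    then show ?thesis using rate_le_reg_rate[OF \<rho>, of 1] by (simp add: R_def)
  qed
  then show ?thesis using reg DNE sub ADNE D_SEP_S_pos[OF \<rho>] by auto
qed

end
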